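(* $\mathcal{D}_H'(\mathbb{R}^d)=\{T\in\mathcal{O}_H'(\mathbb{R}^d):\operatorname{supp}T\subset W_\varepsilon\text{ for some }\varepsilon>0\}$.
   Context: $\mathbb{R}_*=\mathbb{R}\setminus\{0\}$; $\xi y$ is the coordinatewise product. $W_\varepsilon=\{x\in\mathbb{R}^d:\min_j|x_j|\ge\varepsilon\}$. Euler derivatives: $\theta_j=x_j\partial_j$, $\theta^\beta=\theta_1^{\beta_1}\cdots\theta_d^{\beta_d}$. $\mathcal{O}_H'(\mathbb{R}^d)$ is the set of $T\in\mathcal{D}'(\mathbb{R}^d)$ such that for every $k\in\mathbb{N}_0$ there are finitely many measurable functions $t_\beta$ with $(1+|x|^2)^{k/2}t_\beta\in L_\infty(\mathbb{R}^d)$ and $T=\sum_\beta\theta^\beta t_\beta$. $\mathcal{D}_H'(\mathbb{R}^d)$ is the set of $T\in\mathcal{D}'(\mathbb{R}^d)$ such that for every $\varphi\in\mathcal{D}(\mathbb{R}^d)$ the function $y\mapsto T_\xi\varphi(\xi y)$, $y\in\mathbb{R}_*^d$, is the restriction of a function in $\mathcal{D}(\mathbb{R}^d)$. *)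

theory Defs
  imports "HOL-Analysis.Analysis"
begin

definition partial :: "'n::finite \<Rightarrow> (real^'n \<Rightarrow> complex) \<Rightarrow> real^'n \<Rightarrow> complex" where
  "partial i f x = vector_derivative (\<lambda>t. f (x + t *\<^sub>R axis i 1)) (at 0)"

fun dpart :: "'n::finite list \<Rightarrow> (real^'n \<Rightarrow> complex) \<Rightarrow> real^'n \<Rightarrow> complex" where
  "dpart [] f = f"
| "dpart (i # is) f = partial i (dpart is f)"

definition smooth :: "(real^'n::finite \<Rightarrow> complex) \<Rightarrow> bool" where
  "smooth f \<longleftrightarrow> (\<forall>is. continuous_on UNIV (dpart is f) \<and>
      (\<forall>i x. (\<lambda>t. dpart is f (x + t *\<^sub>R axis i 1)) differentiable (at 0)))"

definition tsupport :: "(real^'n::finite \<Rightarrow> complex) \<Rightarrow> (real^'n) set" where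
  "tsupport f = closure {x. f x \<noteq> 0}"

definition test_fun :: "(real^'n::finite \<Rightarrow> complex) set" where
  "test_fun = {f. smooth f \<and> compact (tsupport f)}"

text \<open>Distributions D'(R^d): linear functionals on D(R^d), continuous in the usual sense
  (on each compact set bounded by a finite order C^N seminorm).\<close>
definition distribution :: "((real^'n::finite \<Rightarrow> complex) \<Rightarrow> complex) \<Rightarrow> bool" where
  "distribution T \<longleftrightarrow>
     (\<forall>f\<in>test_fun. \<forall>g\<in>test_fun. T (\<lambda>x. f x + g x) = T f + T g) \<and>
     (\<forall>f\<in>test_fun. \<forall>c. T (\<lambda>x. c * f x) = c * T f) \<and>
     (\<forall>K. compact K \<longrightarrow> (\<exists>C N. \<forall>f\<in>test_fun. \<forall>M. tsupport f \<subseteq> K \<longrightarrow>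
          (\<forall>is x. length is \<le> N \<longrightarrow> norm (dpart is f x) \<le> M) \<longrightarrow> norm (T f) \<le> C * M))"

definition dsupp :: "((real^'n::finite \<Rightarrow> complex) \<Rightarrow> complex) \<Rightarrow> (real^'n) set" where
  "dsupp T = {x. \<forall>U. open U \<and> x \<in> U \<longrightarrow> (\<exists>f\<in>test_fun. tsupport f \<subseteq> U \<and> T f \<noteq> 0)}"

definition regular :: "(real^'n::finite \<Rightarrow> complex) \<Rightarrow> (real^'n \<Rightarrow> complex) \<Rightarrow> complex" where
  "regular t f = integral\<^sup>L lborel (\<lambda>x. t x * f x)"

text \<open>Euler derivative theta_j = x_j d_j on distributions:
  (x_j d_j T)(f) = - T(d_j (x_j f)) = - T(f + x_j d_j f).\<close>
definition theta_dist :: "'n::finite \<Rightarrow> ((real^'n \<Rightarrow> complex) \<Rightarrow> complex) \<Rightarrow> (real^'n \<Rightarrow> complex) \<Rightarrow> complex" where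
  "theta_dist j T f = - T (\<lambda>x. f x + complex_of_real (x $ j) * partial j f x)"

text \<open>theta^beta, the multi-index beta being given as a word of coordinate indices
  (the theta_j commute, so every word is some theta^beta and conversely).\<close>
fun theta_word :: "'n::finite list \<Rightarrow> ((real^'n \<Rightarrow> complex) \<Rightarrow> complex) \<Rightarrow> (real^'n \<Rightarrow> complex) \<Rightarrow> complex" where
  "theta_word [] T = T"
| "theta_word (j # js) T = theta_dist j (theta_word js T)"

definition O_H :: "((real^'n::finite \<Rightarrow> complex) \<Rightarrow> complex) set" where
  "O_H = {T. distribution T \<and>
     (\<forall>k::nat. \<exists>B :: 'n list set. \<exists>t :: 'n list \<Rightarrow> real^'n \<Rightarrow> complex.
        finite B \<and>
        (\<forall>w\<in>B. t w \<in> borel_measurable lborel \<and>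
           (\<exists>C. AE x in lborel. (1 + (norm x)\<^sup>2) powr (real k / 2) * norm (t w x) \<le> C)) \<and>
        (\<forall>f\<in>test_fun. T f = (\<Sum>w\<in>B. theta_word w (regular (t w)) f)))}"

definition D_H :: "((real^'n::finite \<Rightarrow> complex) \<Rightarrow> complex) set" where
  "D_H = {T. distribution T \<and>
     (\<forall>f\<in>test_fun. \<exists>g\<in>test_fun. \<forall>y::real^'n. (\<forall>j. y $ j \<noteq> 0) \<longrightarrow>
         T (\<lambda>\<xi>. f (\<chi> j. \<xi> $ j * y $ j)) = g y)}"

definition W :: "real \<Rightarrow> (real^'n::finite) set" where
  "W \<epsilon> = {x. \<forall>j. \<bar>x $ j\<bar> \<ge> \<epsilon>}"

end

theory Submission
  imports Defs
begin

text \<open>If \<open>T = \<Sum> \<theta>\<^sup>\<beta> t\<^sub>\<beta>\<close> is supported in \<open>W \<epsilon>\<close>, then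
  \<open>T (f(\<cdot>y)) = \<Sum> \<plusminus> \<integral> t\<^sub>\<beta>(\<xi>) (L\<^sub>\<beta> f)(\<xi>y) d\<xi>\<close> with \<open>L\<^sub>\<beta>\<close>
  the formal adjoint of \<open>\<theta>\<^sup>\<beta>\<close> up to sign. The decay of \<open>t\<^sub>\<beta>\<close> allows differentiation in \<open>y\<close> up
  to any given order, so the orbit extends smoothly; it vanishes for large \<open>y\<close> because of the support of \<open>T\<close>.

  Conversely, let all orbits of \<open>T\<close> extend to test functions. A gliding-hump argument makes the supports and
  sizes of the extensions uniform on test functions with support in a fixed cube, which gives
  \<open>supp T \<subseteq> W \<epsilon>\<close>. Euler operators commute with dilations. Applying sufficiently many of them to a function of
  given parity produces orbits that vanish to high order on the coordinate hyperplanes, whence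
  \<open>\<bar>T (e(\<cdot>y))\<bar> \<le> C \<Prod>\<bar>y\<^sub>j\<bar>\<^sup>2\<^sup>k\<close> for such images \<open>e\<close>. The truncated powers \<open>\<xi>\<^sup>s (1 - \<xi>\<^sup>2)\<^sub>+\<^sup>M\<close>,
  smoothed, are fundamental solutions of the product of Euler operators, so mollifying multiplicatively and
  passing to the limit represents \<open>T\<close> by Euler derivatives of the densities
  \<open>t(x) = T (e(\<cdot>/x)) / \<Prod>\<bar>x\<^sub>j\<bar>\<close>, which decay as fast as the estimate says.\<close>

subsection \<open>Smooth functions\<close>

text \<open>Two obstacles shape the second half. First, a general test function is not divisible by
  powers of coordinates, but one of parity s_j in x_j has only the Taylor exponents s_j, s_j + 2,
  ... there, so k factors theta_j - s_j - 2m gain x_j^(2k). Orbits inherit the parity of the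
  function, so this becomes the decay estimate; after x = 1/y the density is O(prod |x_j|^(-2k-1)),
  and away from the hyperplanes prod |x_j| dominates 1 + |x|. Second, a kernel of fixed parity
  cannot concentrate at the single point 1: in each coordinate it sees y_j = 1 and y_j = -1 alike.
  Summing over all s in {0,1}^d creates the factors 1 + 1/y_j, which vanish at -1. The estimate
  needs a C^N norm of the kernel with N depending on k. A truncated power of high order M lies in
  C^N and its smoothings converge there, so N is known before M is chosen: k of the Euler factors
  are spent on decay, the other M + 1 - k are moved to f by integration by parts. The variable
  \<open>\<xi>\<^sup>2\<close> in the kernel makes each factor theta - s - 2c act as one ordinary
  derivative of the profile.\<close>

definition coord_mult :: "real^'n::finite \<Rightarrow> real^'n \<Rightarrow> real^'n" where
  "coord_mult x y = (\<chi> j. x $ j * y $ j)"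

text \<open>With f fixed and c varying this is the orbit of f. Pointwise \<open>dil y f x\<close>
  and \<open>dil x f y\<close> agree, which later lets point and dilation exchange their
  roles.\<close>

definition dil :: "real^'n::finite \<Rightarrow> (real^'n \<Rightarrow> complex) \<Rightarrow> real^'n \<Rightarrow> complex" where
  "dil c f = (\<lambda>x. f (coord_mult x c))"

text \<open>\<open>partial\<close> has an arbitrary value where no derivative exists; the relation
  carries existence and value together.\<close>

definition has_partial :: "'n::finite \<Rightarrow> (real^'n \<Rightarrow> complex) \<Rightarrow> (real^'n \<Rightarrow> complex) \<Rightarrow> bool" where
  "has_partial i f f' \<longleftrightarrow> (\<forall>x. ((\<lambda>t. f (x + t *\<^sub>R axis i 1)) has_vector_derivative f' x) (at 0))"

text \<open>Smoothness of a real function with its derivatives given explicitly: \<open>A 0\<close>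
  is the function and \<open>A k\<close> its k-th derivative.\<close>

definition tower :: "(nat \<Rightarrow> real \<Rightarrow> real) \<Rightarrow> bool" where
  "tower A \<longleftrightarrow> (\<forall>k v. (A k has_real_derivative A (Suc k) v) (at v))"

lemma coord_mult_nth [simp]: "coord_mult x y $ j = x $ j * y $ j"
  by (simp add: coord_mult_def)

lemma coord_mult_commute: "coord_mult x y = coord_mult y x"
  by (simp add: vec_eq_iff mult.commute)

lemma coord_mult_assoc: "coord_mult (coord_mult x y) z = coord_mult x (coord_mult y z)"
  by (simp add: vec_eq_iff mult.assoc)

lemma coord_mult_one [simp]: "coord_mult x 1 = x" "coord_mult 1 x = x"
  by (simp_all add: vec_eq_iff)

lemma continuous_on_coord_mult [continuous_intros]:
  "continuous_on S f \<Longrightarrow> continuous_on S g \<Longrightarrow> continuous_on S (\<lambda>x. coord_mult (f x) (g x))"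
  unfolding coord_mult_def by (intro continuous_intros)

lemma dil_apply: "dil c f x = f (coord_mult x c)"
  by (simp add: dil_def)

lemma dil_dil: "dil c (dil d f) = dil (coord_mult c d) f"
  by (simp add: dil_def coord_mult_assoc)

lemma dil_one [simp]: "dil 1 f = f"
  by (simp add: dil_def)

lemma dil_eq: "dil y f = (\<lambda>\<xi>. f (\<chi> j. \<xi> $ j * y $ j))"
  by (simp add: dil_def coord_mult_def)

lemma has_partialD: "has_partial i f f' \<Longrightarrow> partial i f = f'"
  by (auto simp: has_partial_def partial_def fun_eq_iff intro: vector_derivative_at)

lemma has_partial_exists:
  "(\<exists>f'. has_partial i f f') \<longleftrightarrow> (\<forall>x. (\<lambda>t. f (x + t *\<^sub>R axis i 1)) differentiable (at 0))"
proof
  assume "\<exists>f'. has_partial i f f'"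
  then show "\<forall>x. (\<lambda>t. f (x + t *\<^sub>R axis i 1)) differentiable (at 0)"
    unfolding has_partial_def by (blast intro: differentiableI_vector)
next
  assume "\<forall>x. (\<lambda>t. f (x + t *\<^sub>R axis i 1)) differentiable (at 0)"
  then have "has_partial i f (partial i f)"
    unfolding has_partial_def partial_def by (simp add: vector_derivative_works)
  then show "\<exists>f'. has_partial i f f'" by blast
qed

lemma has_partial_partial: "has_partial i f f' \<Longrightarrow> has_partial i f (partial i f)"
  using has_partialD by blast

text \<open>\<open>has_partial\<close> speaks of t = 0 at every base point; moving the base point
  along the line gives the derivative at any s.\<close>

lemma has_partial_at:
  assumes "has_partial i f f'"
  shows "((\<lambda>t. f (x + t *\<^sub>R axis i 1)) has_vector_derivative f' (x + s *\<^sub>R axis i 1)) (at s)"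
proof -
  have "((\<lambda>t. f ((x + s *\<^sub>R axis i 1) + t *\<^sub>R axis i 1)) has_vector_derivative f' (x + s *\<^sub>R axis i 1)) (at (s - s))"
    using assms by (simp add: has_partial_def)
  moreover have "((\<lambda>t. t - s) has_vector_derivative 1) (at s)"
    by (auto intro!: derivative_eq_intros)
  ultimately have "((\<lambda>t. f ((x + s *\<^sub>R axis i 1) + t *\<^sub>R axis i 1)) \<circ> (\<lambda>t. t - s) has_vector_derivative f' (x + s *\<^sub>R axis i 1)) (at s)"
    using vector_diff_chain_at[of "\<lambda>t. t - s" 1 s] by fastforce
  then show ?thesis
    by (simp add: o_def algebra_simps)
qed

lemma has_partial_add: "has_partial i f f' \<Longrightarrow> has_partial i g g' \<Longrightarrow> has_partial i (\<lambda>x. f x + g x) (\<lambda>x. f' x + g' x)"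
  unfolding has_partial_def by (auto intro: derivative_intros)

lemma has_partial_mult: "has_partial i f f' \<Longrightarrow> has_partial i g g' \<Longrightarrow> has_partial i (\<lambda>x. f x * g x) (\<lambda>x. f x * g' x + f' x * g x)"
  unfolding has_partial_def by (auto intro!: derivative_eq_intros)

lemma has_partial_const: "has_partial i (\<lambda>x. c) (\<lambda>x. 0)"
  unfolding has_partial_def by auto

lemma has_partial_cmult: "has_partial i f f' \<Longrightarrow> has_partial i (\<lambda>x. c * f x) (\<lambda>x. c * f' x)"
  unfolding has_partial_def by (auto intro!: derivative_eq_intros)

lemma has_partial_coord: "has_partial i (\<lambda>x. of_real (x $ j)) (\<lambda>x. if j = i then 1 else 0)"
  unfolding has_partial_def
  by (auto intro!: derivative_eq_intros simp: axis_def of_real_def)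

lemma has_partial_Re: "has_partial i f f' \<Longrightarrow> has_partial i (\<lambda>x. of_real (Re (f x))) (\<lambda>x. of_real (Re (f' x)))"
  unfolding has_partial_def
  by (auto intro!: has_vector_derivative_of_real simp: has_real_derivative_iff_has_vector_derivative
      bounded_linear.has_vector_derivative[OF bounded_linear_Re])

lemma has_partial_dil:
  assumes "has_partial i f f'"
  shows "has_partial i (dil c f) (\<lambda>x. of_real (c $ i) * dil c f' x)"
  unfolding has_partial_def
proof
  fix x
  have "((\<lambda>t. f (coord_mult x c + t *\<^sub>R axis i 1)) has_vector_derivative f' (coord_mult x c)) (at (0 * c $ i))"
    using assms by (simp add: has_partial_def)
  moreover have "((\<lambda>t. t * c $ i) has_vector_derivative c $ i) (at 0)"
    by (auto intro!: derivative_eq_intros)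
  ultimately have "((\<lambda>t. f (coord_mult x c + t *\<^sub>R axis i 1)) \<circ> (\<lambda>t. t * c $ i) has_vector_derivative c $ i *\<^sub>R f' (coord_mult x c)) (at 0)"
    using vector_diff_chain_at[of "\<lambda>t. t * c $ i" "c $ i" 0] by fastforce
  moreover have "coord_mult (x + t *\<^sub>R axis i 1) c = coord_mult x c + (t * c $ i) *\<^sub>R axis i 1" for t
    by (auto simp: vec_eq_iff axis_def algebra_simps)
  ultimately show "((\<lambda>t. dil c f (x + t *\<^sub>R axis i 1)) has_vector_derivative of_real (c $ i) * dil c f' x) (at 0)"
    by (simp add: dil_def o_def scaleR_conv_of_real)
qed

lemma has_partial_comp:
  assumes A: "\<And>v. (a has_real_derivative a' v) (at v)" and f: "has_partial i f f'"
  shows "has_partial i (\<lambda>x. of_real (a (Re (f x)))) (\<lambda>x. of_real (a' (Re (f x))) * of_real (Re (f' x)))"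
  unfolding has_partial_def
proof
  fix x
  have "((\<lambda>t. Re (f (x + t *\<^sub>R axis i 1))) has_vector_derivative Re (f' x)) (at 0)"
    using f by (auto simp: has_partial_def intro: bounded_linear.has_vector_derivative[OF bounded_linear_Re])
  then have "((\<lambda>t. Re (f (x + t *\<^sub>R axis i 1))) has_real_derivative Re (f' x)) (at 0)"
    by (simp add: has_real_derivative_iff_has_vector_derivative)
  from DERIV_chain2[OF A this]
  have "((\<lambda>t. a (Re (f (x + t *\<^sub>R axis i 1)))) has_real_derivative a' (Re (f x)) * Re (f' x)) (at 0)"
    by simp
  from has_vector_derivative_of_real[OF this]
  show "((\<lambda>t. of_real (a (Re (f (x + t *\<^sub>R axis i 1))))) has_vector_derivative of_real (a' (Re (f x))) * of_real (Re (f' x))) (at 0)"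
    by simp
qed

lemma dpart_append: "dpart (u @ w) f = dpart u (dpart w f)"
  by (induction u) auto

text \<open>Every word of derivatives stays in P by induction on the word, so checking one
  differentiation step is enough.\<close>

lemma smooth_coinduct [consumes 1, case_names step]:
  assumes "P f" and step: "\<And>g. P g \<Longrightarrow> continuous_on UNIV g \<and> (\<forall>i. \<exists>g'. has_partial i g g' \<and> P g')"
  shows "smooth f"
proof -
  have "P (dpart is f)" for "is"
  proof (induction "is")
    case (Cons i "is")
    then obtain g' where "has_partial i (dpart is f) g'" "P g'"
      using step by blast
    then show ?case
      by (simp add: has_partialD)
  qed (simp add: assms)
  then show ?thesis
    unfolding smooth_def using step has_partial_exists by blast
qed

lemma smooth_continuous: "smooth f \<Longrightarrow> continuous_on UNIV f"
  unfolding smooth_def by (metis dpart.simps(1))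

lemma smooth_dpart: "smooth f \<Longrightarrow> smooth (dpart w f)"
  unfolding smooth_def by (metis dpart_append)

lemma smooth_partial: "smooth f \<Longrightarrow> smooth (partial i f)"
  using smooth_dpart[of f "[i]"] by simp

lemma smooth_has_partial: "smooth f \<Longrightarrow> has_partial i f (partial i f)"
  unfolding smooth_def by (metis dpart.simps(1) has_partial_exists has_partial_partial)

text \<open>\<open>smooth\<close> quantifies over all iterated derivatives at once. A class of continuous functions that is closed
  under partial derivatives is smooth by coinduction, and this one also contains everything built by the listed operations.\<close>

inductive smooth_closure :: "(real^'n::finite \<Rightarrow> complex) \<Rightarrow> bool" where
  base: "smooth f \<Longrightarrow> smooth_closure f"
| add: "smooth_closure f \<Longrightarrow> smooth_closure g \<Longrightarrow> smooth_closure (\<lambda>x. f x + g x)"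
| mult: "smooth_closure f \<Longrightarrow> smooth_closure g \<Longrightarrow> smooth_closure (\<lambda>x. f x * g x)"
| const: "smooth_closure (\<lambda>x. c)"
| coord: "smooth_closure (\<lambda>x. of_real (x $ j))"
| dil: "smooth_closure f \<Longrightarrow> smooth_closure (dil c f)"
| Re: "smooth_closure f \<Longrightarrow> smooth_closure (\<lambda>x. of_real (Re (f x)))"
| comp: "tower A \<Longrightarrow> smooth_closure f \<Longrightarrow> smooth_closure (\<lambda>x. of_real (A 0 (Re (f x))))"

text \<open>The chain rule turns \<open>A 0\<close> into \<open>A 1\<close>, which heads the shifted
  tower; this keeps the composition case of \<open>smooth_closure\<close> inside the class.\<close>

lemma tower_Suc: "tower A \<Longrightarrow> tower (\<lambda>k. A (Suc k))"
  by (simp add: tower_def)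

lemma tower_continuous: "tower A \<Longrightarrow> continuous_on S (A k)"
  unfolding tower_def by (meson DERIV_isCont continuous_at_imp_continuous_on)

lemma smooth_closure_step: "smooth_closure f \<Longrightarrow> continuous_on UNIV f \<and> (\<forall>i. \<exists>f'. has_partial i f f' \<and> smooth_closure f')"
proof (induction rule: smooth_closure.induct)
    case (base f)
    then show ?case
      using smooth_continuous smooth_has_partial smooth_partial smooth_closure.base by blast
  next
    case (add f g)
    show ?case
    proof (intro conjI allI)
      fix i
      from add obtain f' g' where "has_partial i f f'" "smooth_closure f'" "has_partial i g g'" "smooth_closure g'" by blast
      then show "\<exists>g'. has_partial i (\<lambda>x. f x + g x) g' \<and> smooth_closure g'"
        using has_partial_add smooth_closure.add by metis
    qed (use add in \<open>intro continuous_intros; blast\<close>)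
  next
    case (mult f g)
    show ?case
    proof (intro conjI allI)
      fix i
      from mult obtain f' g' where "has_partial i f f'" "smooth_closure f'" "has_partial i g g'" "smooth_closure g'" by blast
      then have "has_partial i (\<lambda>x. f x * g x) (\<lambda>x. f x * g' x + f' x * g x)" "smooth_closure (\<lambda>x. f x * g' x + f' x * g x)"
        using mult.hyps by (auto intro: has_partial_mult smooth_closure.add smooth_closure.mult)
      then show "\<exists>g'. has_partial i (\<lambda>x. f x * g x) g' \<and> smooth_closure g'"
        by blast
    qed (use mult in \<open>intro continuous_intros; blast\<close>)
  next
    case (const c)
    show ?case
      using has_partial_const[of _ c] smooth_closure.const[of 0] by auto
  next
    case (coord j)
    have "\<exists>g'. has_partial i (\<lambda>x. complex_of_real (x $ j)) g' \<and> smooth_closure g'" for i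
      using has_partial_coord[of i j] smooth_closure.const[of "if j = i then 1 else 0"] by blast
    moreover have "continuous_on UNIV (\<lambda>x::real^'a. complex_of_real (x $ j))"
      by (intro continuous_intros)
    ultimately show ?case by (intro conjI allI)
  next
    case (dil f c)
    have "continuous_on UNIV (dil c f)"
      unfolding dil_def
      by (rule continuous_on_compose2[of UNIV f]) (use dil in \<open>auto intro: continuous_on_coord_mult\<close>)
    moreover have "\<exists>g'. has_partial i (dil c f) g' \<and> smooth_closure g'" for i
    proof -
      obtain f' where f': "has_partial i f f'" "smooth_closure f'"
        using dil by blast
      have "smooth_closure (\<lambda>x. of_real (c $ i) * dil c f' x)"
        by (intro smooth_closure.mult smooth_closure.const smooth_closure.dil f')
      then show ?thesis
        using has_partial_dil[OF f'(1), of c] by blast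
    qed
    ultimately show ?case by (intro conjI allI)
  next
    case (Re f)
    have "\<exists>g'. has_partial i (\<lambda>x. of_real (Re (f x))) g' \<and> smooth_closure g'" for i
    proof -
      obtain f' where f': "has_partial i f f'" "smooth_closure f'"
        using Re by blast
      then show ?thesis
        using has_partial_Re[OF f'(1)] smooth_closure.Re[OF f'(2)] by blast
    qed
    moreover have "continuous_on UNIV (\<lambda>x. complex_of_real (Re (f x)))"
      using Re by (intro continuous_intros) auto
    ultimately show ?case by (intro conjI allI)
  next
    case (comp A f)
    have c: "continuous_on UNIV (\<lambda>x. A 0 (Re (f x)))"
      by (rule continuous_on_compose2[OF tower_continuous[of A UNIV]])
        (use comp in \<open>auto intro: continuous_on_Re\<close>)
    have d: "\<forall>i. \<exists>g'. has_partial i (\<lambda>x. of_real (A 0 (Re (f x)))) g' \<and> smooth_closure g'"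
    proof
      fix i
      obtain f' where f': "has_partial i f f'" "smooth_closure f'"
        using comp by blast
      have "has_partial i (\<lambda>x. of_real (A 0 (Re (f x)))) (\<lambda>x. of_real (A (Suc 0) (Re (f x))) * of_real (Re (f' x)))"
        using comp f' by (intro has_partial_comp) (auto simp: tower_def)
      moreover have "smooth_closure (\<lambda>x. of_real (A (Suc 0) (Re (f x))) * of_real (Re (f' x)))"
        using comp f' by (intro smooth_closure.mult smooth_closure.Re smooth_closure.comp[OF tower_Suc])
      ultimately show "\<exists>g'. has_partial i (\<lambda>x. of_real (A 0 (Re (f x)))) g' \<and> smooth_closure g'"
        by (intro exI conjI)
    qed
    have "continuous_on UNIV (\<lambda>x. complex_of_real (A 0 (Re (f x))))"
      using c by (rule continuous_on_of_real)
    with d show ?case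
      by (rule conjI[rotated])
qed

lemma smooth_closure_imp_smooth: "smooth_closure f \<Longrightarrow> smooth f"
  by (rule smooth_coinduct[of smooth_closure f, OF _ smooth_closure_step])

lemma smooth_add: "smooth f \<Longrightarrow> smooth g \<Longrightarrow> smooth (\<lambda>x. f x + g x)"
  by (rule smooth_closure_imp_smooth[OF smooth_closure.add[OF smooth_closure.base smooth_closure.base]])

lemma smooth_mult: "smooth f \<Longrightarrow> smooth g \<Longrightarrow> smooth (\<lambda>x. f x * g x)"
  by (rule smooth_closure_imp_smooth[OF smooth_closure.mult[OF smooth_closure.base smooth_closure.base]])

lemma smooth_const: "smooth (\<lambda>x. c)"
  by (rule smooth_closure_imp_smooth[OF smooth_closure.const])

lemma smooth_cmult: "smooth f \<Longrightarrow> smooth (\<lambda>x. c * f x)"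
  by (rule smooth_mult[OF smooth_const])

lemma smooth_diff: "smooth f \<Longrightarrow> smooth g \<Longrightarrow> smooth (\<lambda>x. f x - g x)"
  using smooth_add[OF _ smooth_cmult[of g "-1"], of f] by simp

lemma smooth_coord: "smooth (\<lambda>x. of_real (x $ j))"
  by (rule smooth_closure_imp_smooth[OF smooth_closure.coord])

lemma smooth_dil: "smooth f \<Longrightarrow> smooth (dil c f)"
  by (rule smooth_closure_imp_smooth[OF smooth_closure.dil[OF smooth_closure.base]])

lemma smooth_comp: "tower A \<Longrightarrow> smooth f \<Longrightarrow> smooth (\<lambda>x. of_real (A 0 (Re (f x))))"
  using smooth_closure_imp_smooth[OF smooth_closure.comp[of A f]] smooth_closure.base by blast

lemma smooth_sum: "(\<And>a. a \<in> S \<Longrightarrow> smooth (f a)) \<Longrightarrow> smooth (\<lambda>x. \<Sum>a\<in>S. f a x)"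
  by (induction S rule: infinite_finite_induct) (simp_all add: smooth_add smooth_const)

lemma smooth_prod: "(\<And>a. a \<in> S \<Longrightarrow> smooth (f a)) \<Longrightarrow> smooth (\<lambda>x. \<Prod>a\<in>S. f a x)"
  by (induction S rule: infinite_finite_induct) (simp_all add: smooth_mult smooth_const)

lemma smooth_power: "smooth f \<Longrightarrow> smooth (\<lambda>x. f x ^ k)"
  by (induction k) (simp_all add: smooth_mult smooth_const)

lemma partial_add: "smooth f \<Longrightarrow> smooth g \<Longrightarrow> partial i (\<lambda>x. f x + g x) = (\<lambda>x. partial i f x + partial i g x)"
  by (rule has_partialD[OF has_partial_add[OF smooth_has_partial smooth_has_partial]])

lemma partial_mult: "smooth f \<Longrightarrow> smooth g \<Longrightarrow> partial i (\<lambda>x. f x * g x) = (\<lambda>x. f x * partial i g x + partial i f x * g x)"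
  by (rule has_partialD[OF has_partial_mult[OF smooth_has_partial smooth_has_partial]])

lemma partial_cmult: "smooth f \<Longrightarrow> partial i (\<lambda>x. c * f x) = (\<lambda>x. c * partial i f x)"
  by (rule has_partialD[OF has_partial_cmult[OF smooth_has_partial]])

lemma partial_dil: "smooth f \<Longrightarrow> partial i (dil c f) = (\<lambda>x. of_real (c $ i) * dil c (partial i f) x)"
  by (rule has_partialD[OF has_partial_dil[OF smooth_has_partial]])

lemma dpart_add: "smooth f \<Longrightarrow> smooth g \<Longrightarrow> dpart w (\<lambda>x. f x + g x) = (\<lambda>x. dpart w f x + dpart w g x)"
  by (induction w) (simp_all add: partial_add smooth_dpart)

lemma dpart_cmult: "smooth f \<Longrightarrow> dpart w (\<lambda>x. c * f x) = (\<lambda>x. c * dpart w f x)"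
  by (induction w) (simp_all add: partial_cmult smooth_dpart)

lemma dpart_diff: "smooth f \<Longrightarrow> smooth g \<Longrightarrow> dpart w (\<lambda>x. f x - g x) = (\<lambda>x. dpart w f x - dpart w g x)"
  using dpart_add[OF _ smooth_cmult[of g "-1"], of f w] dpart_cmult[of g w "-1"] by simp

lemma dpart_zero: "dpart w (\<lambda>x. 0) = (\<lambda>x. 0)"
  using dpart_cmult[OF smooth_const, of w 0 0] by simp

lemma dpart_sum: "(\<And>a. a \<in> S \<Longrightarrow> smooth (f a)) \<Longrightarrow> dpart w (\<lambda>x. \<Sum>a\<in>S. f a x) = (\<lambda>x. \<Sum>a\<in>S. dpart w (f a) x)"
  by (induction S rule: infinite_finite_induct) (simp_all add: dpart_add smooth_sum dpart_zero)

text \<open>The factor that the chain rule produces when \<open>dpart w\<close> is applied to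
  \<open>dil c f\<close>; see \<open>dpart_dil\<close>.\<close>

definition wprod :: "'n::finite list \<Rightarrow> real^'n \<Rightarrow> complex" where
  "wprod w c = (\<Prod>i\<leftarrow>w. of_real (c $ i))"

lemma wprod_simps [simp]: "wprod [] c = 1" "wprod (i # w) c = of_real (c $ i) * wprod w c"
  by (simp_all add: wprod_def)

lemma dpart_dil: "smooth f \<Longrightarrow> dpart w (dil c f) = (\<lambda>x. wprod w c * dil c (dpart w f) x)"
proof (induction w)
  case (Cons i w)
  then show ?case
    by (simp add: partial_cmult smooth_dil smooth_dpart partial_dil mult_ac)
qed simp

lemma norm_wprod_le: "norm (wprod w c) \<le> norm c ^ length w"
  by (induction w) (simp_all add: norm_mult mult_mono component_le_norm_cart)

lemma continuous_on_wprod [continuous_intros]: "continuous_on S f \<Longrightarrow> continuous_on S (\<lambda>x. wprod w (f x))"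
  by (induction w) (simp_all add: continuous_on_mult continuous_on_of_real continuous_on_component)

subsection \<open>Test functions\<close>

definition cube :: "real \<Rightarrow> (real^'n::finite) set" where
  "cube R = {x. \<forall>j. \<bar>x $ j\<bar> \<le> R}"

text \<open>Cubes suit coordinatewise dilations, and fixing the cube fixes the compact set in the
  continuity condition of a distribution. Since the cube is closed, vanishing off it bounds the
  closed support as well.\<close>

definition test_cube :: "real \<Rightarrow> (real^'n::finite \<Rightarrow> complex) set" where
  "test_cube R = {f. smooth f \<and> (\<forall>x. x \<notin> cube R \<longrightarrow> f x = 0)}"

lemma cube_eq_cbox: "cube R = cbox (\<chi> j. - R) (\<chi> j. R)"
  by (auto simp: cube_def mem_box_cart abs_le_iff minus_le_iff)

lemma compact_cube [simp]: "compact (cube R)"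
  by (simp add: cube_eq_cbox)

lemma closed_cube [simp]: "closed (cube R)"
  by (simp add: compact_imp_closed)

lemma cube_mono: "R \<le> S \<Longrightarrow> cube R \<subseteq> cube S"
  by (auto simp: cube_def intro: order_trans)

lemma test_cube_mono: "R \<le> S \<Longrightarrow> test_cube R \<subseteq> test_cube S"
  using cube_mono by (force simp: test_cube_def)

lemma test_cube_smooth: "f \<in> test_cube R \<Longrightarrow> smooth f"
  by (simp add: test_cube_def)

lemma test_cube_zero: "f \<in> test_cube R \<Longrightarrow> x \<notin> cube R \<Longrightarrow> f x = 0"
  by (simp add: test_cube_def)

lemma test_cube_tsupport: "f \<in> test_cube R \<Longrightarrow> tsupport f \<subseteq> cube R"
  unfolding tsupport_def test_cube_def by (intro closure_minimal) auto

lemma test_cube_test: "f \<in> test_cube R \<Longrightarrow> f \<in> test_fun"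
  using test_cube_tsupport[of f R] bounded_subset[OF compact_imp_bounded[OF compact_cube]]
  by (auto simp: test_fun_def test_cube_def compact_eq_bounded_closed tsupport_def)

lemma bounded_subset_cube:
  fixes S :: "(real^'n::finite) set"
  assumes "bounded S"
  obtains R where "R > 0" "S \<subseteq> cube R"
proof -
  obtain B where "B > 0" "\<And>x. x \<in> S \<Longrightarrow> norm x \<le> B"
    using assms bounded_pos by blast
  then have "S \<subseteq> cube B"
    by (force simp: cube_def intro: order_trans[OF component_le_norm_cart])
  then show ?thesis
    using that \<open>B > 0\<close> by blast
qed

lemma test_test_cube: assumes "f \<in> test_fun" obtains R where "R > 0" "f \<in> test_cube R"
proof -
  have "bounded (tsupport f)" "smooth f"
    using assms by (auto simp: test_fun_def compact_imp_bounded)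
  then obtain R where R: "R > 0" "tsupport f \<subseteq> cube R"
    using bounded_subset_cube by blast
  then have "f x = 0" if "x \<notin> cube R" for x
    using that closure_subset[of "{x. f x \<noteq> 0}"] by (auto simp: tsupport_def)
  then show ?thesis
    using that R \<open>smooth f\<close> by (auto simp: test_cube_def)
qed

lemma test_smooth: "f \<in> test_fun \<Longrightarrow> smooth f"
  by (simp add: test_fun_def)

lemma test_cube_add: "f \<in> test_cube R \<Longrightarrow> g \<in> test_cube R \<Longrightarrow> (\<lambda>x. f x + g x) \<in> test_cube R"
  by (auto simp: test_cube_def smooth_add)

lemma test_cube_diff: "f \<in> test_cube R \<Longrightarrow> g \<in> test_cube R \<Longrightarrow> (\<lambda>x. f x - g x) \<in> test_cube R"
  by (auto simp: test_cube_def smooth_diff)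

lemma test_cube_cmult: "f \<in> test_cube R \<Longrightarrow> (\<lambda>x. c * f x) \<in> test_cube R"
  by (auto simp: test_cube_def smooth_cmult)

lemma test_cube_mult: "f \<in> test_cube R \<Longrightarrow> smooth g \<Longrightarrow> (\<lambda>x. g x * f x) \<in> test_cube R"
  by (auto simp: test_cube_def smooth_mult)

lemma test_cube_sum: "(\<And>a. a \<in> S \<Longrightarrow> f a \<in> test_cube R) \<Longrightarrow> (\<lambda>x. \<Sum>a\<in>S. f a x) \<in> test_cube R"
  by (auto simp: test_cube_def intro!: smooth_sum sum.neutral)

lemma has_partial_zero_off:
  assumes "has_partial i f f'" "open U" "\<And>x. x \<in> U \<Longrightarrow> f x = 0" "x \<in> U"
  shows "f' x = 0"
proof -
  have D: "((\<lambda>t. f (x + t *\<^sub>R axis i 1)) has_vector_derivative f' x) (at 0)"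
    using assms by (simp add: has_partial_def)
  have "((\<lambda>t. x + t *\<^sub>R axis i 1) \<longlongrightarrow> x) (nhds 0)"
    by (auto intro!: tendsto_eq_intros filterlim_ident)
  then have "eventually (\<lambda>t. x + t *\<^sub>R axis i 1 \<in> U) (nhds (0::real))"
    using assms(2,4) topological_tendstoD by blast
  then have ev: "eventually (\<lambda>t. f (x + t *\<^sub>R axis i 1) = 0) (nhds (0::real))"
    by (rule eventually_mono) (use assms in auto)
  have "((\<lambda>t. f (x + t *\<^sub>R axis i 1)) has_vector_derivative f' x) (at 0) = ((\<lambda>t. 0) has_vector_derivative f' x) (at 0)"
  proof (rule has_vector_derivative_cong_ev)
    show "\<forall>\<^sub>F t in nhds 0. t \<in> UNIV \<longrightarrow> f (x + t *\<^sub>R axis i 1) = 0"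
      using ev by simp
    show "f (x + 0 *\<^sub>R axis i 1) = 0"
      using assms(3,4) by simp
  qed
  with D have "((\<lambda>t. 0::complex) has_vector_derivative f' x) (at 0)"
    by blast
  from vector_derivative_at[OF this] show ?thesis
    by simp
qed

lemma test_cube_partial: "f \<in> test_cube R \<Longrightarrow> partial i f \<in> test_cube R"
proof -
  assume f: "f \<in> test_cube R"
  have "partial i f x = 0" if "x \<notin> cube R" for x
    by (rule has_partial_zero_off[OF smooth_has_partial, of f "- cube R"]) (use f that in \<open>auto simp: test_cube_def\<close>)
  then show ?thesis
    using f by (auto simp: test_cube_def smooth_partial)
qed

lemma test_cube_dpart: "f \<in> test_cube R \<Longrightarrow> dpart w f \<in> test_cube R"
  by (induction w) (auto intro: test_cube_partial)

lemma test_cube_coord: "f \<in> test_cube R \<Longrightarrow> (\<lambda>x. of_real (x $ j) * f x) \<in> test_cube R"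
  by (rule test_cube_mult[OF _ smooth_coord])

text \<open>Without a lower bound on the |c_j| a dilation could spread the support without limit;
  with it the cube grows at most by the factor 1 / \<alpha>.\<close>

lemma test_cube_dil:
  assumes "f \<in> test_cube R" "\<alpha> > 0" "\<And>j. \<bar>c $ j\<bar> \<ge> \<alpha>"
  shows "dil c f \<in> test_cube (R / \<alpha>)"
proof -
  have "dil c f x = 0" if x: "x \<notin> cube (R / \<alpha>)" for x
  proof -
    obtain j where "\<bar>x $ j\<bar> > R / \<alpha>"
      using x by (auto simp: cube_def not_le)
    then have "R < \<bar>x $ j\<bar> * \<alpha>"
      using assms(2) by (simp add: field_simps)
    also have "\<dots> \<le> \<bar>x $ j\<bar> * \<bar>c $ j\<bar>"
      using assms(3) by (intro mult_left_mono) auto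
    finally have "coord_mult x c \<notin> cube R"
      by (auto simp: cube_def abs_mult not_le intro!: exI[of _ j])
    then show ?thesis
      using assms(1) by (simp add: dil_def test_cube_zero)
  qed
  then show ?thesis
    using assms by (auto simp: test_cube_def smooth_dil)
qed

section \<open>Points off the coordinate hyperplanes, and bounds on derivatives\<close>

definition all_nonzero :: "real^'n::finite \<Rightarrow> bool" where
  "all_nonzero y \<longleftrightarrow> (\<forall>j. y $ j \<noteq> 0)"

lemma all_nonzero_lower:
  fixes y :: "real^'n::finite"
  assumes "all_nonzero y" obtains \<alpha> where "\<alpha> > 0" "\<And>j. \<bar>y $ j\<bar> \<ge> \<alpha>"
proof
  let ?a = "Min (range (\<lambda>j. \<bar>y $ j\<bar>))"
  show "?a > 0"
    using assms by (auto simp: all_nonzero_def)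
  show "\<And>j. \<bar>y $ j\<bar> \<ge> ?a"
    by (intro Min_le) auto
qed

lemma test_dil: "f \<in> test_fun \<Longrightarrow> all_nonzero y \<Longrightarrow> dil y f \<in> test_fun"
  by (metis test_cube_dil test_cube_test all_nonzero_lower test_test_cube)

text \<open>A C^N norm bound as a relation: it avoids suprema and has the form of the bound in
  \<open>distribution\<close>.\<close>

definition cbound :: "nat \<Rightarrow> (real^'n::finite \<Rightarrow> complex) \<Rightarrow> real \<Rightarrow> bool" where
  "cbound N f B \<longleftrightarrow> (\<forall>w x. length w \<le> N \<longrightarrow> norm (dpart w f x) \<le> B)"

lemma cbound_0: "cbound 0 f B \<longleftrightarrow> (\<forall>x. norm (f x) \<le> B)"
  by (simp add: cbound_def)

text \<open>Words are split at their last letter, the derivative applied first, so that induction on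
  N can pass from f to \<open>partial i f\<close>.\<close>

lemma cbound_Suc: "cbound (Suc N) f B \<longleftrightarrow> (\<forall>x. norm (f x) \<le> B) \<and> (\<forall>i. cbound N (partial i f) B)"
proof
  assume *: "cbound (Suc N) f B"
  have "cbound N (partial i f) B" for i
    unfolding cbound_def
  proof (intro allI impI)
    fix w x assume "length (w :: 'a list) \<le> N"
    then show "norm (dpart w (partial i f) x) \<le> B"
      using *[unfolded cbound_def, rule_format, of "w @ [i]" x] by (simp add: dpart_append)
  qed
  moreover have "norm (f x) \<le> B" for x
    using *[unfolded cbound_def, rule_format, of "[]" x] by simp
  ultimately show "(\<forall>x. norm (f x) \<le> B) \<and> (\<forall>i. cbound N (partial i f) B)" by blast
next
  assume *: "(\<forall>x. norm (f x) \<le> B) \<and> (\<forall>i. cbound N (partial i f) B)"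
  show "cbound (Suc N) f B"
    unfolding cbound_def
  proof (intro allI impI)
    fix w x assume w: "length (w :: 'a list) \<le> Suc N"
    show "norm (dpart w f x) \<le> B"
    proof (cases w rule: rev_cases)
      case (snoc w' i)
      then show ?thesis
        using * w by (simp add: dpart_append cbound_def)
    qed (use * in auto)
  qed
qed

lemma cbound_nonneg: "cbound N f B \<Longrightarrow> 0 \<le> B"
  unfolding cbound_def by (metis dpart.simps(1) le0 list.size(3) norm_ge_zero order_trans)

lemma cbound_mono: "cbound N f B \<Longrightarrow> N' \<le> N \<Longrightarrow> B \<le> B' \<Longrightarrow> cbound N' f B'"
  unfolding cbound_def by (meson order_trans)

lemma cbound_add: "smooth f \<Longrightarrow> smooth g \<Longrightarrow> cbound N f A \<Longrightarrow> cbound N g B \<Longrightarrow> cbound N (\<lambda>x. f x + g x) (A + B)"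
  unfolding cbound_def by (auto simp: dpart_add intro!: norm_triangle_le add_mono)

lemma cbound_diff: "smooth f \<Longrightarrow> smooth g \<Longrightarrow> cbound N f A \<Longrightarrow> cbound N g B \<Longrightarrow> cbound N (\<lambda>x. f x - g x) (A + B)"
  unfolding cbound_def
  by (auto simp: dpart_diff intro!: order_trans[OF norm_triangle_ineq4] add_mono)

lemma cbound_cmult: "smooth f \<Longrightarrow> cbound N f A \<Longrightarrow> cbound N (\<lambda>x. c * f x) (norm c * A)"
  unfolding cbound_def by (auto simp: dpart_cmult norm_mult intro!: mult_left_mono)

lemma test_cube_bounded:
  assumes "f \<in> test_cube R" obtains B where "B \<ge> 0" "\<And>x. norm (f x) \<le> B"
proof -
  have "compact (f ` cube R)"
    using assms by (intro compact_continuous_image) (auto intro: continuous_on_subset[OF smooth_continuous] simp: test_cube_def)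
  then obtain B where "B > 0" "\<And>y. y \<in> f ` cube R \<Longrightarrow> norm y \<le> B"
    using compact_imp_bounded bounded_pos by metis
  then have "norm (f x) \<le> B" for x
    using test_cube_zero[OF assms, of x] by (cases "x \<in> cube R") auto
  then show ?thesis
    using that[of B] \<open>B > 0\<close> by auto
qed

lemma test_cube_cbound:
  assumes "f \<in> test_cube R" shows "\<exists>B. cbound N f B"
  using assms
proof (induction N arbitrary: f)
  case 0
  then show ?case
    using test_cube_bounded cbound_0 by metis
next
  case (Suc N)
  obtain B where B: "\<And>x. norm (f x) \<le> B"
    using Suc.prems test_cube_bounded by metis
  have "\<forall>i. \<exists>C. cbound N (partial i f) C"
    using Suc test_cube_partial by blast
  then obtain C where C: "\<And>i. cbound N (partial i f) (C i)" by metis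
  define D where "D = B + (\<Sum>i\<in>UNIV. C i)"
  have "B \<ge> 0"
    using B norm_ge_zero order_trans by blast
  have "C i \<le> (\<Sum>i\<in>UNIV. C i)" for i
    by (intro member_le_sum) (auto intro: cbound_nonneg C)
  then have "C i \<le> D" for i
    using \<open>B \<ge> 0\<close> by (simp add: D_def add_increasing)
  moreover have "B \<le> D"
    unfolding D_def using C by (auto intro!: sum_nonneg intro: cbound_nonneg)
  ultimately have "cbound (Suc N) f D"
    unfolding cbound_Suc using B by (auto intro: cbound_mono[OF C] order_trans)
  then show ?case by blast
qed

text \<open>In the Leibniz rule at most one derivative hits x_j: |x_j| is at most R on the cube, and
  each of the N derivatives contributes at most one further B.\<close>

lemma cbound_coord:
  assumes "f \<in> test_cube R" "R \<ge> 0" "cbound N f B"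
  shows "cbound N (\<lambda>x. of_real (x $ j) * f x) ((R + real N) * B)"
  using assms
proof (induction N arbitrary: f)
  case 0
  have "norm (of_real (x $ j) * f x) \<le> R * B" for x
  proof (cases "x \<in> cube R")
    case True
    then show ?thesis
      using 0 by (auto simp: norm_mult cbound_0 cube_def intro!: mult_mono)
  next
    case False
    then show ?thesis
      using 0 cbound_nonneg[OF 0(3)] by (simp add: test_cube_zero)
  qed
  then show ?case by (simp add: cbound_0)
next
  case (Suc N)
  have B: "B \<ge> 0" using Suc.prems cbound_nonneg by blast
  have sf: "smooth f" using Suc.prems test_cube_smooth by blast
  have fB: "norm (f x) \<le> B" for x using Suc.prems by (simp add: cbound_Suc)
  have "norm (of_real (x $ j) * f x) \<le> (R + real (Suc N)) * B" for x
  proof (cases "x \<in> cube R")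
    case True
    then have "\<bar>x $ j\<bar> \<le> R" by (simp add: cube_def)
    then show ?thesis
      using fB[of x] by (auto simp: norm_mult intro!: mult_mono)
  next
    case False
    then show ?thesis
      using Suc B by (simp add: test_cube_zero)
  qed
  moreover have "cbound N (partial i (\<lambda>x. of_real (x $ j) * f x)) ((R + real (Suc N)) * B)" for i
  proof -
    have eq: "partial i (\<lambda>x. of_real (x $ j) * f x) = (\<lambda>x. of_real (x $ j) * partial i f x + (if j = i then 1 else 0) * f x)"
      by (rule has_partialD[OF has_partial_mult[OF has_partial_coord smooth_has_partial[OF sf]]])
    have c1: "cbound N (\<lambda>x. of_real (x $ j) * partial i f x) ((R + real N) * B)"
      using Suc.IH[OF test_cube_partial[OF Suc.prems(1), of i] Suc.prems(2)] Suc.prems(3) by (simp add: cbound_Suc)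
    have c2: "cbound N (\<lambda>x. (if j = i then 1 else 0) * f x) B"
    proof -
      have "cbound N f B"
        using Suc.prems(3) cbound_mono[of "Suc N" f B N B] by simp
      from cbound_cmult[OF sf this, of "if j = i then 1 else 0"] show ?thesis
        by (rule cbound_mono[OF _ order_refl]) (use B in auto)
    qed
    have "cbound N (\<lambda>x. of_real (x $ j) * partial i f x + (if j = i then 1 else 0) * f x) ((R + real N) * B + B)"
      by (rule cbound_add[OF smooth_mult[OF smooth_coord smooth_partial[OF sf]] smooth_cmult[OF sf] c1 c2])
    moreover have "(R + real N) * B + B = (R + real (Suc N)) * B"
      by (simp add: algebra_simps)
    ultimately show ?thesis
      unfolding eq by (simp only:)
  qed
  ultimately show ?case
    by (simp add: cbound_Suc)
qed

lemma cbound_dil: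
  assumes "smooth f" "cbound N f B"
  shows "cbound N (dil c f) ((1 + norm c) ^ N * B)"
  unfolding cbound_def
proof (intro allI impI)
  fix w x assume w: "length (w :: 'a list) \<le> N"
  have "norm (wprod w c) \<le> (1 + norm c) ^ N"
  proof -
    have "norm (wprod w c) \<le> (1 + norm c) ^ length w"
      by (rule order_trans[OF norm_wprod_le]) (auto intro!: power_mono)
    also have "\<dots> \<le> (1 + norm c) ^ N"
      using w by (intro power_increasing) auto
    finally show ?thesis .
  qed
  then show "norm (dpart w (dil c f) x) \<le> (1 + norm c) ^ N * B"
    unfolding dpart_dil[OF assms(1)] norm_mult dil_apply
    using assms(2) w by (intro mult_mono) (auto simp: cbound_def)
qed

text \<open>The operator theta_j - b. With b = -1 it is minus the transpose of theta_j; with b = s +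
  2m it annihilates the monomial x_j^(s + 2m).\<close>

definition euler :: "'n::finite \<Rightarrow> complex \<Rightarrow> (real^'n \<Rightarrow> complex) \<Rightarrow> real^'n \<Rightarrow> complex" where
  "euler j b f = (\<lambda>x. of_real (x $ j) * partial j f x - b * f x)"

lemma smooth_euler: "smooth f \<Longrightarrow> smooth (euler j b f)"
  unfolding euler_def by (rule smooth_diff[OF smooth_mult[OF smooth_coord smooth_partial] smooth_cmult])

lemma test_cube_euler: "f \<in> test_cube R \<Longrightarrow> euler j b f \<in> test_cube R"
  unfolding euler_def by (rule test_cube_diff[OF test_cube_coord[OF test_cube_partial] test_cube_cmult])

lemma test_euler: "f \<in> test_fun \<Longrightarrow> euler j b f \<in> test_fun"
  by (metis test_cube_euler test_cube_test test_test_cube)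

text \<open>theta_j is scale invariant: the factor c_j from the chain rule is absorbed by the
  coordinate in front of the derivative.\<close>

lemma euler_dil: "smooth f \<Longrightarrow> euler j b (dil c f) = dil c (euler j b f)"
  by (simp add: euler_def partial_dil) (simp add: dil_def fun_eq_iff)

lemma cbound_euler:
  assumes "f \<in> test_cube R" "R \<ge> 0" "cbound (Suc N) f B"
  shows "cbound N (euler j b f) ((R + real N + norm b) * B)"
proof -
  have sf: "smooth f" using assms(1) by (rule test_cube_smooth)
  have c1: "cbound N (\<lambda>x. of_real (x $ j) * partial j f x) ((R + real N) * B)"
    using cbound_coord[OF test_cube_partial[OF assms(1)] assms(2)] assms(3) by (simp add: cbound_Suc)
  have c2: "cbound N (\<lambda>x. b * f x) (norm b * B)"
    by (rule cbound_cmult[OF sf cbound_mono[OF assms(3)]]) simp_all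
  have "cbound N (euler j b f) ((R + real N) * B + norm b * B)"
    unfolding euler_def
    by (rule cbound_diff[OF smooth_mult[OF smooth_coord smooth_partial[OF sf]] smooth_cmult[OF sf] c1 c2])
  moreover have "(R + real N) * B + norm b * B = (R + real N + norm b) * B"
    by (simp add: algebra_simps)
  ultimately show ?thesis
    by (simp only:)
qed

subsection \<open>Distributions\<close>

lemma test_add: "f \<in> test_fun \<Longrightarrow> g \<in> test_fun \<Longrightarrow> (\<lambda>x. f x + g x) \<in> test_fun"
proof -
  assume "f \<in> test_fun" "g \<in> test_fun"
  then obtain R S where "f \<in> test_cube R" "g \<in> test_cube S"
    by (metis test_test_cube)
  then have "f \<in> test_cube (max R S)" "g \<in> test_cube (max R S)"
    using test_cube_mono[of R "max R S"] test_cube_mono[of S "max R S"] by auto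
  then show ?thesis
    by (blast intro: test_cube_add test_cube_test)
qed

lemma test_cmult: "f \<in> test_fun \<Longrightarrow> (\<lambda>x. c * f x) \<in> test_fun"
  by (metis test_cube_cmult test_cube_test test_test_cube)

lemma test_diff: "f \<in> test_fun \<Longrightarrow> g \<in> test_fun \<Longrightarrow> (\<lambda>x. f x - g x) \<in> test_fun"
  using test_add[OF _ test_cmult[of g "-1"], of f] by simp

lemma test_mult: "f \<in> test_fun \<Longrightarrow> smooth g \<Longrightarrow> (\<lambda>x. g x * f x) \<in> test_fun"
  by (metis test_cube_mult test_cube_test test_test_cube)

lemma test_zero: "(\<lambda>x. 0) \<in> test_fun"
  by (rule test_cube_test[of _ 0]) (simp add: test_cube_def smooth_const)

lemma test_sum: "(\<And>a. a \<in> S \<Longrightarrow> f a \<in> test_fun) \<Longrightarrow> (\<lambda>x. \<Sum>a\<in>S. f a x) \<in> test_fun"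
  by (induction S rule: infinite_finite_induct) (simp_all add: test_add test_zero)

context
  fixes T :: "(real^'n::finite \<Rightarrow> complex) \<Rightarrow> complex"
  assumes T: "distribution T"
begin

lemma dist_add: "f \<in> test_fun \<Longrightarrow> g \<in> test_fun \<Longrightarrow> T (\<lambda>x. f x + g x) = T f + T g"
  using T by (simp add: distribution_def)

lemma dist_cmult: "f \<in> test_fun \<Longrightarrow> T (\<lambda>x. c * f x) = c * T f"
  using T by (simp add: distribution_def)

lemma dist_zero: "T (\<lambda>x. 0) = 0"
  using dist_cmult[OF test_zero, of 0] by simp

lemma dist_diff: "f \<in> test_fun \<Longrightarrow> g \<in> test_fun \<Longrightarrow> T (\<lambda>x. f x - g x) = T f - T g"
  using dist_add[OF _ test_cmult[of g "-1"], of f] dist_cmult[of g "-1"] by simp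

lemma dist_sum: "(\<And>a. a \<in> S \<Longrightarrow> f a \<in> test_fun) \<Longrightarrow> T (\<lambda>x. \<Sum>a\<in>S. f a x) = (\<Sum>a\<in>S. T (f a))"
  by (induction S rule: infinite_finite_induct) (simp_all add: dist_zero dist_add test_sum)

lemma dist_bound: "\<exists>C N. C \<ge> 0 \<and> (\<forall>f\<in>test_cube R. \<forall>B. cbound N f B \<longrightarrow> norm (T f) \<le> C * B)"
proof -
  obtain C N where C: "\<forall>f\<in>test_fun. \<forall>M. tsupport f \<subseteq> cube R \<longrightarrow>
          (\<forall>is x. length is \<le> N \<longrightarrow> norm (dpart is f x) \<le> M) \<longrightarrow> norm (T f) \<le> C * M"
    using T compact_cube[of R] unfolding distribution_def by meson
  have "norm (T f) \<le> \<bar>C\<bar> * B" if "f \<in> test_cube R" "cbound N f B" for f B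
  proof -
    have "norm (T f) \<le> C * B"
      using C that test_cube_test test_cube_tsupport unfolding cbound_def by blast
    also have "\<dots> \<le> \<bar>C\<bar> * B"
      using cbound_nonneg[OF that(2)] by (intro mult_right_mono) auto
    finally show ?thesis .
  qed
  then show ?thesis
    by (intro exI[of _ "\<bar>C\<bar>"] exI[of _ N]) auto
qed

end

subsection \<open>Smooth step functions\<close>

text \<open>The polynomial in 1/v makes the class of these flat functions closed under
  differentiation.\<close>

definition flat_exp :: "real poly \<Rightarrow> real \<Rightarrow> real" where
  "flat_exp P v = (if v \<le> 0 then 0 else poly P (1 / v) * exp (- (1 / v)))"

text \<open>The extra power \<open>z ^ n\<close> is what makes the induction over the coefficients
  of P go through.\<close>

lemma tendsto_power_poly_exp: "((\<lambda>z::real. z ^ n * poly P z * exp (- z)) \<longlongrightarrow> 0) at_top"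
proof (induction P arbitrary: n)
  case (pCons a P)
  have "((\<lambda>z::real. a * (z ^ n / exp z) + z ^ Suc n * poly P z * exp (- z)) \<longlongrightarrow> a * 0 + 0) at_top"
    by (intro tendsto_intros tendsto_power_div_exp_0 pCons.IH)
  then show ?case
    by (simp add: algebra_simps exp_minus divide_inverse)
qed simp

lemma flat_exp_tendsto_0: "(flat_exp P \<longlongrightarrow> 0) (at 0)"
proof (rule filterlim_split_at)
  have "((\<lambda>v. 0) \<longlongrightarrow> 0) (at_left (0::real))" by simp
  then show "(flat_exp P \<longlongrightarrow> 0) (at_left 0)"
    by (rule tendsto_cong[THEN iffD1, rotated]) (auto simp: flat_exp_def eventually_at_filter intro!: always_eventually)
  have "((\<lambda>z::real. poly P z * exp (- z)) \<longlongrightarrow> 0) at_top"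
    using tendsto_power_poly_exp[of 0 P] by simp
  then have "((\<lambda>v::real. poly P (inverse v) * exp (- (inverse v))) \<longlongrightarrow> 0) (at_right 0)"
    by (rule filterlim_compose[OF _ filterlim_inverse_at_top_right])
  then show "(flat_exp P \<longlongrightarrow> 0) (at_right 0)"
    by (rule tendsto_cong[THEN iffD1, rotated])
      (auto simp: flat_exp_def eventually_at_filter divide_inverse intro!: always_eventually)
qed

text \<open>For v > 0 the derivative of P(1/v) exp(-1/v) is z^2 (P - P') at z = 1/v times the
  exponential. At 0 the difference quotient is again a flat function, with polynomial z P, hence
  tends to 0.\<close>

lemma flat_exp_deriv: "(flat_exp P has_real_derivative flat_exp ([:0, 0, 1:] * (P - pderiv P)) v) (at v)"
proof -
  consider "v > 0" | "v < 0" | "v = 0" by linarith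
  then show ?thesis
  proof cases
    case 1
    have "((\<lambda>v. poly P (1 / v) * exp (- (1 / v))) has_real_derivative
        flat_exp ([:0, 0, 1:] * (P - pderiv P)) v) (at v)"
      using 1 by (auto intro!: derivative_eq_intros poly_DERIV[THEN DERIV_chain2]
          simp: flat_exp_def field_simps power2_eq_square)
    then show ?thesis
      by (rule has_field_derivative_transform_within_open[of _ _ _ "{0<..}"]) (use 1 in \<open>auto simp: flat_exp_def\<close>)
  next
    case 2
    have "((\<lambda>v. 0) has_real_derivative flat_exp ([:0, 0, 1:] * (P - pderiv P)) v) (at v)"
      using 2 by (auto simp: flat_exp_def)
    then show ?thesis
      by (rule has_field_derivative_transform_within_open[of _ _ _ "{..<0}"]) (use 2 in \<open>auto simp: flat_exp_def\<close>)
  next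
    case 3
    have "((\<lambda>h. flat_exp P h / h) \<longlongrightarrow> 0) (at 0)"
      using flat_exp_tendsto_0[of "[:0, 1:] * P"]
      by (rule tendsto_cong[THEN iffD1, rotated])
        (auto simp: flat_exp_def eventually_at_filter divide_inverse intro!: always_eventually)
    then have "(flat_exp P has_real_derivative 0) (at 0)"
      unfolding DERIV_def by (simp add: flat_exp_def)
    moreover have "flat_exp ([:0, 0, 1:] * (P - pderiv P)) 0 = 0"
      by (simp add: flat_exp_def)
    ultimately show ?thesis
      using 3 by simp
  qed
qed

lemma tower_flat_exp: "tower (\<lambda>k. flat_exp (((\<lambda>P. [:0, 0, 1:] * (P - pderiv P)) ^^ k) 1))"
  using flat_exp_deriv by (simp add: tower_def)

text \<open>One-variable analogue of \<open>smooth_closure\<close>: closed under derivatives, so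
  that a tower can be extracted by dependent choice.\<close>

inductive smooth1 :: "(real \<Rightarrow> real) \<Rightarrow> bool" where
  tower: "tower A \<Longrightarrow> smooth1 (A 0)"
| add: "smooth1 f \<Longrightarrow> smooth1 g \<Longrightarrow> smooth1 (\<lambda>v. f v + g v)"
| mult: "smooth1 f \<Longrightarrow> smooth1 g \<Longrightarrow> smooth1 (\<lambda>v. f v * g v)"
| aff: "smooth1 f \<Longrightarrow> smooth1 (\<lambda>v. c * f (a * v + b))"

lemma smooth1_step: "smooth1 f \<Longrightarrow> \<exists>f'. (\<forall>v. (f has_real_derivative f' v) (at v)) \<and> smooth1 f'"
proof (induction rule: smooth1.induct)
  case (tower A)
  then show ?case
    using smooth1.tower[OF tower_Suc[OF tower]] by (auto simp: tower_def)
next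
  case (add f g)
  then obtain f' g' where *: "\<forall>v. (f has_real_derivative f' v) (at v)" "smooth1 f'"
    "\<forall>v. (g has_real_derivative g' v) (at v)" "smooth1 g'" by metis
  then have "\<forall>v. ((\<lambda>v. f v + g v) has_real_derivative f' v + g' v) (at v)"
    by (auto intro: derivative_intros)
  then show ?case
    using smooth1.add[OF *(2) *(4)] by (intro exI[of _ "\<lambda>v. f' v + g' v"] conjI)
next
  case (mult f g)
  then obtain f' g' where *: "\<forall>v. (f has_real_derivative f' v) (at v)" "smooth1 f'"
    "\<forall>v. (g has_real_derivative g' v) (at v)" "smooth1 g'" by metis
  then have "\<forall>v. ((\<lambda>v. f v * g v) has_real_derivative f' v * g v + g' v * f v) (at v)"
    by (auto intro!: derivative_eq_intros)
  then show ?case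
    using smooth1.add[OF smooth1.mult[OF *(2) mult.hyps(2)] smooth1.mult[OF *(4) mult.hyps(1)]]
    by (intro exI[of _ "\<lambda>v. f' v * g v + g' v * f v"] conjI)
next
  case (aff f c a b)
  then obtain f' where *: "\<And>v. (f has_real_derivative f' v) (at v)" "smooth1 f'" by metis
  have "\<forall>v. ((\<lambda>v. c * f (a * v + b)) has_real_derivative (c * a) * f' (a * v + b)) (at v)"
    by (auto intro!: derivative_eq_intros DERIV_chain2[OF *(1)])
  then show ?case
    using smooth1.aff[OF *(2), of "c * a" a b]
    by (intro exI[of _ "\<lambda>v. (c * a) * f' (a * v + b)"] conjI)
qed

lemma smooth1_tower: assumes "smooth1 f" obtains A where "tower A" "A 0 = f"
proof -
  have "\<exists>A. \<forall>n. (smooth1 (A n) \<and> (n = 0 \<longrightarrow> A n = f)) \<and> (\<forall>v. (A n has_real_derivative A (Suc n) v) (at v))"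
  proof (rule dependent_nat_choice)
    show "\<exists>x. smooth1 x \<and> (0 = (0::nat) \<longrightarrow> x = f)" using assms by blast
  next
    fix g and n :: nat
    assume "smooth1 g \<and> (n = 0 \<longrightarrow> g = f)"
    then obtain g' where "\<forall>v. (g has_real_derivative g' v) (at v)" "smooth1 g'"
      using smooth1_step by metis
    then show "\<exists>g'. (smooth1 g' \<and> (Suc n = 0 \<longrightarrow> g' = f)) \<and> (\<forall>v. (g has_real_derivative g' v) (at v))"
      by (intro exI[of _ g'] conjI) simp_all
  qed
  then show ?thesis
    using that unfolding tower_def by metis
qed

lemma antiderivative_exists:
  fixes f :: "real \<Rightarrow> real"
  assumes "continuous_on UNIV f"
  obtains F where "\<And>v. (F has_real_derivative f v) (at v)"
proof (rule that[of "\<lambda>u. LBINT y=ereal 0..ereal u. f y"])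
  fix v :: real
  define a where "a = min v 0 - 1"
  define b where "b = max v 0 + 1"
  have "((\<lambda>u. LBINT y=ereal 0..ereal u. f y) has_vector_derivative f v) (at v within {a..b})"
    by (rule interval_integral_FTC2) (auto simp: a_def b_def intro: continuous_on_subset[OF assms])
  then have "((\<lambda>u. LBINT y=ereal 0..ereal u. f y) has_vector_derivative f v) (at v)"
    by (subst (asm) at_within_interior) (auto simp: a_def b_def)
  then show "((\<lambda>u. LBINT y=ereal 0..ereal u. f y) has_real_derivative f v) (at v)"
    by (simp add: has_real_derivative_iff_has_vector_derivative)
qed

text \<open>The normalised decreasing primitive of a bump that is positive exactly on (0, 1). The
  sign of the first derivative later makes the approximate delta functions nonnegative.\<close>

lemma step_tower_exists:
  "\<exists>S. tower S \<and> (\<forall>v\<le>0. S 0 v = 1) \<and> (\<forall>v\<ge>1. S 0 v = 0) \<and>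
     (\<forall>v. 0 \<le> S 0 v \<and> S 0 v \<le> 1) \<and> (\<forall>v. S 1 v \<le> 0)"
proof -
  \<comment> \<open>A flat function at 0 times its mirror image at 1, written in the form that
    \<open>smooth1.aff\<close> produces.\<close>
  define q where "q v = flat_exp 1 v * (1 * flat_exp 1 ((-1) * v + 1))" for v
  have "smooth1 (flat_exp 1)"
    using smooth1.tower[OF tower_flat_exp] by simp
  from smooth1.mult[OF this smooth1.aff[OF this, of 1 "-1" 1]] have "smooth1 q"
    by (simp add: q_def[abs_def])
  then obtain Q where Q: "tower Q" "Q 0 = q"
    by (rule smooth1_tower)
  have q0: "q v \<ge> 0" "v \<le> 0 \<Longrightarrow> q v = 0" "v \<ge> 1 \<Longrightarrow> q v = 0" "0 < v \<Longrightarrow> v < 1 \<Longrightarrow> q v > 0" for v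
    by (auto simp: q_def flat_exp_def)
  obtain F where F: "\<And>v. (F has_real_derivative q v) (at v)"
    using antiderivative_exists tower_continuous[OF Q(1), of UNIV 0] Q(2) by metis
  have "F 0 < F 1"
    by (rule DERIV_pos_imp_increasing_open[OF zero_less_one])
      (use F q0(4) DERIV_isCont in \<open>blast intro: continuous_at_imp_continuous_on\<close>)+
  have mono: "F u \<le> F v" if "u \<le> v" for u v
    by (rule DERIV_nonneg_imp_nondecreasing[OF that]) (use F q0(1) in blast)
  have contF: "continuous_on A F" for A
    using F DERIV_isCont by (metis continuous_at_imp_continuous_on)
  have le0: "F v = F 0" if "v \<le> 0" for v
  proof (cases "v = 0")
    case False
    then have "v < 0" using that by simp
    then have "F 0 = F v"
    proof (rule DERIV_isconst_end)
      show "(F has_real_derivative 0) (at x)" if "x < 0" for x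
        using F[of x] q0(2)[of x] that by simp
    qed (rule contF)
    then show ?thesis by simp
  qed simp
  have ge1: "F v = F 1" if "v \<ge> 1" for v
  proof (cases "v = 1")
    case False
    then have "1 < v" using that by simp
    then show ?thesis
    proof (rule DERIV_isconst_end)
      show "(F has_real_derivative 0) (at x)" if "1 < x" for x
        using F[of x] q0(3)[of x] that by simp
    qed (rule contF)
  qed simp
  define Z where "Z = F 1 - F 0"
  have Z: "Z > 0" using \<open>F 0 < F 1\<close> by (simp add: Z_def)
  define S where "S k v = (case k of 0 \<Rightarrow> (F 1 - F v) / Z | Suc k \<Rightarrow> - Q k v / Z)" for k v
  have "tower S"
    unfolding tower_def
  proof (intro allI)
    fix k v
    show "(S k has_real_derivative S (Suc k) v) (at v)"
    proof (cases k)
      case 0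
      have "((\<lambda>v. (F 1 - F v) / Z) has_real_derivative - q v / Z) (at v)"
        using Z by (auto intro!: derivative_eq_intros F)
      then show ?thesis
        using 0 Q(2) by (simp add: S_def[abs_def])
    next
      case (Suc l)
      have "(Q l has_real_derivative Q (Suc l) v) (at v)"
        using Q(1) by (simp add: tower_def)
      then have "((\<lambda>v. - Q l v / Z) has_real_derivative - Q (Suc l) v / Z) (at v)"
        using Z by (auto intro!: derivative_eq_intros)
      then show ?thesis
        using Suc by (simp add: S_def[abs_def])
    qed
  qed
  moreover have "S 0 v = 1" if "v \<le> 0" for v
    using Z le0[OF that] by (simp add: S_def Z_def)
  moreover have "S 0 v = 0" if "v \<ge> 1" for v
    using ge1[OF that] by (simp add: S_def)
  moreover have "S 1 v \<le> 0" for v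
    using Z q0(1)[of v] by (simp add: S_def Q(2))
  moreover have "0 \<le> S 0 v \<and> S 0 v \<le> 1" for v
  proof -
    have "F 0 \<le> F v" "F v \<le> F 1"
      using le0[of v] mono[of 0 v] ge1[of v] mono[of v 1] \<open>F 0 < F 1\<close> by linarith+
    then show ?thesis
      using Z by (simp add: S_def Z_def)
  qed
  ultimately show ?thesis by (intro exI[of _ S] conjI allI impI) auto
qed

definition smooth_step :: "nat \<Rightarrow> real \<Rightarrow> real" where
  "smooth_step = (SOME S. tower S \<and> (\<forall>v\<le>0. S 0 v = 1) \<and> (\<forall>v\<ge>1. S 0 v = 0) \<and>
     (\<forall>v. 0 \<le> S 0 v \<and> S 0 v \<le> 1) \<and> (\<forall>v. S 1 v \<le> 0))"

lemma smooth_step: "tower smooth_step" "v \<le> 0 \<Longrightarrow> smooth_step 0 v = 1" "v \<ge> 1 \<Longrightarrow> smooth_step 0 v = 0" "0 \<le> smooth_step 0 v" "smooth_step 0 v \<le> 1" "smooth_step 1 v \<le> 0"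
  using someI_ex[OF step_tower_exists, folded smooth_step_def] by blast+

text \<open>To the right of 1 the function is constant; at v = 1 itself each derivative vanishes by
  continuity from the right.\<close>

lemma smooth_step_zero: "v \<ge> 1 \<Longrightarrow> smooth_step k v = 0"
proof (induction k arbitrary: v)
  case 0
  then show ?case by (simp add: smooth_step)
next
  case (Suc k)
  have D: "(smooth_step k has_real_derivative smooth_step (Suc k) u) (at u)" for u
    using smooth_step(1) by (simp add: tower_def)
  have *: "smooth_step (Suc k) u = 0" if "u > 1" for u
  proof -
    have "((\<lambda>v. 0) has_real_derivative smooth_step (Suc k) u) (at u)"
      by (rule has_field_derivative_transform_within_open[OF D, of "{1<..}"]) (use that Suc in auto)
    then show ?thesis
      using DERIV_unique DERIV_const by blast
  qed
  have "continuous_on UNIV (smooth_step (Suc k))"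
    by (rule tower_continuous[OF smooth_step(1)])
  then have "(smooth_step (Suc k) \<longlongrightarrow> smooth_step (Suc k) 1) (at 1)"
    by (simp add: continuous_on_def)
  then have "(smooth_step (Suc k) \<longlongrightarrow> smooth_step (Suc k) 1) (at_right 1)"
    by (rule tendsto_within_subset) simp
  moreover have "(smooth_step (Suc k) \<longlongrightarrow> 0) (at_right 1)"
    by (rule tendsto_eventually) (auto simp: eventually_at_filter *)
  ultimately have "smooth_step (Suc k) 1 = 0"
    using tendsto_unique trivial_limit_at_right_real by blast
  then show ?case
    using * Suc.prems by (cases "v = 1") auto
qed

subsection \<open>Supports\<close>

text \<open>A local cutoff in product form: one smooth step of the squared distance for each
  coordinate.\<close>

lemma plateau:
  fixes x :: "real^'n::finite"
  assumes "open U" "x \<in> U"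
  obtains \<rho> V where "smooth \<rho>" "open V" "x \<in> V" "\<And>z. z \<in> V \<Longrightarrow> \<rho> z = 1" "closure {z. \<rho> z \<noteq> 0} \<subseteq> U"
proof -
  obtain e where e: "e > 0" "cball x e \<subseteq> U"
    using assms open_contains_cball by blast
  \<comment> \<open>Dividing by the dimension puts the cube of half side r into the ball, since the
    norm is at most the l1 norm.\<close>
  define r where "r = e / real CARD('n)"
  have r: "r > 0" using e by (simp add: r_def)
  have *: "z \<in> U" if "\<And>j. \<bar>z $ j - x $ j\<bar> \<le> r" for z
  proof -
    have "norm (z - x) \<le> (\<Sum>j\<in>UNIV. \<bar>(z - x) $ j\<bar>)"
      by (rule norm_le_l1_cart)
    also have "\<dots> \<le> real CARD('n) * r"
      using that by (intro sum_bounded_above[where K = r, simplified]) auto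
    also have "\<dots> = e"
      by (simp add: r_def)
    finally show ?thesis
      using e by (auto simp: dist_norm norm_minus_commute)
  qed
  \<comment> \<open>Scaled so that the real part is \<le> 0 when the coordinate distance is below
    r/2 and \<ge> 1 as soon as the distance reaches r.\<close>
  define h where "h j z = complex_of_real (2 / r\<^sup>2) * (of_real (z $ j) - of_real (x $ j))\<^sup>2 - 1" for j and z :: "real^'n"
  have Reh: "Re (h j z) = 2 / r\<^sup>2 * (z $ j - x $ j)\<^sup>2 - 1" for j z
    by (simp add: h_def flip: of_real_diff of_real_power)
  define \<rho> where "\<rho> z = (\<Prod>j\<in>UNIV. complex_of_real (smooth_step 0 (Re (h j z))))" for z
  have "smooth (h j)" for j
    unfolding h_def[abs_def]
    by (rule smooth_diff[OF smooth_cmult[OF smooth_power[OF smooth_diff[OF smooth_coord smooth_const]]] smooth_const])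
  then have "smooth \<rho>"
    unfolding \<rho>_def[abs_def] by (intro smooth_prod smooth_comp smooth_step(1))
  moreover define V where "V = (\<Inter>j. {z. \<bar>z $ j - x $ j\<bar> < r / 2})"
  moreover have "open V"
    unfolding V_def by (intro open_INT ballI open_Collect_less continuous_intros) auto
  moreover have "x \<in> V"
    using r by (simp add: V_def)
  moreover have "\<rho> z = 1" if "z \<in> V" for z
  proof -
    have "Re (h j z) \<le> 0" for j
    proof -
      have "\<bar>z $ j - x $ j\<bar> < r / 2"
        using that by (simp add: V_def)
      then have "\<bar>z $ j - x $ j\<bar>\<^sup>2 \<le> (r / 2)\<^sup>2"
        by (intro power_mono) auto
      moreover have "(r / 2)\<^sup>2 \<le> r\<^sup>2 / 2"
        by (simp add: power_divide)
      ultimately have "2 * (z $ j - x $ j)\<^sup>2 \<le> r\<^sup>2"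
        by simp
      then show ?thesis
        using r by (simp add: Reh divide_le_eq)
    qed
    then show ?thesis
      by (simp add: \<rho>_def smooth_step)
  qed
  moreover have "closure {z. \<rho> z \<noteq> 0} \<subseteq> U"
  proof -
    have "{z. \<rho> z \<noteq> 0} \<subseteq> {z. \<forall>j. \<bar>z $ j - x $ j\<bar> \<le> r}"
    proof safe
      fix z j assume "\<rho> z \<noteq> 0"
      then have "Re (h j z) < 1"
        using smooth_step(3)[of "Re (h j z)"] by (force simp: \<rho>_def not_le)
      then have "(z $ j - x $ j)\<^sup>2 < r\<^sup>2"
        using r by (simp add: Reh divide_less_eq)
      then show "\<bar>z $ j - x $ j\<bar> \<le> r"
        using r by (metis abs_le_square_iff abs_of_pos less_imp_le)
    qed
    moreover have "closed {z. \<forall>j. \<bar>z $ j - x $ j\<bar> \<le> r}"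
      by (intro closed_Collect_all closed_Collect_le continuous_intros)
    ultimately have "closure {z. \<rho> z \<noteq> 0} \<subseteq> {z. \<forall>j. \<bar>z $ j - x $ j\<bar> \<le> r}"
      by (rule closure_minimal)
    then show ?thesis
      using * by blast
  qed
  ultimately show ?thesis
    using that by blast
qed

text \<open>\<open>dsupp\<close> only gives vanishing near each point. Instead of a partition of
  unity, cutoffs are peeled off one by one: subtracting \<open>\<rho> x z * g z\<close> clears g on
  one member of a finite cover of the support.\<close>

lemma dist_eq_zero_off_dsupp:
  assumes T: "distribution T" and f: "f \<in> test_fun" and disj: "tsupport f \<inter> dsupp T = {}"
  shows "T f = 0"
proof -
  have "\<forall>x\<in>tsupport f. \<exists>\<rho> V. smooth \<rho> \<and> open V \<and> x \<in> V \<and> (\<forall>z\<in>V. \<rho> z = 1) \<and>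
          (\<forall>g\<in>test_fun. T (\<lambda>z. \<rho> z * g z) = 0)"
  proof
    fix x assume "x \<in> tsupport f"
    then have "x \<notin> dsupp T" using disj by blast
    then obtain U where U: "open U" "x \<in> U" "\<And>g. g \<in> test_fun \<Longrightarrow> tsupport g \<subseteq> U \<Longrightarrow> T g = 0"
      by (auto simp: dsupp_def)
    obtain \<rho> V where \<rho>: "smooth \<rho>" "open V" "x \<in> V" "\<And>z. z \<in> V \<Longrightarrow> \<rho> z = 1" "closure {z. \<rho> z \<noteq> 0} \<subseteq> U"
      using plateau[OF U(1,2)] by blast
    have "T (\<lambda>z. \<rho> z * g z) = 0" if "g \<in> test_fun" for g
    proof (rule U(3))
      show "(\<lambda>z. \<rho> z * g z) \<in> test_fun"
        using that \<rho>(1) by (rule test_mult)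
      have "tsupport (\<lambda>z. \<rho> z * g z) \<subseteq> closure {z. \<rho> z \<noteq> 0}"
        unfolding tsupport_def by (rule closure_mono) auto
      then show "tsupport (\<lambda>z. \<rho> z * g z) \<subseteq> U"
        using \<rho>(5) by blast
    qed
    then show "\<exists>\<rho> V. smooth \<rho> \<and> open V \<and> x \<in> V \<and> (\<forall>z\<in>V. \<rho> z = 1) \<and>
          (\<forall>g\<in>test_fun. T (\<lambda>z. \<rho> z * g z) = 0)"
      using \<rho> by (intro exI[of _ \<rho>] exI[of _ V]) auto
  qed
  then obtain \<rho> V where *: "\<And>x. x \<in> tsupport f \<Longrightarrow> smooth (\<rho> x) \<and> open (V x) \<and> x \<in> V x \<and> (\<forall>z\<in>V x. \<rho> x z = 1) \<and>
          (\<forall>g\<in>test_fun. T (\<lambda>z. \<rho> x z * g z) = 0)"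
    by metis
  have "compact (tsupport f)"
    using f by (simp add: test_fun_def)
  then obtain C where C: "C \<subseteq> tsupport f" "finite C" "tsupport f \<subseteq> (\<Union>x\<in>C. V x)"
  proof (rule compactE_image[of "tsupport f" "tsupport f" V])
    show "tsupport f \<subseteq> (\<Union>x\<in>tsupport f. V x)" "\<And>x. x \<in> tsupport f \<Longrightarrow> open (V x)"
      using * by blast+
  qed
  have "T g = 0" if "finite D" "D \<subseteq> tsupport f" "g \<in> test_fun" "tsupport g \<subseteq> (\<Union>x\<in>D. V x)" for D g
    using that
  proof (induction D arbitrary: g rule: finite_induct)
    case empty
    then have "{x. g x \<noteq> 0} = {}"
      using closure_subset[of "{x. g x \<noteq> 0}"] by (simp add: tsupport_def)
    then have "g = (\<lambda>x. 0)" by (auto simp: fun_eq_iff)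
    then show ?case
      using dist_zero[OF T] by simp
  next
    case (insert x D)
    then have x: "x \<in> tsupport f" by blast
    note x = *[OF x]
    \<comment> \<open>h vanishes on \<open>V x\<close>, so its support is covered by the remaining
      sets, and T h = T g because T kills the subtracted part.\<close>
    define h where "h = (\<lambda>z. g z - \<rho> x z * g z)"
    have t1: "(\<lambda>z. \<rho> x z * g z) \<in> test_fun"
      using x insert.prems(2) by (blast intro: test_mult)
    then have t2: "h \<in> test_fun"
      unfolding h_def using insert.prems(2) by (intro test_diff)
    have "{z. h z \<noteq> 0} \<subseteq> tsupport g \<inter> - V x"
      using x closure_subset[of "{x. g x \<noteq> 0}"] by (auto simp: h_def tsupport_def)
    then have "tsupport h \<subseteq> tsupport g \<inter> - V x"
      unfolding tsupport_def[of h]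
      by (rule closure_minimal) (use x in \<open>auto simp: tsupport_def intro!: closed_Int\<close>)
    then have "tsupport h \<subseteq> (\<Union>x\<in>D. V x)"
      using insert.prems(3) by blast
    then have "T h = 0"
      using insert.IH[OF _ t2] insert.prems(1) by blast
    moreover have "T h = T g - T (\<lambda>z. \<rho> x z * g z)"
      unfolding h_def by (rule dist_diff[OF T insert.prems(2) t1])
    ultimately show ?case
      using x insert.prems(2) by simp
  qed
  then show ?thesis
    using C f by blast
qed

text \<open>Consequence for later use: two test functions that agree on \<open>W \<delta>\<close>
  have the same image under T, so identities need checking only away from the hyperplanes. The gap
  \<delta> < \<epsilon> absorbs the closure in the support.\<close>

lemma dist_eq_zero_off_W:
  fixes T :: "(real^'n::finite \<Rightarrow> complex) \<Rightarrow> complex"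
  assumes T: "distribution T" and supp: "dsupp T \<subseteq> W \<epsilon>" and "\<delta> < \<epsilon>"
    and f: "f \<in> test_fun" "\<And>x. x \<in> W \<delta> \<Longrightarrow> f x = 0"
  shows "T f = 0"
proof (rule dist_eq_zero_off_dsupp[OF T f(1)])
  have "closed (\<Union>j. {x::real^'n. \<bar>x $ j\<bar> \<le> \<delta>})"
    by (intro closed_UN finite ballI closed_Collect_le continuous_intros)
  moreover have "{x. f x \<noteq> 0} \<subseteq> (\<Union>j. {x. \<bar>x $ j\<bar> \<le> \<delta>})"
  proof
    fix x assume "x \<in> {x. f x \<noteq> 0}"
    then have "x \<notin> W \<delta>" using f(2) by blast
    then obtain j where "\<bar>x $ j\<bar> \<le> \<delta>"
      by (auto simp: W_def not_le intro: less_imp_le)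
    then show "x \<in> (\<Union>j. {x. \<bar>x $ j\<bar> \<le> \<delta>})" by blast
  qed
  ultimately have "tsupport f \<subseteq> (\<Union>j. {x. \<bar>x $ j\<bar> \<le> \<delta>})"
    unfolding tsupport_def by (intro closure_minimal)
  moreover have "(\<Union>j. {x::real^'n. \<bar>x $ j\<bar> \<le> \<delta>}) \<inter> W \<epsilon> = {}"
    using \<open>\<delta> < \<epsilon>\<close> by (auto simp: W_def) (meson leD le_less_trans)
  ultimately show "tsupport f \<inter> dsupp T = {}"
    using supp by blast
qed

subsection \<open>Integrals of dilates\<close>

lemma has_partial_lipschitz:
  assumes "has_partial i f f'" "\<And>x. norm (f' x) \<le> B"
  shows "norm (f (x + t *\<^sub>R axis i 1) - f x) \<le> B * \<bar>t\<bar>"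
proof -
  have "norm ((\<lambda>t. f (x + t *\<^sub>R axis i 1)) t - (\<lambda>t. f (x + t *\<^sub>R axis i 1)) 0) \<le> B * norm (t - 0)"
  proof (rule differentiable_bound[of UNIV])
    fix s :: real
    show "((\<lambda>t. f (x + t *\<^sub>R axis i 1)) has_derivative (\<lambda>h. h *\<^sub>R f' (x + s *\<^sub>R axis i 1))) (at s within UNIV)"
      using has_partial_at[OF assms(1), of x s] by (simp add: has_vector_derivative_def)
    show "onorm (\<lambda>h. h *\<^sub>R f' (x + s *\<^sub>R axis i 1)) \<le> B"
    proof (rule onorm_le)
      fix h :: real
      show "norm (h *\<^sub>R f' (x + s *\<^sub>R axis i 1)) \<le> B * norm h"
        using mult_left_mono[OF assms(2)[of "x + s *\<^sub>R axis i 1"], of "\<bar>h\<bar>"] by (simp add: mult.commute)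
    qed
  qed auto
  then show ?thesis by simp
qed

text \<open>One form for four uses: the orbit of a density, multiplicative mollification, averages
  of dilates along a segment, and Hadamard's quotient.\<close>

definition dil_integral :: "'b measure \<Rightarrow> ('b \<Rightarrow> complex) \<Rightarrow> ('b \<Rightarrow> real^'n::finite) \<Rightarrow> (real^'n \<Rightarrow> complex) \<Rightarrow> real^'n \<Rightarrow> complex" where
  "dil_integral M c a h x = (\<integral>p. c p * dil (a p) h x \<partial>M)"

lemma dil_measurable:
  assumes "continuous_on UNIV h" "a \<in> borel_measurable M"
  shows "(\<lambda>p. dil (a p) h x) \<in> borel_measurable M"
proof -
  have "continuous_on UNIV (\<lambda>v. h (coord_mult x v))"
    by (rule continuous_on_compose2[OF assms(1)]) (auto intro: continuous_on_coord_mult)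
  then have "(\<lambda>v. h (coord_mult x v)) \<in> borel_measurable borel"
    by (rule borel_measurable_continuous_onI)
  from measurable_compose[OF assms(2) this] show ?thesis
    by (simp add: dil_def)
qed

lemma wprod_measurable: "a \<in> borel_measurable M \<Longrightarrow> (\<lambda>p. wprod w (a p)) \<in> borel_measurable M"
  by (rule measurable_compose[OF _ borel_measurable_continuous_onI[OF continuous_on_wprod[OF continuous_on_id]]])

lemma dil_integral_integrable:
  assumes c: "integrable M c" and a: "a \<in> borel_measurable M" and h: "h \<in> test_cube R"
  shows "integrable M (\<lambda>p. c p * dil (a p) h x)"
proof -
  obtain B where B: "\<And>x. norm (h x) \<le> B" using test_cube_bounded[OF h] by blast
  have m: "(\<lambda>p. dil (a p) h x) \<in> borel_measurable M"
    by (rule dil_measurable[OF smooth_continuous[OF test_cube_smooth[OF h]] a])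
  show ?thesis
  proof (rule Bochner_Integration.integrable_bound)
    show "integrable M (\<lambda>p. B * norm (c p))"
      using c by simp
    show "(\<lambda>p. c p * dil (a p) h x) \<in> borel_measurable M"
      using c m by measurable
    show "AE p in M. norm (c p * dil (a p) h x) \<le> norm (B * norm (c p))"
    proof (rule AE_I2)
      fix p
      have "norm (c p * dil (a p) h x) \<le> norm (c p) * B"
        unfolding norm_mult dil_apply by (rule mult_left_mono[OF B]) simp
      then show "norm (c p * dil (a p) h x) \<le> norm (B * norm (c p))"
        by (metis abs_ge_self mult.commute order_trans real_norm_def)
    qed
  qed
qed

lemma dil_integral_continuous:
  fixes h :: "real^'b::finite \<Rightarrow> complex"
  assumes c: "integrable M c" and a: "a \<in> borel_measurable M" and h: "h \<in> test_cube R"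
  shows "continuous_on UNIV (dil_integral M c a h)"
  unfolding continuous_on_sequentially
proof (intro allI ballI impI)
  fix X :: "nat \<Rightarrow> real^'b" and x assume "(\<forall>n. X n \<in> UNIV) \<and> X \<longlonglongrightarrow> x"
  then have X: "X \<longlonglongrightarrow> x" by simp
  obtain B where B: "B \<ge> 0" "\<And>x. norm (h x) \<le> B" using test_cube_bounded[OF h] by blast
  have ch: "continuous_on UNIV h" using h test_cube_smooth smooth_continuous by blast
  have "(\<lambda>n. \<integral>p. c p * dil (a p) h (X n) \<partial>M) \<longlonglongrightarrow> (\<integral>p. c p * dil (a p) h x \<partial>M)"
  proof (rule integral_dominated_convergence)
    show "integrable M (\<lambda>p. norm (c p) * B)"
      using c by simp
    have m: "(\<lambda>p. dil (a p) h x) \<in> borel_measurable M" for x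
      by (rule dil_measurable[OF ch a])
    show "(\<lambda>p. c p * dil (a p) h x) \<in> borel_measurable M"
      "(\<lambda>p. c p * dil (a p) h (X n)) \<in> borel_measurable M" for n
      using c m by measurable
    show "AE p in M. (\<lambda>n. c p * dil (a p) h (X n)) \<longlonglongrightarrow> c p * dil (a p) h x"
    proof (rule AE_I2)
      fix p
      have "continuous_on UNIV (\<lambda>x. coord_mult x (a p))"
        by (rule continuous_on_coord_mult) auto
      then have "continuous_on UNIV (\<lambda>x. h (coord_mult x (a p)))"
        by (rule continuous_on_compose2[OF ch]) simp
      then have "(\<lambda>n. h (coord_mult (X n) (a p))) \<longlonglongrightarrow> h (coord_mult x (a p))"
        using X by (rule continuous_on_tendsto_compose) auto
      then show "(\<lambda>n. c p * dil (a p) h (X n)) \<longlonglongrightarrow> c p * dil (a p) h x"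
        unfolding dil_apply by (rule tendsto_mult_left)
    qed
    show "AE p in M. norm (c p * dil (a p) h (X n)) \<le> norm (c p) * B" for n
      unfolding norm_mult dil_apply by (rule AE_I2, rule mult_left_mono[OF B(2)]) simp
  qed
  then show "(dil_integral M c a h \<circ> X) \<longlonglongrightarrow> dil_integral M c a h x"
    by (simp add: o_def dil_integral_def)
qed

text \<open>Differentiation under the integral sign; the derivative of a dilate brings out a
  component of \<open>a p\<close>, which the weight \<open>1 + norm (a p)\<close> pays for.\<close>

lemma dil_integral_has_partial:
  fixes h :: "real^'b::finite \<Rightarrow> complex"
  assumes c: "integrable M (\<lambda>p. norm (c p) * (1 + norm (a p)))" "c \<in> borel_measurable M"
    and a: "a \<in> borel_measurable M" and h: "h \<in> test_cube R"
  shows "has_partial i (dil_integral M c a h) (dil_integral M (\<lambda>p. c p * of_real (a p $ i)) a (partial i h))"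
  unfolding has_partial_def
proof
  fix x :: "real^'b"
  have am: "(\<lambda>p. a p $ i) \<in> borel_measurable M"
    by (rule measurable_compose[OF a borel_measurable_continuous_onI]) (intro continuous_intros)
  have cI: "integrable M c"
    by (rule Bochner_Integration.integrable_bound[OF c(1) c(2)]) (auto simp: algebra_simps intro!: AE_I2)
  have caI: "integrable M (\<lambda>p. c p * of_real (a p $ i))"
  proof (rule Bochner_Integration.integrable_bound[OF c(1)])
    show "(\<lambda>p. c p * of_real (a p $ i)) \<in> borel_measurable M"
      using c(2) am by measurable
    have "norm (c p * of_real (a p $ i)) \<le> norm (norm (c p) * (1 + norm (a p)))" for p
      using component_le_norm_cart[of "a p" i] by (auto simp: norm_mult intro!: mult_left_mono)
    then show "AE p in M. norm (c p * of_real (a p $ i)) \<le> norm (norm (c p) * (1 + norm (a p)))"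
      by simp
  qed
  have h': "partial i h \<in> test_cube R" using h by (rule test_cube_partial)
  obtain B where B: "B \<ge> 0" "\<And>x. norm (partial i h x) \<le> B" using test_cube_bounded[OF h'] by blast
  define D where "D = dil_integral M (\<lambda>p. c p * of_real (a p $ i)) a (partial i h) x"
  \<comment> \<open>First-order Taylor remainder in t: it is o(t) for each p and at most |t| times
    an integrable function, so dominated convergence applies to r / t.\<close>
  define r where "r p t = c p * (dil (a p) h (x + t *\<^sub>R axis i 1) - dil (a p) h x - t *\<^sub>R (of_real (a p $ i) * dil (a p) (partial i h) x))" for p t
  have hp: "has_partial i (dil (a p) h) (\<lambda>x. of_real (a p $ i) * dil (a p) (partial i h) x)" for p
    by (rule has_partial_dil[OF smooth_has_partial[OF test_cube_smooth[OF h]]])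
  have int1: "integrable M (\<lambda>p. c p * dil (a p) h y)" for y
    by (rule dil_integral_integrable[OF cI a h])
  have int2: "integrable M (\<lambda>p. c p * of_real (a p $ i) * dil (a p) (partial i h) x)"
    by (rule dil_integral_integrable[OF caI a h'])
  have r_eq: "(\<lambda>p. r p t) = (\<lambda>p. c p * dil (a p) h (x + t *\<^sub>R axis i 1) - c p * dil (a p) h x
      - of_real t * (c p * of_real (a p $ i) * dil (a p) (partial i h) x))" for t
    by (auto simp: r_def algebra_simps scaleR_conv_of_real)
  have int3: "integrable M (\<lambda>p. r p t)" for t
    unfolding r_eq using int1 int2 by (intro Bochner_Integration.integrable_diff integrable_mult_right) auto
  have eq: "dil_integral M c a h (x + t *\<^sub>R axis i 1) - dil_integral M c a h x - t *\<^sub>R D = (\<integral>p. r p t \<partial>M)" for t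
    unfolding r_eq dil_integral_def D_def using int1 int2
    by (subst Bochner_Integration.integral_diff, simp_all add: scaleR_conv_of_real Bochner_Integration.integral_diff)
  have r_bound: "norm (r p t) \<le> \<bar>t\<bar> * (norm (c p) * (1 + norm (a p)) * (2 * B))" for p t
  proof -
    have b: "norm (of_real (a p $ i) * dil (a p) (partial i h) y) \<le> norm (a p) * B" for y
      unfolding norm_mult dil_apply using component_le_norm_cart[of "a p" i] B by (intro mult_mono) auto
    have "norm (dil (a p) h (x + t *\<^sub>R axis i 1) - dil (a p) h x) \<le> (norm (a p) * B) * \<bar>t\<bar>"
      by (rule has_partial_lipschitz[OF hp b])
    moreover have "norm (t *\<^sub>R (of_real (a p $ i) * dil (a p) (partial i h) x)) \<le> (norm (a p) * B) * \<bar>t\<bar>"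
      using b[of x] by (simp add: mult.commute mult_left_mono)
    ultimately have "norm (dil (a p) h (x + t *\<^sub>R axis i 1) - dil (a p) h x - t *\<^sub>R (of_real (a p $ i) * dil (a p) (partial i h) x))
        \<le> (norm (a p) * B) * \<bar>t\<bar> + (norm (a p) * B) * \<bar>t\<bar>"
      by (rule order_trans[OF norm_triangle_ineq4 add_mono])
    also have "\<dots> \<le> \<bar>t\<bar> * ((1 + norm (a p)) * (2 * B))"
      using B by (simp add: algebra_simps)
    finally have "norm (r p t) \<le> norm (c p) * (\<bar>t\<bar> * ((1 + norm (a p)) * (2 * B)))"
      unfolding r_def norm_mult by (rule mult_left_mono) simp
    then show ?thesis
      by (simp add: mult_ac)
  qed
  have "((\<lambda>t. norm (dil_integral M c a h (x + (0 + t) *\<^sub>R axis i 1) - dil_integral M c a h (x + 0 *\<^sub>R axis i 1) - t *\<^sub>R D) / norm t) \<longlongrightarrow> 0) (at 0)"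
    unfolding tendsto_at_iff_sequentially
  proof (intro allI impI)
    fix t :: "nat \<Rightarrow> real" assume t: "\<forall>n. t n \<in> UNIV - {0}" "t \<longlonglongrightarrow> 0"
    have "(\<lambda>n. \<integral>p. r p (t n) / of_real (t n) \<partial>M) \<longlonglongrightarrow> (\<integral>p. 0 \<partial>M)"
    proof (rule integral_dominated_convergence)
      show "integrable M (\<lambda>p. norm (c p) * (1 + norm (a p)) * (2 * B))"
        using c(1) by simp
      show "(\<lambda>p. r p (t n) / of_real (t n)) \<in> borel_measurable M" for n
        using int3[of "t n"] by measurable
      show "AE p in M. norm (r p (t n) / of_real (t n)) \<le> norm (c p) * (1 + norm (a p)) * (2 * B)" for n
        using r_bound[of _ "t n"] t(1) by (simp add: norm_divide divide_le_eq mult.commute)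
      show "AE p in M. (\<lambda>n. r p (t n) / of_real (t n)) \<longlonglongrightarrow> 0"
      proof (rule AE_I2)
        fix p
        have "((\<lambda>t. dil (a p) h (x + t *\<^sub>R axis i 1)) has_derivative (\<lambda>t. t *\<^sub>R (of_real (a p $ i) * dil (a p) (partial i h) x))) (at 0)"
          using hp[of p] by (simp add: has_partial_def has_vector_derivative_def)
        then have "((\<lambda>t. norm (dil (a p) h (x + (0 + t) *\<^sub>R axis i 1) - dil (a p) h (x + 0 *\<^sub>R axis i 1)
            - t *\<^sub>R (of_real (a p $ i) * dil (a p) (partial i h) x)) / norm t) \<longlongrightarrow> 0) (at 0)"
          unfolding has_derivative_at by blast
        then have "((\<lambda>t. norm (c p) * (norm (dil (a p) h (x + (0 + t) *\<^sub>R axis i 1) - dil (a p) h (x + 0 *\<^sub>R axis i 1)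
            - t *\<^sub>R (of_real (a p $ i) * dil (a p) (partial i h) x)) / norm t)) \<longlongrightarrow> norm (c p) * 0) (at 0)"
          by (rule tendsto_mult_left)
        then have "((\<lambda>t. norm (r p t / of_real t)) \<longlongrightarrow> 0) (at 0)"
          by (simp add: r_def norm_mult norm_divide)
        then have "(\<lambda>n. norm (r p (t n) / of_real (t n))) \<longlonglongrightarrow> 0"
          using t by (auto simp: tendsto_at_iff_sequentially o_def)
        then show "(\<lambda>n. r p (t n) / of_real (t n)) \<longlonglongrightarrow> 0"
          by (rule tendsto_norm_zero_cancel)
      qed
    qed auto
    then have "(\<lambda>n. (\<integral>p. r p (t n) \<partial>M) / of_real (t n)) \<longlonglongrightarrow> 0"
      by simp
    then have "(\<lambda>n. norm ((\<integral>p. r p (t n) \<partial>M) / of_real (t n))) \<longlonglongrightarrow> 0"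
      by (rule tendsto_norm_zero)
    then show "((\<lambda>t. norm (dil_integral M c a h (x + (0 + t) *\<^sub>R axis i 1) - dil_integral M c a h (x + 0 *\<^sub>R axis i 1) - t *\<^sub>R D) / norm t) \<circ> t) \<longlonglongrightarrow> 0"
      by (simp add: o_def eq norm_divide)
  qed
  then have "((\<lambda>t. dil_integral M c a h (x + t *\<^sub>R axis i 1)) has_derivative (\<lambda>t. t *\<^sub>R D)) (at 0)"
    unfolding has_derivative_at using bounded_linear_scaleR_left by blast
  then show "((\<lambda>t. dil_integral M c a h (x + t *\<^sub>R axis i 1)) has_vector_derivative dil_integral M (\<lambda>p. c p * of_real (a p $ i)) a (partial i h) x) (at 0)"
    by (simp add: has_vector_derivative_def D_def)
qed

lemma wprod_integrable:
  assumes c: "integrable M (\<lambda>p. norm (c p) * (1 + norm (a p)) ^ m)" "c \<in> borel_measurable M" "a \<in> borel_measurable M"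
    and k: "length w + k \<le> m"
  shows "integrable M (\<lambda>p. norm (c p * wprod w (a p)) * (1 + norm (a p)) ^ k)"
proof (rule Bochner_Integration.integrable_bound[OF c(1)])
  show "(\<lambda>p. norm (c p * wprod w (a p)) * (1 + norm (a p)) ^ k) \<in> borel_measurable M"
    using c(2,3) wprod_measurable[OF c(3)] by measurable
  have "norm (c p * wprod w (a p)) * (1 + norm (a p)) ^ k \<le> norm (c p) * (1 + norm (a p)) ^ m" for p
  proof -
    have "norm (wprod w (a p)) \<le> (1 + norm (a p)) ^ length w"
      by (rule order_trans[OF norm_wprod_le]) (simp add: power_mono)
    then have "norm (wprod w (a p)) * (1 + norm (a p)) ^ k \<le> (1 + norm (a p)) ^ length w * (1 + norm (a p)) ^ k"
      by (rule mult_right_mono) simp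
    also have "\<dots> \<le> (1 + norm (a p)) ^ m"
      using k by (simp add: power_increasing flip: power_add)
    finally show ?thesis
      by (simp add: norm_mult mult.assoc mult_left_mono)
  qed
  then show "AE p in M. norm (norm (c p * wprod w (a p)) * (1 + norm (a p)) ^ k) \<le> norm (norm (c p) * (1 + norm (a p)) ^ m)"
    by (auto intro!: AE_I2)
qed

text \<open>Kept at finite order m, because a density with a given polynomial decay allows only
  finitely many derivatives.\<close>

lemma dil_integral_dpart:
  assumes c: "integrable M (\<lambda>p. norm (c p) * (1 + norm (a p)) ^ m)" "c \<in> borel_measurable M" "a \<in> borel_measurable M"
    and h: "h \<in> test_cube R"
  shows "length w \<le> m \<Longrightarrow> dpart w (dil_integral M c a h) = dil_integral M (\<lambda>p. c p * wprod w (a p)) a (dpart w h)"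
    and "length w < m \<Longrightarrow> has_partial i (dpart w (dil_integral M c a h)) (dpart (i # w) (dil_integral M c a h))"
    and "length w \<le> m \<Longrightarrow> continuous_on UNIV (dpart w (dil_integral M c a h))"
proof -
  have meas: "(\<lambda>p. c p * wprod w (a p)) \<in> borel_measurable M" for w
    using c(2) wprod_measurable[OF c(3)] by measurable
  have step: "has_partial i (dil_integral M (\<lambda>p. c p * wprod w (a p)) a (dpart w h))
      (dil_integral M (\<lambda>p. c p * wprod (i # w) (a p)) a (dpart (i # w) h))" if "length w < m" for i w
    using dil_integral_has_partial[OF _ meas c(3) test_cube_dpart[OF h], of w i w] wprod_integrable[OF c, of w 1] that
    by (simp add: mult_ac)
  have eq: "length w \<le> m \<Longrightarrow> dpart w (dil_integral M c a h) = dil_integral M (\<lambda>p. c p * wprod w (a p)) a (dpart w h)" for w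
  proof (induction w)
    case (Cons i w)
    then show ?case
      using has_partialD[OF step[of w i]] by simp
  qed simp
  show "length w \<le> m \<Longrightarrow> dpart w (dil_integral M c a h) = dil_integral M (\<lambda>p. c p * wprod w (a p)) a (dpart w h)"
    by (rule eq)
  show "length w < m \<Longrightarrow> has_partial i (dpart w (dil_integral M c a h)) (dpart (i # w) (dil_integral M c a h))"
    using step[of w i] eq[of w] eq[of "i # w"] by simp
  show "continuous_on UNIV (dpart w (dil_integral M c a h))" if "length w \<le> m"
  proof -
    have "integrable M (\<lambda>p. norm (c p * wprod w (a p)))"
      using wprod_integrable[OF c, of w 0] that by simp
    then have "integrable M (\<lambda>p. c p * wprod w (a p))"
      using meas integrable_norm_iff by blast
    then show ?thesis
      unfolding eq[OF that] by (rule dil_integral_continuous[OF _ c(3) test_cube_dpart[OF h]])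
  qed
qed

lemma dil_integral_smooth:
  assumes "\<And>m. integrable M (\<lambda>p. norm (c p) * (1 + norm (a p)) ^ m)" "c \<in> borel_measurable M" "a \<in> borel_measurable M"
    and h: "h \<in> test_cube R"
  shows "smooth (dil_integral M c a h)"
proof -
  have "continuous_on UNIV (dpart w (dil_integral M c a h))" for w
    using dil_integral_dpart(3)[OF assms(1)[of "length w"] assms(2-4), of w] by simp
  moreover have "has_partial i (dpart w (dil_integral M c a h)) (dpart (i # w) (dil_integral M c a h))" for i w
    using dil_integral_dpart(2)[OF assms(1)[of "Suc (length w)"] assms(2-4), of w] by simp
  ultimately show ?thesis
    unfolding smooth_def using has_partial_exists by blast
qed

section \<open>Integrals over compact parameter sets, and distributions applied to them\<close>

abbreviation lborel_on :: "'b::euclidean_space set \<Rightarrow> 'b measure" where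
  "lborel_on X \<equiv> restrict_space lborel X"

lemma finite_measure_lborel_on: "compact X \<Longrightarrow> finite_measure (lborel_on X)"
  using emeasure_compact_finite[of X]
  by (intro finite_measureI) (auto simp: emeasure_restrict_space space_restrict_space compact_imp_closed borel_closed)

lemma continuous_on_lborel_on_measurable:
  fixes f :: "'b::euclidean_space \<Rightarrow> 'c::topological_space"
  assumes "continuous_on X f"
  shows "f \<in> borel_measurable (lborel_on X)"
  using borel_measurable_continuous_on_restrict[OF assms]
  by (subst measurable_cong_sets[of _ "restrict_space borel X" _ borel]) (auto simp: sets_restrict_space)

lemma continuous_on_lborel_on_integrable:
  fixes f :: "'b::euclidean_space \<Rightarrow> 'c::{banach, second_countable_topology}"
  assumes "compact X" "continuous_on X f"
  shows "integrable (lborel_on X) f"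
proof -
  interpret finite_measure "lborel_on X" by (rule finite_measure_lborel_on[OF assms(1)])
  have "bounded (f ` X)"
    using assms by (intro compact_imp_bounded compact_continuous_image)
  then obtain B where B: "\<And>x. x \<in> X \<Longrightarrow> norm (f x) \<le> B"
    unfolding bounded_iff by blast
  show ?thesis
    by (rule integrable_const_bound[of _ B])
      (auto simp: space_restrict_space B intro!: AE_I2 continuous_on_lborel_on_measurable[OF assms(2)])
qed

lemma riemann_sum_bound:
  fixes F :: "'b \<Rightarrow> complex" and m :: nat
  assumes M: "finite_measure M" and F: "integrable M F"
    and A: "\<And>i. i < m \<Longrightarrow> A i \<in> sets M" "disjoint_family_on A {..<m}" "space M = (\<Union>i<m. A i)"
    and b: "\<And>i p. i < m \<Longrightarrow> p \<in> A i \<Longrightarrow> norm (F p - F (q i)) \<le> \<eta>"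
  shows "norm ((\<integral>p. F p \<partial>M) - (\<Sum>i<m. of_real (measure M (A i)) * F (q i))) \<le> \<eta> * measure M (space M)"
proof -
  interpret finite_measure M by (rule M)
  define G where "G p = (\<Sum>i<m. indicator (A i) p *\<^sub>R F (q i))" for p
  have G: "G p = F (q i)" if "i < m" "p \<in> A i" for i p
  proof -
    have "indicator (A j) p *\<^sub>R F (q j) = (if j = i then F (q i) else 0)" if "j < m" for j
      using \<open>i < m\<close> \<open>p \<in> A i\<close> that A(2) by (auto simp: disjoint_family_on_def indicator_def)
    then have "G p = (\<Sum>j<m. if j = i then F (q i) else 0)"
      unfolding G_def by (intro sum.cong) auto
    then show ?thesis
      using \<open>i < m\<close> by simp
  qed
  have Ai: "integrable M (\<lambda>p. indicator (A i) p *\<^sub>R F (q i))" if "i < m" for i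
    using A(1)[OF that] by (intro integrable_scaleR_left integrable_real_indicator) (auto simp: emeasure_eq_measure)
  have GI: "integrable M G"
    unfolding G_def[abs_def] by (intro Bochner_Integration.integrable_sum Ai) auto
  have intG: "(\<integral>p. G p \<partial>M) = (\<Sum>i<m. of_real (measure M (A i)) * F (q i))"
    unfolding G_def
    by (subst Bochner_Integration.integral_sum)
      (use Ai A(1) in \<open>auto simp: scaleR_conv_of_real sets.Int_space_eq2 intro!: sum.cong\<close>)
  have *: "norm (F p - G p) \<le> \<eta>" if "p \<in> space M" for p
    using that A(3) b G by auto
  have "norm (\<integral>p. F p - G p \<partial>M) \<le> (\<integral>p. norm (F p - G p) \<partial>M)"
    by (rule integral_norm_bound)
  also have "\<dots> \<le> (\<integral>p. \<eta> \<partial>M)"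
    using F GI * by (intro integral_mono) auto
  finally show ?thesis
    using F GI by (simp add: intG mult.commute)
qed

text \<open>A finite cover by balls, made disjoint. Pieces may be empty, so \<open>q i\<close> is
  claimed to lie in X only when its piece is inhabited.\<close>

lemma compact_partition:
  fixes X :: "'b::euclidean_space set"
  assumes "compact X" "d > 0"
  obtains m :: nat and A q where "\<And>i. i < m \<Longrightarrow> A i \<in> sets (lborel_on X)" "disjoint_family_on A {..<m}"
    "space (lborel_on X) = (\<Union>i<m. A i)" "\<And>i p. i < m \<Longrightarrow> p \<in> A i \<Longrightarrow> q i \<in> X \<and> p \<in> X \<and> dist p (q i) < d"
proof -
  obtain C where C: "C \<subseteq> X" "finite C" "X \<subseteq> (\<Union>x\<in>C. ball x d)"
  proof (rule compactE_image[OF assms(1), of X "\<lambda>x. ball x d"])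
    show "X \<subseteq> (\<Union>x\<in>X. ball x d)" using assms(2) by auto
  qed auto
  obtain m :: nat and q where q: "C = q ` {i. i < m}"
    using finite_imp_nat_seg_image_inj_on[OF C(2)] by blast
  define B where "B i = ball (q i) d \<inter> X" for i
  have BX: "(\<Union>i<m. B i) = X"
    using C(3) by (force simp: B_def q)
  have "B i \<in> sets (lborel_on X)" for i
    unfolding sets_restrict_space B_def by (auto simp: Int_commute)
  then have "disjointed B i \<in> sets (lborel_on X)" for i
    by (auto simp: disjointed_def)
  moreover have "disjoint_family_on (disjointed B) {..<m}"
    using disjoint_family_disjointed[of B] by (auto simp: disjoint_family_on_def)
  moreover have "space (lborel_on X) = (\<Union>i<m. disjointed B i)"
    using finite_UN_disjointed_eq[of B m] BX by (simp add: space_restrict_space atLeast0LessThan)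
  moreover have "q i \<in> X \<and> p \<in> X \<and> dist p (q i) < d" if "i < m" "p \<in> disjointed B i" for i p
  proof -
    have "p \<in> B i" using that disjointed_subset[of B i] by blast
    moreover have "q i \<in> X" using C(1) that q by blast
    ultimately show ?thesis by (auto simp: B_def dist_commute)
  qed
  ultimately show ?thesis
    using that by metis
qed

lemma compact_all_nonzero_lower:
  fixes a :: "'b::euclidean_space \<Rightarrow> real^'n::finite"
  assumes "compact X" "continuous_on X a" "\<And>p. p \<in> X \<Longrightarrow> all_nonzero (a p)"
  obtains \<alpha> where "\<alpha> > 0" "\<And>p j. p \<in> X \<Longrightarrow> \<bar>a p $ j\<bar> \<ge> \<alpha>"
proof -
  have "\<exists>\<alpha>>0. \<forall>p\<in>X. \<bar>a p $ j\<bar> \<ge> \<alpha>" for j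
  proof (cases "X = {}")
    case True
    then show ?thesis by (auto intro: exI[of _ 1])
  next
    case False
    have "continuous_on X (\<lambda>p. \<bar>a p $ j\<bar>)"
      by (intro continuous_intros continuous_on_component assms(2))
    then obtain p0 where p0: "p0 \<in> X" "\<And>p. p \<in> X \<Longrightarrow> \<bar>a p0 $ j\<bar> \<le> \<bar>a p $ j\<bar>"
      using continuous_attains_inf[OF assms(1) False] by blast
    then show ?thesis
      using assms(3)[OF p0(1)] by (intro exI[of _ "\<bar>a p0 $ j\<bar>"]) (auto simp: all_nonzero_def)
  qed
  then obtain \<alpha> where \<alpha>: "\<And>j. \<alpha> j > 0 \<and> (\<forall>p\<in>X. \<bar>a p $ j\<bar> \<ge> \<alpha> j)"
    by metis
  show ?thesis
  proof
    show "Min (range \<alpha>) > 0"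
      using \<alpha> by auto
    fix p j assume "p \<in> X"
    have "Min (range \<alpha>) \<le> \<alpha> j"
      by (intro Min_le) auto
    then show "\<bar>a p $ j\<bar> \<ge> Min (range \<alpha>)"
      using \<alpha>[of j] \<open>p \<in> X\<close> by (meson order_trans)
  qed
qed

lemma lborel_on_weight_integrable:
  fixes a :: "'b::euclidean_space \<Rightarrow> real^'n::finite" and c :: "'b \<Rightarrow> complex"
  assumes "compact X" "continuous_on X c" "continuous_on X a"
  shows "integrable (lborel_on X) (\<lambda>p. norm (c p) * (1 + norm (a p)) ^ m)"
  by (intro continuous_on_lborel_on_integrable assms(1) continuous_intros assms(2,3))

lemma dil_integral_lborel_on_test_cube:
  fixes a :: "'b::euclidean_space \<Rightarrow> real^'n::finite" and c :: "'b \<Rightarrow> complex"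
  assumes X: "compact X" "continuous_on X c" "continuous_on X a"
    and e: "e \<in> test_cube R" and \<alpha>: "\<alpha> > 0" "\<And>p j. p \<in> X \<Longrightarrow> \<bar>a p $ j\<bar> \<ge> \<alpha>"
  shows "dil_integral (lborel_on X) c a e \<in> test_cube (R / \<alpha>)"
proof -
  have "smooth (dil_integral (lborel_on X) c a e)"
    by (rule dil_integral_smooth[OF lborel_on_weight_integrable[OF X] continuous_on_lborel_on_measurable[OF X(2)]
          continuous_on_lborel_on_measurable[OF X(3)] e])
  moreover have "dil_integral (lborel_on X) c a e x = 0" if "x \<notin> cube (R / \<alpha>)" for x
  proof -
    have "(\<integral>p. c p * dil (a p) e x \<partial>lborel_on X) = (\<integral>p. 0 \<partial>lborel_on X)"
    proof (rule Bochner_Integration.integral_cong[OF refl])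
      fix p assume "p \<in> space (lborel_on X)"
      then have "dil (a p) e \<in> test_cube (R / \<alpha>)"
        by (intro test_cube_dil[OF e \<alpha>]) (auto simp: space_restrict_space)
      then show "c p * dil (a p) e x = 0"
        using that by (simp add: test_cube_zero)
    qed
    then show ?thesis by (simp add: dil_integral_def)
  qed
  ultimately show ?thesis by (simp add: test_cube_def)
qed

text \<open>Riemann sums of the integral converge in every C^N norm inside a common cube; T is
  linear on the sums and continuous for one such norm, so it passes under the integral sign.\<close>

lemma dist_dil_integral:
  fixes a :: "'b::euclidean_space \<Rightarrow> real^'n::finite" and c :: "'b \<Rightarrow> complex"
  assumes T: "distribution T" and X: "compact X" "continuous_on X c" "continuous_on X a"
    and all_nonzero: "\<And>p. p \<in> X \<Longrightarrow> all_nonzero (a p)" and e: "e \<in> test_fun"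
  shows "dil_integral (lborel_on X) c a e \<in> test_fun"
    and "continuous_on X (\<lambda>p. c p * T (dil (a p) e))"
    and "T (dil_integral (lborel_on X) c a e) = (\<integral>p. c p * T (dil (a p) e) \<partial>lborel_on X)"
proof -
  interpret finite_measure "lborel_on X" by (rule finite_measure_lborel_on[OF X(1)])
  obtain R where e: "e \<in> test_cube R" using assms(6) test_test_cube by blast
  have se: "smooth e" using e by (rule test_cube_smooth)
  obtain \<alpha> where \<alpha>: "\<alpha> > 0" "\<And>p j. p \<in> X \<Longrightarrow> \<bar>a p $ j\<bar> \<ge> \<alpha>"
    using compact_all_nonzero_lower[OF X(1,3) all_nonzero] by blast
  define R' where "R' = R / \<alpha>"
  have dilR: "dil (a p) e \<in> test_cube R'" if "p \<in> X" for p
    unfolding R'_def using that by (intro test_cube_dil[OF e \<alpha>])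
  have pR: "dil_integral (lborel_on X) c a e \<in> test_cube R'"
    unfolding R'_def by (rule dil_integral_lborel_on_test_cube[OF X e \<alpha>])
  then show "dil_integral (lborel_on X) c a e \<in> test_fun" by (rule test_cube_test)
  obtain C N where C: "C \<ge> 0" "\<And>f B. f \<in> test_cube R' \<Longrightarrow> cbound N f B \<Longrightarrow> norm (T f) \<le> C * B"
    using dist_bound[OF T, of R'] by blast
  \<comment> \<open>The derivative \<open>dpart w\<close> of the integrand. It is jointly continuous
    and vanishes off a fixed cube, which makes its modulus of continuity in p uniform in x.\<close>
  define \<Phi> where "\<Phi> w p x = c p * wprod w (a p) * dil (a p) (dpart w e) x" for w p x
  define u where "u p = c p * T (dil (a p) e)" for p
  have cR: "(\<lambda>x. c p * dil (a p) e x) \<in> test_cube R'" if "p \<in> X" for p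
    by (rule test_cube_cmult[OF dilR[OF that]])
  have u_eq: "u p = T (\<lambda>x. c p * dil (a p) e x)" if "p \<in> X" for p
    unfolding u_def by (rule dist_cmult[OF T test_cube_test[OF dilR[OF that]], symmetric])
  have dp: "dpart w (\<lambda>x. c p * dil (a p) e x) x = \<Phi> w p x" for w p x
    by (simp add: dpart_cmult smooth_dil se dpart_dil \<Phi>_def)
  have \<Phi>0: "\<Phi> w p x = 0" if "p \<in> X" "x \<notin> cube R'" for w p x
    using test_cube_zero[OF test_cube_dpart[OF cR[OF that(1)], of w] that(2)] by (simp add: dp)
  have unif: "\<exists>d>0. \<forall>w. length w \<le> N \<longrightarrow> (\<forall>p\<in>X. \<forall>p'\<in>X. dist p p' < d \<longrightarrow> (\<forall>x. norm (\<Phi> w p x - \<Phi> w p' x) \<le> \<eta>))"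
    if "\<eta> > 0" for \<eta>
  proof -
    have "\<exists>d>0. \<forall>p\<in>X. \<forall>p'\<in>X. dist p p' < d \<longrightarrow> (\<forall>x. norm (\<Phi> w p x - \<Phi> w p' x) \<le> \<eta>)" for w
    proof -
      have ca: "continuous_on (X \<times> cube R') (\<lambda>z. a (fst z))"
        by (rule continuous_on_compose2[OF X(3) continuous_on_fst[OF continuous_on_id]]) auto
      have cc: "continuous_on (X \<times> cube R') (\<lambda>z. c (fst z))"
        by (rule continuous_on_compose2[OF X(2) continuous_on_fst[OF continuous_on_id]]) auto
      have "continuous_on (X \<times> cube R') (\<lambda>z. dpart w e (coord_mult (snd z) (a (fst z))))"
        by (rule continuous_on_compose2[OF smooth_continuous[OF smooth_dpart[OF se]]
              continuous_on_coord_mult[OF continuous_on_snd[OF continuous_on_id] ca]]) auto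
      then have "continuous_on (X \<times> cube R') (\<lambda>z. \<Phi> w (fst z) (snd z))"
        unfolding \<Phi>_def dil_apply by (intro continuous_on_mult cc continuous_on_wprod ca)
      then have "uniformly_continuous_on (X \<times> cube R') (\<lambda>z. \<Phi> w (fst z) (snd z))"
        by (rule compact_uniformly_continuous) (intro compact_Times X(1) compact_cube)
      then obtain d where d: "d > 0" "\<And>z z'. z \<in> X \<times> cube R' \<Longrightarrow> z' \<in> X \<times> cube R' \<Longrightarrow> dist z' z < d \<Longrightarrow>
          dist (\<Phi> w (fst z') (snd z')) (\<Phi> w (fst z) (snd z)) < \<eta>"
        unfolding uniformly_continuous_on_def using \<open>\<eta> > 0\<close> by metis
      have "norm (\<Phi> w p x - \<Phi> w p' x) \<le> \<eta>" if "p \<in> X" "p' \<in> X" "dist p p' < d" for p p' x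
      proof (cases "x \<in> cube R'")
        case True
        then show ?thesis
          using d(2)[of "(p', x)" "(p, x)"] that by (auto simp: dist_Pair_Pair dist_norm)
      next
        case False
        then show ?thesis
          using \<Phi>0 that \<open>\<eta> > 0\<close> by simp
      qed
      then show ?thesis using d(1) by blast
    qed
    then obtain d where d: "\<And>w. d w > 0 \<and> (\<forall>p\<in>X. \<forall>p'\<in>X. dist p p' < d w \<longrightarrow> (\<forall>x. norm (\<Phi> w p x - \<Phi> w p' x) \<le> \<eta>))"
      by metis
    define S where "S = {w :: 'n list. length w \<le> N}"
    have S: "finite S"
      using finite_lists_length_le[of "UNIV :: 'n set" N] by (simp add: S_def)
    have S0: "[] \<in> S" by (simp add: S_def)
    have "Min (d ` S) > 0"
      using S S0 d by (subst Min_gr_iff) auto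
    moreover have "Min (d ` S) \<le> d w" if "length w \<le> N" for w
      using S that by (intro Min_le) (auto simp: S_def)
    ultimately show ?thesis
      using d by (intro exI[of _ "Min (d ` S)"] conjI) (auto, meson order_less_le_trans)
  qed
  have u_diff: "norm (u p - u p') \<le> C * \<eta>"
    if "p \<in> X" "p' \<in> X" "\<And>w x. length w \<le> N \<Longrightarrow> norm (\<Phi> w p x - \<Phi> w p' x) \<le> \<eta>" for p p' \<eta>
  proof -
    have "u p - u p' = T (\<lambda>x. c p * dil (a p) e x - c p' * dil (a p') e x)"
      using that u_eq by (simp add: dist_diff[OF T test_cube_test[OF cR[OF that(1)]] test_cube_test[OF cR[OF that(2)]]])
    moreover have "cbound N (\<lambda>x. c p * dil (a p) e x - c p' * dil (a p') e x) \<eta>"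
      unfolding cbound_def using that(3)
      by (simp add: dpart_diff[OF test_cube_smooth[OF cR[OF that(1)]] test_cube_smooth[OF cR[OF that(2)]]] dp)
    ultimately show ?thesis
      using C(2)[OF test_cube_diff[OF cR[OF that(1)] cR[OF that(2)]]] by simp
  qed
  have cu: "continuous_on X u"
    unfolding continuous_on_iff
  proof (intro ballI allI impI)
    fix p and \<epsilon> :: real assume p: "p \<in> X" and \<epsilon>: "0 < \<epsilon>"
    define \<eta> where "\<eta> = \<epsilon> / (2 * (C + 1))"
    have \<eta>: "\<eta> > 0" "C * \<eta> < \<epsilon>"
      using \<epsilon> C(1) by (auto simp: \<eta>_def field_simps intro!: add_nonneg_pos)
    obtain d where d: "d > 0" "\<forall>w. length w \<le> N \<longrightarrow> (\<forall>p\<in>X. \<forall>p'\<in>X. dist p p' < d \<longrightarrow> (\<forall>x. norm (\<Phi> w p x - \<Phi> w p' x) \<le> \<eta>))"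
      using unif[OF \<eta>(1)] by blast
    have "dist (u p') (u p) < \<epsilon>" if "p' \<in> X" "dist p' p < d" for p'
    proof -
      have "norm (u p' - u p) \<le> C * \<eta>"
        by (rule u_diff[OF that(1) p]) (use d(2) p that in blast)
      then show ?thesis
        using \<eta>(2) by (simp add: dist_norm)
    qed
    then show "\<exists>d>0. \<forall>x'\<in>X. dist x' p < d \<longrightarrow> dist (u x') (u p) < \<epsilon>"
      using d(1) by blast
  qed
  then show "continuous_on X (\<lambda>p. c p * T (dil (a p) e))"
    by (simp add: u_def)
  have uI: "integrable (lborel_on X) u"
    by (rule continuous_on_lborel_on_integrable[OF X(1) cu])
  define \<mu> where "\<mu> = measure (lborel_on X) (space (lborel_on X))"
  have \<mu>: "\<mu> \<ge> 0" by (simp add: \<mu>_def)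
  \<comment> \<open>Both sides are compared with the value T h at one Riemann sum h; each is within
    \<open>C * \<mu> * \<eta>\<close> of it.\<close>
  have main: "norm (T (dil_integral (lborel_on X) c a e) - (\<integral>p. u p \<partial>lborel_on X)) \<le> 2 * C * \<mu> * \<eta>" if \<eta>: "\<eta> > 0" for \<eta>
  proof -
    obtain d where d: "d > 0" "\<And>w p p' x. length w \<le> N \<Longrightarrow> p \<in> X \<Longrightarrow> p' \<in> X \<Longrightarrow> dist p p' < d \<Longrightarrow> norm (\<Phi> w p x - \<Phi> w p' x) \<le> \<eta>"
      using unif[OF \<eta>] by blast
    obtain m :: nat and A q where A: "\<And>i. i < m \<Longrightarrow> A i \<in> sets (lborel_on X)" "disjoint_family_on A {..<m}"
      "space (lborel_on X) = (\<Union>i<m. A i)" and q: "\<And>i p. i < m \<Longrightarrow> p \<in> A i \<Longrightarrow> q i \<in> X \<and> p \<in> X \<and> dist p (q i) < d"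
      using compact_partition[OF X(1) d(1)] by metis
    \<comment> \<open>Sample points of empty pieces are discarded, since they need not lie in X;
      such pieces have measure 0, so the sums do not change.\<close>
    define I where "I = {i. i < m \<and> A i \<noteq> {}}"
    have qX: "q i \<in> X" if "i \<in> I" for i
      using that q by (auto simp: I_def)
    define h where "h x = (\<Sum>i\<in>I. of_real (measure (lborel_on X) (A i)) * (c (q i) * dil (a (q i)) e x))" for x
    have trm: "(\<lambda>x. of_real (measure (lborel_on X) (A i)) * (c (q i) * dil (a (q i)) e x)) \<in> test_cube R'" if "i \<in> I" for i
      using qX[OF that] by (intro test_cube_cmult cR)
    have hR: "h \<in> test_cube R'"
      unfolding h_def[abs_def] by (rule test_cube_sum[OF trm])
    have sumI: "(\<Sum>i<m. of_real (measure (lborel_on X) (A i)) * g i) = (\<Sum>i\<in>I. of_real (measure (lborel_on X) (A i)) * g i)" for g :: "nat \<Rightarrow> complex"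
      by (rule sum.mono_neutral_right) (auto simp: I_def)
    have Th: "T h = (\<Sum>i<m. of_real (measure (lborel_on X) (A i)) * u (q i))"
    proof -
      have "T h = (\<Sum>i\<in>I. T (\<lambda>x. of_real (measure (lborel_on X) (A i)) * (c (q i) * dil (a (q i)) e x)))"
        unfolding h_def[abs_def] by (rule dist_sum[OF T test_cube_test[OF trm]])
      also have "\<dots> = (\<Sum>i\<in>I. of_real (measure (lborel_on X) (A i)) * u (q i))"
        using qX by (intro sum.cong refl) (simp add: dist_cmult[OF T test_cube_test[OF cR]] u_eq)
      finally show ?thesis by (simp add: sumI)
    qed
    have dh: "dpart w h x = (\<Sum>i<m. of_real (measure (lborel_on X) (A i)) * \<Phi> w (q i) x)" for w x
    proof -
      have "dpart w h x = (\<Sum>i\<in>I. dpart w (\<lambda>x. of_real (measure (lborel_on X) (A i)) * (c (q i) * dil (a (q i)) e x)) x)"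
        unfolding h_def[abs_def]
        by (rule fun_cong[OF dpart_sum[of I "\<lambda>i x. of_real (measure (lborel_on X) (A i)) * (c (q i) * dil (a (q i)) e x)" w,
              OF test_cube_smooth[OF trm]]])
      also have "\<dots> = (\<Sum>i\<in>I. of_real (measure (lborel_on X) (A i)) * \<Phi> w (q i) x)"
        using test_cube_smooth[OF cR[OF qX]] by (intro sum.cong refl) (simp add: dpart_cmult dp)
      finally show ?thesis by (simp add: sumI)
    qed
    have dpint: "dpart w (dil_integral (lborel_on X) c a e) x = (\<integral>p. \<Phi> w p x \<partial>lborel_on X)" for w x
      using dil_integral_dpart(1)[OF lborel_on_weight_integrable[OF X] continuous_on_lborel_on_measurable[OF X(2)]
          continuous_on_lborel_on_measurable[OF X(3)] e, of w "length w"]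
      by (simp add: dil_integral_def \<Phi>_def)
    have \<Phi>I: "integrable (lborel_on X) (\<lambda>p. \<Phi> w p x)" for w x
    proof (rule continuous_on_lborel_on_integrable[OF X(1)])
      have "continuous_on X (\<lambda>p. dpart w e (coord_mult x (a p)))"
        by (rule continuous_on_compose2[OF smooth_continuous[OF smooth_dpart[OF se]]
              continuous_on_coord_mult[OF continuous_on_const X(3)]]) auto
      then show "continuous_on X (\<lambda>p. \<Phi> w p x)"
        unfolding \<Phi>_def dil_apply by (intro continuous_on_mult X(2) continuous_on_wprod X(3))
    qed
    have "cbound N (\<lambda>x. dil_integral (lborel_on X) c a e x - h x) (\<eta> * \<mu>)"
      unfolding cbound_def
    proof (intro allI impI)
      fix w x assume w: "length (w :: 'n list) \<le> N"
      show "norm (dpart w (\<lambda>x. dil_integral (lborel_on X) c a e x - h x) x) \<le> \<eta> * \<mu>"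
        unfolding dpart_diff[OF test_cube_smooth[OF pR] test_cube_smooth[OF hR]] dpint dh \<mu>_def
        using q d(2)[OF w] by (intro riemann_sum_bound[OF finite_measure_axioms \<Phi>I A]) blast+
    qed
    from C(2)[OF test_cube_diff[OF pR hR] this]
    have "norm (T (dil_integral (lborel_on X) c a e) - T h) \<le> C * (\<eta> * \<mu>)"
      by (simp add: dist_diff[OF T test_cube_test[OF pR] test_cube_test[OF hR]])
    moreover have "norm ((\<integral>p. u p \<partial>lborel_on X) - T h) \<le> (C * \<eta>) * \<mu>"
      unfolding Th \<mu>_def
    proof (intro riemann_sum_bound[OF finite_measure_axioms uI A])
      fix i p assume "i < m" "p \<in> A i"
      from q[OF this] show "norm (u p - u (q i)) \<le> C * \<eta>"
        using d(2) by (intro u_diff) auto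
    qed
    ultimately have "norm ((T (dil_integral (lborel_on X) c a e) - T h) - ((\<integral>p. u p \<partial>lborel_on X) - T h)) \<le> C * (\<eta> * \<mu>) + (C * \<eta>) * \<mu>"
      by (rule order_trans[OF norm_triangle_ineq4 add_mono])
    then show ?thesis
      by (simp add: algebra_simps)
  qed
  have "norm (T (dil_integral (lborel_on X) c a e) - (\<integral>p. u p \<partial>lborel_on X)) \<le> 0"
  proof (rule field_le_epsilon)
    fix \<epsilon> :: real assume \<epsilon>: "\<epsilon> > 0"
    define \<eta> where "\<eta> = \<epsilon> / (2 * C * \<mu> + 1)"
    have pos: "2 * C * \<mu> + 1 > 0" using C(1) \<mu> by (simp add: add_nonneg_pos)
    then have "\<eta> > 0" using \<epsilon> by (simp add: \<eta>_def)
    have "2 * C * \<mu> * \<eta> \<le> (2 * C * \<mu> + 1) * \<eta>"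
      using \<open>\<eta> > 0\<close> by (intro mult_right_mono) auto
    also have "\<dots> = \<epsilon>" using pos by (simp add: \<eta>_def)
    finally show "norm (T (dil_integral (lborel_on X) c a e) - (\<integral>p. u p \<partial>lborel_on X)) \<le> 0 + \<epsilon>"
      using main[OF \<open>\<eta> > 0\<close>] by simp
  qed
  then show "T (dil_integral (lborel_on X) c a e) = (\<integral>p. c p * T (dil (a p) e) \<partial>lborel_on X)"
    by (simp add: u_def)
qed

subsection \<open>Uniform boundedness\<close>

text \<open>Completeness of the smooth functions under uniform convergence of every derivative; on
  each coordinate line it is the theorem on differentiating a sequence of functions.\<close>

lemma smooth_limit:
  fixes F :: "nat \<Rightarrow> real^'n::finite \<Rightarrow> complex"
  assumes F: "\<And>n. smooth (F n)" and C: "\<And>w. uniformly_Cauchy_on UNIV (\<lambda>n. dpart w (F n))"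
  obtains f where "smooth f" "\<And>w x. (\<lambda>n. dpart w (F n) x) \<longlonglongrightarrow> dpart w f x"
proof -
  have "\<exists>l. uniform_limit UNIV (\<lambda>n. dpart w (F n)) l sequentially" for w
    using C[of w] by (simp add: Cauchy_uniformly_convergent flip: uniformly_convergent_on_def)
  then obtain L where L: "\<And>w. uniform_limit UNIV (\<lambda>n. dpart w (F n)) (L w) sequentially"
    by metis
  have lim: "(\<lambda>n. dpart w (F n) x) \<longlonglongrightarrow> L w x" for w x
    using tendsto_uniform_limitI[OF L[of w], of x] by simp
  have cont: "continuous_on UNIV (L w)" for w
    by (rule uniform_limit_theorem[OF _ L[of w]])
      (use smooth_continuous[OF smooth_dpart[OF F]] in auto)
  have hp: "has_partial i (L w) (L (i # w))" for i w
    unfolding has_partial_def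
  proof
    fix x
    let ?y = "\<lambda>t. x + t *\<^sub>R axis i (1::real)"
    have "\<exists>g. \<forall>t\<in>UNIV. (\<lambda>n. dpart w (F n) (?y t)) \<longlonglongrightarrow> g t \<and>
        (g has_derivative (\<lambda>h. h *\<^sub>R L (i # w) (?y t))) (at t within UNIV)"
    proof (rule has_derivative_sequence)
      fix n t
      show "((\<lambda>t. dpart w (F n) (?y t)) has_derivative (\<lambda>h. h *\<^sub>R dpart (i # w) (F n) (?y t))) (at t within UNIV)"
        using has_partial_at[OF smooth_has_partial[OF smooth_dpart[OF F]], of w n x i t]
        by (simp add: has_vector_derivative_def)
    next
      fix e :: real assume "e > 0"
      then have "\<forall>\<^sub>F n in sequentially. \<forall>x\<in>UNIV. dist (dpart (i # w) (F n) x) (L (i # w) x) < e"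
        using uniform_limitD[OF L[of "i # w"]] by blast
      then show "\<forall>\<^sub>F n in sequentially. \<forall>t\<in>UNIV. \<forall>h. norm (h *\<^sub>R dpart (i # w) (F n) (?y t) - h *\<^sub>R L (i # w) (?y t)) \<le> e * norm h"
      proof (rule eventually_mono, intro ballI allI)
        fix n t and h :: real
        assume "\<forall>x\<in>UNIV. dist (dpart (i # w) (F n) x) (L (i # w) x) < e"
        then have "norm (dpart (i # w) (F n) (?y t) - L (i # w) (?y t)) \<le> e"
          by (simp add: dist_norm less_imp_le)
        then have "\<bar>h\<bar> * norm (dpart (i # w) (F n) (?y t) - L (i # w) (?y t)) \<le> \<bar>h\<bar> * e"
          by (rule mult_left_mono) simp
        then show "norm (h *\<^sub>R dpart (i # w) (F n) (?y t) - h *\<^sub>R L (i # w) (?y t)) \<le> e * norm h"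
          by (simp add: mult.commute flip: scaleR_diff_right)
      qed
    next
      show "(\<lambda>n. dpart w (F n) (?y 0)) \<longlonglongrightarrow> L w (?y 0)" by (rule lim)
    qed auto
    then obtain g where g: "\<And>t. (\<lambda>n. dpart w (F n) (?y t)) \<longlonglongrightarrow> g t"
      "\<And>t. (g has_derivative (\<lambda>h. h *\<^sub>R L (i # w) (?y t))) (at t)"
      by auto
    have "g = (\<lambda>t. L w (?y t))"
      using LIMSEQ_unique[OF g(1) lim] by blast
    then show "((\<lambda>t. L w (?y t)) has_vector_derivative L (i # w) x) (at 0)"
      using g(2)[of 0] by (simp add: has_vector_derivative_def)
  qed
  have dL: "dpart w (L []) = L w" for w
  proof (induction w)
    case (Cons i w)
    then show ?case using has_partialD[OF hp[of i w]] by simp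
  qed simp
  have "smooth (L [])"
    unfolding smooth_def dL using cont hp has_partial_exists by blast
  then show ?thesis
    using that[of "L []"] lim by (simp add: dL)
qed

text \<open>b is half the difference of a + b and a - b. This provides the choice of sign in the
  gliding hump.\<close>

lemma norm_add_or_diff:
  fixes a b :: complex
  shows "norm b \<le> norm (a + b) \<or> norm b \<le> norm (a - b)"
proof (rule ccontr)
  assume "\<not> ?thesis"
  then have "norm (a + b) + norm (a - b) < 2 * norm b" by simp
  moreover have "norm ((a + b) - (a - b)) \<le> norm (a + b) + norm (a - b)"
    by (rule norm_triangle_ineq4)
  ultimately show False by (simp add: norm_mult flip: mult_2)
qed

text \<open>Just enough for a closed subspace of a Frechet space: \<open>lim\<close> asks only for
  pointwise limits already known to be smooth, since \<open>smooth_limit\<close> supplies the rest.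
  The instances are all of \<open>test_cube R\<close> and its parts of fixed parity.\<close>

locale test_subspace =
  fixes V :: "(real^'n::finite \<Rightarrow> complex) set" and R :: real
  assumes sub: "V \<subseteq> test_cube R"
    and add: "\<And>f g. f \<in> V \<Longrightarrow> g \<in> V \<Longrightarrow> (\<lambda>x. f x + g x) \<in> V"
    and cmult: "\<And>f c. f \<in> V \<Longrightarrow> (\<lambda>x. c * f x) \<in> V"
    and nonempty: "V \<noteq> {}"
    and lim: "\<And>F f. (\<And>n. F n \<in> V) \<Longrightarrow> smooth f \<Longrightarrow> (\<And>x. (\<lambda>n. F n x) \<longlonglongrightarrow> f x) \<Longrightarrow> f \<in> V"
begin

lemma V_smooth: "f \<in> V \<Longrightarrow> smooth f"
  using sub test_cube_smooth by blast

lemma diff: "f \<in> V \<Longrightarrow> g \<in> V \<Longrightarrow> (\<lambda>x. f x - g x) \<in> V"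
  using add[OF _ cmult[of g "-1"], of f] by simp

lemma zero: "(\<lambda>x. 0) \<in> V"
  using cmult[of _ 0] nonempty by auto

text \<open>The proof is a gliding hump: each step adds \<open>h\<close> or \<open>- h\<close>, whichever makes the current functional
  large, and all later steps are too small to spoil that.\<close>

lemma uniform_boundedness:
  fixes \<Lambda> :: "'i \<Rightarrow> (real^'n \<Rightarrow> complex) \<Rightarrow> complex"
  assumes ladd: "\<And>i f g. f \<in> V \<Longrightarrow> g \<in> V \<Longrightarrow> \<Lambda> i (\<lambda>x. f x + g x) = \<Lambda> i f + \<Lambda> i g"
    and lcmult: "\<And>i f c. f \<in> V \<Longrightarrow> \<Lambda> i (\<lambda>x. c * f x) = c * \<Lambda> i f"
    and cont: "\<And>i. \<exists>C N. \<forall>f\<in>V. \<forall>B. cbound N f B \<longrightarrow> norm (\<Lambda> i f) \<le> C * B"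
    and pw: "\<And>f. f \<in> V \<Longrightarrow> \<exists>C. \<forall>i. norm (\<Lambda> i f) \<le> C"
  shows "\<exists>C N. \<forall>i. \<forall>f\<in>V. \<forall>B. cbound N f B \<longrightarrow> norm (\<Lambda> i f) \<le> C * B"
proof (rule ccontr)
  assume "\<not> ?thesis"
  then have neg: "\<exists>i. \<exists>f\<in>V. \<exists>B. cbound N f B \<and> C * B < norm (\<Lambda> i f)" for C N
    by (meson not_le)
  have ldiff: "\<Lambda> i (\<lambda>x. f x - g x) = \<Lambda> i f - \<Lambda> i g" if "f \<in> V" "g \<in> V" for i f g
    using ladd[OF that(1) cmult[OF that(2), of "-1"]] lcmult[OF that(2), of i "-1"] by simp
  \<comment> \<open>Failure of every uniform bound, after rescaling: some function as small as
    desired in C^N has a value of prescribed size.\<close>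
  have big: "\<exists>i. \<exists>h\<in>V. cbound N h \<eta> \<and> norm (\<Lambda> i h) = Z" if "\<eta> > 0" "Z > 0" for N and \<eta> Z :: real
  proof -
    obtain i f B where f: "f \<in> V" "cbound N f B" "(Z / \<eta>) * B < norm (\<Lambda> i f)"
      using neg[where C = "Z / \<eta>"] by blast
    have B: "B \<ge> 0" using f(2) by (rule cbound_nonneg)
    have pos: "norm (\<Lambda> i f) > 0"
      using f(3) B \<open>\<eta> > 0\<close> \<open>Z > 0\<close> by (meson divide_nonneg_pos le_less_trans less_imp_le mult_nonneg_nonneg)
    define s where "s = Z / norm (\<Lambda> i f)"
    have s: "s > 0" using pos \<open>Z > 0\<close> by (simp add: s_def)
    have sB: "s * B \<le> \<eta>"
      using f(3) pos \<open>\<eta> > 0\<close> by (simp add: s_def field_simps)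
    have "cbound N (\<lambda>x. of_real s * f x) (norm (complex_of_real s) * B)"
      by (rule cbound_cmult[OF V_smooth[OF f(1)] f(2)])
    then have "cbound N (\<lambda>x. of_real s * f x) \<eta>"
      by (rule cbound_mono) (use s sB in auto)
    moreover have "norm (\<Lambda> i (\<lambda>x. of_real s * f x)) = Z"
      using pos s by (simp add: lcmult[OF f(1)] norm_mult) (simp add: s_def)
    ultimately show ?thesis
      using cmult[OF f(1)] by blast
  qed
  \<comment> \<open>State of the construction: partial sum g, order N in which the next steps are
    controlled, and the size \<eta> allowed for the next step.\<close>
  define P where "P n st = (case st of (g, N, \<eta>) \<Rightarrow> g \<in> V \<and> n \<le> N \<and> 0 < \<eta> \<and> \<eta> \<le> (1/2) ^ n)"
    for n :: nat and st :: "(real^'n \<Rightarrow> complex) \<times> nat \<times> real"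
  define Q where "Q n st st' = (case st of (g, N, \<eta>) \<Rightarrow> case st' of (g', N', \<eta>') \<Rightarrow>
      cbound N (\<lambda>x. g' x - g x) \<eta> \<and> N \<le> N' \<and> \<eta>' \<le> \<eta> / 2 \<and>
      (\<exists>i. norm (\<Lambda> i g') \<ge> real n + 1 \<and> (\<forall>h\<in>V. cbound N' h (2 * \<eta>') \<longrightarrow> norm (\<Lambda> i h) \<le> 1)))"
    for n :: nat and st st' :: "(real^'n \<Rightarrow> complex) \<times> nat \<times> real"
  have "\<exists>s. \<forall>n. P n (s n) \<and> Q n (s n) (s (Suc n))"
  proof (rule dependent_nat_choice)
    show "\<exists>st. P 0 st"
      using zero by (intro exI[of _ "((\<lambda>x. 0), 0, 1)"]) (simp add: P_def)
  next
    fix st n assume "P n st"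
    then obtain g N \<eta> where st: "st = (g, N, \<eta>)" and g: "g \<in> V" "n \<le> N" "0 < \<eta>" "\<eta> \<le> (1/2) ^ n"
      by (auto simp: P_def split: prod.splits)
    obtain i h where h: "h \<in> V" "cbound N h \<eta>" "norm (\<Lambda> i h) = real n + 1"
      using big[OF g(3), of "real n + 1" N] by auto
    obtain s :: complex where s: "norm s = 1" "norm (\<Lambda> i h) \<le> norm (\<Lambda> i g + s * \<Lambda> i h)"
      using norm_add_or_diff[of "\<Lambda> i h" "\<Lambda> i g"] that[of 1] that[of "-1"] by fastforce
    define g' where "g' = (\<lambda>x. g x + s * h x)"
    have g': "g' \<in> V"
      unfolding g'_def by (rule add[OF g(1) cmult[OF h(1)]])
    have "\<Lambda> i g' = \<Lambda> i g + s * \<Lambda> i h"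
      unfolding g'_def ladd[OF g(1) cmult[OF h(1)]] lcmult[OF h(1)] ..
    then have large: "norm (\<Lambda> i g') \<ge> real n + 1"
      using s(2) h(3) by simp
    have "(\<lambda>x. g' x - g x) = (\<lambda>x. s * h x)"
      by (simp add: g'_def)
    then have cb: "cbound N (\<lambda>x. g' x - g x) \<eta>"
      using cbound_cmult[OF V_smooth[OF h(1)] h(2), of s] s(1) by simp
    obtain C M where CM: "\<And>f B. f \<in> V \<Longrightarrow> cbound M f B \<Longrightarrow> norm (\<Lambda> i f) \<le> C * B"
      using cont[of i] by blast
    define N' where "N' = max (Suc N) M"
    \<comment> \<open>Later steps add up to at most 2 \<eta>' in the new norm; the second bound
      makes this change the current functional by at most 1.\<close>
    define \<eta>' where "\<eta>' = min (\<eta> / 2) (1 / (2 * (1 + \<bar>C\<bar>)))"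
    have \<eta>': "0 < \<eta>'" "\<eta>' \<le> \<eta> / 2" "2 * \<eta>' * (1 + \<bar>C\<bar>) \<le> 1"
    proof -
      show "0 < \<eta>'" "\<eta>' \<le> \<eta> / 2" using g(3) by (auto simp: \<eta>'_def)
      have "\<eta>' \<le> 1 / (2 * (1 + \<bar>C\<bar>))" by (simp add: \<eta>'_def)
      then show "2 * \<eta>' * (1 + \<bar>C\<bar>) \<le> 1"
        by (simp add: le_divide_eq mult_ac add_pos_nonneg)
    qed
    have small: "norm (\<Lambda> i f) \<le> 1" if "f \<in> V" "cbound N' f (2 * \<eta>')" for f
    proof -
      have "cbound M f (2 * \<eta>')"
        by (rule cbound_mono[OF that(2)]) (simp_all add: N'_def)
      then have "norm (\<Lambda> i f) \<le> C * (2 * \<eta>')"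
        by (rule CM[OF that(1)])
      also have "\<dots> \<le> (1 + \<bar>C\<bar>) * (2 * \<eta>')"
        using \<eta>'(1) by (intro mult_right_mono) auto
      finally show ?thesis
        using \<eta>'(3) by (simp add: mult_ac)
    qed
    have "P (Suc n) (g', N', \<eta>')"
      using g g' \<eta>' by (auto simp: P_def N'_def)
    moreover have "Q n st (g', N', \<eta>')"
      using cb large small \<eta>'(2) by (auto simp: Q_def st N'_def)
    ultimately show "\<exists>st'. P (Suc n) st' \<and> Q n st st'" by blast
  qed
  then obtain st where st: "\<And>n. P n (st n)" "\<And>n. Q n (st n) (st (Suc n))" by blast
  define g where "g n = fst (st n)" for n
  define N where "N n = fst (snd (st n))" for n
  define \<eta> where "\<eta> n = snd (snd (st n))" for n
  have st_eq: "st n = (g n, N n, \<eta> n)" for n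
    by (simp add: g_def N_def \<eta>_def)
  have gV: "g n \<in> V" and Nn: "n \<le> N n" and \<eta>0: "0 < \<eta> n" and \<eta>n: "\<eta> n \<le> (1/2) ^ n" for n
    using st(1)[of n] by (auto simp: P_def st_eq)
  have step: "cbound (N n) (\<lambda>x. g (Suc n) x - g n x) (\<eta> n)" "N n \<le> N (Suc n)" "\<eta> (Suc n) \<le> \<eta> n / 2"
    "\<exists>i. norm (\<Lambda> i (g (Suc n))) \<ge> real n + 1 \<and> (\<forall>h\<in>V. cbound (N (Suc n)) h (2 * \<eta> (Suc n)) \<longrightarrow> norm (\<Lambda> i h) \<le> 1)" for n
    using st(2)[of n] by (auto simp: Q_def st_eq)
  \<comment> \<open>Geometric series: each \<eta> is at most half the previous one.\<close>
  have tail: "cbound (N n) (\<lambda>x. g (n + k) x - g n x) (2 * \<eta> n)" for n k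
  proof -
    have "\<forall>n. cbound (N n) (\<lambda>x. g (n + k) x - g n x) (2 * \<eta> n)"
    proof (induction k)
      case 0
      then show ?case
        using \<eta>0 by (auto simp: cbound_def dpart_zero less_imp_le)
    next
      case (Suc k)
      show ?case
      proof
        fix n
        have "cbound (N (Suc n)) (\<lambda>x. g (Suc n + k) x - g (Suc n) x) (2 * \<eta> (Suc n))"
          using Suc by blast
        then have "cbound (N n) (\<lambda>x. g (Suc n + k) x - g (Suc n) x) (2 * \<eta> (Suc n))"
          by (rule cbound_mono[OF _ step(2) order_refl])
        from cbound_add[OF V_smooth[OF diff[OF gV gV]] V_smooth[OF diff[OF gV gV]] this step(1)]
        have "cbound (N n) (\<lambda>x. g (n + Suc k) x - g n x) (2 * \<eta> (Suc n) + \<eta> n)"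
          by simp
        then show "cbound (N n) (\<lambda>x. g (n + Suc k) x - g n x) (2 * \<eta> n)"
          by (rule cbound_mono) (use step(3)[of n] in auto)
      qed
    qed
    then show ?thesis by blast
  qed
  have tailw: "norm (dpart w (g (n + k)) x - dpart w (g n) x) \<le> 2 * \<eta> n" if "length w \<le> N n" for w n k x
    using tail[of n k] that unfolding cbound_def by (simp add: dpart_diff[OF V_smooth[OF gV] V_smooth[OF gV]])
  have \<eta>lim: "\<exists>n. 4 * \<eta> n < e" if e: "e > 0" for e
  proof -
    obtain n where "(1/2::real) ^ n < e / 4"
      using real_arch_pow_inv[of "e / 4" "1/2"] e by auto
    then show ?thesis
      using \<eta>n[of n] by (intro exI[of _ n]) linarith
  qed
  have \<eta>mono: "\<eta> (n + k) \<le> \<eta> n" for n k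
  proof (induction k)
    case (Suc k)
    then show ?case using step(3)[of "n + k"] \<eta>0[of "n + k"] by simp
  qed simp
  have "uniformly_Cauchy_on UNIV (\<lambda>n. dpart w (g n))" for w
    unfolding uniformly_Cauchy_on_def
  proof (intro allI impI)
    fix e :: real assume "e > 0"
    then obtain n0 where n0: "4 * \<eta> n0 < e" using \<eta>lim by blast
    \<comment> \<open>Far enough out, the controlled order \<open>N n\<close>, which is at least n,
      covers the word w.\<close>
    define n where "n = n0 + length w"
    have n: "4 * \<eta> n < e" "length w \<le> N n"
      using n0 \<eta>mono[of n0 "length w"] Nn[of n] by (auto simp: n_def)
    have *: "norm (dpart w (g m) x - dpart w (g n) x) \<le> 2 * \<eta> n" if "m \<ge> n" for m x
      using tailw[OF n(2), of "m - n" x] that by simp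
    have "dist (dpart w (g m) x) (dpart w (g l) x) < e" if "m \<ge> n" "l \<ge> n" for m l x
    proof -
      have "norm ((dpart w (g m) x - dpart w (g n) x) - (dpart w (g l) x - dpart w (g n) x)) \<le> 2 * \<eta> n + 2 * \<eta> n"
        by (rule order_trans[OF norm_triangle_ineq4 add_mono[OF *[OF that(1)] *[OF that(2)]]])
      then show ?thesis
        using n(1) by (simp add: dist_norm)
    qed
    then show "\<exists>M. \<forall>x\<in>UNIV. \<forall>m\<ge>M. \<forall>n\<ge>M. dist (dpart w (g m) x) (dpart w (g n) x) < e"
      by blast
  qed
  then obtain f where f: "smooth f" "\<And>w x. (\<lambda>n. dpart w (g n) x) \<longlonglongrightarrow> dpart w f x"
    using smooth_limit[of g, OF V_smooth[OF gV]] by metis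
  have fV: "f \<in> V"
    using f(2)[of "[]"] by (intro lim[of g f] gV f(1)) simp
  have ftail: "cbound (N n) (\<lambda>x. f x - g n x) (2 * \<eta> n)" for n
    unfolding cbound_def
  proof (intro allI impI)
    fix w x assume w: "length (w :: 'n list) \<le> N n"
    have "(\<lambda>k. dpart w (g (n + k)) x) \<longlonglongrightarrow> dpart w f x"
      using LIMSEQ_ignore_initial_segment[OF f(2)[of w x], of n] by (simp add: add.commute)
    then have "(\<lambda>k. norm (dpart w (g (n + k)) x - dpart w (g n) x)) \<longlonglongrightarrow> norm (dpart w f x - dpart w (g n) x)"
      by (intro tendsto_norm tendsto_diff tendsto_const)
    then have "norm (dpart w f x - dpart w (g n) x) \<le> 2 * \<eta> n"
      by (rule LIMSEQ_le_const2) (use tailw[OF w] in blast)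
    then show "norm (dpart w (\<lambda>x. f x - g n x) x) \<le> 2 * \<eta> n"
      by (simp add: dpart_diff[OF f(1) V_smooth[OF gV]])
  qed
  obtain C where C: "\<And>i. norm (\<Lambda> i f) \<le> C"
    using pw[OF fV] by blast
  obtain n where n: "real n > C"
    using reals_Archimedean2 by blast
  \<comment> \<open>The functional of stage n is at least n + 1 on the partial sum, and the rest of
    the series changes it by at most 1; so it is at least n on the limit f.\<close>
  obtain i where i: "norm (\<Lambda> i (g (Suc n))) \<ge> real n + 1" "\<forall>h\<in>V. cbound (N (Suc n)) h (2 * \<eta> (Suc n)) \<longrightarrow> norm (\<Lambda> i h) \<le> 1"
    using step(4)[of n] by blast
  have "norm (\<Lambda> i (\<lambda>x. f x - g (Suc n) x)) \<le> 1"
    using i(2) diff[OF fV gV] ftail by blast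
  then have "norm (\<Lambda> i f - \<Lambda> i (g (Suc n))) \<le> 1"
    by (simp add: ldiff[OF fV gV])
  then have "norm (\<Lambda> i f) \<ge> real n"
    using i(1) norm_triangle_ineq2[of "\<Lambda> i (g (Suc n))" "\<Lambda> i f"] by (simp add: norm_minus_commute)
  then show False
    using C[of i] n by simp
qed

end

lemma test_subspace_test_cube: "test_subspace (test_cube R) R"
proof
  show "test_cube R \<noteq> {}"
    by (auto simp: test_cube_def intro!: exI[of _ "\<lambda>x. 0"] smooth_const)
  fix F :: "nat \<Rightarrow> real^'a \<Rightarrow> complex" and f
  assume F: "\<And>n. F n \<in> test_cube R" and f: "smooth f" "\<And>x. (\<lambda>n. F n x) \<longlonglongrightarrow> f x"
  have "f x = 0" if "x \<notin> cube R" for x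
    using f(2)[of x] test_cube_zero[OF F that] LIMSEQ_unique[OF _ tendsto_const] by simp
  then show "f \<in> test_cube R"
    using f(1) by (simp add: test_cube_def)
qed (auto intro: test_cube_add test_cube_cmult)

subsection \<open>Densities supported away from the coordinate hyperplanes\<close>

text \<open>On \<open>real^'n\<close> the measure \<open>lborel\<close> is the image of a product
  measure indexed by the basis vectors; reindexing these by coordinates gives Fubini for products of
  one-variable functions.\<close>

lemma lborel_prod_integral:
  fixes g :: "'n::finite \<Rightarrow> real \<Rightarrow> 'c::{real_normed_field, banach, second_countable_topology}"
  assumes g: "\<And>j. integrable lborel (g j)"
  shows "integrable lborel (\<lambda>x::real^'n. \<Prod>j\<in>UNIV. g j (x $ j))"
    and "(\<integral>x. (\<Prod>j\<in>UNIV. g j (x $ j)) \<partial>(lborel :: (real^'n) measure)) = (\<Prod>j\<in>UNIV. integral\<^sup>L lborel (g j))"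
proof -
  interpret product_sigma_finite "\<lambda>_ :: real^'n. lborel :: real measure"
    by standard
  let ?B = "Basis :: (real^'n) set"
  let ?G = "\<lambda>b. g (axis_index b)"
  let ?T = "\<lambda>f :: real^'n \<Rightarrow> real. \<Sum>b\<in>?B. f b *\<^sub>R b"
  have B: "?B = (\<lambda>j. axis j 1) ` UNIV"
    by (auto simp: Basis_vec_def)
  have inj: "inj (\<lambda>j. axis j (1::real) :: real^'n)"
    by (auto simp: inj_on_def axis_eq_axis)
  have comp: "?T f $ j = f (axis j 1)" for f j
  proof -
    have "?T f $ j = ?T f \<bullet> axis j 1"
      by (simp add: cart_eq_inner_axis)
    also have "\<dots> = f (axis j 1)"
      by (rule inner_sum_left_Basis) (auto simp: B)
    finally show ?thesis .
  qed
  have eq: "(\<Prod>j\<in>UNIV. g j (?T f $ j)) = (\<Prod>b\<in>?B. ?G b (f b))" for f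
  proof -
    have "(\<Prod>j\<in>UNIV. g j (?T f $ j)) = (\<Prod>j\<in>UNIV. g j (f (axis j 1)))"
      by (simp only: comp)
    also have "\<dots> = (\<Prod>b\<in>range (\<lambda>j. axis j 1). ?G b (f b))"
      by (subst prod.reindex[OF inj]) simp
    finally show ?thesis
      by (simp only: B)
  qed
  have T: "?T \<in> measurable (\<Pi>\<^sub>M b\<in>?B. lborel) borel"
    by measurable
  have gm: "g j \<in> borel_measurable borel" for j
    using g[of j] by (simp add: borel_measurable_integrable)
  have cm: "(\<lambda>x::real^'n. x $ j) \<in> borel_measurable borel" for j
    by (intro borel_measurable_continuous_onI continuous_intros)
  have Pm: "(\<lambda>x::real^'n. \<Prod>j\<in>UNIV. g j (x $ j)) \<in> borel_measurable borel"
    by (intro borel_measurable_prod measurable_compose[OF cm gm])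
  have I: "integrable (\<Pi>\<^sub>M b\<in>?B. lborel) (\<lambda>f. \<Prod>b\<in>?B. ?G b (f b))"
    by (rule product_integrable_prod) (auto intro: g)
  show "integrable lborel (\<lambda>x::real^'n. \<Prod>j\<in>UNIV. g j (x $ j))"
    by (subst lborel_eq, subst integrable_distr_eq[OF T Pm]) (use I in \<open>simp only: eq\<close>)
  have "(\<integral>x. (\<Prod>j\<in>UNIV. g j (x $ j)) \<partial>(lborel :: (real^'n) measure)) = (\<integral>f. (\<Prod>b\<in>?B. ?G b (f b)) \<partial>(\<Pi>\<^sub>M b\<in>?B. lborel))"
    by (subst lborel_eq, subst integral_distr[OF T Pm]) (simp only: eq)
  also have "\<dots> = (\<Prod>b\<in>?B. integral\<^sup>L lborel (?G b))"
    by (rule product_integral_prod) (auto intro: g)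
  also have "\<dots> = (\<Prod>j\<in>UNIV. integral\<^sup>L lborel (g j))"
    unfolding B by (subst prod.reindex[OF inj]) simp
  finally show "(\<integral>x. (\<Prod>j\<in>UNIV. g j (x $ j)) \<partial>(lborel :: (real^'n) measure)) = (\<Prod>j\<in>UNIV. integral\<^sup>L lborel (g j))" .
qed

lemma integrable_inverse_one_plus_square: "integrable lborel (\<lambda>x::real. inverse (1 + x\<^sup>2))"
proof -
  let ?f = "\<lambda>x::real. inverse (1 + x\<^sup>2) * indicator {0..} x"
  have "(\<integral>\<^sup>+x. ennreal (inverse (1 + x\<^sup>2)) * indicator {0..} x \<partial>lborel) = ennreal (pi / 2 - arctan 0)"
  proof (rule nn_integral_FTC_atLeast)
    show "DERIV arctan x :> inverse (1 + x\<^sup>2)" for x by (rule DERIV_arctan)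
    show "(arctan \<longlongrightarrow> pi / 2) at_top" by (rule tendsto_arctan_at_top)
  qed auto
  then have fin: "(\<integral>\<^sup>+x. ennreal (?f x) \<partial>lborel) < \<infinity>"
    by (simp add: ennreal_mult' ennreal_indicator)
  have I: "integrable lborel ?f"
    by (rule integrableI_nonneg) (use fin in auto)
  have "integrable lborel (\<lambda>x. ?f (0 + (-1) * x))"
    by (rule lborel_integrable_real_affine[OF I]) simp
  from Bochner_Integration.integrable_add[OF I this] show ?thesis
    by (rule Bochner_Integration.integrable_bound) (auto simp: indicator_def intro!: AE_I2)
qed

text \<open>Comparison with the product of the functions 1/(1 + x_j^2), each of which is integrable:
  every 1 + x_j^2 is at most 1 + |x|^2.\<close>

lemma integrable_inverse_power:
  "integrable lborel (\<lambda>x::real^'n::finite. inverse ((1 + (norm x)\<^sup>2) ^ CARD('n)))"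
proof -
  have "integrable lborel (\<lambda>x::real^'n. \<Prod>j\<in>UNIV. inverse (1 + (x $ j)\<^sup>2))"
    by (rule lborel_prod_integral(1)) (rule integrable_inverse_one_plus_square)
  then show ?thesis
  proof (rule Bochner_Integration.integrable_bound)
    show "AE x in lborel. norm (inverse ((1 + (norm x)\<^sup>2) ^ CARD('n))) \<le> norm (\<Prod>j\<in>UNIV. inverse (1 + ((x::real^'n) $ j)\<^sup>2))"
    proof (rule AE_I2)
      fix x :: "real^'n"
      have "(\<Prod>j\<in>(UNIV::'n set). 1 + (x $ j)\<^sup>2) \<le> (\<Prod>j\<in>(UNIV::'n set). 1 + (norm x)\<^sup>2)"
      proof (rule prod_mono)
        fix j
        have "\<bar>x $ j\<bar>\<^sup>2 \<le> (norm x)\<^sup>2"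
          by (rule power_mono[OF component_le_norm_cart]) simp
        then show "0 \<le> 1 + (x $ j)\<^sup>2 \<and> 1 + (x $ j)\<^sup>2 \<le> 1 + (norm x)\<^sup>2"
          by simp
      qed
      moreover have pos: "0 < (\<Prod>j\<in>(UNIV::'n set). 1 + (x $ j)\<^sup>2)"
        by (intro prod_pos) (simp add: add_pos_nonneg)
      ultimately have "inverse ((1 + (norm x)\<^sup>2) ^ CARD('n)) \<le> inverse (\<Prod>j\<in>(UNIV::'n set). 1 + (x $ j)\<^sup>2)"
        by (intro le_imp_inverse_le) auto
      moreover have "0 \<le> inverse ((1 + (norm x)\<^sup>2) ^ CARD('n))"
        by (simp add: add_nonneg_nonneg)
      ultimately show "norm (inverse ((1 + (norm x)\<^sup>2) ^ CARD('n))) \<le> norm (\<Prod>j\<in>UNIV. inverse (1 + (x $ j)\<^sup>2))"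
        using prod_inversef[of "\<lambda>j. 1 + (x $ j)\<^sup>2" UNIV] pos by (simp add: o_def abs_of_pos)
    qed
  qed measurable
qed

text \<open>A small shift along the vector 1, avoiding finitely many lengths, leaves all hyperplanes
  at once.\<close>

lemma all_nonzero_dense:
  fixes U :: "(real^'n::finite) set"
  assumes "open U" "x \<in> U"
  obtains y where "y \<in> U" "all_nonzero y"
proof -
  obtain e where e: "e > 0" "ball x e \<subseteq> U"
    using assms open_contains_ball by blast
  define e' where "e' = e / (1 + norm (1 :: real^'n))"
  have e': "e' > 0" using e(1) by (simp add: e'_def add_pos_nonneg)
  have "infinite ({0<..<e'} - range (\<lambda>j. - x $ j))"
    using e' by (intro Diff_infinite_finite) auto
  then have "{0<..<e'} - range (\<lambda>j. - x $ j) \<noteq> {}"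
    by force
  then obtain t where "t \<in> {0<..<e'} - range (\<lambda>j. - x $ j)"
    by blast
  then have t: "0 < t" "t < e'" "\<And>j. t \<noteq> - x $ j"
    by auto
  let ?y = "x + t *\<^sub>R (1 :: real^'n)"
  have "t * norm (1 :: real^'n) \<le> t * (1 + norm (1 :: real^'n))"
    using t(1) by (intro mult_left_mono) auto
  also have "\<dots> < e' * (1 + norm (1 :: real^'n))"
    using t(2) by (intro mult_strict_right_mono) (auto simp: add_pos_nonneg)
  also have "\<dots> = e" by (simp add: e'_def add_pos_nonneg add_nonneg_eq_0_iff)
  finally have "?y \<in> U"
    using e(2) t(1) by (auto simp: dist_norm)
  moreover have "all_nonzero ?y"
    using t(3) by (auto simp: all_nonzero_def add_eq_0_iff2) (metis add.commute add_eq_0_iff)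
  ultimately show ?thesis using that by blast
qed

text \<open>Identity principle by density: it turns equations for orbits, known only off the
  hyperplanes, into equations between continuous extensions.\<close>

lemma all_nonzero_eq_imp_eq:
  fixes f g :: "real^'n::finite \<Rightarrow> complex"
  assumes "open U" "continuous_on U f" "continuous_on U g" "\<And>y. y \<in> U \<Longrightarrow> all_nonzero y \<Longrightarrow> f y = g y" "x \<in> U"
  shows "f x = g x"
proof (rule ccontr)
  assume "f x \<noteq> g x"
  have "open ((\<lambda>y. f y - g y) -` (- {0}) \<inter> U)"
    using assms(1-3) by (intro continuous_on_open_vimage[THEN iffD1, rule_format] continuous_on_diff) auto
  moreover have "x \<in> (\<lambda>y. f y - g y) -` (- {0}) \<inter> U"
    using \<open>f x \<noteq> g x\<close> assms(5) by simp
  ultimately obtain y where "y \<in> (\<lambda>y. f y - g y) -` (- {0}) \<inter> U" "all_nonzero y"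
    by (rule all_nonzero_dense)
  then show False
    using assms(4)[of y] by simp
qed

text \<open>Transpose of \<open>theta_word w\<close> without its sign: the outermost theta of the
  word meets the test function first.\<close>

fun adjoint_word :: "'n::finite list \<Rightarrow> (real^'n \<Rightarrow> complex) \<Rightarrow> real^'n \<Rightarrow> complex" where
  "adjoint_word [] f = f"
| "adjoint_word (j # js) f = adjoint_word js (euler j (-1) f)"

lemma theta_dist_eq: "theta_dist j T f = - T (euler j (-1) f)"
proof -
  have "(\<lambda>x. f x + complex_of_real (x $ j) * partial j f x) = euler j (-1) f"
    by (simp add: euler_def fun_eq_iff)
  then show ?thesis by (simp add: theta_dist_def)
qed

lemma theta_word_eq: "theta_word w T f = (-1) ^ length w * T (adjoint_word w f)"
  by (induction w arbitrary: f) (simp_all add: theta_dist_eq)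

lemma test_cube_adjoint_word: "f \<in> test_cube R \<Longrightarrow> adjoint_word w f \<in> test_cube R"
  by (induction w arbitrary: f) (simp_all add: test_cube_euler)

lemma adjoint_word_dil: "smooth f \<Longrightarrow> adjoint_word w (dil c f) = dil c (adjoint_word w f)"
  by (induction w arbitrary: f) (simp_all add: euler_dil smooth_euler)

text \<open>With d the dimension, the decay order m + 2d splits: m pays for the weight and 2d for
  integrability.\<close>

lemma weight_integrable:
  fixes t :: "real^'n::finite \<Rightarrow> complex"
  assumes t: "t \<in> borel_measurable lborel"
    and C: "AE x in lborel. (1 + (norm x)\<^sup>2) powr (real (m + 2 * CARD('n)) / 2) * norm (t x) \<le> C"
  shows "integrable lborel (\<lambda>x. norm (t x) * (1 + norm x) ^ m)"
proof (rule Bochner_Integration.integrable_bound)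
  let ?d = "CARD('n)"
  show "integrable lborel (\<lambda>x::real^'n. (2 ^ m * C) * inverse ((1 + (norm x)\<^sup>2) ^ ?d))"
    using integrable_inverse_power by (rule integrable_mult_right)
  show "(\<lambda>x. norm (t x) * (1 + norm x) ^ m) \<in> borel_measurable lborel"
    using t by measurable
  show "AE x in lborel. norm (norm (t x) * (1 + norm x) ^ m) \<le> norm ((2 ^ m * C) * inverse ((1 + (norm x)\<^sup>2) ^ ?d))"
    using C
  proof (rule AE_mp, intro AE_I2 impI)
    fix x :: "real^'n"
    let ?q = "1 + (norm x)\<^sup>2"
    assume le: "?q powr (real (m + 2 * ?d) / 2) * norm (t x) \<le> C"
    have q: "?q > 0" "?q \<ge> 1" by (simp_all add: add_pos_nonneg)
    have pw: "?q powr (real (m + 2 * ?d) / 2) = sqrt ?q ^ m * ?q ^ ?d"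
    proof -
      have "?q powr (real (m + 2 * ?d) / 2) = ?q powr (real m / 2) * ?q powr real ?d"
        by (simp add: add_divide_distrib flip: powr_add)
      also have "?q powr (real m / 2) = (?q powr (1 / 2)) powr real m"
        by (simp add: powr_powr)
      also have "\<dots> = sqrt ?q ^ m"
        using q(1) powr_realpow[OF real_sqrt_gt_zero[OF q(1)], of m] by (simp add: powr_half_sqrt)
      also have "?q powr real ?d = ?q ^ ?d"
        by (rule powr_realpow[OF q(1)])
      finally show ?thesis .
    qed
    have "norm x \<le> sqrt ?q"
      by (rule real_le_rsqrt) simp
    moreover have "1 \<le> sqrt ?q" using q by simp
    ultimately have "1 + norm x \<le> 2 * sqrt ?q" by linarith
    then have "(1 + norm x) ^ m \<le> (2 * sqrt ?q) ^ m"
      by (rule power_mono) simp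
    then have "norm (t x) * (1 + norm x) ^ m \<le> norm (t x) * (2 ^ m * sqrt ?q ^ m)"
      by (intro mult_left_mono) (auto simp: power_mult_distrib)
    also have "\<dots> * ?q ^ ?d = 2 ^ m * (?q powr (real (m + 2 * ?d) / 2) * norm (t x))"
      unfolding pw by (simp only: mult_ac)
    finally have "norm (t x) * (1 + norm x) ^ m * ?q ^ ?d \<le> 2 ^ m * (?q powr (real (m + 2 * ?d) / 2) * norm (t x))"
      using q by (simp add: mult_right_mono)
    also have "\<dots> \<le> 2 ^ m * C"
      using le by (intro mult_left_mono) auto
    finally have "norm (t x) * (1 + norm x) ^ m \<le> (2 ^ m * C) * inverse (?q ^ ?d)"
      unfolding divide_inverse[symmetric] pos_le_divide_eq[OF zero_less_power[OF q(1)]] .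
    then have *: "norm (t x) * (1 + norm x) ^ m \<le> norm ((2 ^ m * C) * inverse (?q ^ ?d))"
      unfolding real_norm_def by (rule order_trans[OF _ abs_ge_self])
    have "0 \<le> norm (t x) * (1 + norm x) ^ m" by simp
    then show "norm (norm (t x) * (1 + norm x) ^ m) \<le> norm ((2 ^ m * C) * inverse (?q ^ ?d))"
      using * by (simp only: real_norm_def[of "norm (t x) * (1 + norm x) ^ m"] abs_of_nonneg)
  qed
qed

text \<open>Every decay order gives its own representation, hence its own extension of the orbit,
  which is only known to be finitely smooth. All these extensions agree off the hyperplanes and by
  continuity everywhere, so a single one has all derivatives.\<close>

lemma O_H_supp_imp_D_H:
  fixes T :: "(real^'n::finite \<Rightarrow> complex) \<Rightarrow> complex"
  assumes T: "T \<in> O_H" and \<epsilon>: "\<epsilon> > 0" "dsupp T \<subseteq> W \<epsilon>"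
  shows "T \<in> D_H"
proof -
  have dist: "distribution T" using T by (simp add: O_H_def)
  have rep: "\<exists>B :: 'n list set. \<exists>t. finite B \<and>
        (\<forall>w\<in>B. t w \<in> borel_measurable lborel \<and>
           (\<exists>C. AE x in lborel. (1 + (norm x)\<^sup>2) powr (real k / 2) * norm (t w x) \<le> C)) \<and>
        (\<forall>f\<in>test_fun. T f = (\<Sum>w\<in>B. theta_word w (regular (t w)) f))" for k :: nat
    using T unfolding O_H_def by blast
  have "\<exists>g\<in>test_fun. \<forall>y. all_nonzero y \<longrightarrow> T (dil y f) = g y" if f: "f \<in> test_fun" for f
  proof -
    obtain R where R: "R > 0" "f \<in> test_cube R" using test_test_cube[OF f] by blast
    define P where "P m G \<longleftrightarrow> (\<forall>y. all_nonzero y \<longrightarrow> T (dil y f) = G y) \<and>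
        (\<forall>w. length w \<le> m \<longrightarrow> continuous_on UNIV (dpart w G)) \<and>
        (\<forall>w i. length w < m \<longrightarrow> has_partial i (dpart w G) (dpart (i # w) G))" for m :: nat and G
    have "\<forall>m. \<exists>G. P m G"
    proof
      fix m
      obtain B :: "'n list set" and t where B: "finite B"
        and t: "\<And>w. w \<in> B \<Longrightarrow> t w \<in> borel_measurable lborel"
          "\<And>w. w \<in> B \<Longrightarrow> \<exists>C. AE x in lborel. (1 + (norm x)\<^sup>2) powr (real (m + 2 * CARD('n)) / 2) * norm (t w x) \<le> C"
        and Tf: "\<And>f. f \<in> test_fun \<Longrightarrow> T f = (\<Sum>w\<in>B. theta_word w (regular (t w)) f)"
        using rep[of "m + 2 * CARD('n)"] by blast
      define c where "c w x = (if w \<in> B then (-1) ^ length w * t w x else 0)" for w x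
      define G where "G y = (\<Sum>w\<in>B. dil_integral lborel (c w) (\<lambda>x. x) (adjoint_word w f) y)" for y
      have cm: "c w \<in> borel_measurable lborel" for w
      proof (cases "w \<in> B")
        case True
        have "(\<lambda>x. (-1) ^ length w * t w x) \<in> borel_measurable lborel"
          using t(1)[OF True] by (intro borel_measurable_times borel_measurable_const)
        then show ?thesis using True by (simp add: c_def[abs_def])
      qed (simp add: c_def[abs_def])
      have cI: "integrable lborel (\<lambda>x. norm (c w x) * (1 + norm x) ^ m)" for w
      proof (cases "w \<in> B")
        case True
        then obtain C where "AE x in lborel. (1 + (norm x)\<^sup>2) powr (real (m + 2 * CARD('n)) / 2) * norm (t w x) \<le> C"
          using t(2) by blast
        then have "AE x in lborel. (1 + (norm x)\<^sup>2) powr (real (m + 2 * CARD('n)) / 2) * norm (c w x) \<le> C"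
          using True by (simp add: c_def norm_mult norm_power)
        then show ?thesis
          by (rule weight_integrable[OF cm])
      qed (simp add: c_def)
      have xm: "(\<lambda>x::real^'n. x) \<in> borel_measurable lborel" by measurable
      note pd = dil_integral_dpart[OF cI cm xm test_cube_adjoint_word[OF R(2)]]
      have dG: "dpart w G = (\<lambda>y. \<Sum>v\<in>B. dpart w (dil_integral lborel (c v) (\<lambda>x. x) (adjoint_word v f)) y)" if "length w \<le> m" for w
        using that
      proof (induction w)
        case Nil
        then show ?case by (simp add: G_def[abs_def])
      next
        case (Cons i w)
        have hs: "has_partial i (\<lambda>y. \<Sum>v\<in>A. dpart w (dil_integral lborel (c v) (\<lambda>x. x) (adjoint_word v f)) y)
          (\<lambda>y. \<Sum>v\<in>A. dpart (i # w) (dil_integral lborel (c v) (\<lambda>x. x) (adjoint_word v f)) y)" for A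
        proof (induction A rule: infinite_finite_induct)
          case (insert v A)
          have "has_partial i (dpart w (dil_integral lborel (c v) (\<lambda>x. x) (adjoint_word v f))) (dpart (i # w) (dil_integral lborel (c v) (\<lambda>x. x) (adjoint_word v f)))"
            using pd(2)[of w i v] Cons.prems by simp
          from has_partial_add[OF this insert.IH] show ?case
            using insert.hyps by simp
        qed (simp_all add: has_partial_const)
        then show ?case
          using Cons has_partialD[OF hs[of B]] by simp
      qed
      have "has_partial i (dpart w G) (dpart (i # w) G)" if "length w < m" for i w
      proof -
        have hs: "has_partial i (\<lambda>y. \<Sum>v\<in>A. dpart w (dil_integral lborel (c v) (\<lambda>x. x) (adjoint_word v f)) y)
          (\<lambda>y. \<Sum>v\<in>A. dpart (i # w) (dil_integral lborel (c v) (\<lambda>x. x) (adjoint_word v f)) y)" for A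
        proof (induction A rule: infinite_finite_induct)
          case (insert v A)
          have "has_partial i (dpart w (dil_integral lborel (c v) (\<lambda>x. x) (adjoint_word v f))) (dpart (i # w) (dil_integral lborel (c v) (\<lambda>x. x) (adjoint_word v f)))"
            using pd(2)[of w i v] that by simp
          from has_partial_add[OF this insert.IH] show ?case
            using insert.hyps by simp
        qed (simp_all add: has_partial_const)
        show ?thesis
          using hs[of B] that by (simp only: dG[of w] dG[of "i # w"] less_imp_le_nat Suc_le_eq list.size add_Suc_right add_0_right)
      qed
      moreover have "continuous_on UNIV (dpart w G)" if "length w \<le> m" for w
        unfolding dG[OF that] using pd(3) that by (intro continuous_on_sum) auto
      moreover have "T (dil y f) = G y" if "all_nonzero y" for y
      proof -
        have "T (dil y f) = (\<Sum>w\<in>B. (-1) ^ length w * regular (t w) (adjoint_word w (dil y f)))"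
          using Tf[OF test_dil[OF f that]] by (simp add: theta_word_eq)
        also have "\<dots> = (\<Sum>w\<in>B. (-1) ^ length w * (\<integral>x. t w x * dil x (adjoint_word w f) y \<partial>lborel))"
          \<comment> \<open>The product of x and y is symmetric: dilating by y at the point x is
            dilating by x at the point y, so the pairing becomes a \<open>dil_integral\<close> in
            the variable y.\<close>
          unfolding regular_def adjoint_word_dil[OF test_smooth[OF f]] dil_apply by (simp add: coord_mult_commute)
        also have "\<dots> = G y"
          unfolding G_def dil_integral_def by (intro sum.cong refl) (simp add: c_def mult.assoc)
        finally show ?thesis .
      qed
      ultimately have "P m G" unfolding P_def by blast
      then show "\<exists>G. P m G" by (rule exI[of "P m" G])
    qed
    then obtain G where "\<forall>m. P m (G m)"
      using choice by blast
    then have G: "\<And>m y. all_nonzero y \<Longrightarrow> T (dil y f) = G m y"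
      "\<And>m w. length w \<le> m \<Longrightarrow> continuous_on UNIV (dpart w (G m))"
      "\<And>m w i. length w < m \<Longrightarrow> has_partial i (dpart w (G m)) (dpart (i # w) (G m))"
      unfolding P_def by blast+
    have G0: "G m = G 0" for m
    proof
      fix x
      have c: "continuous_on UNIV (G m)" for m
        using G(2)[of "[]" m] by simp
      have "G m y = G 0 y" if "all_nonzero y" for y
        using G(1)[OF that, of m] G(1)[OF that, of 0] by simp
      then show "G m x = G 0 x"
        by (rule all_nonzero_eq_imp_eq[OF open_UNIV c c _ UNIV_I])
    qed
    have "continuous_on UNIV (dpart w (G 0))" for w
      using G(2)[of w "length w"] unfolding G0[of "length w"] by simp
    moreover have "has_partial i (dpart w (G 0)) (dpart (i # w) (G 0))" for i w
      using G(3)[of w "Suc (length w)" i] unfolding G0[of "Suc (length w)"] by simp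
    ultimately have sG: "smooth (G 0)"
      unfolding smooth_def has_partial_exists[symmetric] by auto
    define \<delta> where "\<delta> = \<epsilon> / 2"
    have \<delta>: "0 < \<delta>" "\<delta> < \<epsilon>" using \<epsilon>(1) by (auto simp: \<delta>_def)
    \<comment> \<open>When some |y_j| is large, x y leaves the cube of f for every x in
      \<open>W \<delta>\<close>, so the dilate vanishes where T can see it.\<close>
    have zero: "G 0 y = 0" if "all_nonzero y" "y \<notin> cube (R / \<delta>)" for y
    proof -
      obtain j where j: "\<bar>y $ j\<bar> > R / \<delta>"
        using \<open>y \<notin> cube (R / \<delta>)\<close> by (auto simp: cube_def not_le)
      have "dil y f x = 0" if "x \<in> W \<delta>" for x
      proof -
        have "R = \<delta> * (R / \<delta>)" using \<delta> by simp
        also have "\<dots> < \<delta> * \<bar>y $ j\<bar>"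
          using j \<delta> by (intro mult_strict_left_mono) auto
        also have "\<dots> \<le> \<bar>x $ j\<bar> * \<bar>y $ j\<bar>"
          using that by (intro mult_right_mono) (auto simp: W_def)
        finally have "coord_mult x y \<notin> cube R"
          by (auto simp: cube_def abs_mult not_le intro!: exI[of _ j])
        then show ?thesis
          by (simp add: dil_apply test_cube_zero[OF R(2)])
      qed
      then have "T (dil y f) = 0"
        by (intro dist_eq_zero_off_W[OF dist \<epsilon>(2) \<delta>(2) test_dil[OF f \<open>all_nonzero y\<close>]])
      then show ?thesis using G(1)[OF \<open>all_nonzero y\<close>] by simp
    qed
    have "G 0 x = 0" if "x \<notin> cube (R / \<delta>)" for x
    proof (rule all_nonzero_eq_imp_eq[of "- cube (R / \<delta>)" "G 0" "\<lambda>x. 0"])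
      show "continuous_on (- cube (R / \<delta>)) (G 0)"
        by (rule continuous_on_subset[OF smooth_continuous[OF sG]]) simp
      show "open (- cube (R / \<delta>) :: (real^'n) set)"
        by (rule open_Compl[OF closed_cube])
    qed (use zero that in simp_all)
    then have "G 0 \<in> test_cube (R / \<delta>)"
      using sG by (simp add: test_cube_def)
    then have "G 0 \<in> test_fun" by (rule test_cube_test)
    moreover have "\<forall>y. all_nonzero y \<longrightarrow> T (dil y f) = G 0 y"
      using G(1)[of _ 0] by simp
    ultimately show ?thesis by (intro bexI[of _ "G 0"])
  qed
  then show ?thesis
    using dist by (simp add: D_H_def dil_eq all_nonzero_def)
qed

subsection \<open>The orbit of a test function under dilations\<close>

text \<open>The extension promised by \<open>D_H\<close>, kept as a relation between function and
  extension so that one operator can be applied to both.\<close>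

definition orbit_ext :: "((real^'n::finite \<Rightarrow> complex) \<Rightarrow> complex) \<Rightarrow> (real^'n \<Rightarrow> complex) \<Rightarrow> (real^'n \<Rightarrow> complex) \<Rightarrow> bool" where
  "orbit_ext T \<phi> g \<longleftrightarrow> g \<in> test_fun \<and> (\<forall>y. all_nonzero y \<longrightarrow> T (dil y \<phi>) = g y)"

lemma D_H_distribution: "T \<in> D_H \<Longrightarrow> distribution T"
  by (simp add: D_H_def)

lemma D_H_orbit_ext: "T \<in> D_H \<Longrightarrow> \<phi> \<in> test_fun \<Longrightarrow> \<exists>g. orbit_ext T \<phi> g"
  by (force simp: D_H_def orbit_ext_def dil_eq all_nonzero_def)

text \<open>Continuity for one fixed dilation, with constants depending on y; removing this
  dependence is what uniform boundedness is for.\<close>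

lemma dist_dil_bound:
  assumes T: "distribution T" and y: "all_nonzero y"
  shows "\<exists>C N. \<forall>f\<in>test_cube R. \<forall>B. cbound N f B \<longrightarrow> norm (T (dil y f)) \<le> C * B"
proof -
  obtain \<alpha> where \<alpha>: "\<alpha> > 0" "\<And>j. \<bar>y $ j\<bar> \<ge> \<alpha>"
    using all_nonzero_lower[OF y] by blast
  obtain C N where C: "\<And>f B. f \<in> test_cube (R / \<alpha>) \<Longrightarrow> cbound N f B \<Longrightarrow> norm (T f) \<le> C * B"
    using dist_bound[OF T, of "R / \<alpha>"] by blast
  have "norm (T (dil y f)) \<le> (C * (1 + norm y) ^ N) * B" if "f \<in> test_cube R" "cbound N f B" for f B
    using C[OF test_cube_dil[OF that(1) \<alpha>] cbound_dil[OF test_cube_smooth[OF that(1)] that(2)]] by (simp add: mult.assoc)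
  then show ?thesis by blast
qed

text \<open>Each orbit vanishes off some cube that depends on f. If no cube served all f, functions
  \<open>f n\<close> and points \<open>y n\<close> escaping to infinity would give functionals that
  are pointwise bounded but violate uniform boundedness.\<close>

lemma D_H_vanish:
  fixes T :: "(real^'n::finite \<Rightarrow> complex) \<Rightarrow> complex"
  assumes T: "T \<in> D_H"
  obtains R where "R > 0" "\<And>f y. f \<in> test_cube 1 \<Longrightarrow> all_nonzero y \<Longrightarrow> y \<notin> cube R \<Longrightarrow> T (dil y f) = 0"
proof -
  note dist = D_H_distribution[OF T]
  interpret test_subspace "test_cube 1" 1 by (rule test_subspace_test_cube)
  have "\<exists>n::nat. \<forall>f\<in>test_cube 1. \<forall>y. all_nonzero y \<longrightarrow> y \<notin> cube (real n) \<longrightarrow> T (dil y f) = 0"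
  proof (rule ccontr)
    assume "\<not> ?thesis"
    then have "\<forall>n::nat. \<exists>z. fst z \<in> test_cube 1 \<and> all_nonzero (snd z) \<and> snd z \<notin> cube (real n) \<and> T (dil (snd z) (fst z)) \<noteq> 0"
      unfolding split_paired_Ex fst_conv snd_conv by blast
    then obtain z where z: "\<forall>n::nat. fst (z n) \<in> test_cube 1 \<and> all_nonzero (snd (z n)) \<and> snd (z n) \<notin> cube (real n) \<and> T (dil (snd (z n)) (fst (z n))) \<noteq> 0"
      by (rule choice[THEN exE])
    define f where "f n = fst (z n)" for n
    define y where "y n = snd (z n)" for n
    have f: "f n \<in> test_cube 1" and y: "all_nonzero (y n)" "y n \<notin> cube (real n)" and nonz: "T (dil (y n) (f n)) \<noteq> 0" for n
      using z by (auto simp: f_def y_def)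
    \<comment> \<open>At index n the C^n norm is recorded, so that any order N supplied by uniform
      boundedness is eventually covered.\<close>
    have "\<forall>n. \<exists>B. cbound n (f n) B"
      using test_cube_cbound[OF f] by blast
    then obtain B where B: "\<And>n. cbound n (f n) (B n)" by metis
    have B0: "B n \<ge> 0" for n using B by (rule cbound_nonneg)
    \<comment> \<open>Makes the n-th functional take the value n (1 + B n) at \<open>f n\<close>,
      which for large n exceeds \<open>C * B n\<close> whatever C is.\<close>
    define a where "a n = of_real (real n * (1 + B n)) / T (dil (y n) (f n))" for n
    have lin1: "a n * T (dil (y n) (\<lambda>x. g x + h x)) = a n * T (dil (y n) g) + a n * T (dil (y n) h)"
      if "g \<in> test_cube 1" "h \<in> test_cube 1" for n g h
    proof -
      have "dil (y n) (\<lambda>x. g x + h x) = (\<lambda>x. dil (y n) g x + dil (y n) h x)"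
        by (simp add: dil_def)
      then show ?thesis
        using dist_add[OF dist test_dil[OF test_cube_test[OF that(1)] y(1)] test_dil[OF test_cube_test[OF that(2)] y(1)], of n n]
        by (simp add: distrib_left)
    qed
    have lin2: "a n * T (dil (y n) (\<lambda>x. c * g x)) = c * (a n * T (dil (y n) g))" if "g \<in> test_cube 1" for n c g
    proof -
      have "dil (y n) (\<lambda>x. c * g x) = (\<lambda>x. c * dil (y n) g x)"
        by (simp add: dil_def)
      then show ?thesis
        using dist_cmult[OF dist test_dil[OF test_cube_test[OF that] y(1)], of c n] by simp
    qed
    have cont: "\<exists>C N. \<forall>g\<in>test_cube 1. \<forall>B. cbound N g B \<longrightarrow> norm (a n * T (dil (y n) g)) \<le> C * B" for n
    proof -
      obtain C N where C: "\<And>g B. g \<in> test_cube 1 \<Longrightarrow> cbound N g B \<Longrightarrow> norm (T (dil (y n) g)) \<le> C * B"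
        using dist_dil_bound[OF dist y(1), of 1 n] by blast
      have "norm (a n * T (dil (y n) g)) \<le> (norm (a n) * C) * B" if "g \<in> test_cube 1" "cbound N g B" for g B
        using mult_left_mono[OF C[OF that], of "norm (a n)"] by (simp add: norm_mult mult.assoc)
      then show ?thesis by blast
    qed
    \<comment> \<open>On a fixed g only finitely many of the functionals are nonzero, because the
      orbit of g has bounded support while \<open>y n\<close> lies outside the cube of size
      n.\<close>
    have pw: "\<exists>C. \<forall>n. norm (a n * T (dil (y n) g)) \<le> C" if gD: "g \<in> test_cube 1" for g
    proof -
      obtain h where h: "h \<in> test_fun" "\<And>y. all_nonzero y \<Longrightarrow> T (dil y g) = h y"
        using D_H_orbit_ext[OF T test_cube_test[OF gD]] by (auto simp: orbit_ext_def)
      obtain S where S: "h \<in> test_cube S" using test_test_cube[OF h(1)] by blast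
      obtain n0 :: nat where n0: "S \<le> real n0" using real_arch_simple by blast
      have zero: "T (dil (y n) g) = 0" if "n \<ge> n0" for n
      proof -
        have "y n \<notin> cube S"
          using y(2)[of n] cube_mono[of S "real n"] n0 that by auto
        then show ?thesis
          using h(2)[OF y(1)] test_cube_zero[OF S] by simp
      qed
      have "norm (a n * T (dil (y n) g)) \<le> (\<Sum>i<n0. norm (a i * T (dil (y i) g)))" for n
      proof (cases "n < n0")
        case True
        then show ?thesis
          by (intro member_le_sum) auto
      next
        case False
        then show ?thesis using zero[of n] by (simp add: sum_nonneg)
      qed
      then show ?thesis by blast
    qed
    obtain C N where CN: "\<And>n g B. g \<in> test_cube 1 \<Longrightarrow> cbound N g B \<Longrightarrow> norm (a n * T (dil (y n) g)) \<le> C * B"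
      using uniform_boundedness[of "\<lambda>n g. a n * T (dil (y n) g)", OF lin1 lin2 cont pw] by blast
    obtain m :: nat where m: "\<bar>C\<bar> < real m" using reals_Archimedean2 by blast
    define n where "n = max N m"
    have "cbound N (f n) (B n)"
      by (rule cbound_mono[OF B]) (simp_all add: n_def)
    from CN[OF f this, of n] have "norm (a n * T (dil (y n) (f n))) \<le> C * B n" .
    moreover have "a n * T (dil (y n) (f n)) = of_real (real n * (1 + B n))"
      using nonz[of n] by (simp add: a_def)
    ultimately have "real n * (1 + B n) \<le> C * B n"
      using B0[of n] by (simp del: of_real_mult of_real_add)
    also have "\<dots> \<le> \<bar>C\<bar> * (1 + B n)"
      using B0[of n] by (intro mult_mono) auto
    finally have "real n \<le> \<bar>C\<bar>"
      by (rule mult_right_le_imp_le) (use B0[of n] in simp)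
    then show False using m by (simp add: n_def)
  qed
  then obtain n :: nat where n: "\<And>f y. f \<in> test_cube 1 \<Longrightarrow> all_nonzero y \<Longrightarrow> y \<notin> cube (real n) \<Longrightarrow> T (dil y f) = 0"
    by blast
  show ?thesis
  proof (rule that[of "real n + 1"])
    fix f :: "real^'n \<Rightarrow> complex" and y :: "real^'n" assume "f \<in> test_cube 1" "all_nonzero y" "y \<notin> cube (real n + 1)"
    moreover have "cube (real n) \<subseteq> (cube (real n + 1) :: (real^'n) set)" by (rule cube_mono) simp
    ultimately show "T (dil y f) = 0" using n by blast
  qed simp
qed

text \<open>A test function supported in a box that is thin in direction j, |z_j| < \<epsilon>, is
  the dilate of one in \<open>test_cube 1\<close> by a y with y_j = 1/\<epsilon>, hence outside the
  cube of \<open>D_H_vanish\<close>.\<close>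

lemma D_H_support:
  fixes T :: "(real^'n::finite \<Rightarrow> complex) \<Rightarrow> complex"
  assumes T: "T \<in> D_H"
  shows "\<exists>\<epsilon>>0. dsupp T \<subseteq> W \<epsilon>"
proof -
  obtain R where R: "R > 0" "\<And>f y. f \<in> test_cube 1 \<Longrightarrow> all_nonzero y \<Longrightarrow> y \<notin> cube R \<Longrightarrow> T (dil y f) = 0"
    using D_H_vanish[OF T] by blast
  define \<epsilon> where "\<epsilon> = 1 / (R + 1)"
  have \<epsilon>: "\<epsilon> > 0" "1 / \<epsilon> > R" using R(1) by (auto simp: \<epsilon>_def)
  have "x \<notin> dsupp T" if "x \<notin> W \<epsilon>" for x
  proof -
    obtain j where j: "\<bar>x $ j\<bar> < \<epsilon>" using \<open>x \<notin> W \<epsilon>\<close> by (auto simp: W_def not_le)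
    define L where "L = norm x + 1"
    have L: "L > 0" "\<And>i. \<bar>x $ i\<bar> < L"
      using norm_ge_zero[of x] component_le_norm_cart[of x] le_less_trans[OF _ less_add_one] unfolding L_def by (linarith, blast)
    \<comment> \<open>Half sides of a box containing x: thin in the offending coordinate j, wide in
      the others.\<close>
    define d where "d i = (if i = j then \<epsilon> else L)" for i
    have d: "d i > 0" for i using \<epsilon> L by (simp add: d_def)
    define U where "U = (\<Inter>i. {z::real^'n. \<bar>z $ i\<bar> < d i})"
    have "open U"
      unfolding U_def by (intro open_INT ballI open_Collect_less continuous_intros) auto
    moreover have "x \<in> U"
      using j L(2) by (auto simp: U_def d_def)
    moreover have "T f = 0" if f: "f \<in> test_fun" "tsupport f \<subseteq> U" for f
    proof -
      define f1 where "f1 = dil (\<chi> i. d i) f"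
      define y :: "real^'n" where "y = (\<chi> i. 1 / d i)"
      have "f1 z = 0" if z: "z \<notin> cube 1" for z
      proof -
        obtain i where i: "\<bar>z $ i\<bar> > 1" using z by (auto simp: cube_def not_le)
        have "d i * 1 < d i * \<bar>z $ i\<bar>"
          using i d by (intro mult_strict_left_mono) auto
        then have "coord_mult z (\<chi> i. d i) \<notin> U"
          using d[of i] by (auto simp: U_def abs_mult not_less mult.commute intro!: exI[of _ i])
        then have "coord_mult z (\<chi> i. d i) \<notin> tsupport f" using f(2) by blast
        then show ?thesis
          using closure_subset[of "{x. f x \<noteq> 0}"] by (auto simp: f1_def dil_apply tsupport_def)
      qed
      then have f1: "f1 \<in> test_cube 1"
        unfolding test_cube_def f1_def using smooth_dil[OF test_smooth[OF f(1)]] by simp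
      have "all_nonzero y" using d by (simp add: all_nonzero_def y_def less_imp_neq[THEN not_sym])
      moreover have "y \<notin> cube R"
        using \<epsilon> by (auto simp: cube_def y_def d_def not_le intro!: exI[of _ j])
      moreover have "dil y f1 = f"
      proof -
        have "coord_mult y (\<chi> i. d i) = 1"
          using d by (simp add: vec_eq_iff y_def less_imp_neq[THEN not_sym])
        then show ?thesis by (simp add: f1_def dil_dil)
      qed
      ultimately show ?thesis using R(2)[OF f1, of y] by simp
    qed
    ultimately show ?thesis by (auto simp: dsupp_def)
  qed
  then show ?thesis using \<epsilon>(1) by blast
qed

section \<open>Euler operators and orbits\<close>

lemma lborel_on_integral_eq:
  fixes f :: "real \<Rightarrow> complex"
  assumes "continuous_on {a..b} f"
  shows "(\<integral>t. f t \<partial>lborel_on {a..b}) = integral {a..b} f"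
proof -
  have "integrable (lborel_on {a..b}) f"
    by (rule continuous_on_lborel_on_integrable[OF compact_Icc assms])
  then have "set_integrable lborel {a..b} f"
    by (simp add: set_integrable_def integrable_restrict_space)
  from set_borel_integral_eq_integral(2)[OF this] show ?thesis
    by (simp add: set_lebesgue_integral_def integral_restrict_space)
qed

text \<open>Formally theta_j in y of \<phi>(\<xi> y) is (theta_j \<phi>)(\<xi> y). To avoid
  differentiating under T, this relation is integrated along a segment, T is moved under the
  integral, and the resulting identity for g is differentiated.\<close>

lemma orbit_ext_euler:
  fixes T :: "(real^'n::finite \<Rightarrow> complex) \<Rightarrow> complex"
  assumes T: "T \<in> D_H" and \<phi>: "\<phi> \<in> test_fun" and g: "orbit_ext T \<phi> g"
  shows "orbit_ext T (euler j b \<phi>) (euler j b g)"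
proof -
  note dist = D_H_distribution[OF T]
  have s\<phi>: "smooth \<phi>" using \<phi> by (rule test_smooth)
  have t0: "euler j 0 \<phi> \<in> test_fun" using \<phi> by (rule test_euler)
  have gt: "g \<in> test_fun" and gT: "\<And>y. all_nonzero y \<Longrightarrow> T (dil y \<phi>) = g y"
    using g by (auto simp: orbit_ext_def)
  obtain g' where g't: "g' \<in> test_fun" and g'T: "\<And>y. all_nonzero y \<Longrightarrow> T (dil y (euler j 0 \<phi>)) = g' y"
    using D_H_orbit_ext[OF T t0] by (auto simp: orbit_ext_def)
  have key: "g' y = of_real (y $ j) * partial j g y" if y: "all_nonzero y" for y
  proof -
    \<comment> \<open>Keeps the segment through y at distance at least |y_j|/2 from the hyperplane
      where the j-th coordinate is 0.\<close>
    define r where "r = \<bar>y $ j\<bar> / 2"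
    have yj: "y $ j \<noteq> 0" using y by (simp add: all_nonzero_def)
    then have r: "r > 0" by (simp add: r_def)
    define p where "p t = y + t *\<^sub>R axis j (1::real)" for t
    have pj: "p t $ i = (if i = j then y $ j + t else y $ i)" for t i
      by (simp add: p_def axis_def)
    have ne: "y $ j + t \<noteq> 0" if "t \<in> {-r..r}" for t
      using that yj by (auto simp: r_def abs_if split: if_splits)
    have nzp: "all_nonzero (p t)" if "t \<in> {-r..r}" for t
      using ne[OF that] y by (auto simp: all_nonzero_def pj)
    have cp: "continuous_on S p" for S
      unfolding p_def by (intro continuous_intros)
    \<comment> \<open>Turns the Euler derivative along the segment, whose j-th coordinate is y_j +
      t, into the derivative in t.\<close>
    define c where "c t = complex_of_real (1 / (y $ j + t))" for t
    have cc: "continuous_on {-r..u} c" if "u \<in> {-r..r}" for u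
      unfolding c_def by (intro continuous_intros) (use ne that in auto)
    have main: "g (p u) - g (p (-r)) = integral {-r..u} (\<lambda>t. c t * g' (p t))" if u: "u \<in> {-r..r}" for u
    proof -
      have nzu: "all_nonzero (p t)" if "t \<in> {-r..u}" for t using nzp that u by auto
      have cu: "continuous_on {-r..u} c" by (rule cc[OF u])
      note dp = dist_dil_integral[OF dist compact_Icc cu cp nzu t0]
      have "dil_integral (lborel_on {-r..u}) c p (euler j 0 \<phi>) = (\<lambda>\<xi>. dil (p u) \<phi> \<xi> - dil (p (-r)) \<phi> \<xi>)"
      proof
        fix \<xi>
        define q where "q t = \<phi> (coord_mult \<xi> (p t))" for t
        have hmp: "coord_mult \<xi> (p t) = coord_mult \<xi> y + (t * \<xi> $ j) *\<^sub>R axis j 1" for t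
          by (simp add: vec_eq_iff pj) (simp add: axis_def algebra_simps)
        have dq: "(q has_vector_derivative (\<xi> $ j) *\<^sub>R partial j \<phi> (coord_mult \<xi> (p t))) (at t within {-r..u})" for t
        proof -
          have "((\<lambda>s. \<phi> (coord_mult \<xi> y + s *\<^sub>R axis j 1)) has_vector_derivative partial j \<phi> (coord_mult \<xi> y + (t * \<xi> $ j) *\<^sub>R axis j 1)) (at (t * \<xi> $ j))"
            by (rule has_partial_at[OF smooth_has_partial[OF s\<phi>]])
          moreover have "((\<lambda>t. t * \<xi> $ j) has_vector_derivative \<xi> $ j) (at t)"
            by (auto intro!: derivative_eq_intros)
          ultimately have "((\<lambda>s. \<phi> (coord_mult \<xi> y + s *\<^sub>R axis j 1)) \<circ> (\<lambda>t. t * \<xi> $ j) has_vector_derivative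
              (\<xi> $ j) *\<^sub>R partial j \<phi> (coord_mult \<xi> y + (t * \<xi> $ j) *\<^sub>R axis j 1)) (at t)"
            using vector_diff_chain_at by blast
          then show ?thesis
            unfolding q_def hmp o_def by (rule has_vector_derivative_at_within)
        qed
        have eq: "c t * dil (p t) (euler j 0 \<phi>) \<xi> = (\<xi> $ j) *\<^sub>R partial j \<phi> (coord_mult \<xi> (p t))" if "t \<in> {-r..u}" for t
        proof -
          have "c t * of_real (\<xi> $ j * (y $ j + t)) = of_real (\<xi> $ j)"
            unfolding c_def of_real_mult[symmetric] using ne[of t] that u by simp
          then show ?thesis
            by (simp add: dil_apply euler_def pj scaleR_conv_of_real mult.assoc[symmetric] del: of_real_mult of_real_add)
        qed
        have cont: "continuous_on {-r..u} (\<lambda>t. c t * dil (p t) (euler j 0 \<phi>) \<xi>)"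
          unfolding dil_apply
          by (intro continuous_on_mult cu continuous_on_compose2[OF smooth_continuous[OF smooth_euler[OF s\<phi>]]]
              continuous_on_coord_mult continuous_on_const cp) auto
        have "dil_integral (lborel_on {-r..u}) c p (euler j 0 \<phi>) \<xi> = integral {-r..u} (\<lambda>t. c t * dil (p t) (euler j 0 \<phi>) \<xi>)"
          unfolding dil_integral_def by (rule lborel_on_integral_eq[OF cont])
        also have "\<dots> = integral {-r..u} (\<lambda>t. (\<xi> $ j) *\<^sub>R partial j \<phi> (coord_mult \<xi> (p t)))"
          by (rule integral_cong) (rule eq)
        also have "\<dots> = q u - q (-r)"
          by (rule integral_unique, rule fundamental_theorem_of_calculus) (use u dq in auto)
        finally show "dil_integral (lborel_on {-r..u}) c p (euler j 0 \<phi>) \<xi> = dil (p u) \<phi> \<xi> - dil (p (-r)) \<phi> \<xi>"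
          by (simp add: q_def dil_apply)
      qed
      then have "T (\<lambda>\<xi>. dil (p u) \<phi> \<xi> - dil (p (-r)) \<phi> \<xi>) = (\<integral>t. c t * T (dil (p t) (euler j 0 \<phi>)) \<partial>lborel_on {-r..u})"
        using dp(3) by simp
      also have "\<dots> = integral {-r..u} (\<lambda>t. c t * T (dil (p t) (euler j 0 \<phi>)))"
        by (rule lborel_on_integral_eq[OF dp(2)])
      also have "\<dots> = integral {-r..u} (\<lambda>t. c t * g' (p t))"
        by (rule integral_cong) (use g'T nzu in simp)
      also have "T (\<lambda>\<xi>. dil (p u) \<phi> \<xi> - dil (p (-r)) \<phi> \<xi>) = g (p u) - g (p (-r))"
        using nzp[OF u] nzp[of "-r"] r
        by (simp add: dist_diff[OF dist test_dil[OF \<phi>] test_dil[OF \<phi>]] gT)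
      finally show ?thesis .
    qed
    have "continuous_on {-r..r} (\<lambda>t. c t * g' (p t))"
      by (intro continuous_on_mult cc continuous_on_compose2[OF smooth_continuous[OF test_smooth[OF g't]] cp]) (use r in auto)
    then have "((\<lambda>u. integral {-r..u} (\<lambda>t. c t * g' (p t))) has_vector_derivative c 0 * g' (p 0)) (at 0 within {-r..r})"
      by (rule integral_has_vector_derivative) (use r in auto)
    then have "((\<lambda>u. g (p u) - g (p (-r))) has_vector_derivative c 0 * g' (p 0)) (at 0 within {-r..r})"
      by (rule has_vector_derivative_transform[rotated 2]) (use r main in auto)
    moreover have "at (0::real) within {-r..r} = at 0"
      by (rule at_within_interior) (use r in auto)
    ultimately have "((\<lambda>u. g (p u) - g (p (-r))) has_vector_derivative c 0 * g' (p 0)) (at 0)"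
      by simp
    from has_vector_derivative_add[OF this has_vector_derivative_const[of "g (p (-r))"]]
    have "((\<lambda>u. g (p u)) has_vector_derivative c 0 * g' (p 0)) (at 0)"
      by simp
    moreover have "((\<lambda>u. g (p u)) has_vector_derivative partial j g y) (at 0)"
      using smooth_has_partial[OF test_smooth[OF gt], of j] by (simp add: has_partial_def p_def)
    ultimately have "c 0 * g' (p 0) = partial j g y"
      using vector_derivative_unique_at by blast
    then have "of_real (y $ j) * partial j g y = of_real (y $ j) * c 0 * g' y"
      by (simp add: p_def)
    also have "of_real (y $ j) * c 0 = 1"
      using yj by (simp add: c_def)
    finally show ?thesis by simp
  qed
  have "T (dil y (euler j b \<phi>)) = euler j b g y" if y: "all_nonzero y" for y
  proof -
    have "dil y (euler j b \<phi>) = (\<lambda>x. dil y (euler j 0 \<phi>) x - b * dil y \<phi> x)"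
      by (simp add: dil_def euler_def)
    then have "T (dil y (euler j b \<phi>)) = T (dil y (euler j 0 \<phi>)) - b * T (dil y \<phi>)"
      using dist_diff[OF dist test_dil[OF t0 y] test_cmult[OF test_dil[OF \<phi> y]]] dist_cmult[OF dist test_dil[OF \<phi> y]] by simp
    then show ?thesis
      using key[OF y] g'T[OF y] gT[OF y] by (simp add: euler_def)
  qed
  then show ?thesis
    using test_euler[OF gt] by (simp add: orbit_ext_def)
qed

subsection \<open>Parity and Hadamard division\<close>

lemma has_partial_tensor:
  fixes a :: "'n::finite \<Rightarrow> real \<Rightarrow> complex"
  assumes "\<And>v. (a j has_vector_derivative a' v) (at v)"
  shows "has_partial j (\<lambda>x. \<Prod>i\<in>UNIV. a i (x $ i)) (\<lambda>x. a' (x $ j) * (\<Prod>i\<in>UNIV-{j}. a i (x $ i)))"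
  unfolding has_partial_def
proof
  fix x :: "real^'n"
  have "(\<Prod>i\<in>UNIV. a i ((x + t *\<^sub>R axis j 1) $ i)) = a j (x $ j + t) * (\<Prod>i\<in>UNIV-{j}. a i (x $ i))" for t
  proof -
    have "(\<Prod>i\<in>UNIV. a i ((x + t *\<^sub>R axis j 1) $ i)) = a j ((x + t *\<^sub>R axis j 1) $ j) * (\<Prod>i\<in>UNIV-{j}. a i ((x + t *\<^sub>R axis j 1) $ i))"
      by (rule prod.remove) auto
    also have "(\<Prod>i\<in>UNIV-{j}. a i ((x + t *\<^sub>R axis j 1) $ i)) = (\<Prod>i\<in>UNIV-{j}. a i (x $ i))"
      by (rule prod.cong) (auto simp: axis_def)
    finally show ?thesis by (simp add: axis_def)
  qed
  moreover have "((\<lambda>t. a j (x $ j + t)) has_vector_derivative a' (x $ j)) (at 0)"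
  proof -
    have "((\<lambda>t. x $ j + t) has_vector_derivative 1) (at 0)"
      by (auto intro!: derivative_eq_intros)
    moreover have "(a j has_vector_derivative a' (x $ j)) (at (x $ j + 0))"
      using assms by simp
    ultimately have "(a j \<circ> (\<lambda>t. x $ j + t) has_vector_derivative 1 *\<^sub>R a' (x $ j)) (at 0)"
      by (rule vector_diff_chain_at)
    then show ?thesis by (simp add: o_def)
  qed
  ultimately show "((\<lambda>t. \<Prod>i\<in>UNIV. a i ((x + t *\<^sub>R axis j 1) $ i)) has_vector_derivative a' (x $ j) * (\<Prod>i\<in>UNIV-{j}. a i (x $ i))) (at 0)"
    by (simp add: has_vector_derivative_mult_left)
qed

definition reflect_coord :: "'n::finite \<Rightarrow> real^'n" where
  "reflect_coord j = (\<chi> i. if i = j then -1 else 1)"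

text \<open>Only s j modulo 2 matters here, so \<open>Suc\<close> toggles the parity; natural
  numbers are used because s j also serves as an exponent.\<close>

definition parity :: "('n::finite \<Rightarrow> nat) \<Rightarrow> (real^'n \<Rightarrow> complex) \<Rightarrow> bool" where
  "parity s f \<longleftrightarrow> (\<forall>j x. dil (reflect_coord j) f x = (-1) ^ s j * f x)"

lemma parity_partial:
  assumes "smooth f" "parity s f"
  shows "parity (s(j := Suc (s j))) (partial j f)"
  unfolding parity_def
proof (intro allI)
  fix i x
  have "dil (reflect_coord i) f = (\<lambda>x. (-1) ^ s i * f x)"
    using assms(2) by (simp add: parity_def fun_eq_iff)
  then have "partial j (dil (reflect_coord i) f) x = (-1) ^ s i * partial j f x"
    using assms(1) by (simp add: partial_cmult)
  then have *: "of_real (reflect_coord i $ j) * dil (reflect_coord i) (partial j f) x = (-1) ^ s i * partial j f x"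
    using partial_dil[OF assms(1), of j "reflect_coord i"] by simp
  show "dil (reflect_coord i) (partial j f) x = (-1) ^ (s(j := Suc (s j))) i * partial j f x"
  proof (cases "i = j")
    case True
    then show ?thesis using * by (simp add: reflect_coord_def minus_equation_iff)
  next
    case False
    then show ?thesis using * by (simp add: reflect_coord_def)
  qed
qed

lemma parity_cong: "(\<And>j. even (s j) = even (s' j)) \<Longrightarrow> parity s f \<Longrightarrow> parity s' f"
  unfolding parity_def by (metis minus_one_power_iff)

text \<open>A function odd in x_j vanishes at x_j = 0, so the mean of its j-th derivative over the
  segment from there to x is the quotient. This mean is a \<open>dil_integral\<close>, hence
  smooth.\<close>

lemma hadamard_division:
  fixes f :: "real^'n::finite \<Rightarrow> complex"
  assumes f: "f \<in> test_cube R" and p: "parity s f" and odd: "odd (s j)"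
  obtains g where "g \<in> test_cube R" "\<And>x. f x = of_real (x $ j) * g x" "parity (s(j := Suc (s j))) g"
proof -
  have sf: "smooth f" using f by (rule test_cube_smooth)
  define a :: "real \<Rightarrow> real^'n" where "a \<tau> = (\<chi> i. if i = j then \<tau> else 1)" for \<tau>
  have "continuous_on S (\<lambda>\<tau>. if i = j then \<tau> else 1)" for S :: "real set" and i
    by (cases "i = j") (simp_all add: continuous_on_id)
  then have ca: "continuous_on S a" for S
    unfolding a_def by (rule continuous_on_vec_lambda)
  have c1: "continuous_on S (\<lambda>\<tau>::real. 1::complex)" for S by simp
  have pf: "partial j f \<in> test_cube R" using f by (rule test_cube_partial)
  define g where "g = dil_integral (lborel_on {0..1}) (\<lambda>\<tau>. 1) a (partial j f)"
  have sg: "smooth g"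
    unfolding g_def
    by (rule dil_integral_smooth[OF lborel_on_weight_integrable[OF compact_Icc c1 ca] continuous_on_lborel_on_measurable[OF c1] continuous_on_lborel_on_measurable[OF ca] pf])
  have cg: "continuous_on {0..1} (\<lambda>\<tau>. partial j f (coord_mult x (a \<tau>)))" for x
    by (intro continuous_on_compose2[OF smooth_continuous[OF test_cube_smooth[OF pf]]] continuous_on_coord_mult continuous_on_const ca) auto
  have g_eq: "g x = integral {0..1} (\<lambda>\<tau>. partial j f (coord_mult x (a \<tau>)))" for x
    unfolding g_def dil_integral_def dil_apply by (simp add: lborel_on_integral_eq[OF cg])
  have fg: "f x = of_real (x $ j) * g x" for x
  proof -
    have hmp: "coord_mult x (a \<tau>) = coord_mult x (a 0) + (\<tau> * x $ j) *\<^sub>R axis j 1" for \<tau>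
      by (simp add: vec_eq_iff a_def axis_def)
    have "((\<lambda>\<tau>. (x $ j) *\<^sub>R partial j f (coord_mult x (a \<tau>))) has_integral f (coord_mult x (a 1)) - f (coord_mult x (a 0))) {0..1}"
    proof (rule fundamental_theorem_of_calculus)
      fix \<tau> :: real
      have "((\<lambda>s. f (coord_mult x (a 0) + s *\<^sub>R axis j 1)) has_vector_derivative partial j f (coord_mult x (a 0) + (\<tau> * x $ j) *\<^sub>R axis j 1)) (at (\<tau> * x $ j))"
        by (rule has_partial_at[OF smooth_has_partial[OF sf]])
      moreover have "((\<lambda>t. t * x $ j) has_vector_derivative x $ j) (at \<tau>)"
        by (auto intro!: derivative_eq_intros)
      ultimately have "((\<lambda>s. f (coord_mult x (a 0) + s *\<^sub>R axis j 1)) \<circ> (\<lambda>t. t * x $ j) has_vector_derivative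
          (x $ j) *\<^sub>R partial j f (coord_mult x (a 0) + (\<tau> * x $ j) *\<^sub>R axis j 1)) (at \<tau>)"
        using vector_diff_chain_at by blast
      then have "((\<lambda>\<tau>. f (coord_mult x (a 0) + (\<tau> * x $ j) *\<^sub>R axis j 1)) has_vector_derivative
          (x $ j) *\<^sub>R partial j f (coord_mult x (a 0) + (\<tau> * x $ j) *\<^sub>R axis j 1)) (at \<tau> within {0..1})"
        unfolding o_def by (rule has_vector_derivative_at_within)
      then show "((\<lambda>\<tau>. f (coord_mult x (a \<tau>))) has_vector_derivative (x $ j) *\<^sub>R partial j f (coord_mult x (a \<tau>))) (at \<tau> within {0..1})"
        by (simp only: hmp[symmetric])
    qed simp
    then have "integral {0..1} (\<lambda>\<tau>. (x $ j) *\<^sub>R partial j f (coord_mult x (a \<tau>))) = f (coord_mult x (a 1)) - f (coord_mult x (a 0))"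
      by (rule integral_unique)
    moreover have "a 1 = 1" by (simp add: a_def vec_eq_iff)
    moreover have "f (coord_mult x (a 0)) = 0"
    proof -
      have "coord_mult (coord_mult x (a 0)) (reflect_coord j) = coord_mult x (a 0)"
        by (simp add: vec_eq_iff a_def reflect_coord_def)
      then have "f (coord_mult x (a 0)) = (-1) ^ s j * f (coord_mult x (a 0))"
        using p[unfolded parity_def dil_apply, rule_format, of "coord_mult x (a 0)" j] by simp
      then show ?thesis using odd by simp
    qed
    ultimately show ?thesis
      by (simp add: g_eq scaleR_conv_of_real)
  qed
  have "g x = 0" if "x \<notin> cube R" for x
  proof (cases "x $ j = 0")
    case False
    then show ?thesis using fg[of x] test_cube_zero[OF f that] by simp
  next
    case True
    \<comment> \<open>On the hyperplane the segment degenerates to the point x, where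
      \<open>partial j f\<close> is already 0.\<close>
    then have "coord_mult x (a \<tau>) = x" for \<tau>
      by (simp add: vec_eq_iff a_def)
    then show ?thesis
      using test_cube_zero[OF pf that] by (simp add: g_eq)
  qed
  then have "g \<in> test_cube R" using sg by (simp add: test_cube_def)
  moreover have "parity (s(j := Suc (s j))) g"
    unfolding parity_def
  proof (intro allI)
    fix i x
    have "partial j f (coord_mult (coord_mult x (reflect_coord i)) (a \<tau>)) = (-1) ^ (s(j := Suc (s j))) i * partial j f (coord_mult x (a \<tau>))" for \<tau>
    proof -
      have "coord_mult (coord_mult x (reflect_coord i)) (a \<tau>) = coord_mult (coord_mult x (a \<tau>)) (reflect_coord i)"
        by (simp add: vec_eq_iff mult_ac)
      then show ?thesis
        using parity_partial[OF sf p, of j, unfolded parity_def dil_apply, rule_format, of "coord_mult x (a \<tau>)" i] by simp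
    qed
    then show "dil (reflect_coord i) g x = (-1) ^ (s(j := Suc (s j))) i * g x"
      unfolding dil_apply g_eq by simp
  qed
  ultimately show ?thesis
    using that fg by blast
qed

section \<open>Products of Euler operators on functions of fixed parity\<close>

definition zero_one :: "('n::finite \<Rightarrow> nat) \<Rightarrow> bool" where
  "zero_one s \<longleftrightarrow> (\<forall>j. s j \<in> {0, 1})"

text \<open>The Euler operators \<open>x\<^sub>j \<partial>\<^sub>j - s j - 2 m\<close>, for \<open>m = 0, 1, \<dots>\<close>, successively remove the
  leading monomials of the Taylor expansion in \<open>x\<^sub>j\<close> of a function of parity \<open>s j\<close>.\<close>

lemma euler_parity_gain:
  assumes f: "f \<in> test_cube R" and p: "parity s f" and s: "zero_one s"
  obtains g where "g \<in> test_cube R" "parity s g" "\<And>x. euler j (of_nat (s j)) f x = of_real (x $ j) ^ 2 * g x"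
proof (cases "s j = 0")
  case True
  \<comment> \<open>Here theta_j f is x_j times \<open>partial j f\<close>; the latter is odd in
    x_j, so Hadamard division yields a second factor x_j.\<close>
  have pf: "partial j f \<in> test_cube R" "parity (s(j := Suc (s j))) (partial j f)"
    using f p test_cube_partial parity_partial test_cube_smooth by blast+
  obtain g where g: "g \<in> test_cube R" "\<And>x. partial j f x = of_real (x $ j) * g x"
    "parity ((s(j := Suc (s j)))(j := Suc ((s(j := Suc (s j))) j))) g"
    by (rule hadamard_division[OF pf, of j]) (use True in auto)
  show ?thesis
  proof (rule that[OF g(1)])
    show "parity s g"
      by (rule parity_cong[OF _ g(3)]) simp
    show "euler j (of_nat (s j)) f x = of_real (x $ j) ^ 2 * g x" for x
      by (simp add: euler_def True g(2) power2_eq_square)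
  qed
next
  case False
  then have s1: "s j = 1" using s by (auto simp: zero_one_def dest: spec[of _ j])
  \<comment> \<open>Here f = x_j h with h even in x_j, and theta_j - 1 turns this into x_j^2 times
    \<open>partial j h\<close>.\<close>
  obtain h where h: "h \<in> test_cube R" "\<And>x. f x = of_real (x $ j) * h x" "parity (s(j := Suc (s j))) h"
    by (rule hadamard_division[OF f p, of j]) (use s1 in auto)
  have sh: "smooth h" using h(1) by (rule test_cube_smooth)
  show ?thesis
  proof (rule that[OF test_cube_partial[OF h(1)]])
    show "parity s (partial j h)"
      by (rule parity_cong[OF _ parity_partial[OF sh h(3)]]) simp
    have "f = (\<lambda>x. of_real (x $ j) * h x)" using h(2) by (simp add: fun_eq_iff)
    then have "partial j f = (\<lambda>x. of_real (x $ j) * partial j h x + (if j = j then 1 else 0) * h x)"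
      using has_partialD[OF has_partial_mult[OF has_partial_coord smooth_has_partial[OF sh]]] by blast
    then show "euler j (of_nat (s j)) f x = of_real (x $ j) ^ 2 * partial j h x" for x
      by (simp add: euler_def s1 h(2) power2_eq_square algebra_simps)
  qed
qed

text \<open>Letters act from the right, and the number of earlier letters j selects the exponent; so
  k letters j amount to the product of theta_j - s_j - 2m over m < k.\<close>

fun euler_word :: "('n::finite \<Rightarrow> nat) \<Rightarrow> 'n list \<Rightarrow> (real^'n \<Rightarrow> complex) \<Rightarrow> real^'n \<Rightarrow> complex" where
  "euler_word s [] f = f"
| "euler_word s (j # w) f = euler j (of_nat (s j + 2 * count_list w j)) (euler_word s w f)"

lemma test_cube_euler_word: "f \<in> test_cube R \<Longrightarrow> euler_word s w f \<in> test_cube R"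
  by (induction w) (simp_all add: test_cube_euler)

lemma test_euler_word: "f \<in> test_fun \<Longrightarrow> euler_word s w f \<in> test_fun"
  by (induction w) (simp_all add: test_euler)

lemma smooth_euler_word: "smooth f \<Longrightarrow> smooth (euler_word s w f)"
  by (induction w) (simp_all add: smooth_euler)

lemma euler_add: "smooth f \<Longrightarrow> smooth g \<Longrightarrow> euler j b (\<lambda>x. f x + g x) = (\<lambda>x. euler j b f x + euler j b g x)"
  by (simp add: euler_def partial_add algebra_simps)

lemma euler_cmult: "smooth f \<Longrightarrow> euler j b (\<lambda>x. c * f x) = (\<lambda>x. c * euler j b f x)"
  by (simp add: euler_def partial_cmult algebra_simps)

lemma euler_word_add: "smooth f \<Longrightarrow> smooth g \<Longrightarrow> euler_word s w (\<lambda>x. f x + g x) = (\<lambda>x. euler_word s w f x + euler_word s w g x)"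
  by (induction w) (simp_all add: euler_add smooth_euler_word)

lemma euler_word_cmult: "smooth f \<Longrightarrow> euler_word s w (\<lambda>x. c * f x) = (\<lambda>x. c * euler_word s w f x)"
  by (induction w) (simp_all add: euler_cmult smooth_euler_word)

lemma orbit_ext_euler_word:
  assumes "T \<in> D_H" "\<phi> \<in> test_fun" "orbit_ext T \<phi> g"
  shows "orbit_ext T (euler_word s w \<phi>) (euler_word s w g)"
  by (induction w) (simp_all add: assms orbit_ext_euler test_euler_word)

text \<open>Conjugation by a monomial: theta_j - s_j - c_j applied to x^c g equals x^c (theta_j -
  s_j) g. Each new letter thus reduces to \<open>euler_parity_gain\<close> for g and adds a factor
  x_j^2.\<close>

lemma euler_word_parity:
  assumes f: "f \<in> test_cube R" and p: "parity s f" and s: "zero_one s"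
  shows "\<exists>g. g \<in> test_cube R \<and> parity s g \<and> (\<forall>x. euler_word s w f x = (\<Prod>i\<in>UNIV. of_real (x $ i) ^ (2 * count_list w i)) * g x)"
proof (induction w)
  case Nil
  then show ?case using f p by auto
next
  case (Cons j w)
  then obtain g where g: "g \<in> test_cube R" "parity s g" "euler_word s w f = (\<lambda>x. (\<Prod>i\<in>UNIV. of_real (x $ i) ^ (2 * count_list w i)) * g x)"
    by (auto simp: fun_eq_iff)
  define c where "c = (\<lambda>i. 2 * count_list w i)"
  define m where "m x = (\<Prod>i\<in>UNIV. complex_of_real (x $ i) ^ c i)" for x :: "real^'a"
  obtain h where h: "h \<in> test_cube R" "parity s h" "\<And>x. euler j (of_nat (s j)) g x = of_real (x $ j) ^ 2 * h x"
    using euler_parity_gain[OF g(1,2) s, where j = j] by metis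
  have "((\<lambda>v. complex_of_real v ^ c j) has_vector_derivative of_nat (c j) * complex_of_real v ^ (c j - 1)) (at v)" for v
  proof -
    have "((\<lambda>v. v ^ c j) has_real_derivative of_nat (c j) * v ^ (c j - 1)) (at v)"
      by (auto intro!: derivative_eq_intros)
    from has_vector_derivative_of_real[OF this] show ?thesis by simp
  qed
  note hp = has_partial_tensor[of "\<lambda>i v. complex_of_real v ^ c i", OF this]
  define E where "E x = of_nat (c j) * complex_of_real (x $ j) ^ (c j - 1) * (\<Prod>i\<in>UNIV-{j}. complex_of_real (x $ i) ^ c i)" for x :: "real^'a"
  have coord_mult: "has_partial j m E"
    using hp by (simp add: m_def[abs_def] E_def[abs_def])
  have m_split: "m x = complex_of_real (x $ j) ^ c j * (\<Prod>i\<in>UNIV-{j}. complex_of_real (x $ i) ^ c i)" for x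
    unfolding m_def by (rule prod.remove) auto
  have euler: "of_real (x $ j) * E x = of_nat (c j) * m x" for x
    by (cases "c j") (simp_all add: E_def m_split mult_ac)
  have g3: "euler_word s w f = (\<lambda>x. m x * g x)"
    unfolding g(3) m_def c_def ..
  have "partial j (euler_word s w f) = (\<lambda>x. m x * partial j g x + E x * g x)"
    unfolding g3 by (rule has_partialD[OF has_partial_mult[OF coord_mult smooth_has_partial[OF test_cube_smooth[OF g(1)]]]])
  then have "euler_word s (j # w) f x = of_real (x $ j) * (m x * partial j g x + E x * g x) - (of_nat (s j) + of_nat (c j)) * (m x * g x)" for x
    by (simp add: euler_def g3 c_def)
  then have "euler_word s (j # w) f x = m x * euler j (of_nat (s j)) g x + (of_real (x $ j) * E x - of_nat (c j) * m x) * g x" for x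
    by (simp add: euler_def algebra_simps)
  then have "euler_word s (j # w) f x = m x * euler j (of_nat (s j)) g x" for x
    by (simp add: euler)
  moreover have "m x * of_real (x $ j) ^ 2 = (\<Prod>i\<in>UNIV. of_real (x $ i) ^ (2 * count_list (j # w) i))" for x
  proof -
    have "(\<Prod>i\<in>UNIV. of_real (x $ i) ^ (2 * count_list (j # w) i)) = (\<Prod>i\<in>UNIV. complex_of_real (x $ i) ^ c i * (if i = j then of_real (x $ j) ^ 2 else 1))"
      by (rule prod.cong) (auto simp: c_def power2_eq_square)
    also have "\<dots> = m x * of_real (x $ j) ^ 2"
      by (simp add: prod.distrib m_def)
    finally show ?thesis ..
  qed
  ultimately have "\<forall>x. euler_word s (j # w) f x = (\<Prod>i\<in>UNIV. of_real (x $ i) ^ (2 * count_list (j # w) i)) * h x"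
    using h(3) by (metis mult.assoc)
  then show ?case using h by blast
qed

text \<open>Each letter costs one derivative, hence the order \<open>N + length w\<close>.\<close>

lemma cbound_euler_word:
  assumes "R \<ge> 0"
  shows "\<exists>C. C \<ge> 0 \<and> (\<forall>f\<in>test_cube R. \<forall>B. cbound (N + length w) f B \<longrightarrow> cbound N (euler_word s w f) (C * B))"
proof (induction w arbitrary: N)
  case Nil
  then show ?case by (intro exI[of _ 1]) auto
next
  case (Cons j w)
  obtain C where C: "C \<ge> 0" "\<And>f B. f \<in> test_cube R \<Longrightarrow> cbound (Suc N + length w) f B \<Longrightarrow> cbound (Suc N) (euler_word s w f) (C * B)"
    using Cons[of "Suc N"] by blast
  let ?D = "R + real N + norm (of_nat (s j + 2 * count_list w j) :: complex)"
  have "cbound N (euler_word s (j # w) f) ((?D * C) * B)" if "f \<in> test_cube R" "cbound (N + length (j # w)) f B" for f B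
  proof -
    have "cbound (Suc N) (euler_word s w f) (C * B)"
      using C(2)[OF that(1)] that(2) by simp
    from cbound_euler[OF test_cube_euler_word[OF that(1)] assms this, of j "of_nat (s j + 2 * count_list w j)"] show ?thesis
      by (simp add: mult.assoc)
  qed
  moreover have "?D * C \<ge> 0"
    using C(1) assms by (intro mult_nonneg_nonneg add_nonneg_nonneg) auto
  ultimately show ?case by blast
qed

lemma parity_subspace: "test_subspace (test_cube R \<inter> Collect (parity s)) R"
proof
  show "test_cube R \<inter> Collect (parity s) \<noteq> {}"
    by (auto simp: test_cube_def parity_def dil_def intro!: exI[of _ "\<lambda>x. 0"] smooth_const)
  fix F :: "nat \<Rightarrow> real^'a \<Rightarrow> complex" and f
  assume F: "\<And>n. F n \<in> test_cube R \<inter> Collect (parity s)" and f: "smooth f" "\<And>x. (\<lambda>n. F n x) \<longlonglongrightarrow> f x"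
  have "f \<in> test_cube R"
    using test_subspace.lim[OF test_subspace_test_cube, of F R f] F f by blast
  moreover have "f (coord_mult x (reflect_coord j)) = (-1) ^ s j * f x" for x j
  proof -
    have "F n (coord_mult x (reflect_coord j)) = (-1) ^ s j * F n x" for n
      using F[of n] by (simp add: parity_def dil_apply)
    then have "(\<lambda>n. (-1) ^ s j * F n x) \<longlonglongrightarrow> f (coord_mult x (reflect_coord j))"
      using f(2)[of "coord_mult x (reflect_coord j)"] by simp
    moreover have "(\<lambda>n. (-1) ^ s j * F n x) \<longlonglongrightarrow> (-1) ^ s j * f x"
      by (rule tendsto_mult_left[OF f(2)])
    ultimately show ?thesis by (rule LIMSEQ_unique)
  qed
  ultimately show "f \<in> test_cube R \<inter> Collect (parity s)"
    by (simp add: parity_def dil_apply)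
qed (auto simp: parity_def dil_def algebra_simps intro: test_cube_add test_cube_cmult)

text \<open>Uniform boundedness, over all y, of the functionals divided by the monomial. They are
  pointwise bounded because the orbit inherits the parity of f, so that its image under the Euler
  word is the monomial times a test function. The gain is that C and N serve all f and y at
  once.\<close>

lemma D_H_decay:
  fixes T :: "(real^'n::finite \<Rightarrow> complex) \<Rightarrow> complex"
  assumes T: "T \<in> D_H" and s: "zero_one s" and R: "R \<ge> 0"
  shows "\<exists>C N. \<forall>y. all_nonzero y \<longrightarrow> (\<forall>f. f \<in> test_cube R \<longrightarrow> parity s f \<longrightarrow> (\<forall>B. cbound N f B \<longrightarrow>
    norm (T (dil y (euler_word s w f))) \<le> C * (\<Prod>i\<in>UNIV. \<bar>y $ i\<bar> ^ (2 * count_list w i)) * B))"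
proof -
  note dist = D_H_distribution[OF T]
  interpret test_subspace "test_cube R \<inter> Collect (parity s)" R by (rule parity_subspace)
  define m :: "real^'n \<Rightarrow> real" where "m y = (\<Prod>i\<in>UNIV. \<bar>y $ i\<bar> ^ (2 * count_list w i))" for y
  have m: "m y > 0" if "all_nonzero y" for y
    using that unfolding m_def all_nonzero_def by (intro prod_pos) auto
  define \<Lambda> where "\<Lambda> y f = (if all_nonzero y then T (dil y (euler_word s w f)) / of_real (m y) else 0)" for y f
  have op_test: "dil y (euler_word s w f) \<in> test_fun" if "f \<in> test_cube R" "all_nonzero y" for f y
    using that by (intro test_dil test_euler_word test_cube_test)
  have "\<exists>C N. \<forall>y. \<forall>f\<in>test_cube R \<inter> Collect (parity s). \<forall>B. cbound N f B \<longrightarrow> norm (\<Lambda> y f) \<le> C * B"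
  proof (rule uniform_boundedness)
    fix y f g assume fg: "f \<in> test_cube R \<inter> Collect (parity s)" "g \<in> test_cube R \<inter> Collect (parity s)"
    have "dil y (euler_word s w (\<lambda>x. f x + g x)) = (\<lambda>x. dil y (euler_word s w f) x + dil y (euler_word s w g) x)"
      using fg euler_word_add[OF V_smooth[OF fg(1)] V_smooth[OF fg(2)]] by (simp add: dil_def)
    then show "\<Lambda> y (\<lambda>x. f x + g x) = \<Lambda> y f + \<Lambda> y g"
      using dist_add[OF dist op_test op_test, of f y g y] fg by (simp add: \<Lambda>_def add_divide_distrib)
  next
    fix y f c assume f: "f \<in> test_cube R \<inter> Collect (parity s)"
    have "dil y (euler_word s w (\<lambda>x. c * f x)) = (\<lambda>x. c * dil y (euler_word s w f) x)"
      using euler_word_cmult[OF V_smooth[OF f]] by (simp add: dil_def)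
    then show "\<Lambda> y (\<lambda>x. c * f x) = c * \<Lambda> y f"
      using dist_cmult[OF dist op_test, of f y c] f by (simp add: \<Lambda>_def)
  next
    fix y :: "real^'n"
    show "\<exists>C N. \<forall>f\<in>test_cube R \<inter> Collect (parity s). \<forall>B. cbound N f B \<longrightarrow> norm (\<Lambda> y f) \<le> C * B"
    proof (cases "all_nonzero y")
      case True
      obtain C N where C: "\<And>f B. f \<in> test_cube R \<Longrightarrow> cbound N f B \<Longrightarrow> norm (T (dil y f)) \<le> C * B"
        using dist_dil_bound[OF dist True, of R] by blast
      obtain D where D: "\<And>f B. f \<in> test_cube R \<Longrightarrow> cbound (N + length w) f B \<Longrightarrow> cbound N (euler_word s w f) (D * B)"
        using cbound_euler_word[OF R, of N w s] by blast
      have "norm (\<Lambda> y f) \<le> (C * D / m y) * B" if "f \<in> test_cube R" "cbound (N + length w) f B" for f B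
      proof -
        have "norm (T (dil y (euler_word s w f))) \<le> C * (D * B)"
          by (rule C[OF test_cube_euler_word[OF that(1)] D[OF that]])
        then show ?thesis
          using True m[OF True] by (simp add: \<Lambda>_def norm_divide divide_right_mono mult.assoc)
      qed
      then show ?thesis by blast
    next
      case False
      then show ?thesis by (intro exI[of _ 0]) (auto simp: \<Lambda>_def)
    qed
  next
    fix f assume f: "f \<in> test_cube R \<inter> Collect (parity s)"
    then have ft: "f \<in> test_fun" by (auto intro: test_cube_test)
    obtain g where g: "orbit_ext T f g" using D_H_orbit_ext[OF T ft] by blast
    then have gt: "g \<in> test_fun" and gT: "\<And>y. all_nonzero y \<Longrightarrow> T (dil y f) = g y" by (auto simp: orbit_ext_def)
    obtain S where gS: "g \<in> test_cube S" using test_test_cube[OF gt] by blast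
    \<comment> \<open>Reflections are dilations, so they commute with taking the orbit; the
      resulting identity extends over the hyperplanes by density.\<close>
    have "parity s g"
      unfolding parity_def
    proof (intro allI)
      fix j x
      have "dil (reflect_coord j) g y = (-1) ^ s j * g y" if y: "all_nonzero y" for y
      proof -
        have nzf: "all_nonzero (coord_mult y (reflect_coord j))" using y by (simp add: all_nonzero_def reflect_coord_def)
        have "dil (reflect_coord j) g y = T (dil (coord_mult y (reflect_coord j)) f)"
          using gT[OF nzf] by (simp add: dil_apply)
        also have "dil (coord_mult y (reflect_coord j)) f = dil y (dil (reflect_coord j) f)"
          by (simp add: dil_dil coord_mult_commute)
        also have "\<dots> = (\<lambda>x. (-1) ^ s j * dil y f x)"
          using f by (simp add: parity_def dil_def)
        also have "T \<dots> = (-1) ^ s j * g y"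
          using dist_cmult[OF dist test_dil[OF ft y]] gT[OF y] by simp
        finally show ?thesis .
      qed
      then show "dil (reflect_coord j) g x = (-1) ^ s j * g x"
        by (rule all_nonzero_eq_imp_eq[OF open_UNIV smooth_continuous[OF smooth_dil[OF test_cube_smooth[OF gS]]]
              smooth_continuous[OF smooth_cmult[OF test_cube_smooth[OF gS]]] _ UNIV_I])
    qed
    then obtain h where h: "h \<in> test_cube S" "\<And>x. euler_word s w g x = (\<Prod>i\<in>UNIV. of_real (x $ i) ^ (2 * count_list w i)) * h x"
      using euler_word_parity[OF gS _ s, of w] by blast
    obtain B where B: "B \<ge> 0" "\<And>x. norm (h x) \<le> B" using test_cube_bounded[OF h(1)] by blast
    have rop: "orbit_ext T (euler_word s w f) (euler_word s w g)"
      by (rule orbit_ext_euler_word[OF T ft g])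
    have "norm (\<Lambda> y f) \<le> B" for y
    proof (cases "all_nonzero y")
      case True
      have "T (dil y (euler_word s w f)) = (\<Prod>i\<in>UNIV. of_real (y $ i) ^ (2 * count_list w i)) * h y"
        using rop True h(2) by (simp add: orbit_ext_def)
      then have "norm (T (dil y (euler_word s w f))) = m y * norm (h y)"
        by (simp add: norm_mult m_def norm_power flip: prod_norm)
      then show ?thesis
        using True m[OF True] B(2)[of y] by (simp add: \<Lambda>_def norm_divide)
    next
      case False
      then show ?thesis using B(1) by (simp add: \<Lambda>_def)
    qed
    then show "\<exists>C. \<forall>y. norm (\<Lambda> y f) \<le> C" by blast
  qed
  then obtain C N where CN: "\<And>y f B. f \<in> test_cube R \<Longrightarrow> parity s f \<Longrightarrow> cbound N f B \<Longrightarrow> norm (\<Lambda> y f) \<le> C * B"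
    by blast
  have "norm (T (dil y (euler_word s w f))) \<le> C * m y * B" if "all_nonzero y" "f \<in> test_cube R" "parity s f" "cbound N f B" for y f B
    using CN[OF that(2-4), of y] m[OF that(1)] that(1) by (simp add: \<Lambda>_def norm_divide divide_le_eq mult_ac)
  then show ?thesis unfolding m_def by blast
qed

subsection \<open>Truncated powers\<close>

text \<open>The integral of f from v to 2. The endpoint 2 is chosen because the smoothed indicators
  below vanish from there on once n \<ge> 1.\<close>

definition tail_primitive :: "(real \<Rightarrow> real) \<Rightarrow> real \<Rightarrow> real" where
  "tail_primitive f = (SOME F. (\<forall>v. (F has_real_derivative - f v) (at v)) \<and> F 2 = 0)"

lemma tail_primitive:
  assumes "continuous_on UNIV f"
  shows "(tail_primitive f has_real_derivative - f v) (at v)" "tail_primitive f 2 = 0"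
proof -
  obtain G where G: "\<And>v. (G has_real_derivative f v) (at v)"
    using antiderivative_exists[OF assms] by blast
  have "((\<lambda>v. G 2 - G v) has_real_derivative - f v) (at v)" for v
    by (auto intro!: derivative_eq_intros G)
  then have "\<exists>F. (\<forall>v. (F has_real_derivative - f v) (at v)) \<and> F 2 = 0"
    by (intro exI[of _ "\<lambda>v. G 2 - G v"]) simp
  from someI_ex[OF this, folded tail_primitive_def] show "(tail_primitive f has_real_derivative - f v) (at v)" "tail_primitive f 2 = 0"
    by blast+
qed

text \<open>The base is a smoothed indicator of u \<le> 1 with transition on [1, 1 + 1/n]; as n
  grows, the r-th iterate tends to (1 - u)_+^r / r!.\<close>

fun step_integral :: "nat \<Rightarrow> nat \<Rightarrow> real \<Rightarrow> real" where
  "step_integral n 0 = (\<lambda>u. smooth_step 0 (real n * (u - 1)))"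
| "step_integral n (Suc r) = tail_primitive (step_integral n r)"

lemma step_integral_continuous: "continuous_on UNIV (step_integral n r)"
proof (induction r)
  case 0
  show ?case
    unfolding step_integral.simps
    by (rule continuous_on_compose2[OF tower_continuous[OF smooth_step(1), of UNIV]]) (auto intro!: continuous_intros)
next
  case (Suc r)
  then show ?case
    using tail_primitive(1) DERIV_isCont by (metis step_integral.simps(2) continuous_at_imp_continuous_on)
qed

lemma step_integral_deriv: "(step_integral n (Suc r) has_real_derivative - step_integral n r v) (at v)"
  and step_integral_2: "step_integral n (Suc r) 2 = 0"
  using tail_primitive[OF step_integral_continuous] by simp_all

lemma step_integral_zero: assumes "n \<ge> 1" "u \<ge> 2" shows "step_integral n r u = 0"
  using assms(2)
proof (induction r arbitrary: u)
  case 0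
  have "1 * 1 \<le> real n * (u - 1)"
    using 0 assms(1) by (intro mult_mono) auto
  then show ?case by (simp add: smooth_step)
next
  case (Suc r)
  show ?case
  proof (cases "u = 2")
    case False
    then have "2 < u" using Suc.prems by simp
    then have "step_integral n (Suc r) u = step_integral n (Suc r) 2"
    proof (rule DERIV_isconst_end)
      show "continuous_on {2..u} (step_integral n (Suc r))"
        by (rule continuous_on_subset[OF step_integral_continuous]) simp
      show "(step_integral n (Suc r) has_real_derivative 0) (at v)" if "2 < v" for v
        using step_integral_deriv[of n r v] Suc.IH[of v] that by simp
    qed
    then show ?thesis using step_integral_2[of n r] by simp
  qed (use step_integral_2[of n r] in simp)
qed

lemma deriv_bound:
  fixes F f :: "real \<Rightarrow> real"
  assumes "\<And>v. (F has_real_derivative f v) (at v)" "\<And>v. v \<in> {a..b} \<Longrightarrow> \<bar>f v\<bar> \<le> B" "a \<le> b"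
  shows "\<bar>F a - F b\<bar> \<le> B * (b - a)"
proof -
  have "norm (F a - F b) \<le> B * norm (a - b)"
    by (rule field_differentiable_bound[of "{a..b}" F f])
      (use assms in \<open>auto intro: has_field_derivative_at_within\<close>)
  then show ?thesis using assms(3) by simp
qed

lemma step_integral_bound: assumes "0 \<le> u" "u \<le> 2" shows "\<bar>step_integral n r u\<bar> \<le> 2 ^ r"
  using assms
proof (induction r arbitrary: u)
  case 0
  then show ?case using smooth_step(4,5) by simp
next
  case (Suc r)
  have "\<bar>step_integral n (Suc r) u - step_integral n (Suc r) 2\<bar> \<le> 2 ^ r * (2 - u)"
    by (rule deriv_bound[OF step_integral_deriv]) (use Suc in auto)
  also have "\<dots> \<le> 2 ^ r * 2"
    using Suc.prems by (intro mult_left_mono) auto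
  finally show ?case using step_integral_2[of n r] by (simp add: mult.commute)
qed

text \<open>Two smoothed indicators differ only on a transition layer of length 1/n, by at most 1.
  Going down from u = 2, the difference of the primitives is 0, then grows to at most 1/n, then
  stays constant.\<close>

lemma step_integral_diff_1:
  assumes n: "n \<ge> 1" "n \<le> m" "n \<le> m'" and u: "0 \<le> u" "u \<le> 2"
  shows "\<bar>step_integral m 1 u - step_integral m' 1 u\<bar> \<le> 1 / real n"
proof -
  define d where "d = 1 / real n"
  have d: "0 < d" "d \<le> 1" using n(1) by (auto simp: d_def)
  define D where "D v = step_integral m 1 v - step_integral m' 1 v" for v
  have D': "(D has_real_derivative step_integral m' 0 v - step_integral m 0 v) (at v)" for v
    unfolding D_def using step_integral_deriv[of m 0 v] step_integral_deriv[of m' 0 v] by (auto intro!: derivative_eq_intros)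
  have z: "step_integral l 0 v = 0" if "1 + d \<le> v" "n \<le> l" for l v
  proof -
    have "1 \<le> real l * d"
      using that(2) n(1) by (simp add: d_def)
    also have "\<dots> \<le> real l * (v - 1)"
      using that by (intro mult_left_mono) auto
    finally show ?thesis by (simp add: smooth_step)
  qed
  have one: "step_integral l 0 v = 1" if "v \<le> 1" for l v
    using that by (simp add: smooth_step mult_nonneg_nonpos)
  have ge: "D v = 0" if "1 + d \<le> v" "v \<le> 2" for v
  proof -
    have "\<bar>D v - D 2\<bar> \<le> 0 * (2 - v)"
      by (rule deriv_bound[OF D']) (use that z n in auto)
    moreover have "D 2 = 0" using step_integral_2[of m 0] step_integral_2[of m' 0] by (simp add: D_def)
    ultimately show ?thesis by simp
  qed
  have mid: "\<bar>D v\<bar> \<le> d" if "1 \<le> v" "v \<le> 1 + d" for v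
  proof -
    have "\<bar>D v - D (1 + d)\<bar> \<le> 1 * (1 + d - v)"
    proof (rule deriv_bound[OF D'])
      fix v
      have "0 \<le> step_integral m 0 v" "step_integral m 0 v \<le> 1" "0 \<le> step_integral m' 0 v" "step_integral m' 0 v \<le> 1"
        using smooth_step(4,5) by simp_all
      then show "\<bar>step_integral m' 0 v - step_integral m 0 v\<bar> \<le> 1" by linarith
    qed (use that in simp)
    then show ?thesis using ge[of "1 + d"] d that by simp
  qed
  have "\<bar>D u\<bar> \<le> d"
  proof -
    consider "u \<le> 1" | "1 \<le> u" "u \<le> 1 + d" | "1 + d \<le> u" by linarith
    then show ?thesis
    proof cases
      case 1
      have "\<bar>D u - D 1\<bar> \<le> 0 * (1 - u)"
        by (rule deriv_bound[OF D']) (use 1 one in auto)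
      then show ?thesis using mid[of 1] d by simp
    next
      case 2
      then show ?thesis by (rule mid)
    next
      case 3
      then show ?thesis using ge[of u] u d by simp
    qed
  qed
  then show ?thesis by (simp add: D_def d_def)
qed

text \<open>Each further integration over [u, 2] at most doubles the error.\<close>

lemma step_integral_diff:
  assumes n: "n \<ge> 1" "n \<le> m" "n \<le> m'" and u: "0 \<le> u" "u \<le> 2"
  shows "\<bar>step_integral m (Suc r) u - step_integral m' (Suc r) u\<bar> \<le> 2 ^ r / real n"
  using u
proof (induction r arbitrary: u)
  case 0
  then show ?case using step_integral_diff_1[OF n] by simp
next
  case (Suc r)
  define D where "D v = step_integral m (Suc (Suc r)) v - step_integral m' (Suc (Suc r)) v" for v
  have D': "(D has_real_derivative step_integral m' (Suc r) v - step_integral m (Suc r) v) (at v)" for v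
    unfolding D_def using step_integral_deriv[of m "Suc r" v] step_integral_deriv[of m' "Suc r" v]
    by (auto intro!: derivative_eq_intros simp del: step_integral.simps)
  have "\<bar>D u - D 2\<bar> \<le> (2 ^ r / real n) * (2 - u)"
  proof (rule deriv_bound[OF D'])
    fix v assume "v \<in> {u..2}"
    then show "\<bar>step_integral m' (Suc r) v - step_integral m (Suc r) v\<bar> \<le> 2 ^ r / real n"
      using Suc.IH[of v] Suc.prems by (simp add: abs_minus_commute del: step_integral.simps)
  qed (use Suc.prems in simp)
  also have "\<dots> \<le> (2 ^ r / real n) * 2"
    using Suc.prems by (intro mult_left_mono) auto
  finally show ?case
    using step_integral_2[of m "Suc r"] step_integral_2[of m' "Suc r"] by (simp add: D_def mult.commute del: step_integral.simps)
qed

text \<open>\<open>trunc_power M n\<close> lists the derivatives of a smooth approximation of the truncated power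
  \<open>(1 - u)\<^sub>+ ^ M / M!\<close>, which is (up to a constant) a fundamental solution of the product of Euler operators.\<close>

definition trunc_power :: "nat \<Rightarrow> nat \<Rightarrow> nat \<Rightarrow> real \<Rightarrow> real" where
  "trunc_power M n i u = (if i < M then (-1) ^ i * step_integral n (M - i) u
     else (-1) ^ M * real n ^ (i - M) * smooth_step (i - M) (real n * (u - 1)))"

lemma trunc_power_deriv: "(trunc_power M n i has_real_derivative trunc_power M n (Suc i) u) (at u)"
proof (cases "i < M")
  case True
  have "(step_integral n (M - i) has_real_derivative - step_integral n (M - Suc i) u) (at u)"
    using step_integral_deriv[of n "M - Suc i" u] True by (simp only: Suc_diff_Suc)
  then have "((\<lambda>u. (-1) ^ i * step_integral n (M - i) u) has_real_derivative (-1) ^ i * - step_integral n (M - Suc i) u) (at u)"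
    by (rule DERIV_cmult)
  moreover have "(-1) ^ i * - step_integral n (M - Suc i) u = trunc_power M n (Suc i) u"
  proof (cases "Suc i < M")
    \<comment> \<open>The seam of the definition: the first integral differentiates into the
      smoothed indicator itself, and the signs match.\<close>
    case False
    then have "M = Suc i" using True by simp
    then show ?thesis by (simp add: trunc_power_def)
  qed (simp add: trunc_power_def)
  ultimately show ?thesis using True by (simp add: trunc_power_def[abs_def])
next
  case False
  have "(smooth_step (i - M) has_real_derivative smooth_step (Suc (i - M)) (real n * (u - 1))) (at (real n * (u - 1)))"
    using smooth_step(1) by (simp add: tower_def)
  moreover have "((\<lambda>u. real n * (u - 1)) has_real_derivative real n) (at u)"
    by (auto intro!: derivative_eq_intros)
  ultimately have "((\<lambda>u. smooth_step (i - M) (real n * (u - 1))) has_real_derivative smooth_step (Suc (i - M)) (real n * (u - 1)) * real n) (at u)"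
    by (rule DERIV_chain2)
  then have "((\<lambda>u. ((-1) ^ M * real n ^ (i - M)) * smooth_step (i - M) (real n * (u - 1))) has_real_derivative
     ((-1) ^ M * real n ^ (i - M)) * (smooth_step (Suc (i - M)) (real n * (u - 1)) * real n)) (at u)"
    by (rule DERIV_cmult)
  then show ?thesis
    using False by (simp add: trunc_power_def[abs_def] Suc_diff_le mult_ac)
qed

lemma tower_trunc_power: "tower (trunc_power M n)"
  by (simp add: tower_def trunc_power_deriv)

lemma trunc_power_zero: assumes "n \<ge> 1" "u \<ge> 2" shows "trunc_power M n i u = 0"
proof -
  have "1 * 1 \<le> real n * (u - 1)"
    using assms by (intro mult_mono) auto
  then show ?thesis
    using step_integral_zero[OF assms] by (simp add: trunc_power_def smooth_step_zero)
qed

text \<open>The bound does not depend on n; beyond order M the derivatives carry powers of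
  n.\<close>

lemma trunc_power_bound: assumes "i < M" "n \<ge> 1" "0 \<le> u" shows "\<bar>trunc_power M n i u\<bar> \<le> 2 ^ M"
proof (cases "u \<le> 2")
  case True
  have "\<bar>step_integral n (M - i) u\<bar> \<le> 2 ^ (M - i)"
    using assms True by (intro step_integral_bound)
  also have "\<dots> \<le> (2::real) ^ M"
    by (rule power_increasing) auto
  finally show ?thesis using assms by (simp add: trunc_power_def abs_mult)
qed (use assms trunc_power_zero in auto)

lemma trunc_power_diff:
  assumes "i < M" "1 \<le> n" "n \<le> m" "n \<le> m'" "0 \<le> u"
  shows "\<bar>trunc_power M m i u - trunc_power M m' i u\<bar> \<le> 2 ^ M / real n"
proof (cases "u \<le> 2")
  case True
  have "trunc_power M m i u - trunc_power M m' i u = (-1) ^ i * (step_integral m (M - i) u - step_integral m' (M - i) u)"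
    using assms by (simp add: trunc_power_def algebra_simps)
  then have "\<bar>trunc_power M m i u - trunc_power M m' i u\<bar> = \<bar>step_integral m (Suc (M - Suc i)) u - step_integral m' (Suc (M - Suc i)) u\<bar>"
    using assms(1) by (simp add: abs_mult Suc_diff_Suc del: step_integral.simps)
  also have "\<dots> \<le> 2 ^ (M - Suc i) / real n"
    using assms True by (intro step_integral_diff)
  also have "\<dots> \<le> 2 ^ M / real n"
    by (intro divide_right_mono power_increasing) auto
  finally show ?thesis .
qed (use assms trunc_power_zero in auto)

subsection \<open>Kernels\<close>

text \<open>Convergence in C^N without naming a limit. The uniform bounds are included because
  products need them.\<close>

definition CN_Cauchy :: "nat \<Rightarrow> (nat \<Rightarrow> real^'n::finite \<Rightarrow> complex) \<Rightarrow> bool" where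
  "CN_Cauchy N F \<longleftrightarrow> (\<forall>w. length w \<le> N \<longrightarrow> uniformly_Cauchy_on UNIV (\<lambda>n. dpart w (F n)) \<and> (\<exists>B. \<forall>n x. norm (dpart w (F n) x) \<le> B))"

lemma CN_Cauchy_0: "CN_Cauchy 0 F \<longleftrightarrow> uniformly_Cauchy_on UNIV F \<and> (\<exists>B. \<forall>n x. norm (F n x) \<le> B)"
  by (simp add: CN_Cauchy_def)

lemma CN_Cauchy_Suc: "CN_Cauchy (Suc N) F \<longleftrightarrow> CN_Cauchy 0 F \<and> (\<forall>i. CN_Cauchy N (\<lambda>n. partial i (F n)))"
proof
  assume *: "CN_Cauchy (Suc N) F"
  have "CN_Cauchy N (\<lambda>n. partial i (F n))" for i
    unfolding CN_Cauchy_def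
  proof (intro allI impI)
    fix w assume "length (w :: 'a list) \<le> N"
    then show "uniformly_Cauchy_on UNIV (\<lambda>n. dpart w (partial i (F n))) \<and> (\<exists>B. \<forall>n x. norm (dpart w (partial i (F n)) x) \<le> B)"
      using *[unfolded CN_Cauchy_def, rule_format, of "w @ [i]"] by (simp add: dpart_append)
  qed
  moreover have "CN_Cauchy 0 F"
    using *[unfolded CN_Cauchy_def, rule_format, of "[]"] by (simp add: CN_Cauchy_0)
  ultimately show "CN_Cauchy 0 F \<and> (\<forall>i. CN_Cauchy N (\<lambda>n. partial i (F n)))" by blast
next
  assume *: "CN_Cauchy 0 F \<and> (\<forall>i. CN_Cauchy N (\<lambda>n. partial i (F n)))"
  show "CN_Cauchy (Suc N) F"
    unfolding CN_Cauchy_def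
  proof (intro allI impI)
    fix w assume w: "length (w :: 'a list) \<le> Suc N"
    show "uniformly_Cauchy_on UNIV (\<lambda>n. dpart w (F n)) \<and> (\<exists>B. \<forall>n x. norm (dpart w (F n) x) \<le> B)"
    proof (cases w rule: rev_cases)
      case (snoc w' i)
      then show ?thesis
        using * w by (simp add: dpart_append CN_Cauchy_def)
    qed (use * in \<open>simp add: CN_Cauchy_0\<close>)
  qed
qed

lemma CN_Cauchy_mono: "CN_Cauchy N F \<Longrightarrow> N' \<le> N \<Longrightarrow> CN_Cauchy N' F"
  by (simp add: CN_Cauchy_def)

lemma CN_Cauchy_0_add: assumes "CN_Cauchy 0 F" "CN_Cauchy 0 G" shows "CN_Cauchy 0 (\<lambda>n x. F n x + G n x)"
  unfolding CN_Cauchy_0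
proof
  show "uniformly_Cauchy_on UNIV (\<lambda>n x. F n x + G n x)"
    unfolding uniformly_Cauchy_on_def
  proof (intro allI impI)
    fix e :: real assume "e > 0"
    then have e: "e / 2 > 0" by simp
    obtain A where A: "\<And>x m n. m \<ge> A \<Longrightarrow> n \<ge> A \<Longrightarrow> dist (F m x) (F n x) < e / 2"
      using assms(1) e unfolding CN_Cauchy_0 uniformly_Cauchy_on_def by blast
    obtain B where B: "\<And>x m n. m \<ge> B \<Longrightarrow> n \<ge> B \<Longrightarrow> dist (G m x) (G n x) < e / 2"
      using assms(2) e unfolding CN_Cauchy_0 uniformly_Cauchy_on_def by blast
    have "dist (F m x + G m x) (F n x + G n x) < e" if "m \<ge> max A B" "n \<ge> max A B" for m n x
    proof -
      have "dist (F m x + G m x) (F n x + G n x) \<le> dist (F m x) (F n x) + dist (G m x) (G n x)"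
        by (rule dist_triangle_add)
      also have "\<dots> < e" using A[of m n x] B[of m n x] that by simp
      finally show ?thesis .
    qed
    then show "\<exists>M. \<forall>x\<in>UNIV. \<forall>m\<ge>M. \<forall>n\<ge>M. dist (F m x + G m x) (F n x + G n x) < e" by blast
  qed
  obtain A B where "\<And>n x. norm (F n x) \<le> A" "\<And>n x. norm (G n x) \<le> B"
    using assms unfolding CN_Cauchy_0 by blast
  then show "\<exists>B. \<forall>n x. norm (F n x + G n x) \<le> B"
    by (intro exI[of _ "A + B"] allI norm_triangle_le add_mono)
qed

lemma CN_Cauchy_0_mult: assumes "CN_Cauchy 0 F" "CN_Cauchy 0 G" shows "CN_Cauchy 0 (\<lambda>n x. F n x * G n x)"
  unfolding CN_Cauchy_0
proof
  obtain A0 B0 where b0: "\<And>n x. norm (F n x) \<le> A0" "\<And>n x. norm (G n x) \<le> B0"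
    using assms unfolding CN_Cauchy_0 by blast
  define K where "K = max 1 (max A0 B0)"
  have K: "K \<ge> 1" "\<And>n x. norm (F n x) \<le> K" "\<And>n x. norm (G n x) \<le> K"
    using b0 by (auto simp: K_def le_max_iff_disj)
  show "uniformly_Cauchy_on UNIV (\<lambda>n x. F n x * G n x)"
    unfolding uniformly_Cauchy_on_def
  proof (intro allI impI)
    fix e :: real assume "e > 0"
    then have e: "e / (2 * K) > 0" using K(1) by simp
    obtain A where A: "\<And>x m n. m \<ge> A \<Longrightarrow> n \<ge> A \<Longrightarrow> dist (F m x) (F n x) < e / (2 * K)"
      using assms(1) e unfolding CN_Cauchy_0 uniformly_Cauchy_on_def by blast
    obtain B where B: "\<And>x m n. m \<ge> B \<Longrightarrow> n \<ge> B \<Longrightarrow> dist (G m x) (G n x) < e / (2 * K)"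
      using assms(2) e unfolding CN_Cauchy_0 uniformly_Cauchy_on_def by blast
    have "dist (F m x * G m x) (F n x * G n x) < e" if "m \<ge> max A B" "n \<ge> max A B" for m n x
    proof -
      have eq: "F m x * G m x - F n x * G n x = F m x * (G m x - G n x) + (F m x - F n x) * G n x"
        by (simp add: algebra_simps)
      have "norm (F m x * G m x - F n x * G n x) \<le> norm (F m x) * norm (G m x - G n x) + norm (F m x - F n x) * norm (G n x)"
        unfolding eq by (rule order_trans[OF norm_triangle_ineq]) (simp add: norm_mult)
      also have "\<dots> \<le> K * norm (G m x - G n x) + norm (F m x - F n x) * K"
        using K by (intro add_mono mult_mono) auto
      also have "\<dots> < K * (e / (2 * K)) + (e / (2 * K)) * K"
        using A[of m n x] B[of m n x] that K(1)
        by (intro add_strict_mono mult_strict_left_mono mult_strict_right_mono) (auto simp: dist_norm)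
      also have "\<dots> = e" using K(1) by simp
      finally show ?thesis by (simp add: dist_norm)
    qed
    then show "\<exists>M. \<forall>x\<in>UNIV. \<forall>m\<ge>M. \<forall>n\<ge>M. dist (F m x * G m x) (F n x * G n x) < e" by blast
  qed
  show "\<exists>B. \<forall>n x. norm (F n x * G n x) \<le> B"
    using K by (intro exI[of _ "K * K"]) (auto simp: norm_mult intro!: mult_mono)
qed

lemma CN_Cauchy_add:
  assumes "\<And>n. smooth (F n)" "\<And>n. smooth (G n)" "CN_Cauchy N F" "CN_Cauchy N G"
  shows "CN_Cauchy N (\<lambda>n x. F n x + G n x)"
  using assms
proof (induction N arbitrary: F G)
  case 0
  then show ?case by (intro CN_Cauchy_0_add)
next
  case (Suc N)
  have "CN_Cauchy N (\<lambda>n x. partial i (F n) x + partial i (G n) x)" for i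
    by (rule Suc.IH) (use Suc.prems in \<open>auto simp: CN_Cauchy_Suc smooth_partial\<close>)
  then show ?case
    using Suc.prems by (auto simp: CN_Cauchy_Suc partial_add intro: CN_Cauchy_0_add)
qed

lemma CN_Cauchy_mult:
  assumes "\<And>n. smooth (F n)" "\<And>n. smooth (G n)" "CN_Cauchy N F" "CN_Cauchy N G"
  shows "CN_Cauchy N (\<lambda>n x. F n x * G n x)"
  using assms
proof (induction N arbitrary: F G)
  case 0
  then show ?case by (intro CN_Cauchy_0_mult)
next
  case (Suc N)
  have FG: "CN_Cauchy N F" "CN_Cauchy N G" using Suc.prems CN_Cauchy_mono[of "Suc N" _ N] by auto
  have "CN_Cauchy N (\<lambda>n x. F n x * partial i (G n) x + partial i (F n) x * G n x)" for i
  proof (rule CN_Cauchy_add)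
    show "CN_Cauchy N (\<lambda>n x. F n x * partial i (G n) x)"
      by (rule Suc.IH) (use Suc.prems FG in \<open>auto simp: CN_Cauchy_Suc smooth_partial\<close>)
    show "CN_Cauchy N (\<lambda>n x. partial i (F n) x * G n x)"
      by (rule Suc.IH) (use Suc.prems FG in \<open>auto simp: CN_Cauchy_Suc smooth_partial\<close>)
  qed (use Suc.prems in \<open>auto intro!: smooth_mult smooth_partial\<close>)
  moreover have "CN_Cauchy 0 (\<lambda>n x. F n x * G n x)"
    using Suc.prems by (intro CN_Cauchy_0_mult) (auto simp: CN_Cauchy_Suc)
  ultimately show ?case
    using Suc.prems by (simp add: CN_Cauchy_Suc partial_mult)
qed

lemma CN_Cauchy_const: "CN_Cauchy N (\<lambda>n x. c)"
proof -
  have "partial i (\<lambda>x. c) = (\<lambda>x. 0)" for i :: 'a and c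
    by (rule has_partialD[OF has_partial_const])
  then have "dpart w (\<lambda>x::real^'a. c) = (\<lambda>x. if w = [] then c else 0)" for w
    by (induction w) simp_all
  then show ?thesis
    unfolding CN_Cauchy_def uniformly_Cauchy_on_def by auto
qed

lemma CN_Cauchy_prod:
  assumes "\<And>n j. j \<in> S \<Longrightarrow> smooth (F j n)" "\<And>j. j \<in> S \<Longrightarrow> CN_Cauchy N (F j)"
  shows "CN_Cauchy N (\<lambda>n x. \<Prod>j\<in>S. F j n x)"
  using assms
proof (induction S rule: infinite_finite_induct)
  case (insert j S)
  have "CN_Cauchy N (\<lambda>n x. F j n x * (\<Prod>j\<in>S. F j n x))"
    by (rule CN_Cauchy_mult) (use insert in \<open>auto intro!: smooth_prod\<close>)
  then show ?case using insert.hyps by simp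
qed (auto intro: CN_Cauchy_const)

section \<open>The kernels and their images under Euler operators\<close>

lemma has_partial_coordfun:
  assumes "\<And>v. (a has_real_derivative a' v) (at v)"
  shows "has_partial i (\<lambda>x. of_real (a (x $ j))) (\<lambda>x. if i = j then of_real (a' (x $ j)) else 0)"
proof -
  have "has_partial i (\<lambda>x. of_real (a (Re (of_real (x $ j))))) (\<lambda>x. of_real (a' (Re (of_real (x $ j)))) * of_real (Re (if j = i then 1 else 0)))"
    by (rule has_partial_comp[OF assms has_partial_coord])
  moreover have "(\<lambda>x. complex_of_real (a' (Re (of_real (x $ j)))) * of_real (Re (if j = i then 1 else 0))) = (\<lambda>x. if i = j then of_real (a' (x $ j)) else 0)"
    by auto
  ultimately show ?thesis by simp
qed

text \<open>A family closed under differentiation: (a, i) produces (a - 1, i) and (a + 1, i + 1),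
  where i counts derivatives of the profile.\<close>

definition kernel_factor :: "nat \<Rightarrow> 'n::finite \<Rightarrow> nat \<Rightarrow> nat \<Rightarrow> nat \<Rightarrow> real^'n \<Rightarrow> complex" where
  "kernel_factor M j a i n x = of_real ((x $ j) ^ a * trunc_power M n i ((x $ j)\<^sup>2))"

lemma smooth_kernel_factor: "smooth (kernel_factor M j a i n)"
proof -
  have "tower (\<lambda>k. trunc_power M n (i + k))"
    using tower_trunc_power[of M n] by (simp add: tower_def)
  from smooth_comp[OF this smooth_power[OF smooth_coord, of j 2]]
  have "smooth (\<lambda>x. of_real (trunc_power M n i ((x $ j)\<^sup>2)))"
    by (simp flip: of_real_power)
  from smooth_mult[OF smooth_power[OF smooth_coord, of j a] this]
  show ?thesis
    by (simp add: kernel_factor_def[abs_def])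
qed

lemma deriv_power_trunc_power:
  "((\<lambda>v. v ^ a * trunc_power M n i (v\<^sup>2)) has_real_derivative of_nat a * (v ^ (a - 1) * trunc_power M n i (v\<^sup>2)) + 2 * (v ^ Suc a * trunc_power M n (Suc i) (v\<^sup>2))) (at v)"
proof -
  have "((\<lambda>v. trunc_power M n i (v\<^sup>2)) has_real_derivative trunc_power M n (Suc i) (v\<^sup>2) * (2 * v)) (at v)"
    by (rule DERIV_chain2[OF trunc_power_deriv]) (auto intro!: derivative_eq_intros)
  then have "((\<lambda>v. v ^ a * trunc_power M n i (v\<^sup>2)) has_real_derivative (of_nat a * v ^ (a - 1)) * trunc_power M n i (v\<^sup>2) + (trunc_power M n (Suc i) (v\<^sup>2) * (2 * v)) * v ^ a) (at v)"
    by (intro DERIV_mult) (auto intro!: derivative_eq_intros)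
  then show ?thesis
    by (simp add: mult_ac)
qed

lemma partial_kernel_factor: "partial i' (kernel_factor M j a i n) = (\<lambda>x. (if i' = j then of_nat a else 0) * kernel_factor M j (a - 1) i n x + (if i' = j then 2 else 0) * kernel_factor M j (Suc a) (Suc i) n x)"
proof -
  have "has_partial i' (kernel_factor M j a i n) (\<lambda>x. if i' = j then of_real (of_nat a * ((x $ j) ^ (a - 1) * trunc_power M n i ((x $ j)\<^sup>2)) + 2 * ((x $ j) ^ Suc a * trunc_power M n (Suc i) ((x $ j)\<^sup>2))) else 0)"
    unfolding kernel_factor_def[abs_def] by (rule has_partial_coordfun[of "\<lambda>v. v ^ a * trunc_power M n i (v\<^sup>2)", OF deriv_power_trunc_power])
  from has_partialD[OF this] show ?thesis
    by (auto simp: kernel_factor_def fun_eq_iff)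
qed

lemma kernel_factor_bounds:
  assumes "i < M" "1 \<le> n" "n \<le> m" "n \<le> m'"
  shows "norm (kernel_factor M j a i m x) \<le> 2 ^ a * 2 ^ M" "norm (kernel_factor M j a i m x - kernel_factor M j a i m' x) \<le> 2 ^ a * (2 ^ M / real n)"
proof -
  let ?v = "x $ j"
  have big: "trunc_power M l i (?v\<^sup>2) = 0" if "\<not> \<bar>?v\<bar> \<le> 2" "l \<ge> n" for l
  proof (rule trunc_power_zero)
    have "2\<^sup>2 \<le> \<bar>?v\<bar>\<^sup>2" using that by (intro power_mono) auto
    then show "2 \<le> ?v\<^sup>2" by simp
  qed (use that assms in simp)
  have pw: "\<bar>?v\<bar> ^ a \<le> 2 ^ a" if "\<bar>?v\<bar> \<le> 2"
    using that by (intro power_mono) auto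
  show "norm (kernel_factor M j a i m x) \<le> 2 ^ a * 2 ^ M"
  proof (cases "\<bar>?v\<bar> \<le> 2")
    case True
    then show ?thesis
      using pw trunc_power_bound[of i M m "?v\<^sup>2"] assms by (auto simp: kernel_factor_def abs_mult power_abs simp del: of_real_mult intro!: mult_mono)
  qed (use big[of m] assms in \<open>simp add: kernel_factor_def\<close>)
  show "norm (kernel_factor M j a i m x - kernel_factor M j a i m' x) \<le> 2 ^ a * (2 ^ M / real n)"
  proof (cases "\<bar>?v\<bar> \<le> 2")
    case True
    have "kernel_factor M j a i m x - kernel_factor M j a i m' x = of_real (?v ^ a * (trunc_power M m i (?v\<^sup>2) - trunc_power M m' i (?v\<^sup>2)))"
      by (simp add: kernel_factor_def algebra_simps)
    also have "norm \<dots> = \<bar>?v\<bar> ^ a * \<bar>trunc_power M m i (?v\<^sup>2) - trunc_power M m' i (?v\<^sup>2)\<bar>"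
      by (simp only: norm_of_real abs_mult power_abs)
    also have "\<dots> \<le> 2 ^ a * (2 ^ M / real n)"
      using pw[OF True] trunc_power_diff[OF assms, of "?v\<^sup>2"] by (intro mult_mono) auto
    finally show ?thesis .
  qed (use big[of m] big[of m'] assms in \<open>simp add: kernel_factor_def\<close>)
qed

text \<open>N derivatives raise the profile index i by at most N, so i + N < M stays in the range of
  uniform convergence. \<open>Suc n\<close> excludes n = 0.\<close>

lemma CN_Cauchy_kernel_factor: "i + N < M \<Longrightarrow> CN_Cauchy N (\<lambda>n. kernel_factor M j a i (Suc n))"
proof (induction N arbitrary: a i)
  case 0
  show ?case
    unfolding CN_Cauchy_0
  proof
    show "uniformly_Cauchy_on UNIV (\<lambda>n. kernel_factor M j a i (Suc n))"
      unfolding uniformly_Cauchy_on_def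
    proof (intro allI impI)
      fix e :: real assume "e > 0"
      obtain n where n: "2 ^ a * 2 ^ M / e < real n" using reals_Archimedean2 by blast
      have "0 < 2 ^ a * 2 ^ M / e" using \<open>e > 0\<close> by simp
      then have n1: "1 \<le> n" using n by (cases n) auto
      then have ne: "2 ^ a * (2 ^ M / real n) < e"
        using n \<open>e > 0\<close> by (simp add: field_simps)
      have "dist (kernel_factor M j a i (Suc m) x) (kernel_factor M j a i (Suc m') x) < e" if "m \<ge> n" "m' \<ge> n" for m m' x
        using kernel_factor_bounds(2)[of i M n "Suc m" "Suc m'" j a x] 0 n1 that ne by (simp add: dist_norm)
      then show "\<exists>n0. \<forall>x\<in>UNIV. \<forall>m\<ge>n0. \<forall>m'\<ge>n0. dist (kernel_factor M j a i (Suc m) x) (kernel_factor M j a i (Suc m') x) < e"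
        by blast
    qed
    show "\<exists>B. \<forall>n x. norm (kernel_factor M j a i (Suc n) x) \<le> B"
    proof (intro exI[of _ "2 ^ a * 2 ^ M"] allI)
      show "norm (kernel_factor M j a i (Suc n) x) \<le> 2 ^ a * 2 ^ M" for n x
        using kernel_factor_bounds(1)[of i M 1 "Suc n" "Suc n" j a x] 0 by simp
    qed
  qed
next
  case (Suc N)
  have "CN_Cauchy N (\<lambda>n. partial i' (kernel_factor M j a i (Suc n)))" for i'
    unfolding partial_kernel_factor
    by (intro CN_Cauchy_add CN_Cauchy_mult smooth_mult smooth_const smooth_kernel_factor CN_Cauchy_const Suc.IH) (use Suc.prems in auto)
  moreover have "CN_Cauchy 0 (\<lambda>n. kernel_factor M j a i (Suc n))"
    using Suc.IH[of i a] Suc.prems CN_Cauchy_mono[of N _ 0] by simp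
  ultimately show ?case by (simp add: CN_Cauchy_Suc)
qed

text \<open>In one variable theta - s - 2c maps x^(s+2c) F(x^2) to 2 x^(s+2c+2) F'(x^2). The number
  c j counts how often this has been done in coordinate j, starting from x^s F(x^2).\<close>

definition euler_kernel :: "('n::finite \<Rightarrow> nat) \<Rightarrow> nat \<Rightarrow> nat \<Rightarrow> ('n \<Rightarrow> nat) \<Rightarrow> real^'n \<Rightarrow> complex" where
  "euler_kernel s M n c x = (\<Prod>j\<in>UNIV. of_real ((x $ j) ^ (s j + 2 * c j) * 2 ^ c j * trunc_power M n (c j) ((x $ j)\<^sup>2)))"

lemma euler_kernel_kernel_factor: "euler_kernel s M n c x = (\<Prod>j\<in>UNIV. 2 ^ c j * kernel_factor M j (s j + 2 * c j) (c j) n x)"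
  by (auto simp: euler_kernel_def kernel_factor_def intro!: prod.cong)

lemma euler_kernel_test_cube: assumes "n \<ge> 1" shows "euler_kernel s M n c \<in> test_cube 2"
proof -
  have "smooth (euler_kernel s M n c)"
    unfolding euler_kernel_kernel_factor[abs_def] by (intro smooth_prod smooth_mult smooth_const smooth_kernel_factor)
  moreover have "euler_kernel s M n c x = 0" if x: "x \<notin> cube 2" for x
  proof -
    obtain j where j: "\<bar>x $ j\<bar> > 2" using x by (auto simp: cube_def not_le)
    have "2\<^sup>2 \<le> \<bar>x $ j\<bar>\<^sup>2" using j by (intro power_mono) auto
    then have "trunc_power M n (c j) ((x $ j)\<^sup>2) = 0"
      using assms by (intro trunc_power_zero) auto
    then show ?thesis
      unfolding euler_kernel_def by (intro prod_zero) (auto intro!: bexI[of _ j])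
  qed
  ultimately show ?thesis by (simp add: test_cube_def)
qed

text \<open>The profile sees only the square of each coordinate, so the parity comes from the powers
  x_j^(s j).\<close>

lemma euler_kernel_parity: "parity s (euler_kernel s M n (\<lambda>_. 0))"
  unfolding parity_def
proof (intro allI)
  fix j and x :: "real^'a"
  define a where "a i v = complex_of_real (v ^ s i * trunc_power M n 0 (v\<^sup>2))" for i v
  have euler_kernel_a: "euler_kernel s M n (\<lambda>_. 0) y = (\<Prod>i\<in>UNIV. a i (y $ i))" for y
    by (simp add: euler_kernel_def a_def)
  have "a i (coord_mult x (reflect_coord j) $ i) = a i (x $ i) * (if i = j then (-1) ^ s j else 1)" for i
    by (auto simp: a_def reflect_coord_def power_minus[of "x $ j"] power_minus[of "complex_of_real (x $ j)"])
  then show "dil (reflect_coord j) (euler_kernel s M n (\<lambda>_. 0)) x = (-1) ^ s j * euler_kernel s M n (\<lambda>_. 0) x"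
    by (simp add: dil_apply euler_kernel_a prod.distrib del: coord_mult_nth)
qed

lemma euler_kernel_CN_Cauchy: assumes "N < M" shows "CN_Cauchy N (\<lambda>n. euler_kernel s M (Suc n) (\<lambda>_. 0))"
  unfolding euler_kernel_kernel_factor[abs_def]
  by (intro CN_Cauchy_prod CN_Cauchy_mult smooth_mult smooth_const smooth_kernel_factor CN_Cauchy_const CN_Cauchy_kernel_factor) (use assms in simp)

lemma euler_euler_kernel: "euler j (of_nat (s j + 2 * c j)) (euler_kernel s M n c) = euler_kernel s M n (c(j := Suc (c j)))"
proof
  fix x
  define a where "a i v = complex_of_real (v ^ (s i + 2 * c i) * 2 ^ c i * trunc_power M n (c i) (v\<^sup>2))" for i v
  define k where "k = s j + 2 * c j"
  define a' where "a' v = complex_of_real (2 ^ c j * (of_nat k * (v ^ (k - 1) * trunc_power M n (c j) (v\<^sup>2)) + 2 * (v ^ Suc k * trunc_power M n (Suc (c j)) (v\<^sup>2))))" for v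
  have "(a j has_vector_derivative a' v) (at v)" for v
  proof -
    have "((\<lambda>v. 2 ^ c j * (v ^ k * trunc_power M n (c j) (v\<^sup>2))) has_real_derivative
       2 ^ c j * (of_nat k * (v ^ (k - 1) * trunc_power M n (c j) (v\<^sup>2)) + 2 * (v ^ Suc k * trunc_power M n (Suc (c j)) (v\<^sup>2)))) (at v)"
      by (rule DERIV_cmult[OF deriv_power_trunc_power])
    then have "((\<lambda>v. complex_of_real (2 ^ c j * (v ^ k * trunc_power M n (c j) (v\<^sup>2)))) has_vector_derivative a' v) (at v)"
      unfolding a'_def by (rule has_vector_derivative_of_real)
    moreover have "a j = (\<lambda>v. complex_of_real (2 ^ c j * (v ^ k * trunc_power M n (c j) (v\<^sup>2))))"
      by (simp add: a_def k_def fun_eq_iff mult_ac)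
    ultimately show ?thesis by simp
  qed
  from has_partial_tensor[of a, OF this]
  have hp: "partial j (euler_kernel s M n c) = (\<lambda>x. a' (x $ j) * (\<Prod>i\<in>UNIV-{j}. a i (x $ i)))"
    by (intro has_partialD) (simp add: euler_kernel_def[abs_def] a_def)
  let ?P = "\<Prod>i\<in>UNIV-{j}. a i (x $ i)"
  have euler_kernel_split: "euler_kernel s M n c x = a j (x $ j) * ?P"
    unfolding euler_kernel_def a_def by (rule prod.remove) auto
  define c' where "c' = c(j := Suc (c j))"
  have c': "c' j = Suc (c j)" "\<And>i. i \<noteq> j \<Longrightarrow> c' i = c i" by (simp_all add: c'_def)
  have "euler_kernel s M n c' x = of_real ((x $ j) ^ (s j + 2 * c' j) * 2 ^ c' j * trunc_power M n (c' j) ((x $ j)\<^sup>2)) *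
      (\<Prod>i\<in>UNIV-{j}. of_real ((x $ i) ^ (s i + 2 * c' i) * 2 ^ c' i * trunc_power M n (c' i) ((x $ i)\<^sup>2)))"
    unfolding euler_kernel_def by (rule prod.remove) auto
  also have "(\<Prod>i\<in>UNIV-{j}. of_real ((x $ i) ^ (s i + 2 * c' i) * 2 ^ c' i * trunc_power M n (c' i) ((x $ i)\<^sup>2))) = ?P"
    by (rule prod.cong) (auto simp: a_def c'(2))
  finally have en': "euler_kernel s M n c' x = of_real ((x $ j) ^ (k + 2) * 2 ^ Suc (c j) * trunc_power M n (Suc (c j)) ((x $ j)\<^sup>2)) * ?P"
    by (simp add: k_def c'(1))
  have "of_real (x $ j) * a' (x $ j) - of_nat k * a j (x $ j) = of_real ((x $ j) ^ (k + 2) * 2 ^ Suc (c j) * trunc_power M n (Suc (c j)) ((x $ j)\<^sup>2))"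
    by (cases k) (simp_all add: a'_def a_def flip: k_def, simp_all add: algebra_simps)
  then show "euler j (of_nat (s j + 2 * c j)) (euler_kernel s M n c) x = euler_kernel s M n (c(j := Suc (c j))) x"
    unfolding euler_def hp c'_def[symmetric] en' euler_kernel_split k_def[symmetric]
    by (simp only: mult.assoc[symmetric] left_diff_distrib[symmetric])
qed

lemma euler_word_euler_kernel: "euler_word s w (euler_kernel s M n (\<lambda>_. 0)) = euler_kernel s M n (count_list w)"
proof (induction w)
  case Nil
  have "count_list [] = (\<lambda>_::'a. 0)" by (simp add: fun_eq_iff)
  then show ?case by simp
next
  case (Cons j w)
  have "count_list (j # w) = (count_list w)(j := Suc (count_list w j))"
    by (auto simp: fun_eq_iff)
  then show ?case
    by (simp only: euler_word.simps Cons.IH euler_euler_kernel)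
qed

section \<open>The kernels under coordinatewise inversion\<close>

definition coord_inverse :: "real^'n::finite \<Rightarrow> real^'n" where
  "coord_inverse y = (\<chi> j. inverse (y $ j))"

text \<open>\<open>dual_factor s c\<close> is the one-dimensional factor of \<open>euler_kernel\<close> read at \<open>1 / v\<close>, as a density with respect to \<open>dv\<close>.\<close>

definition dual_factor :: "nat \<Rightarrow> nat \<Rightarrow> nat \<Rightarrow> nat \<Rightarrow> real \<Rightarrow> real" where
  "dual_factor M n s c v = (if v = 0 then 0 else inverse v ^ (s + 2 * c) * 2 ^ c * trunc_power M n c ((inverse v)\<^sup>2) / \<bar>v\<bar>)"

definition dual_kernel :: "('n::finite \<Rightarrow> nat) \<Rightarrow> nat \<Rightarrow> nat \<Rightarrow> ('n \<Rightarrow> nat) \<Rightarrow> real^'n \<Rightarrow> complex" where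
  "dual_kernel s M n c y = (\<Prod>j\<in>UNIV. of_real (dual_factor M n (s j) (c j) (y $ j)))"

lemma dual_kernel_euler_kernel: "all_nonzero y \<Longrightarrow> dual_kernel s M n c y = euler_kernel s M n c (coord_inverse y) / of_real (\<Prod>j\<in>UNIV. \<bar>y $ j\<bar>)"
  by (simp add: dual_kernel_def euler_kernel_def dual_factor_def coord_inverse_def all_nonzero_def prod_dividef)

lemma dual_kernel_zero: "\<not> all_nonzero y \<Longrightarrow> dual_kernel s M n c y = 0"
  by (auto simp: dual_kernel_def all_nonzero_def dual_factor_def intro!: prod_zero)

text \<open>Inversion moves the bounded support of the kernel away from 0, so the singular factor
  1/|v| does no harm and the density is continuous on the whole line.\<close>

lemma dual_factor_zero: assumes "n \<ge> 1" "\<bar>v\<bar> \<le> 1/2" shows "dual_factor M n s c v = 0"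
proof (cases "v = 0")
  case False
  then have "2 \<le> inverse \<bar>v\<bar>"
    using assms(2) by (simp add: field_simps)
  then have "2\<^sup>2 \<le> (inverse \<bar>v\<bar>)\<^sup>2"
    by (intro power_mono) auto
  then have "trunc_power M n c ((inverse v)\<^sup>2) = 0"
    using assms(1) by (intro trunc_power_zero) (auto simp: power_inverse)
  then show ?thesis by (simp add: dual_factor_def)
qed (simp add: dual_factor_def)

text \<open>Up to the sign of v, v times the density is the one-dimensional kernel at 1/v; its
  derivative is -1/|v| times theta of the kernel there, and theta raises c as in
  \<open>euler_kernel\<close>. This is the integration by parts formula in one variable.\<close>

lemma dual_factor_deriv:
  assumes n: "n \<ge> 1"
  shows "((\<lambda>v. v * dual_factor M n s c v) has_real_derivative - (dual_factor M n s (Suc c) v + real (s + 2 * c) * dual_factor M n s c v)) (at v)"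
proof (cases "v = 0")
  case True
  have "((\<lambda>v. 0) has_real_derivative 0) (at v)" by simp
  then have "((\<lambda>v. v * dual_factor M n s c v) has_real_derivative 0) (at v)"
    by (rule has_field_derivative_transform_within_open[of _ _ _ "{-1/2<..<1/2}"]) (use True dual_factor_zero[OF n] in auto)
  then show ?thesis using True by (simp add: dual_factor_def)
next
  case False
  define k where "k = s + 2 * c"
  define h where "h u = 2 ^ c * (u ^ k * trunc_power M n c (u\<^sup>2))" for u
  define h' where "h' u = 2 ^ c * (of_nat k * (u ^ (k - 1) * trunc_power M n c (u\<^sup>2)) + 2 * (u ^ Suc k * trunc_power M n (Suc c) (u\<^sup>2)))" for u
  have h: "(h has_real_derivative h' u) (at u)" for u
    unfolding h_def h'_def by (rule DERIV_cmult[OF deriv_power_trunc_power])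
  have "((\<lambda>v. h (inverse v)) has_real_derivative h' (inverse v) * - (inverse v ^ Suc (Suc 0))) (at v)"
    by (rule DERIV_chain2[OF h DERIV_inverse[OF False]])
  \<comment> \<open>The sign of v is locally constant, which removes the absolute value from the
    differentiation.\<close>
  then have d: "((\<lambda>w. sgn v * h (inverse w)) has_real_derivative sgn v * (h' (inverse v) * - (inverse v ^ Suc (Suc 0)))) (at v)"
    by (rule DERIV_cmult)
  have "((\<lambda>v. v * dual_factor M n s c v) has_real_derivative sgn v * (h' (inverse v) * - (inverse v ^ Suc (Suc 0)))) (at v)"
  proof (rule has_field_derivative_transform_within_open[OF d])
    show "open {w. 0 < v * w}" by (intro open_Collect_less continuous_intros)
    show "v \<in> {w. 0 < v * w}" using False by (auto simp: zero_less_mult_iff linorder_neq_iff)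
    fix w assume "w \<in> {w. 0 < v * w}"
    then have "w \<noteq> 0" "sgn v = w / \<bar>w\<bar>" by (auto simp: zero_less_mult_iff)
    then show "sgn v * h (inverse w) = w * dual_factor M n s c w"
      by (simp add: dual_factor_def h_def k_def)
  qed
  moreover have "sgn v * (h' (inverse v) * - (inverse v ^ Suc (Suc 0))) = - (dual_factor M n s (Suc c) v + real (s + 2 * c) * dual_factor M n s c v)"
  proof -
    have sg: "sgn v * inverse v = 1 / \<bar>v\<bar>"
      using False by (cases "v > 0") (auto simp: divide_inverse)
    have "inverse v * h' (inverse v) = 2 ^ c * (of_nat k * (inverse v ^ k * trunc_power M n c ((inverse v)\<^sup>2)) + 2 * (inverse v ^ (k + 2) * trunc_power M n (Suc c) ((inverse v)\<^sup>2)))"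
      by (cases k) (simp_all add: h'_def algebra_simps)
    then have "sgn v * (h' (inverse v) * - (inverse v ^ Suc (Suc 0))) = - ((1 / \<bar>v\<bar>) * (2 ^ c * (of_nat k * (inverse v ^ k * trunc_power M n c ((inverse v)\<^sup>2)) + 2 * (inverse v ^ (k + 2) * trunc_power M n (Suc c) ((inverse v)\<^sup>2)))))"
      by (simp add: mult_ac flip: sg)
    also have "\<dots> = - (dual_factor M n s (Suc c) v + real (s + 2 * c) * dual_factor M n s c v)"
      using False by (simp add: dual_factor_def flip: k_def) (simp add: k_def add_divide_distrib algebra_simps)
    finally show ?thesis .
  qed
  ultimately show ?thesis by simp
qed

lemma dual_factor_continuous: assumes n: "n \<ge> 1" shows "continuous_on UNIV (dual_factor M n s c)"
proof -
  have c: "continuous_on UNIV (\<lambda>v. v * dual_factor M n s c v)"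
    using dual_factor_deriv[OF n] DERIV_isCont by (blast intro: continuous_at_imp_continuous_on)
  have 1: "continuous_on {v. v \<noteq> 0} (dual_factor M n s c)"
  proof (rule continuous_on_eq)
    show "continuous_on {v. v \<noteq> 0} (\<lambda>v. (v * dual_factor M n s c v) / v)"
      by (intro continuous_intros continuous_on_subset[OF c]) auto
  qed auto
  have 2: "continuous_on {-1/2<..<1/2} (dual_factor M n s c)"
    by (rule continuous_on_eq[of _ "\<lambda>v. 0"]) (use dual_factor_zero[OF n] in auto)
  have "continuous_on ({v. v \<noteq> 0} \<union> {-1/2<..<1/2}) (dual_factor M n s c)"
    by (rule continuous_on_open_Un[OF _ _ 1 2]) (auto intro: open_Collect_neq continuous_intros)
  moreover have "{v::real. v \<noteq> 0} \<union> {-1/2<..<1/2} = UNIV" by auto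
  ultimately show ?thesis by simp
qed

lemma dual_kernel_continuous: "n \<ge> 1 \<Longrightarrow> continuous_on UNIV (dual_kernel s M n c)"
  unfolding dual_kernel_def[abs_def]
  by (intro continuous_on_prod continuous_on_of_real continuous_on_compose2[OF dual_factor_continuous] continuous_on_component continuous_on_id) auto

section \<open>Integration by parts against the dual kernels\<close>

lemma cube_integrable:
  fixes f :: "real^'n::finite \<Rightarrow> complex"
  assumes "continuous_on UNIV f" "\<And>x. x \<notin> cube R \<Longrightarrow> f x = 0"
  shows "integrable lborel f"
proof -
  have "integrable (lborel_on (cube R)) f"
    by (rule continuous_on_lborel_on_integrable[OF compact_cube continuous_on_subset[OF assms(1)]]) simp
  then have "integrable lborel (\<lambda>x. indicator (cube R) x *\<^sub>R f x)"
    by (simp add: integrable_restrict_space)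
  moreover have "(\<lambda>x. indicator (cube R) x *\<^sub>R f x) = f"
    using assms(2) by (auto simp: indicator_def fun_eq_iff)
  ultimately show ?thesis by simp
qed

text \<open>Difference quotients integrate to 0 by translation invariance, and they converge with a
  common integrable bound because all of them vanish off a slightly larger cube.\<close>

lemma integral_partial_zero:
  fixes v v' :: "real^'n::finite \<Rightarrow> complex"
  assumes v: "continuous_on UNIV v" "\<And>x. x \<notin> cube R \<Longrightarrow> v x = 0"
    and hp: "has_partial j v v'"
    and v': "continuous_on UNIV v'" "\<And>x. x \<notin> cube R \<Longrightarrow> v' x = 0"
  shows "(\<integral>x. v' x \<partial>lborel) = 0"
proof -
  have "compact (v' ` cube R)"
    by (intro compact_continuous_image continuous_on_subset[OF v'(1)]) auto
  from compact_imp_bounded[OF this] obtain B0 where "\<forall>y\<in>v' ` cube R. norm y \<le> B0"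
    unfolding bounded_iff by blast
  then have B0: "norm (v' x) \<le> B0" if "x \<in> cube R" for x
    using that by blast
  define B where "B = max B0 0"
  have B: "norm (v' x) \<le> B" for x
    using B0[of x] v'(2)[of x] by (cases "x \<in> cube R") (auto simp: B_def)
  define t where "t n = inverse (real (Suc n))" for n
  have t: "0 < t n" "t n \<le> 1" for n by (auto simp: t_def field_simps)
  have tz: "t \<longlonglongrightarrow> 0" unfolding t_def by (rule LIMSEQ_inverse_real_of_nat)
  let ?q = "\<lambda>n x. (v (x + t n *\<^sub>R axis j 1) - v x) / of_real (t n)"
  have vI: "integrable lborel v" by (rule cube_integrable[OF v])
  have shift: "integrable lborel (\<lambda>x. v (x + a))" "(\<integral>x. v (x + a) \<partial>lborel) = (\<integral>x. v x \<partial>lborel)" for a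
  proof -
    have eq: "lborel = distr lborel borel (\<lambda>x::real^'n. a + x)"
      by (rule lborel_distr_plus[symmetric])
    have com: "(\<lambda>x. v (x + a)) = (\<lambda>x. v (a + x))"
      by (rule ext) (simp only: add.commute)
    have vm: "v \<in> borel_measurable borel" by (rule borel_measurable_continuous_onI[OF v(1)])
    show "integrable lborel (\<lambda>x. v (x + a))"
      unfolding com using vI by (subst (asm) eq) (simp add: integrable_distr_eq vm)
    show "(\<integral>x. v (x + a) \<partial>lborel) = (\<integral>x. v x \<partial>lborel)"
      unfolding com by (subst (2) eq) (simp add: integral_distr vm)
  qed
  have "(\<lambda>n. \<integral>x. ?q n x \<partial>lborel) \<longlonglongrightarrow> (\<integral>x. v' x \<partial>lborel)"
  proof (rule integral_dominated_convergence)
    show "v' \<in> borel_measurable lborel"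
      using borel_measurable_continuous_onI[OF v'(1)] by simp
    show "?q n \<in> borel_measurable lborel" for n
      using shift(1)[of "t n *\<^sub>R axis j 1"] vI by measurable
    have fin: "emeasure lborel (cube (R + 1) :: (real^'n) set) < \<infinity>"
      by (rule emeasure_compact_finite[OF compact_cube])
    show "integrable lborel (\<lambda>x. B * indicator (cube (R + 1) :: (real^'n) set) x)"
      by (intro integrable_mult_right integrable_real_indicator) (use fin in \<open>auto simp: borel_closed\<close>)
    show "AE x in lborel. (\<lambda>n. ?q n x) \<longlonglongrightarrow> v' x"
    proof (rule AE_I2)
      fix x
      have "((\<lambda>s. v (x + s *\<^sub>R axis j 1)) has_derivative (\<lambda>s. s *\<^sub>R v' x)) (at 0)"
        using hp by (simp add: has_partial_def has_vector_derivative_def)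
      then have "((\<lambda>s. norm (v (x + s *\<^sub>R axis j 1) - v x - s *\<^sub>R v' x) / norm s) \<longlongrightarrow> 0) (at 0)"
        unfolding has_derivative_at by simp
      moreover have "\<forall>n. t n \<in> UNIV - {0}" using t(1) by (auto simp: less_imp_neq[THEN not_sym])
      ultimately have "(\<lambda>n. norm (v (x + t n *\<^sub>R axis j 1) - v x - t n *\<^sub>R v' x) / norm (t n)) \<longlonglongrightarrow> 0"
        using tz unfolding tendsto_at_iff_sequentially o_def by blast
      moreover have "norm (v (x + t n *\<^sub>R axis j 1) - v x - t n *\<^sub>R v' x) / norm (t n) = norm (?q n x - v' x)" for n
      proof -
        have "?q n x - v' x = (v (x + t n *\<^sub>R axis j 1) - v x - t n *\<^sub>R v' x) / of_real (t n)"
          using t(1)[of n] by (simp add: diff_divide_distrib scaleR_conv_of_real)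
        then show ?thesis by (simp add: norm_divide)
      qed
      ultimately have "(\<lambda>n. norm (?q n x - v' x)) \<longlonglongrightarrow> 0" by simp
      then show "(\<lambda>n. ?q n x) \<longlonglongrightarrow> v' x"
        by (rule LIM_zero_cancel[OF tendsto_norm_zero_cancel])
    qed
    show "AE x in lborel. norm (?q n x) \<le> B * indicator (cube (R + 1)) x" for n
    proof (rule AE_I2)
      fix x
      show "norm (?q n x) \<le> B * indicator (cube (R + 1)) x"
      proof (cases "x \<in> cube (R + 1)")
        case True
        have "norm (v (x + t n *\<^sub>R axis j 1) - v x) \<le> B * \<bar>t n\<bar>"
          by (rule has_partial_lipschitz[OF hp B])
        then show ?thesis
          using True t(1)[of n] by (simp add: norm_divide divide_le_eq)
      next
        case False
        then obtain i where i: "\<bar>x $ i\<bar> > R + 1" by (auto simp: cube_def not_le)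
        then have "x \<notin> cube R" by (auto simp: cube_def not_le intro!: exI[of _ i])
        moreover have "x + t n *\<^sub>R axis j 1 \<notin> cube R"
        proof -
          have "\<bar>(x + t n *\<^sub>R axis j 1) $ i\<bar> > R"
            using i t[of n] by (auto simp: axis_def)
          then show ?thesis by (auto simp: cube_def not_le)
        qed
        ultimately show ?thesis using v(2) False by simp
      qed
    qed
  qed
  moreover have z: "(\<integral>x. ?q n x \<partial>lborel) = 0" for n
    using shift[of "t n *\<^sub>R axis j 1"] vI by (simp add: Bochner_Integration.integral_diff)
  ultimately have "(\<lambda>n::nat. 0) \<longlonglongrightarrow> (\<integral>x. v' x \<partial>lborel)"
    by (simp only: z)
  from LIMSEQ_unique[OF this tendsto_const] show ?thesis .
qed

text \<open>The integral of the j-th partial derivative of y_j times the dual kernel times F is 0,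
  and \<open>dual_factor_deriv\<close> expands it into the difference of the two sides.\<close>

lemma dual_kernel_int_by_parts:
  assumes n: "n \<ge> 1" and F: "F \<in> test_cube R"
  shows "(\<integral>y. dual_kernel s M n (c(j := Suc (c j))) y * F y \<partial>lborel) = (\<integral>y. dual_kernel s M n c y * euler j (of_nat (s j + 2 * c j)) F y \<partial>lborel)"
proof -
  let ?c = "c(j := Suc (c j))"
  let ?k = "complex_of_nat (s j + 2 * c j)"
  have sF: "smooth F" using F by (rule test_cube_smooth)
  have cF: "continuous_on UNIV F" and cpF: "continuous_on UNIV (partial j F)"
    using sF smooth_continuous smooth_partial by blast+
  have pF: "partial j F \<in> test_cube R" using F by (rule test_cube_partial)
  note cE = dual_kernel_continuous[OF n]
  define a where "a i v = complex_of_real (if i = j then v * dual_factor M n (s j) (c j) v else dual_factor M n (s i) (c i) v)" for i v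
  define a' where "a' v = complex_of_real (- (dual_factor M n (s j) (Suc (c j)) v + real (s j + 2 * c j) * dual_factor M n (s j) (c j) v))" for v
  have "(a j has_vector_derivative a' v) (at v)" for v
    using has_vector_derivative_of_real[OF dual_factor_deriv[OF n, of M "s j" "c j" v]] by (simp add: a_def[abs_def] a'_def)
  from has_partial_tensor[of a, OF this]
  have hpa: "has_partial j (\<lambda>x. \<Prod>i\<in>UNIV. a i (x $ i)) (\<lambda>x. a' (x $ j) * (\<Prod>i\<in>UNIV-{j}. a i (x $ i)))" .
  have rest: "(\<Prod>i\<in>UNIV-{j}. a i (x $ i)) = (\<Prod>i\<in>UNIV-{j}. of_real (dual_factor M n (s i) (c i) (x $ i)))" for x :: "real^'a"
    by (rule prod.cong) (auto simp: a_def)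
  have rest': "(\<Prod>i\<in>UNIV-{j}. of_real (dual_factor M n (s i) (?c i) (x $ i))) = (\<Prod>i\<in>UNIV-{j}. complex_of_real (dual_factor M n (s i) (c i) (x $ i)))" for x :: "real^'a"
    by (rule prod.cong) auto
  have E_split: "dual_kernel s M n c x = of_real (dual_factor M n (s j) (c j) (x $ j)) * (\<Prod>i\<in>UNIV-{j}. of_real (dual_factor M n (s i) (c i) (x $ i)))" for x
    unfolding dual_kernel_def by (rule prod.remove) auto
  have E_split': "dual_kernel s M n ?c x = of_real (dual_factor M n (s j) (Suc (c j)) (x $ j)) * (\<Prod>i\<in>UNIV-{j}. of_real (dual_factor M n (s i) (c i) (x $ i)))" for x
    unfolding dual_kernel_def rest'[symmetric] by (subst prod.remove[of UNIV j]) auto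
  have prod_a: "(\<Prod>i\<in>UNIV. a i (x $ i)) = of_real (x $ j) * dual_kernel s M n c x" for x
    by (subst prod.remove[of UNIV j]) (auto simp: rest E_split a_def)
  have "has_partial j (\<lambda>x. of_real (x $ j) * dual_kernel s M n c x) (\<lambda>x. - (dual_kernel s M n ?c x + ?k * dual_kernel s M n c x))"
    using hpa unfolding prod_a rest E_split E_split' a'_def by (simp add: algebra_simps)
  from has_partial_mult[OF this smooth_has_partial[OF sF]]
  have hp: "has_partial j (\<lambda>x. of_real (x $ j) * dual_kernel s M n c x * F x)
     (\<lambda>x. of_real (x $ j) * dual_kernel s M n c x * partial j F x + - (dual_kernel s M n ?c x + ?k * dual_kernel s M n c x) * F x)" .
  have "(\<integral>x. of_real (x $ j) * dual_kernel s M n c x * partial j F x + - (dual_kernel s M n ?c x + ?k * dual_kernel s M n c x) * F x \<partial>lborel) = 0"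
  proof (rule integral_partial_zero[OF _ _ hp, of R])
    have cj: "continuous_on UNIV (\<lambda>x::real^'a. complex_of_real (x $ j))"
      by (intro continuous_on_of_real continuous_on_component continuous_on_id)
    show "continuous_on UNIV (\<lambda>x. of_real (x $ j) * dual_kernel s M n c x * F x)"
      by (intro continuous_on_mult cj cE cF)
    show "continuous_on UNIV (\<lambda>x. of_real (x $ j) * dual_kernel s M n c x * partial j F x + - (dual_kernel s M n ?c x + ?k * dual_kernel s M n c x) * F x)"
      by (intro continuous_on_add continuous_on_mult continuous_on_minus continuous_on_const cj cE cF cpF)
  qed (use test_cube_zero[OF F] test_cube_zero[OF pF] in auto)
  moreover have "integrable lborel (\<lambda>x. dual_kernel s M n c x * euler j ?k F x)"
    by (rule cube_integrable[OF continuous_on_mult[OF cE smooth_continuous[OF smooth_euler[OF sF]]], of R])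
      (simp add: test_cube_zero[OF test_cube_euler[OF F]])
  moreover have "integrable lborel (\<lambda>x. dual_kernel s M n ?c x * F x)"
    by (rule cube_integrable[OF continuous_on_mult[OF cE cF], of R]) (simp add: test_cube_zero[OF F])
  moreover have "(\<lambda>x. of_real (x $ j) * dual_kernel s M n c x * partial j F x + - (dual_kernel s M n ?c x + ?k * dual_kernel s M n c x) * F x)
     = (\<lambda>x. dual_kernel s M n c x * euler j ?k F x - dual_kernel s M n ?c x * F x)"
    by (simp add: euler_def fun_eq_iff algebra_simps)
  ultimately show ?thesis
    by (simp add: Bochner_Integration.integral_diff)
qed

text \<open>The Euler factors still missing when the word w has been spent: they raise the letter
  counts from w to \<open>u @ w\<close>. On the side of F the factor with the highest exponent acts
  first.\<close>

fun euler_word_after :: "('n::finite \<Rightarrow> nat) \<Rightarrow> 'n list \<Rightarrow> 'n list \<Rightarrow> (real^'n \<Rightarrow> complex) \<Rightarrow> real^'n \<Rightarrow> complex" where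
  "euler_word_after s w [] F = F"
| "euler_word_after s w (j # u) F = euler_word_after s w u (euler j (of_nat (s j + 2 * count_list (u @ w) j)) F)"

lemma test_cube_euler_word_after: "F \<in> test_cube R \<Longrightarrow> euler_word_after s w u F \<in> test_cube R"
  by (induction u arbitrary: F) (simp_all add: test_cube_euler)

lemma euler_word_after_dil: "smooth F \<Longrightarrow> euler_word_after s w u (dil c F) = dil c (euler_word_after s w u F)"
  by (induction u arbitrary: F) (simp_all add: euler_dil smooth_euler)

lemma dual_kernel_euler_word_after:
  assumes n: "n \<ge> 1"
  shows "F \<in> test_cube R \<Longrightarrow> (\<integral>y. dual_kernel s M n (count_list (u @ w)) y * F y \<partial>lborel) = (\<integral>y. dual_kernel s M n (count_list w) y * euler_word_after s w u F y \<partial>lborel)"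
proof (induction u arbitrary: F)
  case (Cons j u)
  have c: "count_list ((j # u) @ w) = (count_list (u @ w))(j := Suc (count_list (u @ w) j))"
    by (auto simp: fun_eq_iff)
  show ?case
    unfolding c euler_word_after.simps
    by (rule trans[OF dual_kernel_int_by_parts[OF n Cons.prems] Cons.IH[OF test_cube_euler[OF Cons.prems]]])
qed simp

subsection \<open>The kernels as an approximation of a delta function\<close>

lemma smooth_step1_neg: assumes "v < 0" shows "smooth_step 1 v = 0"
proof -
  have D: "(smooth_step 0 has_real_derivative smooth_step 1 v) (at v)"
    using smooth_step(1) by (simp add: tower_def)
  have "((\<lambda>v. 1) has_real_derivative smooth_step 1 v) (at v)"
    by (rule has_field_derivative_transform_within_open[OF D, of "{..<0}"]) (use assms in \<open>auto simp: smooth_step(2)\<close>)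
  then show ?thesis
    using DERIV_unique DERIV_const by blast
qed

text \<open>The derivative of v times \<open>dual_factor 0 n 0 0 v\<close>, that is, of sgn v times
  a smoothed indicator of |v| \<ge> 1. So it has mass 1 just inside v = 1 and mass 1 just inside v =
  -1.\<close>

definition delta_approx :: "nat \<Rightarrow> real \<Rightarrow> real" where
  "delta_approx n v = - dual_factor 0 n 0 1 v"

lemma delta_approx_eq: "delta_approx n v = (if v = 0 then 0 else - (2 * real n * smooth_step 1 (real n * ((inverse v)\<^sup>2 - 1)) * (inverse v)\<^sup>2 / \<bar>v\<bar>))"
  by (simp add: delta_approx_def dual_factor_def trunc_power_def power2_eq_square)

lemma delta_approx_nonneg: "delta_approx n v \<ge> 0"
  using smooth_step(6) by (auto simp: delta_approx_eq mult_nonneg_nonpos mult_nonpos_nonneg divide_nonpos_nonneg)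

lemma delta_approx_continuous: "n \<ge> 1 \<Longrightarrow> continuous_on S (delta_approx n)"
  unfolding delta_approx_def[abs_def]
  by (intro continuous_on_minus continuous_on_subset[OF dual_factor_continuous]) auto

text \<open>The step has nonzero derivative only for 0 \<le> n (1/v^2 - 1) < 1, that is for n/(n+1)
  < v^2 \<le> 1, and v^2 \<le> |v| there.\<close>

lemma delta_approx_support:
  assumes "delta_approx n v \<noteq> 0" "n \<ge> 1"
  shows "1 - 1 / real (Suc n) \<le> \<bar>v\<bar>" "\<bar>v\<bar> \<le> 1"
proof -
  have v: "v \<noteq> 0" and all_nonzero: "smooth_step 1 (real n * ((inverse v)\<^sup>2 - 1)) \<noteq> 0"
    using assms(1) by (auto simp: delta_approx_eq split: if_splits)
  let ?x = "real n * ((inverse v)\<^sup>2 - 1)"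
  have x: "0 \<le> ?x" "?x < 1"
    using all_nonzero smooth_step1_neg[of ?x] smooth_step_zero[of ?x 1] by (auto simp: not_less[symmetric] simp del: One_nat_def)
  have v2: "v\<^sup>2 > 0" using v by simp
  have "1 \<le> (inverse v)\<^sup>2"
    using x(1) assms(2) by (simp add: zero_le_mult_iff)
  then have "v\<^sup>2 \<le> 1"
    using v2 by (simp add: power_inverse field_simps)
  then show le: "\<bar>v\<bar> \<le> 1"
    using abs_square_le_1 by blast
  have "real n < v\<^sup>2 * (real n + 1)"
    using x(2) v2 by (simp add: power_inverse field_simps)
  then have "1 - 1 / real (Suc n) < v\<^sup>2"
    by (simp add: field_simps)
  also have "v\<^sup>2 \<le> \<bar>v\<bar>"
    using mult_left_mono[OF le, of "\<bar>v\<bar>"] by (simp add: power2_eq_square)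
  finally show "1 - 1 / real (Suc n) \<le> \<bar>v\<bar>" by simp
qed

lemma delta_approx_integral:
  assumes n: "n \<ge> 1" and ab: "(a, b) \<in> {(0, 1), (-1, 0::real)}"
  shows "integrable lborel (\<lambda>v. indicator {a..b} v * delta_approx n v)" "(\<integral>v. indicator {a..b} v * delta_approx n v \<partial>lborel) = 1"
proof -
  have "integrable (lborel_on {a..b}) (delta_approx n)"
    by (rule continuous_on_lborel_on_integrable[OF compact_Icc delta_approx_continuous[OF n]])
  then have I: "integrable lborel (\<lambda>v. indicator {a..b} v *\<^sub>R delta_approx n v)"
    by (simp add: integrable_restrict_space)
  then show "integrable lborel (\<lambda>v. indicator {a..b} v * delta_approx n v)" by simp
  have "(delta_approx n has_integral (b * dual_factor 0 n 0 0 b - a * dual_factor 0 n 0 0 a)) {a..b}"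
  proof (rule fundamental_theorem_of_calculus)
    fix v
    have "((\<lambda>v. v * dual_factor 0 n 0 0 v) has_real_derivative delta_approx n v) (at v)"
      using dual_factor_deriv[OF n, of 0 0 0 v] by (simp add: delta_approx_def)
    then show "((\<lambda>v. v * dual_factor 0 n 0 0 v) has_vector_derivative delta_approx n v) (at v within {a..b})"
      by (simp add: has_real_derivative_iff_has_vector_derivative has_vector_derivative_at_within)
  qed (use ab in auto)
  then have "integral {a..b} (delta_approx n) = 1"
    using ab by (auto simp: dual_factor_def trunc_power_def smooth_step integral_unique)
  then show "(\<integral>v. indicator {a..b} v * delta_approx n v \<partial>lborel) = 1"
    using set_borel_integral_eq_integral(2)[of "{a..b}" "delta_approx n"] I
    by (simp add: set_integrable_def set_lebesgue_integral_def)
qed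

lemma delta_approx_split: assumes "n \<ge> 1" shows "delta_approx n v = indicator {0..1} v * delta_approx n v + indicator {-1..0} v * delta_approx n v"
  using delta_approx_support(2)[of n v] assms by (cases "delta_approx n v = 0") (auto simp: indicator_def delta_approx_eq)

lemma delta_approx_total:
  assumes n: "n \<ge> 1"
  shows "integrable lborel (delta_approx n)" "(\<integral>v. delta_approx n v \<partial>lborel) = 2"
proof -
  have eq: "delta_approx n = (\<lambda>v. indicator {0..1} v * delta_approx n v + indicator {-1..0} v * delta_approx n v)"
    using delta_approx_split[OF n] by (rule ext)
  have I1: "integrable lborel (\<lambda>v. indicator {0..1} v * delta_approx n v)" "(\<integral>v. indicator {0..1} v * delta_approx n v \<partial>lborel) = 1"
    using delta_approx_integral[OF n, of 0 1] by auto
  have I2: "integrable lborel (\<lambda>v. indicator {-1..0} v * delta_approx n v)" "(\<integral>v. indicator {-1..0} v * delta_approx n v \<partial>lborel) = 1"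
    using delta_approx_integral[OF n, of "-1" 0] by auto
  show "integrable lborel (delta_approx n)"
    by (subst eq) (intro Bochner_Integration.integrable_add I1 I2)
  show "(\<integral>v. delta_approx n v \<partial>lborel) = 2"
    by (subst eq) (simp add: Bochner_Integration.integral_add I1 I2)
qed

text \<open>One derivative beyond order M reaches the derivative of the smoothed indicator, hence
  the concentrating density.\<close>

lemma dual_factor_top: "dual_factor M n s (Suc M) v = inverse v ^ (s + 2 * M) * 2 ^ M * (-1) ^ Suc M * delta_approx n v"
proof (cases "v = 0")
  case False
  have "inverse v ^ (s + 2 * Suc M) = inverse v ^ (s + 2 * M) * (inverse v)\<^sup>2"
    by (simp flip: power_add)
  then show ?thesis
    using False by (simp add: dual_factor_def delta_approx_eq trunc_power_def)
qed (simp add: dual_factor_def delta_approx_def)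

definition parities :: "('n::finite \<Rightarrow> nat) set" where
  "parities = PiE UNIV (\<lambda>_. {0, 1})"

lemma parities_zero_one: "s \<in> parities \<Longrightarrow> zero_one s"
  by (auto simp: parities_def zero_one_def PiE_def Pi_def)

lemma finite_parities: "finite parities"
  unfolding parities_def by (intro finite_PiE) auto

text \<open>The two parities of a coordinate add up to the factor 1 + 1/y_j, which vanishes at y_j =
  -1 and so cancels the concentration there.\<close>

lemma sum_dual_kernel:
  "(\<Sum>s\<in>parities. dual_kernel s M n (\<lambda>_. Suc M) y) = (\<Prod>j\<in>UNIV. of_real (delta_approx n (y $ j))) *
     (\<Prod>j\<in>UNIV. of_real ((1 + inverse (y $ j)) * inverse (y $ j) ^ (2 * M) * 2 ^ M * (-1) ^ Suc M))"
proof -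
  have "(\<Sum>s\<in>parities. dual_kernel s M n (\<lambda>_. Suc M) y) = (\<Prod>j\<in>UNIV. \<Sum>s\<in>{0,1}. complex_of_real (dual_factor M n s (Suc M) (y $ j)))"
    unfolding dual_kernel_def parities_def by (rule prod_sum_PiE[symmetric]) auto
  also have "\<dots> = (\<Prod>j\<in>UNIV. of_real (delta_approx n (y $ j)) * of_real ((1 + inverse (y $ j)) * inverse (y $ j) ^ (2 * M) * 2 ^ M * (-1) ^ Suc M))"
    by (rule prod.cong) (simp_all add: dual_factor_top algebra_simps)
  finally show ?thesis
    unfolding prod.distrib .
qed

definition annulus :: "real \<Rightarrow> real \<Rightarrow> (real^'n::finite) set" where
  "annulus r R = {y. \<forall>j. r \<le> \<bar>y $ j\<bar> \<and> \<bar>y $ j\<bar> \<le> R}"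

lemma compact_annulus: "compact (annulus r R :: (real^'n::finite) set)"
proof -
  have "annulus r R = cube R \<inter> (\<Inter>j. {y::real^'n. r \<le> \<bar>y $ j\<bar>})"
    by (auto simp: annulus_def cube_def)
  moreover have "closed (\<Inter>j. {y::real^'n. r \<le> \<bar>y $ j\<bar>})"
    by (intro closed_INT ballI closed_Collect_le continuous_intros)
  ultimately show ?thesis
    by (simp add: compact_Int_closed)
qed

lemma annulus_all_nonzero: "0 < r \<Longrightarrow> y \<in> annulus r R \<Longrightarrow> all_nonzero y"
  by (auto simp: annulus_def all_nonzero_def) (metis abs_zero not_le)

lemma sum_dual_kernel_zero:
  assumes "n \<ge> 1" "y \<notin> annulus (1/2) 1"
  shows "(\<Sum>s\<in>parities. dual_kernel s M n (\<lambda>_. Suc M) y) = 0"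
proof -
  obtain j where j: "\<not> (1/2 \<le> \<bar>y $ j\<bar> \<and> \<bar>y $ j\<bar> \<le> 1)"
    using assms(2) by (auto simp: annulus_def)
  have "(1/2::real) \<le> 1 - 1 / real (Suc n)"
    using assms(1) by (simp add: field_simps)
  then have "delta_approx n (y $ j) = 0"
    using delta_approx_support[of n "y $ j"] assms(1) j by linarith
  then show ?thesis
    unfolding sum_dual_kernel by (simp add: prod_zero_iff) (metis)
qed

text \<open>The product densities concentrate at all sign vectors, but the remaining factor vanishes
  at each of them except 1. The constant collects 1 + 1 = 2, the power 2^M and a sign from every
  coordinate.\<close>

lemma kernel_limit:
  fixes G :: "real^'n::finite \<Rightarrow> complex"
  assumes G: "continuous_on UNIV G"
  shows "(\<lambda>n. \<integral>y. (\<Sum>s\<in>parities. dual_kernel s M (Suc n) (\<lambda>_. Suc M) y) * G y \<partial>lborel) \<longlonglongrightarrow> (2 ^ Suc M * (-1) ^ Suc M) ^ CARD('n) * G 1"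
  unfolding LIMSEQ_iff
proof (intro allI impI)
  fix e :: real assume "e > 0"
  define d where "d = real CARD('n)"
  have d: "d > 0" by (simp add: d_def)
  \<comment> \<open>The product density has total mass 2^d, one unit for each sign vector.\<close>
  define \<eta> where "\<eta> = e / (2 * 2 ^ CARD('n))"
  have \<eta>: "\<eta> > 0" "\<eta> * 2 ^ CARD('n) < e" using \<open>e > 0\<close> by (simp_all add: \<eta>_def)
  let ?C = "annulus (1/2) 1 :: (real^'n) set"
  define \<Phi> where "\<Phi> y = (\<Prod>j\<in>UNIV. complex_of_real ((1 + inverse (y $ j)) * inverse (y $ j) ^ (2 * M) * 2 ^ M * (-1) ^ Suc M))" for y :: "real^'n"
  define H where "H y = \<Phi> y * G y" for y
  have "continuous_on ?C H"
    unfolding H_def \<Phi>_def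
    by (intro continuous_on_mult continuous_on_prod continuous_on_of_real continuous_on_add continuous_on_power continuous_on_const
        continuous_on_inverse continuous_on_component continuous_on_id continuous_on_subset[OF G] ballI)
       (auto dest!: annulus_all_nonzero[rotated] simp: all_nonzero_def)
  then have "uniformly_continuous_on ?C H"
    by (rule compact_uniformly_continuous[OF _ compact_annulus])
  then obtain \<delta> where \<delta>: "\<delta> > 0" "\<forall>x\<in>?C. \<forall>x'\<in>?C. dist x' x < \<delta> \<longrightarrow> dist (H x') (H x) < \<eta>"
    unfolding uniformly_continuous_on_def using \<eta>(1) by blast
  obtain n0 :: nat where n0: "d / \<delta> < real n0" using reals_Archimedean2 by blast
  have H1: "H 1 = (2 ^ Suc M * (-1) ^ Suc M) ^ CARD('n) * G 1"
    by (simp add: H_def \<Phi>_def mult_ac)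
  have "norm ((\<integral>y. (\<Sum>s\<in>parities. dual_kernel s M (Suc n) (\<lambda>_. Suc M) y) * G y \<partial>lborel) - H 1) < e" if n: "n \<ge> n0" for n
  proof -
    let ?n = "Suc n"
    have n1: "?n \<ge> 1" by simp
    define bp where "bp v = indicator {0..1} v * delta_approx ?n v" for v
    define P where "P y = (\<Prod>j\<in>UNIV. delta_approx ?n (y $ j))" for y :: "real^'n"
    define Pp where "Pp y = (\<Prod>j\<in>UNIV. bp (y $ j))" for y :: "real^'n"
    have PI: "integrable lborel P" "(\<integral>y. P y \<partial>lborel) = 2 ^ CARD('n)"
      using lborel_prod_integral[of "\<lambda>_::'n. delta_approx ?n", OF delta_approx_total(1)[OF n1]] delta_approx_total(2)[OF n1] by (simp_all add: P_def[abs_def])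
    have PpI: "integrable lborel Pp" "(\<integral>y. Pp y \<partial>lborel) = 1"
      using lborel_prod_integral[of "\<lambda>_::'n. bp"] delta_approx_integral[OF n1, of 0 1] by (simp_all add: Pp_def[abs_def] bp_def[abs_def])
    have eq: "(\<Sum>s\<in>parities. dual_kernel s M ?n (\<lambda>_. Suc M) y) * G y = of_real (P y) * H y" for y
      by (simp add: sum_dual_kernel P_def H_def \<Phi>_def)
    have "continuous_on UNIV (\<lambda>y. (\<Sum>s\<in>parities. dual_kernel s M ?n (\<lambda>_. Suc M) y) * G y)"
      by (intro continuous_on_mult continuous_on_sum dual_kernel_continuous n1 G)
    moreover have "(\<Sum>s\<in>parities. dual_kernel s M ?n (\<lambda>_. Suc M) y) * G y = 0" if "y \<notin> cube 1" for y
    proof -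
      have "y \<notin> ?C" using that by (auto simp: annulus_def cube_def)
      from sum_dual_kernel_zero[OF n1 this] show ?thesis by (simp only: mult_zero_left)
    qed
    ultimately have "integrable lborel (\<lambda>y. (\<Sum>s\<in>parities. dual_kernel s M ?n (\<lambda>_. Suc M) y) * G y)"
      by (rule cube_integrable)
    then have HI: "integrable lborel (\<lambda>y. of_real (P y) * H y)" by (simp only: eq)
    have bound: "norm (of_real (P y) * H y - of_real (Pp y) * H 1) \<le> P y * \<eta>" for y
    proof (cases "P y = 0")
      case True
      then obtain j where "delta_approx ?n (y $ j) = 0" by (auto simp: P_def)
      then have "Pp y = 0" unfolding Pp_def by (intro prod_zero) (auto simp: bp_def intro!: bexI[of _ j])
      then show ?thesis using True by simp
    next
      case False
      then have bnz: "delta_approx ?n (y $ j) \<noteq> 0" for j by (auto simp: P_def)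
      have yj: "1 - 1 / real (Suc ?n) \<le> \<bar>y $ j\<bar>" "\<bar>y $ j\<bar> \<le> 1" for j
        using delta_approx_support[OF bnz n1] by auto
      have "(1/2::real) \<le> 1 - 1 / real (Suc ?n)" by (simp add: field_simps)
      then have half: "1/2 \<le> \<bar>y $ j\<bar>" for j using yj(1)[of j] by linarith
      have yC: "y \<in> ?C" using half yj(2) by (simp add: annulus_def)
      \<comment> \<open>The sign vector nearest to y: on the support every |y_j| is within 1/(n+2)
        of 1.\<close>
      define sg :: "real^'n" where "sg = (\<chi> j. sgn (y $ j))"
      have ynz: "y $ j \<noteq> 0" for j using half[of j] by auto
      have sgC: "sg \<in> ?C" using ynz by (simp add: annulus_def sg_def abs_sgn_eq)
      have "dist y sg \<le> (\<Sum>j\<in>UNIV. \<bar>(y - sg) $ j\<bar>)"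
        unfolding dist_norm by (rule norm_le_l1_cart)
      also have "\<dots> \<le> d * (1 / real (Suc ?n))"
        unfolding d_def
      proof (rule sum_bounded_above)
        fix j
        show "\<bar>(y - sg) $ j\<bar> \<le> 1 / real (Suc ?n)"
          using yj[of j] ynz[of j] by (auto simp: sg_def sgn_if abs_if split: if_splits)
      qed
      also have "\<dots> < \<delta>"
      proof -
        have "d / \<delta> < real (Suc ?n)" using n0 n by simp
        then show ?thesis using \<delta>(1) by (simp add: field_simps)
      qed
      finally have Hd: "norm (H y - H sg) \<le> \<eta>"
        using \<delta>(2) yC sgC by (simp add: dist_norm less_imp_le)
      have Pnn: "P y \<ge> 0" unfolding P_def by (intro prod_nonneg) (simp add: delta_approx_nonneg)
      have "of_real (P y) * H sg = of_real (Pp y) * H 1"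
      proof (cases "\<forall>j. y $ j > 0")
        case True
        then have "sg = 1" by (simp add: sg_def vec_eq_iff)
        moreover have "Pp y = P y"
          unfolding Pp_def P_def by (rule prod.cong) (use True yj(2) in \<open>auto simp: bp_def indicator_def less_imp_le\<close>)
        ultimately show ?thesis by simp
      next
        case False
        then obtain j where j: "y $ j < 0" using ynz by (metis linorder_neqE_linordered_idom)
        then have "bp (y $ j) = 0" by (simp add: bp_def)
        then have "Pp y = 0" unfolding Pp_def by (intro prod_zero) (auto intro!: bexI[of _ j])
        \<comment> \<open>Some coordinate of sg is -1, and there the factor 1 + 1/y_j is
          zero.\<close>
        moreover have "\<Phi> sg = 0"
          unfolding \<Phi>_def by (rule prod_zero) (use j in \<open>auto simp: sg_def intro!: exI[of _ j]\<close>)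
        ultimately show ?thesis by (simp add: H_def)
      qed
      then have "of_real (P y) * H y - of_real (Pp y) * H 1 = of_real (P y) * (H y - H sg)"
        by (simp add: algebra_simps)
      then show ?thesis
        using Hd Pnn by (simp add: norm_mult mult_left_mono)
    qed
    have I1: "integrable lborel (\<lambda>y. of_real (Pp y) * H 1)"
      using PpI(1) by (intro integrable_mult_left integrable_of_real)
    have i1: "(\<integral>y. of_real (Pp y) * H 1 \<partial>lborel) = H 1"
      using PpI by simp
    have "norm ((\<integral>y. of_real (P y) * H y \<partial>lborel) - H 1) = norm (\<integral>y. of_real (P y) * H y - of_real (Pp y) * H 1 \<partial>lborel)"
      unfolding Bochner_Integration.integral_diff[OF HI I1] i1 ..
    also have "\<dots> \<le> (\<integral>y. norm (of_real (P y) * H y - of_real (Pp y) * H 1) \<partial>lborel)"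
      by (rule integral_norm_bound)
    also have "\<dots> \<le> (\<integral>y. P y * \<eta> \<partial>lborel)"
      by (rule integral_mono[OF integrable_norm[OF Bochner_Integration.integrable_diff[OF HI I1]] integrable_mult_left[OF PI(1)] bound])
    also have "\<dots> = \<eta> * 2 ^ CARD('n)"
      using PI by simp
    also have "\<dots> < e" by (rule \<eta>(2))
    finally show ?thesis by (simp only: eq)
  qed
  then show "\<exists>n0. \<forall>n\<ge>n0. norm ((\<integral>y. (\<Sum>s\<in>parities. dual_kernel s M (Suc n) (\<lambda>_. Suc M) y) * G y \<partial>lborel) - (2 ^ Suc M * (-1) ^ Suc M) ^ CARD('n) * G 1) < e"
    unfolding H1 by blast
qed

lemma integral_coord_mult:
  fixes F :: "real^'n::finite \<Rightarrow> complex"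
  assumes z: "all_nonzero \<xi>" and F: "F \<in> borel_measurable borel"
  shows "(\<integral>x. F x \<partial>lborel) = of_real (\<Prod>j\<in>UNIV. \<bar>\<xi> $ j\<bar>) * (\<integral>y. F (coord_mult \<xi> y) \<partial>lborel)"
proof -
  let ?T = "\<lambda>x. 0 + (\<Sum>b\<in>Basis. ((\<xi> \<bullet> b) * (x \<bullet> b)) *\<^sub>R b)"
  have inB: "b \<in> (Basis :: (real^'n) set) \<Longrightarrow> \<exists>j. b = axis j 1" for b
    by (auto simp: Basis_vec_def)
  have T: "?T x = coord_mult \<xi> x" for x
  proof (rule euclidean_eqI)
    fix b :: "real^'n" assume b: "b \<in> Basis"
    then obtain j where j: "b = axis j 1" using inB by blast
    have "?T x \<bullet> b = (\<xi> \<bullet> b) * (x \<bullet> b)"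
      using inner_sum_left_Basis[OF b, of "\<lambda>b. (\<xi> \<bullet> b) * (x \<bullet> b)"] by simp
    then show "?T x \<bullet> b = coord_mult \<xi> x \<bullet> b"
      by (simp add: j inner_axis)
  qed
  have nzb: "\<xi> \<bullet> b \<noteq> 0" if "b \<in> Basis" for b
    using inB[OF that] z by (auto simp: all_nonzero_def inner_axis)
  have pr: "(\<Prod>b\<in>Basis. \<bar>\<xi> \<bullet> b\<bar>) = (\<Prod>j\<in>UNIV. \<bar>\<xi> $ j\<bar>)"
  proof -
    have B: "(Basis :: (real^'n) set) = (\<lambda>j. axis j 1) ` UNIV"
      by (auto simp: Basis_vec_def)
    have inj: "inj (\<lambda>j. axis j (1::real) :: real^'n)"
      by (auto simp: inj_on_def axis_eq_axis)
    show ?thesis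
      unfolding B by (subst prod.reindex[OF inj]) (simp add: inner_axis)
  qed
  have eq: "lborel = density (distr lborel borel (coord_mult \<xi>)) (\<lambda>_. ennreal (\<Prod>j\<in>UNIV. \<bar>\<xi> $ j\<bar>))"
    using lborel_affine_euclidean[of "\<lambda>b. \<xi> \<bullet> b" 0, OF nzb] unfolding T pr by (simp add: T[abs_def])
  have hmm: "coord_mult \<xi> \<in> measurable lborel borel"
    by (simp add: borel_measurable_continuous_onI continuous_on_coord_mult)
  have "(\<integral>x. F x \<partial>lborel) = (\<integral>x. F x \<partial>density (distr lborel borel (coord_mult \<xi>)) (\<lambda>_. ennreal (\<Prod>j\<in>UNIV. \<bar>\<xi> $ j\<bar>)))"
    using eq by simp
  also have "\<dots> = (\<integral>x. (\<Prod>j\<in>UNIV. \<bar>\<xi> $ j\<bar>) *\<^sub>R F x \<partial>distr lborel borel (coord_mult \<xi>))"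
    by (rule integral_density) (use F in \<open>auto intro!: AE_I2 prod_nonneg\<close>)
  also have "\<dots> = (\<integral>y. (\<Prod>j\<in>UNIV. \<bar>\<xi> $ j\<bar>) *\<^sub>R F (coord_mult \<xi> y) \<partial>lborel)"
    by (rule integral_distr[OF hmm]) (use F in measurable)
  also have "\<dots> = of_real (\<Prod>j\<in>UNIV. \<bar>\<xi> $ j\<bar>) * (\<integral>y. F (coord_mult \<xi> y) \<partial>lborel)"
    by (simp add: scaleR_conv_of_real)
  finally show ?thesis .
qed

subsection \<open>Representation by Euler derivatives\<close>

text \<open>The clause of \<open>O_H\<close> for a single order k, isolated so that closure under
  sums, scalars and Euler operators can be proved for it.\<close>

definition theta_rep :: "nat \<Rightarrow> ((real^'n::finite \<Rightarrow> complex) \<Rightarrow> complex) \<Rightarrow> bool" where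
  "theta_rep k S \<longleftrightarrow> (\<exists>B :: 'n list set. \<exists>t :: 'n list \<Rightarrow> real^'n \<Rightarrow> complex.
        finite B \<and>
        (\<forall>w\<in>B. t w \<in> borel_measurable lborel \<and>
           (\<exists>C. AE x in lborel. (1 + (norm x)\<^sup>2) powr (real k / 2) * norm (t w x) \<le> C)) \<and>
        (\<forall>f\<in>test_fun. S f = (\<Sum>w\<in>B. theta_word w (regular (t w)) f)))"

lemma O_H_theta_rep: "T \<in> O_H \<longleftrightarrow> distribution T \<and> (\<forall>k. theta_rep k T)"
  by (simp add: O_H_def theta_rep_def)

lemma test_adjoint_word: "f \<in> test_fun \<Longrightarrow> adjoint_word w f \<in> test_fun"
  by (induction w arbitrary: f) (simp_all add: test_euler)

text \<open>The weight is at least 1, so t is essentially bounded, while f is integrable.\<close>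

lemma weight_times_test_integrable:
  fixes t :: "real^'n::finite \<Rightarrow> complex"
  assumes t: "t \<in> borel_measurable lborel" and C: "AE x in lborel. (1 + (norm x)\<^sup>2) powr (real k / 2) * norm (t x) \<le> C"
    and f: "f \<in> test_fun"
  shows "integrable lborel (\<lambda>x. t x * f x)"
proof -
  obtain R where R: "f \<in> test_cube R" using test_test_cube[OF f] by blast
  have cf: "continuous_on UNIV f" by (rule smooth_continuous[OF test_smooth[OF f]])
  have fI: "integrable lborel f" by (rule cube_integrable[OF cf test_cube_zero[OF R]])
  show ?thesis
  proof (rule Bochner_Integration.integrable_bound)
    show "integrable lborel (\<lambda>x. C * norm (f x))" using fI by simp
    show "(\<lambda>x. t x * f x) \<in> borel_measurable lborel" using t fI by measurable
    show "AE x in lborel. norm (t x * f x) \<le> norm (C * norm (f x))"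
      using C
    proof (rule AE_mp, intro AE_I2 impI)
      fix x :: "real^'n"
      assume le: "(1 + (norm x)\<^sup>2) powr (real k / 2) * norm (t x) \<le> C"
      have "1 \<le> (1 + (norm x)\<^sup>2) powr (real k / 2)"
        by (rule ge_one_powr_ge_zero) auto
      then have "1 * norm (t x) \<le> (1 + (norm x)\<^sup>2) powr (real k / 2) * norm (t x)"
        by (rule mult_right_mono) simp
      then have "norm (t x) \<le> \<bar>C\<bar>" using le by linarith
      then show "norm (t x * f x) \<le> norm (C * norm (f x))"
        by (simp add: norm_mult abs_mult mult_right_mono)
    qed
  qed
qed

lemma theta_rep_cong: "theta_rep k S \<Longrightarrow> (\<And>f. f \<in> test_fun \<Longrightarrow> S' f = S f) \<Longrightarrow> theta_rep k S'"
  unfolding theta_rep_def by simp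

lemma theta_rep_regular:
  assumes "t \<in> borel_measurable lborel" "AE x in lborel. (1 + (norm x)\<^sup>2) powr (real k / 2) * norm (t x) \<le> C"
  shows "theta_rep k (regular t)"
  unfolding theta_rep_def using assms by (intro exI[of _ "{[]}"] exI[of _ "\<lambda>_. t"]) auto

lemma theta_rep_cmult:
  assumes "theta_rep k S" shows "theta_rep k (\<lambda>f. c * S f)"
proof -
  obtain B t where B: "finite B" and t: "\<And>w. w \<in> B \<Longrightarrow> t w \<in> borel_measurable lborel"
    "\<And>w. w \<in> B \<Longrightarrow> \<exists>C. AE x in lborel. (1 + (norm x)\<^sup>2) powr (real k / 2) * norm (t w x) \<le> C"
    and S: "\<And>f. f \<in> test_fun \<Longrightarrow> S f = (\<Sum>w\<in>B. theta_word w (regular (t w)) f)"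
    using assms unfolding theta_rep_def by blast
  have "\<exists>C. AE x in lborel. (1 + (norm x)\<^sup>2) powr (real k / 2) * norm (c * t w x) \<le> C" if w: "w \<in> B" for w
  proof -
    obtain C where C: "AE x in lborel. (1 + (norm x)\<^sup>2) powr (real k / 2) * norm (t w x) \<le> C"
      using t(2)[OF w] by blast
    have "AE x in lborel. (1 + (norm x)\<^sup>2) powr (real k / 2) * norm (c * t w x) \<le> norm c * C"
      using C
    proof (rule AE_mp, intro AE_I2 impI)
      fix x
      assume "(1 + (norm x)\<^sup>2) powr (real k / 2) * norm (t w x) \<le> C"
      from mult_left_mono[OF this norm_ge_zero[of c]]
      show "(1 + (norm x)\<^sup>2) powr (real k / 2) * norm (c * t w x) \<le> norm c * C"
        by (simp add: norm_mult mult_ac)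
    qed
    then show ?thesis ..
  qed
  moreover have "(\<lambda>x. c * t w x) \<in> borel_measurable lborel" if "w \<in> B" for w
    using t(1)[OF that] by (intro borel_measurable_times borel_measurable_const)
  moreover have "c * S f = (\<Sum>w\<in>B. theta_word w (regular (\<lambda>x. c * t w x)) f)" if "f \<in> test_fun" for f
    unfolding S[OF that] theta_word_eq regular_def sum_distrib_left by (simp add: mult_ac)
  ultimately show ?thesis
    unfolding theta_rep_def using B by (intro exI[of _ B] exI[of _ "\<lambda>w x. c * t w x"]) blast
qed

lemma theta_rep_add:
  fixes S1 S2 :: "(real^'n::finite \<Rightarrow> complex) \<Rightarrow> complex"
  assumes "theta_rep k S1" "theta_rep k S2" shows "theta_rep k (\<lambda>f. S1 f + S2 f)"
proof -
  obtain B1 t1 where B1: "finite B1" and t1: "\<And>w. w \<in> B1 \<Longrightarrow> t1 w \<in> borel_measurable lborel"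
    "\<And>w. w \<in> B1 \<Longrightarrow> \<exists>C. AE x in lborel. (1 + (norm x)\<^sup>2) powr (real k / 2) * norm (t1 w x) \<le> C"
    and S1: "\<And>f. f \<in> test_fun \<Longrightarrow> S1 f = (\<Sum>w\<in>B1. theta_word w (regular (t1 w)) f)"
    using assms(1) unfolding theta_rep_def by blast
  obtain B2 t2 where B2: "finite B2" and t2: "\<And>w. w \<in> B2 \<Longrightarrow> t2 w \<in> borel_measurable lborel"
    "\<And>w. w \<in> B2 \<Longrightarrow> \<exists>C. AE x in lborel. (1 + (norm x)\<^sup>2) powr (real k / 2) * norm (t2 w x) \<le> C"
    and S2: "\<And>f. f \<in> test_fun \<Longrightarrow> S2 f = (\<Sum>w\<in>B2. theta_word w (regular (t2 w)) f)"
    using assms(2) unfolding theta_rep_def by blast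
  \<comment> \<open>Both families are extended by zero to the union of their index sets, where they
    can be added termwise.\<close>
  define u1 where "u1 w = (if w \<in> B1 then t1 w else (\<lambda>x. 0))" for w
  define u2 where "u2 w = (if w \<in> B2 then t2 w else (\<lambda>x. 0))" for w
  have m1: "u1 w \<in> borel_measurable lborel" and m2: "u2 w \<in> borel_measurable lborel" for w
    using t1(1)[of w] t2(1)[of w] by (auto simp: u1_def u2_def)
  have c1: "\<exists>C. AE x in lborel. (1 + (norm x)\<^sup>2) powr (real k / 2) * norm (u1 w x) \<le> C" for w
    using t1(2)[of w] by (cases "w \<in> B1") (auto simp: u1_def)
  have c2: "\<exists>C. AE x in lborel. (1 + (norm x)\<^sup>2) powr (real k / 2) * norm (u2 w x) \<le> C" for w
    using t2(2)[of w] by (cases "w \<in> B2") (auto simp: u2_def)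
  have "\<exists>C. AE x in lborel. (1 + (norm x)\<^sup>2) powr (real k / 2) * norm (u1 w x + u2 w x) \<le> C" for w
  proof -
    obtain C1 C2 where C: "AE x in lborel. (1 + (norm x)\<^sup>2) powr (real k / 2) * norm (u1 w x) \<le> C1"
      "AE x in lborel. (1 + (norm x)\<^sup>2) powr (real k / 2) * norm (u2 w x) \<le> C2"
      using c1[of w] c2[of w] by blast
    have "AE x in lborel. (1 + (norm x)\<^sup>2) powr (real k / 2) * norm (u1 w x + u2 w x) \<le> C1 + C2"
      using C
    proof eventually_elim
      case (elim x)
      have "(1 + (norm x)\<^sup>2) powr (real k / 2) * norm (u1 w x + u2 w x) \<le> (1 + (norm x)\<^sup>2) powr (real k / 2) * (norm (u1 w x) + norm (u2 w x))"
        by (intro mult_left_mono norm_triangle_ineq) simp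
      then show ?case using elim by (simp add: distrib_left)
    qed
    then show ?thesis ..
  qed
  moreover have "(\<lambda>x. u1 w x + u2 w x) \<in> borel_measurable lborel" for w
    using m1 m2 by (rule borel_measurable_add)
  moreover have "S1 f + S2 f = (\<Sum>w\<in>B1 \<union> B2. theta_word w (regular (\<lambda>x. u1 w x + u2 w x)) f)" if f: "f \<in> test_fun" for f
  proof -
    have "theta_word w (regular (\<lambda>x. u1 w x + u2 w x)) f = theta_word w (regular (u1 w)) f + theta_word w (regular (u2 w)) f" for w
    proof -
      obtain C1 C2 where C: "AE x in lborel. (1 + (norm x)\<^sup>2) powr (real k / 2) * norm (u1 w x) \<le> C1"
        "AE x in lborel. (1 + (norm x)\<^sup>2) powr (real k / 2) * norm (u2 w x) \<le> C2"
        using c1[of w] c2[of w] by blast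
      have "regular (\<lambda>x. u1 w x + u2 w x) (adjoint_word w f) = regular (u1 w) (adjoint_word w f) + regular (u2 w) (adjoint_word w f)"
        unfolding regular_def distrib_right
        by (rule Bochner_Integration.integral_add[OF weight_times_test_integrable[OF m1 C(1) test_adjoint_word[OF f]]
              weight_times_test_integrable[OF m2 C(2) test_adjoint_word[OF f]]])
      then show ?thesis
        by (simp add: theta_word_eq distrib_left)
    qed
    moreover have "S1 f = (\<Sum>w\<in>B1 \<union> B2. theta_word w (regular (u1 w)) f)"
      unfolding S1[OF f]
      by (rule sum.mono_neutral_cong_left) (use B1 B2 in \<open>auto simp: u1_def theta_word_eq regular_def\<close>)
    moreover have "S2 f = (\<Sum>w\<in>B1 \<union> B2. theta_word w (regular (u2 w)) f)"
      unfolding S2[OF f]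
      by (rule sum.mono_neutral_cong_left) (use B1 B2 in \<open>auto simp: u2_def theta_word_eq regular_def\<close>)
    ultimately show ?thesis by (simp add: sum.distrib)
  qed
  ultimately show ?thesis
    unfolding theta_rep_def using B1 B2
    by (intro exI[of _ "B1 \<union> B2"] exI[of _ "\<lambda>w x. u1 w x + u2 w x"]) blast
qed

lemma theta_rep_sum:
  "finite A \<Longrightarrow> A \<noteq> {} \<Longrightarrow> (\<And>a. a \<in> A \<Longrightarrow> theta_rep k (S a)) \<Longrightarrow> theta_rep k (\<lambda>f. \<Sum>a\<in>A. S a f)"
proof (induction A rule: finite_ne_induct)
  case (insert a A)
  then have "theta_rep k (\<lambda>f. S a f + (\<Sum>a\<in>A. S a f))"
    by (intro theta_rep_add) auto
  then show ?case
    using insert.hyps by simp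
qed simp

lemma adjoint_word_lin: "smooth f \<Longrightarrow> smooth g \<Longrightarrow> adjoint_word w (\<lambda>x. f x + c * g x) = (\<lambda>x. adjoint_word w f x + c * adjoint_word w g x)"
proof (induction w arbitrary: f g)
  case (Cons j w)
  then show ?case
    by (simp add: euler_add[OF _ smooth_cmult] euler_cmult smooth_euler)
qed simp

text \<open>\<open>euler j b f\<close> is \<open>euler j (-1) f\<close> minus (1 + b) f, and the
  first term is, up to sign, one more letter j in front of every word.\<close>

lemma theta_rep_euler:
  fixes S :: "(real^'n::finite \<Rightarrow> complex) \<Rightarrow> complex"
  assumes "theta_rep k S" shows "theta_rep k (\<lambda>f. S (euler j b f))"
proof -
  obtain B t where B: "finite B" and t: "\<And>w. w \<in> B \<Longrightarrow> t w \<in> borel_measurable lborel"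
    "\<And>w. w \<in> B \<Longrightarrow> \<exists>C. AE x in lborel. (1 + (norm x)\<^sup>2) powr (real k / 2) * norm (t w x) \<le> C"
    and S: "\<And>f. f \<in> test_fun \<Longrightarrow> S f = (\<Sum>w\<in>B. theta_word w (regular (t w)) f)"
    using assms unfolding theta_rep_def by blast
  \<comment> \<open>\<open>tl\<close> recovers the original word from the lengthened one and so
    selects the same density.\<close>
  define S' where "S' f = (\<Sum>w\<in>(#) j ` B. theta_word w (regular (t (tl w))) f)" for f
  have "theta_rep k S'"
    unfolding theta_rep_def S'_def using B t
    by (intro exI[of _ "(#) j ` B"] exI[of _ "\<lambda>w. t (tl w)"]) auto
  then have "theta_rep k (\<lambda>f. (-1) * S' f + (- (1 + b)) * S f)"
    by (intro theta_rep_add theta_rep_cmult assms)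
  then show ?thesis
  proof (rule theta_rep_cong)
    fix f :: "real^'n \<Rightarrow> complex" assume f: "f \<in> test_fun"
    have sf: "smooth f" using f by (rule test_smooth)
    have "euler j b f = (\<lambda>x. euler j (-1) f x + (- (1 + b)) * f x)"
      by (simp add: euler_def fun_eq_iff algebra_simps)
    then have L: "adjoint_word w (euler j b f) = (\<lambda>x. adjoint_word (j # w) f x + (- (1 + b)) * adjoint_word w f x)" for w
      using adjoint_word_lin[OF smooth_euler[OF sf] sf, of w j "-1" "- (1 + b)"] by simp
    have "theta_word w (regular (t w)) (euler j b f) = (-1) * theta_word (j # w) (regular (t w)) f + (- (1 + b)) * theta_word w (regular (t w)) f"
      if w: "w \<in> B" for w
    proof -
      obtain C where C: "AE x in lborel. (1 + (norm x)\<^sup>2) powr (real k / 2) * norm (t w x) \<le> C"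
        using t(2)[OF w] by blast
      have I1: "integrable lborel (\<lambda>x. t w x * adjoint_word (j # w) f x)"
        by (rule weight_times_test_integrable[OF t(1)[OF w] C test_adjoint_word[OF f]])
      have I2: "integrable lborel (\<lambda>x. (- (1 + b)) * (t w x * adjoint_word w f x))"
        by (rule integrable_mult_right[OF weight_times_test_integrable[OF t(1)[OF w] C test_adjoint_word[OF f]]])
      have "regular (t w) (adjoint_word w (euler j b f)) = (\<integral>x. t w x * adjoint_word (j # w) f x + (- (1 + b)) * (t w x * adjoint_word w f x) \<partial>lborel)"
        unfolding regular_def L by (simp only: distrib_left mult.left_commute)
      also have "\<dots> = regular (t w) (adjoint_word (j # w) f) + (- (1 + b)) * regular (t w) (adjoint_word w f)"
        unfolding regular_def Bochner_Integration.integral_add[OF I1 I2] by (simp only: integral_mult_right_zero)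
      finally have e: "regular (t w) (adjoint_word w (euler j b f)) = regular (t w) (adjoint_word (j # w) f) + (- (1 + b)) * regular (t w) (adjoint_word w f)" .
      show ?thesis
        unfolding theta_word_eq e by (simp add: algebra_simps)
    qed
    then have "S (euler j b f) = (\<Sum>w\<in>B. (-1) * theta_word (j # w) (regular (t w)) f + (- (1 + b)) * theta_word w (regular (t w)) f)"
      using S[OF test_euler[OF f]] by simp
    also have "\<dots> = (-1) * (\<Sum>w\<in>B. theta_word (j # w) (regular (t w)) f) + (- (1 + b)) * S f"
      unfolding S[OF f] sum.distrib sum_distrib_left ..
    also have "(\<Sum>w\<in>B. theta_word (j # w) (regular (t w)) f) = S' f"
      unfolding S'_def by (subst sum.reindex) auto
    finally show "S (euler j b f) = (-1) * S' f + (- (1 + b)) * S f" .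
  qed
qed

lemma theta_rep_euler_word_after: "theta_rep k S \<Longrightarrow> theta_rep k (\<lambda>f. S (euler_word_after s w u f))"
proof (induction u)
  case (Cons j u)
  then show ?case
    using theta_rep_euler[of k "\<lambda>f. S (euler_word_after s w u f)" j] by simp
qed simp

text \<open>There are finitely many words of length at most N; sums over them serve as common bound
  and common threshold.\<close>

lemma CN_Cauchy_cbound:
  assumes sF: "\<And>n. smooth (F n)" and F: "CN_Cauchy N F"
  shows "\<exists>B. \<forall>n. cbound N (F n) B"
    and "\<eta> > 0 \<Longrightarrow> \<exists>n0. \<forall>n\<ge>n0. \<forall>m\<ge>n0. cbound N (\<lambda>x. F n x - F m x) \<eta>"
proof -
  define S where "S = {w :: 'a list. length w \<le> N}"
  have S: "finite S"
    using finite_lists_length_le[of "UNIV :: 'a set" N] by (simp add: S_def)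
  have "\<forall>w\<in>S. \<exists>B. \<forall>n x. norm (dpart w (F n) x) \<le> B"
    using F by (simp add: CN_Cauchy_def S_def)
  then obtain B where B: "\<And>w n x. w \<in> S \<Longrightarrow> norm (dpart w (F n) x) \<le> B w" by metis
  have "cbound N (F n) (\<Sum>w\<in>S. \<bar>B w\<bar>)" for n
    unfolding cbound_def
  proof (intro allI impI)
    fix w x assume w: "length (w :: 'a list) \<le> N"
    have "norm (dpart w (F n) x) \<le> \<bar>B w\<bar>" using B[of w n x] w by (simp add: S_def)
    also have "\<dots> \<le> (\<Sum>w\<in>S. \<bar>B w\<bar>)"
      using S w by (intro member_le_sum) (auto simp: S_def)
    finally show "norm (dpart w (F n) x) \<le> (\<Sum>w\<in>S. \<bar>B w\<bar>)" .
  qed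
  then show "\<exists>B. \<forall>n. cbound N (F n) B" by blast
  assume \<eta>: "\<eta> > 0"
  have "\<forall>w\<in>S. \<exists>n0. \<forall>x. \<forall>n\<ge>n0. \<forall>m\<ge>n0. dist (dpart w (F n) x) (dpart w (F m) x) < \<eta>"
    using F \<eta> by (simp add: CN_Cauchy_def S_def uniformly_Cauchy_on_def)
  then obtain n0 where n0: "\<And>w x n m. w \<in> S \<Longrightarrow> n \<ge> n0 w \<Longrightarrow> m \<ge> n0 w \<Longrightarrow> dist (dpart w (F n) x) (dpart w (F m) x) < \<eta>"
    by metis
  have "cbound N (\<lambda>x. F n x - F m x) \<eta>" if "n \<ge> (\<Sum>w\<in>S. n0 w)" "m \<ge> (\<Sum>w\<in>S. n0 w)" for n m
    unfolding cbound_def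
  proof (intro allI impI)
    fix w x assume w: "length (w :: 'a list) \<le> N"
    have "n0 w \<le> (\<Sum>w\<in>S. n0 w)"
      using S w by (intro member_le_sum) (auto simp: S_def)
    then show "norm (dpart w (\<lambda>x. F n x - F m x) x) \<le> \<eta>"
      using n0[of w n m x] w that by (simp add: dpart_diff sF S_def dist_norm less_imp_le)
  qed
  then show "\<exists>n0. \<forall>n\<ge>n0. \<forall>m\<ge>n0. cbound N (\<lambda>x. F n x - F m x) \<eta>" by blast
qed

text \<open>Lets the radial weight be estimated coordinate by coordinate, like the product bound on
  the densities.\<close>

lemma one_plus_norm_le: "1 + norm x \<le> (\<Prod>j\<in>UNIV. 1 + \<bar>x $ j\<bar>)" for x :: "real^'n::finite"
proof -
  have "1 + (\<Sum>j\<in>A. \<bar>x $ j\<bar>) \<le> (\<Prod>j\<in>A. 1 + \<bar>x $ j\<bar>)" for A :: "'n set"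
  proof (induction A rule: infinite_finite_induct)
    case (insert j A)
    have "1 \<le> (\<Prod>j\<in>A. 1 + \<bar>x $ j\<bar>)" by (rule prod_ge_1) simp
    then have "\<bar>x $ j\<bar> * 1 \<le> \<bar>x $ j\<bar> * (\<Prod>j\<in>A. 1 + \<bar>x $ j\<bar>)"
      by (rule mult_left_mono) simp
    then show ?case
      using insert by (simp add: distrib_right)
  qed simp_all
  from this[of UNIV] norm_le_l1_cart[of x] show ?thesis by linarith
qed

section \<open>The densities of the representation\<close>

lemma coord_inverse_all_nonzero: "all_nonzero x \<Longrightarrow> all_nonzero (coord_inverse x)"
  by (simp add: all_nonzero_def coord_inverse_def)

text \<open>Inversion is discontinuous at the hyperplanes, so measurability is obtained
  componentwise, from a finite sum over the basis.\<close>

lemma coord_inverse_measurable: "(coord_inverse :: real^'n::finite \<Rightarrow> real^'n) \<in> borel_measurable borel"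
proof -
  have "coord_inverse = (\<lambda>x::real^'n. \<Sum>j\<in>UNIV. inverse (x $ j) *\<^sub>R axis j 1)"
    by (simp add: fun_eq_iff coord_inverse_def vec_eq_iff axis_def if_distrib cong: if_cong)
  moreover have c: "(\<lambda>x::real^'n. x $ j) \<in> borel_measurable borel" for j
    by (intro borel_measurable_continuous_onI continuous_intros)
  have "(\<lambda>x::real^'n. \<Sum>j\<in>UNIV. inverse (x $ j) *\<^sub>R axis j (1::real) :: real^'n) \<in> borel_measurable borel"
    by (intro borel_measurable_sum borel_measurable_scaleR borel_measurable_inverse borel_measurable_const c)
  ultimately show ?thesis
    by (simp only:)
qed

lemma lborel_on_integral:
  fixes h :: "'b::euclidean_space \<Rightarrow> complex"
  assumes "compact X" "\<And>x. x \<notin> X \<Longrightarrow> h x = 0"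
  shows "(\<integral>x. h x \<partial>lborel_on X) = (\<integral>x. h x \<partial>lborel)"
proof -
  have "(\<integral>x. h x \<partial>lborel_on X) = (\<integral>x. indicator X x *\<^sub>R h x \<partial>lborel)"
    by (rule integral_restrict_space) (simp add: assms(1) borel_closed compact_imp_closed)
  also have "(\<lambda>x. indicator X x *\<^sub>R h x) = h"
    using assms(2) by (auto simp: indicator_def fun_eq_iff)
  finally show ?thesis .
qed

text \<open>Here k is the number of Euler factors spent in each coordinate and n the smoothing
  index. The value 0 on the hyperplanes fits \<open>theta_density_zero\<close>.\<close>

definition theta_density :: "((real^'n::finite \<Rightarrow> complex) \<Rightarrow> complex) \<Rightarrow> ('n \<Rightarrow> nat) \<Rightarrow> nat \<Rightarrow> nat \<Rightarrow> nat \<Rightarrow> real^'n \<Rightarrow> complex" where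
  "theta_density T s M n k x = (if all_nonzero x then T (dil (coord_inverse x) (euler_kernel s M n (\<lambda>_. k))) / of_real (\<Prod>j\<in>UNIV. \<bar>x $ j\<bar>) else 0)"

text \<open>The kernel vanishes off the cube of half side 2, and \<xi>_j / x_j exceeds 2 in
  modulus.\<close>

lemma euler_kernel_dil_zero:
  assumes n: "n \<ge> 1" and x: "all_nonzero x" "\<bar>x $ j\<bar> < \<delta> / 2" and \<xi>: "\<xi> \<in> W \<delta>"
  shows "dil (coord_inverse x) (euler_kernel s M n c) \<xi> = 0"
proof -
  have xj: "\<bar>x $ j\<bar> > 0" using x(1) by (simp add: all_nonzero_def)
  have "2 * \<bar>x $ j\<bar> < \<bar>\<xi> $ j\<bar>" using x(2) \<xi> by (auto simp: W_def dest!: spec[of _ j])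
  then have "2 < \<bar>\<xi> $ j\<bar> / \<bar>x $ j\<bar>"
    using xj by (simp add: less_divide_eq)
  then have "coord_mult \<xi> (coord_inverse x) \<notin> cube 2"
    by (auto simp: cube_def coord_inverse_def not_le abs_mult divide_inverse abs_inverse intro!: exI[of _ j])
  then show ?thesis
    unfolding dil_apply by (rule test_cube_zero[OF euler_kernel_test_cube[OF n]])
qed

context
  fixes T :: "(real^'n::finite \<Rightarrow> complex) \<Rightarrow> complex" and \<epsilon> :: real
  assumes T: "T \<in> D_H" and \<epsilon>: "\<epsilon> > 0" and supp: "dsupp T \<subseteq> W \<epsilon>"
begin

lemma theta_density_zero:
  assumes n: "n \<ge> 1" and x: "\<bar>x $ j\<bar> < \<epsilon> / 4"
  shows "theta_density T s M n k x = 0"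
proof (cases "all_nonzero x")
  case True
  have "T (dil (coord_inverse x) (euler_kernel s M n (\<lambda>_. k))) = 0"
  proof (rule dist_eq_zero_off_W[OF D_H_distribution[OF T] supp])
    show "\<epsilon> / 2 < \<epsilon>" using \<epsilon> by simp
    show "dil (coord_inverse x) (euler_kernel s M n (\<lambda>_. k)) \<in> test_fun"
      by (rule test_dil[OF test_cube_test[OF euler_kernel_test_cube[OF n]] coord_inverse_all_nonzero[OF True]])
    show "dil (coord_inverse x) (euler_kernel s M n (\<lambda>_. k)) \<xi> = 0" if "\<xi> \<in> W (\<epsilon> / 2)" for \<xi>
      by (rule euler_kernel_dil_zero[OF n True _ that, of j]) (use x in simp)
  qed
  then show ?thesis by (simp add: theta_density_def)
qed (simp add: theta_density_def)

lemma theta_density_measurable: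
  assumes n: "n \<ge> 1" shows "theta_density T s M n k \<in> borel_measurable lborel"
proof -
  obtain g where g: "orbit_ext T (euler_kernel s M n (\<lambda>_. k)) g"
    using D_H_orbit_ext[OF T test_cube_test[OF euler_kernel_test_cube[OF n]]] by blast
  have eq: "theta_density T s M n k = (\<lambda>x. if all_nonzero x then g (coord_inverse x) / of_real (\<Prod>j\<in>UNIV. \<bar>x $ j\<bar>) else 0)"
    using g coord_inverse_all_nonzero by (auto simp: theta_density_def orbit_ext_def fun_eq_iff)
  have gm: "g \<in> borel_measurable borel"
    using g by (intro borel_measurable_continuous_onI smooth_continuous test_smooth) (simp add: orbit_ext_def)
  have "open {x::real^'n. all_nonzero x}"
  proof -
    have "{x::real^'n. all_nonzero x} = (\<Inter>j. {x. x $ j \<noteq> 0})" by (auto simp: all_nonzero_def)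
    moreover have "open (\<Inter>j. {x::real^'n. x $ j \<noteq> 0})"
      by (intro open_INT ballI open_Collect_neq continuous_intros) auto
    ultimately show ?thesis by simp
  qed
  then have nzm: "{x \<in> space borel. all_nonzero (x::real^'n)} \<in> sets borel"
    by (simp add: borel_open)
  have "(\<lambda>x::real^'n. complex_of_real (\<Prod>j\<in>UNIV. \<bar>x $ j\<bar>)) \<in> borel_measurable borel"
    by (intro borel_measurable_continuous_onI continuous_on_of_real continuous_on_prod continuous_on_rabs
        continuous_on_component continuous_on_id)
  then have "(\<lambda>x. g (coord_inverse x) / of_real (\<Prod>j\<in>UNIV. \<bar>x $ j\<bar>)) \<in> borel_measurable borel"
    by (intro borel_measurable_divide measurable_compose[OF coord_inverse_measurable gm])
  then have "theta_density T s M n k \<in> borel_measurable borel"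
    unfolding eq by (intro measurable_If nzm) auto
  then show ?thesis by simp
qed

text \<open>Both sides are \<open>T\<close> applied to functions that coincide on \<open>W (\<epsilon> / 2)\<close>: the multiplicative
  mollification of \<open>f\<close>, written once with dilates of \<open>f\<close> and once with dilates of the kernels \<open>euler_kernel\<close>.\<close>

lemma theta_density_identity:
  assumes n: "n \<ge> 1" and f: "f \<in> test_cube L" and g: "orbit_ext T f g"
    and w: "count_list w = (\<lambda>_. k)" and uw: "count_list (u @ w) = (\<lambda>_. Suc M)"
  shows "(\<integral>y. (\<Sum>s\<in>parities. dual_kernel s M n (\<lambda>_. Suc M) y) * g y \<partial>lborel) = (\<Sum>s\<in>parities. \<integral>x. theta_density T s M n k x * euler_word_after s w u f x \<partial>lborel)"
proof -
  note dist = D_H_distribution[OF T]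
  have sf: "smooth f" using f by (rule test_cube_smooth)
  have ft: "f \<in> test_fun" using f by (rule test_cube_test)
  define \<delta> where "\<delta> = \<epsilon> / 2"
  have \<delta>: "0 < \<delta>" "\<delta> < \<epsilon>" using \<epsilon> by (auto simp: \<delta>_def)
  define Y where "Y = (annulus (1/2) 1 :: (real^'n) set)"
  \<comment> \<open>Off X either the image of f vanishes or some |x_j| < \<delta>/2, and then the
    dilated kernel vanishes on \<open>W \<delta>\<close>; so a compact range of x is enough.\<close>
  define X where "X = (annulus (\<delta> / 2) L :: (real^'n) set)"
  have cY: "compact Y" and cX: "compact X" by (simp_all add: Y_def X_def compact_annulus)
  have nzY: "all_nonzero y" if "y \<in> Y" for y using annulus_all_nonzero[of "1/2" y 1] that by (simp add: Y_def)
  have nzX: "all_nonzero x" if "x \<in> X" for x using annulus_all_nonzero[of "\<delta> / 2" x L] that \<delta> by (simp add: X_def)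
  define c where "c y = (\<Sum>s\<in>parities. dual_kernel s M n (\<lambda>_. Suc M) y)" for y :: "real^'n"
  have c0: "c y = 0" if "y \<notin> Y" for y
    using sum_dual_kernel_zero[OF n, of y M] that by (simp add: c_def Y_def)
  have cc: "continuous_on S c" for S
    unfolding c_def[abs_def] by (intro continuous_on_sum continuous_on_subset[OF dual_kernel_continuous[OF n]]) auto
  note pY = dist_dil_integral[OF dist cY cc continuous_on_id nzY ft]
  \<comment> \<open>Mollification with dilates of f; its value under T is the left-hand
    side.\<close>
  define Fn where "Fn = dil_integral (lborel_on Y) c (\<lambda>y. y) f"
  have Ft: "Fn \<in> test_fun" unfolding Fn_def by (rule pY(1))
  have TF: "T Fn = (\<integral>y. c y * g y \<partial>lborel)"
  proof -
    have "T Fn = (\<integral>y. c y * T (dil y f) \<partial>lborel_on Y)"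
      unfolding Fn_def by (rule pY(3))
    also have "\<dots> = (\<integral>y. c y * g y \<partial>lborel_on Y)"
      by (rule Bochner_Integration.integral_cong[OF refl]) (use g nzY in \<open>auto simp: orbit_ext_def space_restrict_space\<close>)
    also have "\<dots> = (\<integral>y. c y * g y \<partial>lborel)"
      by (rule lborel_on_integral[OF cY]) (simp add: c0)
    finally show ?thesis .
  qed
  define q where "q s x = euler_word_after s w u f x / of_real (\<Prod>j\<in>UNIV. \<bar>x $ j\<bar>)" for s and x :: "real^'n"
  have sB: "smooth (euler_word_after s w u f)" for s by (rule test_cube_smooth[OF test_cube_euler_word_after[OF f]])
  have cabs: "continuous_on S (\<lambda>x::real^'n. complex_of_real (\<Prod>j\<in>UNIV. \<bar>x $ j\<bar>))" for S
    by (intro continuous_on_of_real continuous_on_prod continuous_on_rabs continuous_on_component continuous_on_id)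
  have cq: "continuous_on X (q s)" for s
    unfolding q_def[abs_def]
    by (intro continuous_on_divide continuous_on_subset[OF smooth_continuous[OF sB]] cabs)
      (use nzX in \<open>auto simp: all_nonzero_def\<close>)
  have civ: "continuous_on X (coord_inverse :: real^'n \<Rightarrow> real^'n)"
    unfolding coord_inverse_def[abs_def]
    by (intro continuous_on_vec_lambda continuous_on_inverse continuous_on_component continuous_on_id)
      (use nzX in \<open>auto simp: all_nonzero_def\<close>)
  define e where "e s = euler_kernel s M n (\<lambda>_. k)" for s :: "'n \<Rightarrow> nat"
  have et: "e s \<in> test_fun" for s unfolding e_def by (rule test_cube_test[OF euler_kernel_test_cube[OF n]])
  note pX = dist_dil_integral[OF dist cX cq civ coord_inverse_all_nonzero[OF nzX] et]
  \<comment> \<open>The same mollification with point and dilation exchanged; its value under T is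
    the summand for s on the right-hand side.\<close>
  define P where "P s = dil_integral (lborel_on X) (q s) coord_inverse (e s)" for s
  have Pt: "P s \<in> test_fun" for s unfolding P_def by (rule pX(1))
  have offX: "euler_word_after s w u f x = 0 \<or> (\<exists>j. \<bar>x $ j\<bar> < \<delta> / 2)" if "x \<notin> X" for s x
  proof (cases "x \<in> cube L")
    case True
    then show ?thesis using that by (auto simp: X_def annulus_def cube_def not_le)
  next
    case False
    then show ?thesis using test_cube_zero[OF test_cube_euler_word_after[OF f]] by blast
  qed
  have TP: "T (P s) = (\<integral>x. theta_density T s M n k x * euler_word_after s w u f x \<partial>lborel)" for s
  proof -
    have "T (P s) = (\<integral>x. q s x * T (dil (coord_inverse x) (e s)) \<partial>lborel_on X)"
      unfolding P_def by (rule pX(3))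
    also have "\<dots> = (\<integral>x. theta_density T s M n k x * euler_word_after s w u f x \<partial>lborel_on X)"
      by (rule Bochner_Integration.integral_cong[OF refl])
        (use nzX in \<open>auto simp: theta_density_def q_def e_def space_restrict_space\<close>)
    also have "\<dots> = (\<integral>x. theta_density T s M n k x * euler_word_after s w u f x \<partial>lborel)"
    proof (rule lborel_on_integral[OF cX])
      fix x assume "x \<notin> X"
      from offX[OF this, of s] show "theta_density T s M n k x * euler_word_after s w u f x = 0"
        using theta_density_zero[OF n, of x _ s M k] by (auto simp: \<delta>_def)
    qed
    finally show ?thesis .
  qed
  \<comment> \<open>For fixed \<xi> the missing Euler factors are first moved to the dilate of f by
    parts, then x = \<xi> y is substituted.\<close>
  have key: "Fn \<xi> = (\<Sum>s\<in>parities. P s \<xi>)" if \<xi>: "\<xi> \<in> W \<delta>" for \<xi>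
  proof -
    have all_nonzero\<xi>: "all_nonzero \<xi>"
      using \<xi> \<delta>(1) by (auto simp: W_def all_nonzero_def) (metis abs_zero not_le)
    obtain \<alpha> where \<alpha>: "\<alpha> > 0" "\<And>j. \<bar>\<xi> $ j\<bar> \<ge> \<alpha>" using all_nonzero_lower[OF all_nonzero\<xi>] by blast
    have dR: "dil \<xi> f \<in> test_cube (L / \<alpha>)" by (rule test_cube_dil[OF f \<alpha>])
    have sym: "dil y f \<xi> = dil \<xi> f y" for y by (simp add: dil_apply coord_mult_commute)
    have "Fn \<xi> = (\<integral>y. c y * dil \<xi> f y \<partial>lborel_on Y)"
      unfolding Fn_def dil_integral_def sym ..
    also have "\<dots> = (\<integral>y. c y * dil \<xi> f y \<partial>lborel)"
      by (rule lborel_on_integral[OF cY]) (simp add: c0)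
    also have "\<dots> = (\<integral>y. (\<Sum>s\<in>parities. dual_kernel s M n (\<lambda>_. Suc M) y * dil \<xi> f y) \<partial>lborel)"
      by (simp add: c_def sum_distrib_right)
    also have "\<dots> = (\<Sum>s\<in>parities. \<integral>y. dual_kernel s M n (\<lambda>_. Suc M) y * dil \<xi> f y \<partial>lborel)"
    proof (rule Bochner_Integration.integral_sum)
      fix s
      show "integrable lborel (\<lambda>y. dual_kernel s M n (\<lambda>_. Suc M) y * dil \<xi> f y)"
        by (rule cube_integrable[OF continuous_on_mult[OF dual_kernel_continuous[OF n] smooth_continuous[OF test_cube_smooth[OF dR]]], of "L / \<alpha>"])
          (simp add: test_cube_zero[OF dR])
    qed
    also have "\<dots> = (\<Sum>s\<in>parities. P s \<xi>)"
    proof (rule sum.cong[OF refl])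
      fix s :: "'n \<Rightarrow> nat"
      let ?F = "\<lambda>x. dual_kernel s M n (\<lambda>_. k) (coord_mult (coord_inverse \<xi>) x) * euler_word_after s w u f x"
      let ?Z = "complex_of_real (\<Prod>j\<in>UNIV. \<bar>\<xi> $ j\<bar>)"
      have Z: "?Z \<noteq> 0" using all_nonzero\<xi> by (simp add: all_nonzero_def)
      have inv1: "coord_mult (coord_inverse \<xi>) (coord_mult \<xi> y) = y" for y
        using all_nonzero\<xi> by (simp add: vec_eq_iff coord_inverse_def all_nonzero_def)
      have "(\<integral>y. dual_kernel s M n (\<lambda>_. Suc M) y * dil \<xi> f y \<partial>lborel) = (\<integral>y. dual_kernel s M n (\<lambda>_. k) y * euler_word_after s w u (dil \<xi> f) y \<partial>lborel)"
        using dual_kernel_euler_word_after[OF n dR, of s M u w] by (simp only: w uw)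
      also have "\<dots> = (\<integral>y. ?F (coord_mult \<xi> y) \<partial>lborel)"
        unfolding euler_word_after_dil[OF sf] dil_apply inv1 by (simp only: coord_mult_commute)
      finally have A: "?Z * (\<integral>y. dual_kernel s M n (\<lambda>_. Suc M) y * dil \<xi> f y \<partial>lborel) = (\<integral>x. ?F x \<partial>lborel)"
      proof -
        assume a: "(\<integral>y. dual_kernel s M n (\<lambda>_. Suc M) y * dil \<xi> f y \<partial>lborel) = (\<integral>y. ?F (coord_mult \<xi> y) \<partial>lborel)"
        have "continuous_on UNIV (\<lambda>x. dual_kernel s M n (\<lambda>_. k) (coord_mult (coord_inverse \<xi>) x))"
          by (rule continuous_on_compose2[OF dual_kernel_continuous[OF n] continuous_on_coord_mult[OF continuous_on_const continuous_on_id]]) simp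
        then have "?F \<in> borel_measurable borel"
          by (intro borel_measurable_continuous_onI continuous_on_mult smooth_continuous[OF sB])
        from integral_coord_mult[OF all_nonzero\<xi> this] show ?thesis unfolding a ..
      qed
      have B: "?F x = ?Z * (q s x * dil (coord_inverse x) (e s) \<xi>)" for x
      proof (cases "all_nonzero x")
        case True
        have nzh: "all_nonzero (coord_mult (coord_inverse \<xi>) x)" using True all_nonzero\<xi> by (simp add: all_nonzero_def coord_inverse_def)
        have "coord_inverse (coord_mult (coord_inverse \<xi>) x) = coord_mult \<xi> (coord_inverse x)" by (simp add: vec_eq_iff coord_inverse_def)
        moreover have "(\<Prod>j\<in>UNIV. \<bar>coord_mult (coord_inverse \<xi>) x $ j\<bar>) = (\<Prod>j\<in>UNIV. \<bar>x $ j\<bar>) / (\<Prod>j\<in>UNIV. \<bar>\<xi> $ j\<bar>)"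
        proof -
          have "\<bar>coord_mult (coord_inverse \<xi>) x $ j\<bar> = \<bar>x $ j\<bar> / \<bar>\<xi> $ j\<bar>" for j
            by (simp add: coord_inverse_def abs_mult divide_inverse mult.commute)
          then show ?thesis by (simp only: prod_dividef)
        qed
        ultimately have "dual_kernel s M n (\<lambda>_. k) (coord_mult (coord_inverse \<xi>) x) = ?Z * (e s (coord_mult \<xi> (coord_inverse x)) / of_real (\<Prod>j\<in>UNIV. \<bar>x $ j\<bar>))"
          unfolding dual_kernel_euler_kernel[OF nzh] by (simp add: e_def)
        then show ?thesis by (simp add: q_def dil_apply)
      next
        case False
        then have "\<not> all_nonzero (coord_mult (coord_inverse \<xi>) x)" "(\<Prod>j\<in>UNIV. \<bar>x $ j\<bar>) = 0" by (auto simp: all_nonzero_def)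
        then show ?thesis by (simp add: dual_kernel_zero q_def)
      qed
      have C: "(\<integral>x. q s x * dil (coord_inverse x) (e s) \<xi> \<partial>lborel) = P s \<xi>"
        unfolding P_def dil_integral_def
      proof (rule lborel_on_integral[OF cX, symmetric])
        fix x assume x: "x \<notin> X"
        show "q s x * dil (coord_inverse x) (e s) \<xi> = 0"
        proof (cases "all_nonzero x")
          case True
          then show ?thesis
            using offX[OF x, of s] euler_kernel_dil_zero[OF n True _ \<xi>] by (auto simp: q_def e_def)
        next
          case False
          then have "(\<Prod>j\<in>UNIV. \<bar>x $ j\<bar>) = 0" by (auto simp: all_nonzero_def)
          then show ?thesis by (simp add: q_def)
        qed
      qed
      have "?Z * (\<integral>y. dual_kernel s M n (\<lambda>_. Suc M) y * dil \<xi> f y \<partial>lborel) = ?Z * P s \<xi>"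
        unfolding A B integral_mult_right_zero C ..
      then show "(\<integral>y. dual_kernel s M n (\<lambda>_. Suc M) y * dil \<xi> f y \<partial>lborel) = P s \<xi>"
        using Z by (simp only: mult_cancel_left simp_thms)
    qed
    finally show ?thesis .
  qed
  have St: "(\<lambda>\<xi>. \<Sum>s\<in>parities. P s \<xi>) \<in> test_fun" by (rule test_sum[OF Pt])
  have "T (\<lambda>\<xi>. Fn \<xi> - (\<Sum>s\<in>parities. P s \<xi>)) = 0"
    by (rule dist_eq_zero_off_W[OF dist supp \<delta>(2) test_diff[OF Ft St]]) (simp add: key)
  then have "T Fn = T (\<lambda>\<xi>. \<Sum>s\<in>parities. P s \<xi>)"
    using dist_diff[OF dist Ft St] by simp
  also have "\<dots> = (\<Sum>s\<in>parities. T (P s))"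
    by (rule dist_sum[OF dist Pt])
  finally show ?thesis
    unfolding TF TP by (simp only: c_def)
qed

text \<open>Order of the choices: k fixes the word w; the decay estimate for w gives the orders
  \<open>N s\<close>; M exceeds all of them, so that the kernels converge in the corresponding
  norms; u supplies the remaining factors up to M + 1 in each coordinate.\<close>

lemma D_H_theta_rep: "theta_rep k T"
proof -
  note dist = D_H_distribution[OF T]
  obtain xs :: "'n list" where xs: "set xs = UNIV" "distinct xs"
    using finite_distinct_list[OF finite_class.finite_UNIV] by blast
  define rw where "rw m = concat (replicate m xs)" for m
  have crw: "count_list (rw m) j = m" for m j
  proof (induction m)
    case (Suc m)
    have "count_list ys j = (if j \<in> set ys then 1 else 0)" if "distinct ys" for ys
      using that by (induction ys) auto
    then have "count_list xs j = 1" using xs by simp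
    then show ?case using Suc by (simp add: rw_def)
  qed (simp add: rw_def)
  define w where "w = rw k"
  have cw: "count_list w = (\<lambda>_. k)" by (simp add: w_def crw fun_eq_iff)
  have "\<forall>s\<in>parities. \<exists>C N. \<forall>y. all_nonzero y \<longrightarrow> (\<forall>f. f \<in> test_cube 2 \<longrightarrow> parity s f \<longrightarrow> (\<forall>B. cbound N f B \<longrightarrow>
      norm (T (dil y (euler_word s w f))) \<le> C * (\<Prod>i\<in>UNIV. \<bar>y $ i\<bar> ^ (2 * count_list w i)) * B))"
    using D_H_decay[OF T parities_zero_one] by simp
  then obtain C N where "\<forall>s\<in>parities. \<forall>y. all_nonzero y \<longrightarrow> (\<forall>f. f \<in> test_cube 2 \<longrightarrow> parity s f \<longrightarrow> (\<forall>B. cbound (N s) f B \<longrightarrow>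
      norm (T (dil y (euler_word s w f))) \<le> C s * (\<Prod>i\<in>UNIV. \<bar>y $ i\<bar> ^ (2 * count_list w i)) * B))"
    by (subst (asm) bchoice_iff, elim exE, subst (asm) bchoice_iff, elim exE) blast
  then have CN: "norm (T (dil y (euler_word s w f))) \<le> C s * (\<Prod>i\<in>UNIV. \<bar>y $ i\<bar> ^ (2 * k)) * B"
    if "s \<in> parities" "all_nonzero y" "f \<in> test_cube 2" "parity s f" "cbound (N s) f B" for s y f B
    using that by (simp add: cw)
  \<comment> \<open>The summand k makes \<open>Suc M - k\<close> an honest difference; the 1 makes N
    s < M strict.\<close>
  define M where "M = (\<Sum>s\<in>parities. N s) + k + 1"
  have NM: "N s < M" if "s \<in> parities" for s
  proof -
    have "N s \<le> (\<Sum>s\<in>parities. N s)" by (rule member_le_sum[OF that _ finite_parities]) simp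
    then show ?thesis by (simp add: M_def)
  qed
  define u :: "'n list" where "u = rw (Suc M - k)"
  have cuw: "count_list (u @ w) = (\<lambda>_. Suc M)"
    by (simp add: u_def w_def crw fun_eq_iff M_def)
  define \<phi> where "\<phi> s n = euler_kernel s M (Suc n) (\<lambda>_. 0)" for s :: "'n \<Rightarrow> nat" and n
  have \<phi>D: "\<phi> s n \<in> test_cube 2" for s n unfolding \<phi>_def by (rule euler_kernel_test_cube) simp
  have \<phi>p: "parity s (\<phi> s n)" for s n unfolding \<phi>_def by (rule euler_kernel_parity)
  have \<phi>u: "CN_Cauchy (N s) (\<phi> s)" if "s \<in> parities" for s
    unfolding \<phi>_def by (rule euler_kernel_CN_Cauchy[OF NM[OF that]])
  have \<phi>op: "euler_word s w (\<phi> s n) = euler_kernel s M (Suc n) (\<lambda>_. k)" for s n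
    unfolding \<phi>_def euler_word_euler_kernel cw ..
  define t where "t s n = theta_density T s M (Suc n) k" for s n
  \<comment> \<open>The size of the densities: the decay estimate at y = 1/x, divided by the product
    of the |x_j| from \<open>theta_density\<close>.\<close>
  define m where "m x = (\<Prod>i\<in>UNIV. \<bar>coord_inverse x $ i\<bar> ^ (2 * k)) / (\<Prod>j\<in>UNIV. \<bar>x $ j\<bar>)" for x :: "real^'n"
  have m0: "m x \<ge> 0" for x unfolding m_def by (intro divide_nonneg_nonneg prod_nonneg) auto
  have tb: "norm (t s n x) \<le> (\<bar>C s\<bar> * B) * m x" if "s \<in> parities" "cbound (N s) (\<phi> s n) B" for s n x B
  proof (cases "all_nonzero x")
    case True
    have B: "B \<ge> 0" using that(2) by (rule cbound_nonneg)
    have "norm (T (dil (coord_inverse x) (euler_kernel s M (Suc n) (\<lambda>_. k)))) \<le> C s * (\<Prod>i\<in>UNIV. \<bar>coord_inverse x $ i\<bar> ^ (2 * k)) * B"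
      using CN[OF that(1) coord_inverse_all_nonzero[OF True] \<phi>D \<phi>p that(2)] by (simp only: \<phi>op)
    also have "\<dots> \<le> \<bar>C s\<bar> * (\<Prod>i\<in>UNIV. \<bar>coord_inverse x $ i\<bar> ^ (2 * k)) * B"
      using B by (intro mult_right_mono prod_nonneg) auto
    finally have "norm (t s n x) \<le> (\<bar>C s\<bar> * (\<Prod>i\<in>UNIV. \<bar>coord_inverse x $ i\<bar> ^ (2 * k)) * B) / (\<Prod>j\<in>UNIV. \<bar>x $ j\<bar>)"
      using True by (simp add: t_def theta_density_def norm_divide abs_prod divide_right_mono prod_nonneg del: of_real_prod)
    then show ?thesis by (simp add: m_def mult_ac)
  next
    case False
    then show ?thesis
      using m0[of x] cbound_nonneg[OF that(2)] by (simp add: t_def theta_density_def)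
  qed
  \<comment> \<open>The same estimate for differences: kernels close in C^(N s) have close
    densities, whence pointwise convergence as n grows.\<close>
  have td: "norm (t s n x - t s n' x) \<le> (\<bar>C s\<bar> * B) * m x" if "s \<in> parities" "cbound (N s) (\<lambda>x. \<phi> s n x - \<phi> s n' x) B" for s n n' x B
  proof (cases "all_nonzero x")
    case True
    have B: "B \<ge> 0" using that(2) by (rule cbound_nonneg)
    have s1: "smooth (\<phi> s n)" and s2: "smooth (\<lambda>x. (-1) * \<phi> s n' x)"
      using test_cube_smooth[OF \<phi>D] smooth_cmult by blast+
    have dD: "(\<lambda>x. \<phi> s n x - \<phi> s n' x) \<in> test_cube 2" by (rule test_cube_diff[OF \<phi>D \<phi>D])
    have dp: "parity s (\<lambda>x. \<phi> s n x - \<phi> s n' x)"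
      using \<phi>p by (simp add: parity_def dil_def algebra_simps)
    have "euler_word s w (\<lambda>x. \<phi> s n x - \<phi> s n' x) = (\<lambda>x. euler_kernel s M (Suc n) (\<lambda>_. k) x - euler_kernel s M (Suc n') (\<lambda>_. k) x)"
      using euler_word_add[OF s1 s2, of s w] euler_word_cmult[OF test_cube_smooth[OF \<phi>D], of s w "-1" s n'] by (simp add: \<phi>op)
    then have "dil (coord_inverse x) (euler_word s w (\<lambda>x. \<phi> s n x - \<phi> s n' x)) = (\<lambda>\<xi>. dil (coord_inverse x) (euler_kernel s M (Suc n) (\<lambda>_. k)) \<xi> - dil (coord_inverse x) (euler_kernel s M (Suc n') (\<lambda>_. k)) \<xi>)"
      by (simp add: dil_def)
    then have eq: "T (dil (coord_inverse x) (euler_word s w (\<lambda>x. \<phi> s n x - \<phi> s n' x))) = T (dil (coord_inverse x) (euler_kernel s M (Suc n) (\<lambda>_. k))) - T (dil (coord_inverse x) (euler_kernel s M (Suc n') (\<lambda>_. k)))"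
      using dist_diff[OF dist test_dil[OF test_cube_test[OF euler_kernel_test_cube] coord_inverse_all_nonzero[OF True]] test_dil[OF test_cube_test[OF euler_kernel_test_cube] coord_inverse_all_nonzero[OF True]],
        of "Suc n" "Suc n'" s M "\<lambda>_. k" s M "\<lambda>_. k"] by simp
    have "norm (T (dil (coord_inverse x) (euler_word s w (\<lambda>x. \<phi> s n x - \<phi> s n' x)))) \<le> C s * (\<Prod>i\<in>UNIV. \<bar>coord_inverse x $ i\<bar> ^ (2 * k)) * B"
      by (rule CN[OF that(1) coord_inverse_all_nonzero[OF True] dD dp that(2)])
    also have "\<dots> \<le> \<bar>C s\<bar> * (\<Prod>i\<in>UNIV. \<bar>coord_inverse x $ i\<bar> ^ (2 * k)) * B"
      using B by (intro mult_right_mono prod_nonneg) auto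
    finally have "norm (t s n x - t s n' x) \<le> (\<bar>C s\<bar> * (\<Prod>i\<in>UNIV. \<bar>coord_inverse x $ i\<bar> ^ (2 * k)) * B) / (\<Prod>j\<in>UNIV. \<bar>x $ j\<bar>)"
      using True unfolding eq
      by (simp add: t_def theta_density_def norm_divide abs_prod divide_right_mono prod_nonneg diff_divide_distrib[symmetric] del: of_real_prod)
    then show ?thesis by (simp add: m_def mult_ac)
  next
    case False
    then show ?thesis
      using m0[of x] cbound_nonneg[OF that(2)] by (simp add: t_def theta_density_def)
  qed
  have "\<forall>s\<in>parities. \<exists>B. \<forall>n. cbound (N s) (\<phi> s n) B"
    using CN_Cauchy_cbound(1)[OF test_cube_smooth[OF \<phi>D] \<phi>u] by blast
  then obtain B where B: "\<And>s n. s \<in> parities \<Longrightarrow> cbound (N s) (\<phi> s n) (B s)" by metis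
  have B0: "B s \<ge> 0" if "s \<in> parities" for s using B[OF that] cbound_nonneg by blast
  have cau: "Cauchy (\<lambda>n. t s n x)" if s: "s \<in> parities" for s x
    unfolding Cauchy_altdef2
  proof (intro allI impI)
    fix e :: real assume e: "e > 0"
    define \<eta> where "\<eta> = e / (\<bar>C s\<bar> * m x + 1)"
    have pos: "\<bar>C s\<bar> * m x + 1 > 0" using m0[of x] by (simp add: add_nonneg_pos)
    then have \<eta>: "\<eta> > 0" using e by (simp add: \<eta>_def)
    obtain n0 where n0: "\<And>n m. n \<ge> n0 \<Longrightarrow> m \<ge> n0 \<Longrightarrow> cbound (N s) (\<lambda>x. \<phi> s n x - \<phi> s m x) \<eta>"
      using CN_Cauchy_cbound(2)[OF test_cube_smooth[OF \<phi>D] \<phi>u[OF s] \<eta>] by blast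
    have "dist (t s n x) (t s n0 x) < e" if n: "n \<ge> n0" for n
    proof -
      have "norm (t s n x - t s n0 x) \<le> (\<bar>C s\<bar> * \<eta>) * m x"
        by (rule td[OF s n0[OF n order_refl]])
      also have "\<dots> < (\<bar>C s\<bar> * m x + 1) * \<eta>"
        using \<eta> by (simp add: algebra_simps)
      also have "\<dots> = e" using pos by (simp add: \<eta>_def)
      finally show ?thesis by (simp add: dist_norm)
    qed
    then show "\<exists>N. \<forall>n\<ge>N. dist (t s n x) (t s N x) < e" by blast
  qed
  define \<tau> where "\<tau> s x = lim (\<lambda>n. t s n x)" for s x
  have \<tau>: "(\<lambda>n. t s n x) \<longlonglongrightarrow> \<tau> s x" if "s \<in> parities" for s x
    unfolding \<tau>_def using Cauchy_convergent[OF cau[OF that]] by (simp add: convergent_LIMSEQ_iff)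
  have tm: "t s n \<in> borel_measurable lborel" for s n
    unfolding t_def by (rule theta_density_measurable) simp
  have \<tau>m: "\<tau> s \<in> borel_measurable lborel" if "s \<in> parities" for s
    by (rule borel_measurable_LIMSEQ_metric[OF tm]) (rule \<tau>[OF that])
  define \<epsilon>' where "\<epsilon>' = \<epsilon> / 4"
  have \<epsilon>': "\<epsilon>' > 0" using \<epsilon> by (simp add: \<epsilon>'_def)
  \<comment> \<open>For |x_j| \<ge> \<epsilon>' one has 1 + |x_j| \<le> r |x_j|.\<close>
  define r where "r = 1 + 1 / \<epsilon>'"
  have r: "r > 0" using \<epsilon>' by (simp add: r_def add_pos_pos)
  \<comment> \<open>With a = |x_j| each coordinate contributes (r a)^k a^(-2k) / a = r^k a^(-k-1),
    which on a \<ge> \<epsilon>' is largest at a = \<epsilon>'.\<close>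
  define D where "D = (r ^ k * (1 / \<epsilon>') ^ Suc k) ^ CARD('n)"
  have wm: "(1 + (norm x)\<^sup>2) powr (real k / 2) * m x \<le> D" if x: "\<And>j. \<epsilon>' \<le> \<bar>x $ j\<bar>" for x :: "real^'n"
  proof -
    have q: "1 + (norm x)\<^sup>2 > 0" by (simp add: add_pos_nonneg)
    have "(1 + (norm x)\<^sup>2) powr (real k / 2) \<le> ((1 + norm x)\<^sup>2) powr (real k / 2)"
      by (rule powr_mono2) (use q in \<open>auto simp: power2_eq_square algebra_simps\<close>)
    also have "\<dots> = (1 + norm x) powr (2 * (real k / 2))"
    proof -
      have p: "1 + norm x > 0" by (simp add: add_pos_nonneg)
      have "(1 + norm x)\<^sup>2 = (1 + norm x) powr 2" using powr_realpow[OF p, of 2] by simp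
      then show ?thesis by (simp only: powr_powr)
    qed
    also have "\<dots> = (1 + norm x) ^ k"
      by (simp add: powr_realpow add_pos_nonneg)
    also have "\<dots> \<le> (\<Prod>j\<in>UNIV. 1 + \<bar>x $ j\<bar>) ^ k"
      by (rule power_mono[OF one_plus_norm_le]) simp
    also have "\<dots> \<le> (\<Prod>j\<in>UNIV. r * \<bar>x $ j\<bar>) ^ k"
    proof (rule power_mono[OF prod_mono])
      fix j
      have "1 \<le> (1 / \<epsilon>') * \<bar>x $ j\<bar>" using x[of j] \<epsilon>' by (simp add: field_simps)
      then show "0 \<le> 1 + \<bar>x $ j\<bar> \<and> 1 + \<bar>x $ j\<bar> \<le> r * \<bar>x $ j\<bar>" by (simp add: r_def distrib_right)
    qed (auto intro: prod_nonneg)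
    finally have "(1 + (norm x)\<^sup>2) powr (real k / 2) * m x \<le> (\<Prod>j\<in>UNIV. r * \<bar>x $ j\<bar>) ^ k * m x"
      by (rule mult_right_mono[OF _ m0])
    also have "\<dots> = (\<Prod>j\<in>UNIV. (r * \<bar>x $ j\<bar>) ^ k * \<bar>coord_inverse x $ j\<bar> ^ (2 * k) / \<bar>x $ j\<bar>)"
      unfolding m_def prod_power_distrib[of "\<lambda>j. r * \<bar>x $ j\<bar>"] prod_dividef prod.distrib[of "\<lambda>j. (r * \<bar>x $ j\<bar>) ^ k"] by (simp only: times_divide_eq_right)
    also have "\<dots> \<le> (\<Prod>j\<in>(UNIV :: 'n set). r ^ k * (1 / \<epsilon>') ^ Suc k)"
    proof (rule prod_mono)
      fix j
      let ?a = "\<bar>x $ j\<bar>"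
      have a: "?a > 0" using x[of j] \<epsilon>' by linarith
      have "(r * ?a) ^ k * \<bar>coord_inverse x $ j\<bar> ^ (2 * k) / ?a = r ^ k * (1 / ?a) ^ Suc k"
        using a by (simp add: coord_inverse_def abs_inverse power_mult_distrib power_divide mult_2 power_add divide_simps)
      moreover have "(1 / ?a) ^ Suc k \<le> (1 / \<epsilon>') ^ Suc k"
        using a \<epsilon>' x[of j] by (intro power_mono) (auto simp: field_simps)
      ultimately show "0 \<le> (r * ?a) ^ k * \<bar>coord_inverse x $ j\<bar> ^ (2 * k) / ?a \<and>
          (r * ?a) ^ k * \<bar>coord_inverse x $ j\<bar> ^ (2 * k) / ?a \<le> r ^ k * (1 / \<epsilon>') ^ Suc k"
        using r a by (auto simp del: power_Suc intro!: mult_left_mono)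
    qed
    also have "\<dots> = D" by (simp add: D_def)
    finally show ?thesis .
  qed
  have D0: "D \<ge> 0" using r \<epsilon>' by (simp add: D_def)
  have tw: "(1 + (norm x)\<^sup>2) powr (real k / 2) * norm (t s n x) \<le> (\<bar>C s\<bar> * B s) * D" if s: "s \<in> parities" for s n x
  proof (cases "\<forall>j. \<epsilon>' \<le> \<bar>x $ j\<bar>")
    case True
    have "(1 + (norm x)\<^sup>2) powr (real k / 2) * norm (t s n x) \<le> (1 + (norm x)\<^sup>2) powr (real k / 2) * ((\<bar>C s\<bar> * B s) * m x)"
      by (rule mult_left_mono[OF tb[OF s B[OF s]]]) simp
    also have "\<dots> = (\<bar>C s\<bar> * B s) * ((1 + (norm x)\<^sup>2) powr (real k / 2) * m x)"
      by (simp add: mult_ac)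
    also have "\<dots> \<le> (\<bar>C s\<bar> * B s) * D"
      using True B0[OF s] by (intro mult_left_mono wm) auto
    finally show ?thesis .
  next
    case False
    then obtain j where "\<bar>x $ j\<bar> < \<epsilon> / 4" by (auto simp: \<epsilon>'_def not_le)
    then have "t s n x = 0" unfolding t_def by (intro theta_density_zero) auto
    then show ?thesis using D0 B0[OF s] by simp
  qed
  have \<tau>w: "(1 + (norm x)\<^sup>2) powr (real k / 2) * norm (\<tau> s x) \<le> (\<bar>C s\<bar> * B s) * D" if s: "s \<in> parities" for s x
  proof (rule LIMSEQ_le_const2)
    show "(\<lambda>n. (1 + (norm x)\<^sup>2) powr (real k / 2) * norm (t s n x)) \<longlonglongrightarrow> (1 + (norm x)\<^sup>2) powr (real k / 2) * norm (\<tau> s x)"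
      by (intro tendsto_mult_left tendsto_norm \<tau>[OF s])
  qed (use tw[OF s] in blast)
  \<comment> \<open>The weighted bound is uniform in n and the weight is at least 1, so a constant
    multiple of |h| dominates.\<close>
  have lim: "(\<lambda>n. \<integral>x. t s n x * h x \<partial>lborel) \<longlonglongrightarrow> (\<integral>x. \<tau> s x * h x \<partial>lborel)" if s: "s \<in> parities" and h: "h \<in> test_cube L" for s h L
  proof (rule integral_dominated_convergence)
    have hI: "integrable lborel h"
      by (rule cube_integrable[OF smooth_continuous[OF test_cube_smooth[OF h]] test_cube_zero[OF h]])
    show "integrable lborel (\<lambda>x. ((\<bar>C s\<bar> * B s) * D) * norm (h x))"
      using hI by simp
    show "(\<lambda>x. \<tau> s x * h x) \<in> borel_measurable lborel" "(\<lambda>x. t s n x * h x) \<in> borel_measurable lborel" for n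
      using \<tau>m[OF s] tm[of s n] hI by measurable
    show "AE x in lborel. (\<lambda>n. t s n x * h x) \<longlonglongrightarrow> \<tau> s x * h x"
      by (intro AE_I2 tendsto_mult_right \<tau>[OF s])
    show "AE x in lborel. norm (t s n x * h x) \<le> ((\<bar>C s\<bar> * B s) * D) * norm (h x)" for n
    proof (rule AE_I2)
      fix x :: "real^'n"
      have "1 \<le> (1 + (norm x)\<^sup>2) powr (real k / 2)"
        by (rule ge_one_powr_ge_zero) auto
      then have "1 * norm (t s n x) \<le> (1 + (norm x)\<^sup>2) powr (real k / 2) * norm (t s n x)"
        by (rule mult_right_mono) simp
      then have "norm (t s n x) \<le> (\<bar>C s\<bar> * B s) * D" using tw[OF s, of x n] by linarith
      then show "norm (t s n x * h x) \<le> ((\<bar>C s\<bar> * B s) * D) * norm (h x)"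
        unfolding norm_mult by (rule mult_right_mono) simp
    qed
  qed
  define Kc where "Kc = ((2 ^ Suc M * (-1) ^ Suc M) ^ CARD('n) :: complex)"
  have Kc: "Kc \<noteq> 0" by (simp add: Kc_def)
  have "T f = inverse Kc * (\<Sum>s\<in>parities. regular (\<tau> s) (euler_word_after s w u f))" if f: "f \<in> test_fun" for f
  proof -
    obtain L where L: "f \<in> test_cube L" using test_test_cube[OF f] by blast
    obtain g where g: "orbit_ext T f g" using D_H_orbit_ext[OF T f] by blast
    then have gt: "g \<in> test_fun" by (simp add: orbit_ext_def)
    have nz1: "all_nonzero (1 :: real^'n)" by (simp add: all_nonzero_def)
    \<comment> \<open>T f is the value of the orbit at the point 1, where the summed kernels
      concentrate.\<close>
    have g1: "g 1 = T f" using g nz1 by (auto simp: orbit_ext_def dest!: spec[of _ "1 :: real^'n"])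
    have "(\<lambda>n. \<integral>y. (\<Sum>s\<in>parities. dual_kernel s M (Suc n) (\<lambda>_. Suc M) y) * g y \<partial>lborel) \<longlonglongrightarrow> Kc * g 1"
      unfolding Kc_def by (rule kernel_limit[OF smooth_continuous[OF test_smooth[OF gt]]])
    moreover have "(\<integral>y. (\<Sum>s\<in>parities. dual_kernel s M (Suc n) (\<lambda>_. Suc M) y) * g y \<partial>lborel) = (\<Sum>s\<in>parities. \<integral>x. t s n x * euler_word_after s w u f x \<partial>lborel)" for n
      unfolding t_def by (rule theta_density_identity[OF _ L g cw cuw]) simp
    moreover have "(\<lambda>n. \<Sum>s\<in>parities. \<integral>x. t s n x * euler_word_after s w u f x \<partial>lborel) \<longlonglongrightarrow> (\<Sum>s\<in>parities. \<integral>x. \<tau> s x * euler_word_after s w u f x \<partial>lborel)"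
      by (rule tendsto_sum[OF lim[OF _ test_cube_euler_word_after[OF L]]])
    ultimately have "Kc * g 1 = (\<Sum>s\<in>parities. \<integral>x. \<tau> s x * euler_word_after s w u f x \<partial>lborel)"
      using LIMSEQ_unique by simp
    then show ?thesis
      using Kc by (simp add: g1 regular_def field_simps)
  qed
  moreover have "theta_rep k (\<lambda>f. inverse Kc * (\<Sum>s\<in>parities. regular (\<tau> s) (euler_word_after s w u f)))"
  proof (intro theta_rep_cmult theta_rep_sum theta_rep_euler_word_after theta_rep_regular finite_parities)
    show "(parities :: ('n \<Rightarrow> nat) set) \<noteq> {}" by (simp add: parities_def PiE_eq_empty_iff)
    show "\<tau> s \<in> borel_measurable lborel" if "s \<in> parities" for s by (rule \<tau>m[OF that])
    show "AE x in lborel. (1 + (norm x)\<^sup>2) powr (real k / 2) * norm (\<tau> s x) \<le> (\<bar>C s\<bar> * B s) * D" if "s \<in> parities" for s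
      using \<tau>w[OF that] by simp
  qed
  ultimately show ?thesis
    using theta_rep_cong by blast
qed

end

theorem theorem5:
  "(D_H :: ((real^'n::finite \<Rightarrow> complex) \<Rightarrow> complex) set)
     = {T \<in> O_H. \<exists>\<epsilon>>0. dsupp T \<subseteq> W \<epsilon>}"
proof (intro equalityI subsetI CollectI conjI)
  fix T :: "(real^'n \<Rightarrow> complex) \<Rightarrow> complex"
  assume T: "T \<in> D_H"
  show S: "\<exists>\<epsilon>>0. dsupp T \<subseteq> W \<epsilon>"
    by (rule D_H_support[OF T])
  then show "T \<in> O_H"
    using D_H_theta_rep[OF T] D_H_distribution[OF T] by (auto simp: O_H_theta_rep)
next
  fix T :: "(real^'n \<Rightarrow> complex) \<Rightarrow> complex"
  assume "T \<in> {T \<in> O_H. \<exists>\<epsilon>>0. dsupp T \<subseteq> W \<epsilon>}"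
  then show "T \<in> D_H"
    using O_H_supp_imp_D_H by blast
qed

end
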